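(* Let $M$ be a smooth manifold and let $D\subset TM$ be a Lie subalgebroid of $TM$ (an involutive subbundle). The isomorphism classes of generalized exact Courant algebroids over $M$ with fixed image $\operatorname{im}\rho=D$ of the anchor are in one-to-one correspondence with $H^3_{Lie}(D)$, the third cohomology group of the Lie algebroid $D$. The correspondence assigns to a Courant algebroid $E$ its Ševera characteristic class $[C]$.
   Context: **Courant algebroid.** A Courant algebroid is a smooth vector bundle $E\to M$ with a symmetric non-degenerate fibrewise bilinear form $\langle\cdot,\cdot\rangle$ (the pseudo-metric), an $\mathbb{R}$-bilinear bracket $[\cdot,\cdot]$ on $\Gamma(E)$ (not necessarily skew-symmetric) and a bundle map $\rho:E\to TM$ (the anchor) such that for all $\phi,\psi,\psi_1,\psi_2\in\Gamma(E)$, $f\in C^\infty(M)$: $[\phi,[\psi_1,\psi_2]]=[[\phi,\psi_1],\psi_2]+[\psi_1,[\phi,\psi_2]]$; $[\phi,f\psi]=(\rho(\phi)f)\psi+f[\phi,\psi]$; $[\phi,\phi]=\frac12\rho^*\mathrm{d}\langle\phi,\phi\rangle$; $\rho(\phi)\langle\psi,\psi\rangle=2\langle[\phi,\psi],\psi\rangle$. Here $\rho^*:T^*M\to E$ is the dual of $\rho$, with $E\cong E^*$ via the pseudo-metric. An isomorphism of Courant algebroids over $M$ is a vector bundle isomorphism covering the identity of $M$ and preserving pseudo-metric, bracket and anchor. **Generalized exact.** A Courant algebroid whose anchor has constant rank, so that $D=\operatorname{im}\rho$ is a subbundle of $TM$, is generalized exact if $0\to D^*\xrightarrow{\rho^*}E\xrightarrow{\rho}D\to0$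 is an exact sequence of bundles over $M$, where $\rho^*:D^*\to E^*\cong E$ is the dual of $\rho:E\to D$. The Lie algebroid $D$ has a complex of forms $(\Omega^\bullet(D)=\Gamma(\Lambda^\bullet D^* ),\mathrm{d}_D)$ with the Cartan-type differential; its cohomology is $H^\bullet_{Lie}(D)$. **Ševera class.** For a generalized exact $E$, choose a section $\sigma:D\to E$ of $\rho$ with isotropic image (one exists). For $X,Y\in\Gamma(D)$, $[\sigma(X),\sigma(Y)]=\sigma([X,Y])+\tilde C_\sigma(X,Y)$ with $\tilde C_\sigma(X,Y)\in\Gamma(\rho^*D^* )\cong\Gamma(D^* )$; then $C_\sigma(X,Y,Z)=\langle\tilde C_\sigma(X,Y),Z\rangle$ is a closed form in $\Omega^3(D)$ whose class $[C]\in H^3_{Lie}(D)$ is independent of $\sigma$. It is called the Ševera (characteristic) class of $E$. *)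

theory Defs
  imports "HOL-Analysis.Analysis" "HOL-Library.Function_Algebras"
begin

section \<open>Pointwise vector space structure on functions\<close>

instantiation "fun" :: (type, scaleR) scaleR
begin
definition "c *\<^sub>R f = (\<lambda>x. c *\<^sub>R f x)"
instance ..
end

lemma scaleR_fun_apply [simp]: "(c *\<^sub>R f) x = c *\<^sub>R f x"
  by (simp add: scaleR_fun_def)

instance "fun" :: (type, real_vector) real_vector
  by standard (simp_all add: fun_eq_iff scaleR_add_right scaleR_add_left)

definition linear_on :: "'a::real_vector set \<Rightarrow> ('a \<Rightarrow> 'b::real_vector) \<Rightarrow> bool" where
  "linear_on S f \<longleftrightarrow>
     (\<forall>x\<in>S. \<forall>y\<in>S. f (x + y) = f x + f y) \<and> (\<forall>c. \<forall>x\<in>S. f (c *\<^sub>R x) = c *\<^sub>R f x)"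

text \<open>Functionals on a subspace are extended by zero, so that equality of functions is equality
  of functionals.\<close>

definition dual_space :: "'a::real_vector set \<Rightarrow> ('a \<Rightarrow> real) set" where
  "dual_space S = {\<alpha>. linear_on S \<alpha> \<and> (\<forall>x. x \<notin> S \<longrightarrow> \<alpha> x = 0)}"

text \<open>\<open>\<real>\<^sup>r\<close> for a variable \<open>r\<close> (possibly 0): sequences vanishing from index \<open>r\<close> on.\<close>

definition coord_space :: "nat \<Rightarrow> (nat \<Rightarrow> real) set" where
  "coord_space r = {x. \<forall>i\<ge>r. x i = 0}"


section \<open>Smooth manifolds\<close>

text \<open>On an open subset of a finite-dimensional space, \<open>f\<close> is \<open>C\<^sup>k\<^sup>+\<^sup>1\<close> iff it is differentiable and
  all its directional derivatives are \<open>C\<^sup>k\<close>.\<close>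

primrec Ck_on :: "nat \<Rightarrow> ('v::real_normed_vector \<Rightarrow> 'w::real_normed_vector) \<Rightarrow> 'v set \<Rightarrow> bool" where
  "Ck_on 0 f S \<longleftrightarrow> continuous_on S f"
| "Ck_on (Suc k) f S \<longleftrightarrow>
     (\<forall>x\<in>S. f differentiable at x) \<and> (\<forall>v. Ck_on k (\<lambda>x. frechet_derivative f (at x) v) S)"

definition smooth_on :: "('v::real_normed_vector \<Rightarrow> 'w::real_normed_vector) \<Rightarrow> 'v set \<Rightarrow> bool" where
  "smooth_on f S \<longleftrightarrow> (\<forall>k. Ck_on k f S)"

type_synonym ('m, 'v) atlas = "('m set \<times> ('m \<Rightarrow> 'v)) set"

text \<open>The manifold is the whole type \<open>'m\<close>, Hausdorff and second countable by its sort. The model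
  space \<open>'v\<close> is a finite-dimensional inner product space rather than a type of class
  \<open>euclidean_space\<close>, because that class excludes dimension 0.\<close>

definition smooth_manifold ::
  "('m::{t2_space, second_countable_topology}, 'v::real_inner) atlas \<Rightarrow> bool" where
  "smooth_manifold A \<longleftrightarrow>
     (\<exists>B::'v set. finite B \<and> span B = UNIV) \<and>
     (\<Union>(U, \<phi>)\<in>A. U) = UNIV \<and>
     (\<forall>(U, \<phi>)\<in>A. open U \<and> open (\<phi> ` U) \<and> homeomorphism U (\<phi> ` U) \<phi> (inv_into U \<phi>)) \<and>
     (\<forall>(U, \<phi>)\<in>A. \<forall>(V, \<psi>)\<in>A. smooth_on (\<psi> \<circ> inv_into U \<phi>) (\<phi> ` (U \<inter> V)))"

definition smooth_map ::
  "('m, 'v::real_normed_vector) atlas \<Rightarrow> 'm set \<Rightarrow> ('m \<Rightarrow> 'w::real_normed_vector) \<Rightarrow> bool" where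
  "smooth_map A U f \<longleftrightarrow> (\<forall>(V, \<phi>)\<in>A. smooth_on (f \<circ> inv_into V \<phi>) (\<phi> ` (U \<inter> V)))"

definition smooth_near ::
  "('m::topological_space, 'v::real_normed_vector) atlas \<Rightarrow> 'm \<Rightarrow> ('m \<Rightarrow> real) \<Rightarrow> bool" where
  "smooth_near A p f \<longleftrightarrow> (\<exists>U. open U \<and> p \<in> U \<and> smooth_map A U f)"


section \<open>Tangent vectors and vector fields\<close>

text \<open>A tangent vector at \<open>p\<close> is the directional derivative, in some chart around \<open>p\<close>, of functions
  that are smooth near \<open>p\<close>. It is set to 0 on all other functions, which makes it a unique element
  of the function space.\<close>

type_synonym 'm tvec = "('m \<Rightarrow> real) \<Rightarrow> real"

definition chart_tangent :: "('m::topological_space, 'v::real_normed_vector) atlas \<Rightarrow>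
    'm set \<Rightarrow> ('m \<Rightarrow> 'v) \<Rightarrow> 'm \<Rightarrow> 'v \<Rightarrow> 'm tvec" where
  "chart_tangent A U \<phi> p v =
     (\<lambda>f. if smooth_near A p f then frechet_derivative (f \<circ> inv_into U \<phi>) (at (\<phi> p)) v else 0)"

definition tangent_space ::
  "('m::topological_space, 'v::real_normed_vector) atlas \<Rightarrow> 'm \<Rightarrow> 'm tvec set" where
  "tangent_space A p = {chart_tangent A U \<phi> p v | U \<phi> v. (U, \<phi>) \<in> A \<and> p \<in> U}"

definition vector_fields :: "('m::topological_space, 'v::real_normed_vector) atlas \<Rightarrow>
    'm set \<Rightarrow> ('m \<Rightarrow> 'm tvec) set" where
  "vector_fields A U =
     {X. (\<forall>p\<in>U. X p \<in> tangent_space A p) \<and>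
         (\<forall>(V, \<phi>)\<in>A. smooth_map A (U \<inter> V) (\<lambda>p. THE v. X p = chart_tangent A V \<phi> p v))}"

definition lie_bracket :: "('m::topological_space, 'v::real_normed_vector) atlas \<Rightarrow>
    ('m \<Rightarrow> 'm tvec) \<Rightarrow> ('m \<Rightarrow> 'm tvec) \<Rightarrow> 'm \<Rightarrow> 'm tvec" where
  "lie_bracket A X Y p =
     (\<lambda>f. if smooth_near A p f then X p (\<lambda>q. Y q f) - Y p (\<lambda>q. X q f) else 0)"

definition tangent_subbundle :: "('m::topological_space, 'v::real_normed_vector) atlas \<Rightarrow>
    ('m \<Rightarrow> 'm tvec set) \<Rightarrow> bool" where
  "tangent_subbundle A D \<longleftrightarrow>
     (\<exists>r::nat. \<forall>p. \<exists>U X. open U \<and> p \<in> U \<and> (\<forall>i<r. X i \<in> vector_fields A U) \<and>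
        (\<forall>q\<in>U. inj_on (\<lambda>i. X i q) {..<r} \<and> independent ((\<lambda>i. X i q) ` {..<r}) \<and>
               span ((\<lambda>i. X i q) ` {..<r}) = D q))"

definition D_sections :: "('m::topological_space, 'v::real_normed_vector) atlas \<Rightarrow>
    ('m \<Rightarrow> 'm tvec set) \<Rightarrow> 'm set \<Rightarrow> ('m \<Rightarrow> 'm tvec) set" where
  "D_sections A D U = {X \<in> vector_fields A U. \<forall>p\<in>U. X p \<in> D p}"

definition lie_subalgebroid :: "('m::topological_space, 'v::real_normed_vector) atlas \<Rightarrow>
    ('m \<Rightarrow> 'm tvec set) \<Rightarrow> bool" where
  "lie_subalgebroid A D \<longleftrightarrow> tangent_subbundle A D \<and>
     (\<forall>X\<in>D_sections A D UNIV. \<forall>Y\<in>D_sections A D UNIV. lie_bracket A X Y \<in> D_sections A D UNIV)"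


section \<open>Cohomology of the Lie algebroid \<open>D\<close>\<close>

text \<open>A form takes the list of its arguments and is extended by zero to lists that are not
  \<open>k\<close>-tuples of elements of \<open>D\<close>.\<close>

definition forms :: "('m::topological_space, 'v::real_normed_vector) atlas \<Rightarrow>
    ('m \<Rightarrow> 'm tvec set) \<Rightarrow> nat \<Rightarrow> ('m \<Rightarrow> 'm tvec list \<Rightarrow> real) set" where
  "forms A D k =
     {\<omega>. (\<forall>p xs. \<not> (length xs = k \<and> set xs \<subseteq> D p) \<longrightarrow> \<omega> p xs = 0) \<and>
         (\<forall>p xs. length xs = k \<and> set xs \<subseteq> D p \<longrightarrow>
            (\<forall>i<k. linear_on (D p) (\<lambda>x. \<omega> p (xs[i := x]))) \<and>
            (\<not> distinct xs \<longrightarrow> \<omega> p xs = 0)) \<and>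
         (\<forall>U Xs. open U \<and> length Xs = k \<and> set Xs \<subseteq> D_sections A D U \<longrightarrow>
            smooth_map A U (\<lambda>p. \<omega> p (map (\<lambda>X. X p) Xs)))}"

definition omit :: "nat \<Rightarrow> 'a list \<Rightarrow> 'a list" where
  "omit i xs = take i xs @ drop (Suc i) xs"

definition cartan :: "('m::topological_space, 'v::real_normed_vector) atlas \<Rightarrow>
    ('m \<Rightarrow> 'm tvec list \<Rightarrow> real) \<Rightarrow> ('m \<Rightarrow> 'm tvec) list \<Rightarrow> 'm \<Rightarrow> real" where
  "cartan A \<omega> Xs p =
     (\<Sum>i<length Xs. (-1) ^ i * (Xs ! i) p (\<lambda>q. \<omega> q (map (\<lambda>X. X q) (omit i Xs)))) +
     (\<Sum>j<length Xs. \<Sum>i<j. (-1) ^ (i + j) *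
        \<omega> p (map (\<lambda>X. X p) (lie_bracket A (Xs ! i) (Xs ! j) # omit i (omit j Xs))))"

text \<open>The Cartan formula is tensorial, so its value at \<open>p\<close> does not depend on the sections chosen
  to extend the arguments.\<close>

definition ext_d :: "('m::topological_space, 'v::real_normed_vector) atlas \<Rightarrow>
    ('m \<Rightarrow> 'm tvec set) \<Rightarrow> nat \<Rightarrow> ('m \<Rightarrow> 'm tvec list \<Rightarrow> real) \<Rightarrow> 'm \<Rightarrow> 'm tvec list \<Rightarrow> real" where
  "ext_d A D k \<omega> p xs =
     (if length xs = Suc k \<and> set xs \<subseteq> D p
      then THE y. \<exists>Xs. length Xs = Suc k \<and> set Xs \<subseteq> D_sections A D UNIV \<and>
                    map (\<lambda>X. X p) Xs = xs \<and> y = cartan A \<omega> Xs p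
      else 0)"

definition closed_forms :: "('m::topological_space, 'v::real_normed_vector) atlas \<Rightarrow>
    ('m \<Rightarrow> 'm tvec set) \<Rightarrow> nat \<Rightarrow> ('m \<Rightarrow> 'm tvec list \<Rightarrow> real) set" where
  "closed_forms A D k = {\<omega> \<in> forms A D k. ext_d A D k \<omega> = 0}"

definition exact_forms :: "('m::topological_space, 'v::real_normed_vector) atlas \<Rightarrow>
    ('m \<Rightarrow> 'm tvec set) \<Rightarrow> nat \<Rightarrow> ('m \<Rightarrow> 'm tvec list \<Rightarrow> real) set" where
  "exact_forms A D k = (case k of 0 \<Rightarrow> {0} | Suc j \<Rightarrow> ext_d A D j ` forms A D j)"

definition cohomologous :: "('m::topological_space, 'v::real_normed_vector) atlas \<Rightarrow>
    ('m \<Rightarrow> 'm tvec set) \<Rightarrow> nat \<Rightarrow>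
    (('m \<Rightarrow> 'm tvec list \<Rightarrow> real) \<times> ('m \<Rightarrow> 'm tvec list \<Rightarrow> real)) set" where
  "cohomologous A D k =
     {(\<omega>, \<eta>). \<omega> \<in> closed_forms A D k \<and> \<eta> \<in> closed_forms A D k \<and> \<eta> - \<omega> \<in> exact_forms A D k}"

definition lie_cohomology :: "('m::topological_space, 'v::real_normed_vector) atlas \<Rightarrow>
    ('m \<Rightarrow> 'm tvec set) \<Rightarrow> nat \<Rightarrow> ('m \<Rightarrow> 'm tvec list \<Rightarrow> real) set set" where
  "lie_cohomology A D k = closed_forms A D k // cohomologous A D k"

definition coh_class :: "('m::topological_space, 'v::real_normed_vector) atlas \<Rightarrow>
    ('m \<Rightarrow> 'm tvec set) \<Rightarrow> nat \<Rightarrow> ('m \<Rightarrow> 'm tvec list \<Rightarrow> real) \<Rightarrow>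
    ('m \<Rightarrow> 'm tvec list \<Rightarrow> real) set" where
  "coh_class A D k \<omega> = cohomologous A D k `` {\<omega>}"


section \<open>Vector bundles\<close>

text \<open>The fibres are subspaces of an ambient vector space \<open>'e\<close>; the total space is their disjoint
  union \<open>\<Union>p. {p} \<times> fibre E p\<close>. The ambient space carries no geometry: fibres over different points
  are unrelated, and the smooth structure comes from the local trivializations \<open>(U, \<tau>)\<close>, where
  \<open>\<tau> p\<close> is the coordinate isomorphism from the fibre over \<open>p \<in> U\<close> to \<open>coord_space (rk E)\<close>.\<close>

record ('m, 'e) vbundle =
  fibre :: "'m \<Rightarrow> 'e set"
  rk :: nat
  trivs :: "('m set \<times> ('m \<Rightarrow> 'e \<Rightarrow> nat \<Rightarrow> real)) set"

definition vector_bundle :: "('m::topological_space, 'v::real_normed_vector) atlas \<Rightarrow>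
    ('m, 'e::real_vector, 'z) vbundle_scheme \<Rightarrow> bool" where
  "vector_bundle A E \<longleftrightarrow>
     (\<forall>p. subspace (fibre E p)) \<and>
     (\<Union>(U, \<tau>)\<in>trivs E. U) = UNIV \<and>
     (\<forall>(U, \<tau>)\<in>trivs E. open U \<and>
        (\<forall>p\<in>U. linear_on (fibre E p) (\<tau> p) \<and>
               bij_betw (\<tau> p) (fibre E p) (coord_space (rk E)))) \<and>
     (\<forall>(U, \<tau>)\<in>trivs E. \<forall>(V, \<upsilon>)\<in>trivs E. \<forall>x\<in>coord_space (rk E). \<forall>i<rk E.
        smooth_map A (U \<inter> V) (\<lambda>p. \<upsilon> p (inv_into (fibre E p) (\<tau> p) x) i))"

definition sections :: "('m::topological_space, 'v::real_normed_vector) atlas \<Rightarrow>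
    ('m, 'e::real_vector, 'z) vbundle_scheme \<Rightarrow> 'm set \<Rightarrow> ('m \<Rightarrow> 'e) set" where
  "sections A E U =
     {s. (\<forall>p\<in>U. s p \<in> fibre E p) \<and>
         (\<forall>(V, \<tau>)\<in>trivs E. \<forall>i<rk E. smooth_map A (U \<inter> V) (\<lambda>p. \<tau> p (s p) i))}"

text \<open>Smooth fibrewise linear maps covering the identity, for bundles given by their fibres and
  their smooth local sections.\<close>

definition bundle_map ::
  "('m::topological_space \<Rightarrow> 'a::real_vector set) \<Rightarrow> ('m set \<Rightarrow> ('m \<Rightarrow> 'a) set) \<Rightarrow>
   ('m \<Rightarrow> 'b::real_vector set) \<Rightarrow> ('m set \<Rightarrow> ('m \<Rightarrow> 'b) set) \<Rightarrow> ('m \<Rightarrow> 'a \<Rightarrow> 'b) \<Rightarrow> bool" where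
  "bundle_map F \<Gamma>F G \<Gamma>G \<Phi> \<longleftrightarrow>
     (\<forall>p. linear_on (F p) (\<Phi> p) \<and> \<Phi> p ` F p \<subseteq> G p) \<and>
     (\<forall>U. open U \<longrightarrow> (\<forall>s\<in>\<Gamma>F U. (\<lambda>p. \<Phi> p (s p)) \<in> \<Gamma>G U))"


section \<open>Courant algebroids\<close>

record ('m, 'e) courant = "('m, 'e) vbundle" +
  metric :: "'m \<Rightarrow> 'e \<Rightarrow> 'e \<Rightarrow> real"
  bracket :: "('m \<Rightarrow> 'e) \<Rightarrow> ('m \<Rightarrow> 'e) \<Rightarrow> 'm \<Rightarrow> 'e"
  anchor :: "'m \<Rightarrow> 'e \<Rightarrow> 'm tvec"

definition pseudo_metric :: "('m::topological_space, 'v::real_normed_vector) atlas \<Rightarrow>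
    ('m, 'e::real_vector) courant \<Rightarrow> bool" where
  "pseudo_metric A E \<longleftrightarrow>
     (\<forall>p. \<forall>v\<in>fibre E p. linear_on (fibre E p) (metric E p v) \<and>
        (\<forall>w\<in>fibre E p. metric E p v w = metric E p w v) \<and>
        ((\<forall>w\<in>fibre E p. metric E p v w = 0) \<longrightarrow> v = 0)) \<and>
     (\<forall>U. open U \<longrightarrow> (\<forall>s\<in>sections A E U. \<forall>t\<in>sections A E U.
        smooth_map A U (\<lambda>p. metric E p (s p) (t p))))"

text \<open>The image of the functional \<open>\<alpha>\<close> on the target of the anchor under the dual map
  \<open>\<rho>\<^sup>*\<close>, with \<open>E\<close> identified with its dual by the pseudo-metric. Only the values of \<open>\<alpha>\<close> on the
  image of \<open>\<rho>\<close> matter, so this serves both for \<open>\<rho>\<^sup>* : T\<^sup>*M \<rightarrow> E\<close> and for \<open>\<rho>\<^sup>* : D\<^sup>* \<rightarrow> E\<close>.\<close>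

definition rho_star ::
  "('m, 'e::real_vector) courant \<Rightarrow> 'm \<Rightarrow> ('m tvec \<Rightarrow> real) \<Rightarrow> 'e" where
  "rho_star E p \<alpha> =
     (THE e. e \<in> fibre E p \<and> (\<forall>w\<in>fibre E p. metric E p e w = \<alpha> (anchor E p w)))"

definition differential :: "('m \<Rightarrow> real) \<Rightarrow> 'm tvec \<Rightarrow> real" where
  "differential f = (\<lambda>t. t f)"

definition courant_algebroid :: "('m::topological_space, 'v::real_normed_vector) atlas \<Rightarrow>
    ('m, 'e::real_vector) courant \<Rightarrow> bool" where
  "courant_algebroid A E \<longleftrightarrow>
     vector_bundle A E \<and> pseudo_metric A E \<and>
     bundle_map (fibre E) (sections A E) (tangent_space A) (vector_fields A) (anchor E) \<and>
     (let \<Gamma> = sections A E UNIV; br = bracket E; \<rho> = anchor E in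
        (\<forall>\<phi>\<in>\<Gamma>. \<forall>\<psi>\<in>\<Gamma>. br \<phi> \<psi> \<in> \<Gamma>) \<and>
        (\<forall>\<phi>\<in>\<Gamma>. linear_on \<Gamma> (br \<phi>) \<and> linear_on \<Gamma> (\<lambda>\<psi>. br \<psi> \<phi>)) \<and>
        (\<forall>\<phi>\<in>\<Gamma>. \<forall>\<psi>1\<in>\<Gamma>. \<forall>\<psi>2\<in>\<Gamma>. br \<phi> (br \<psi>1 \<psi>2) = br (br \<phi> \<psi>1) \<psi>2 + br \<psi>1 (br \<phi> \<psi>2)) \<and>
        (\<forall>\<phi>\<in>\<Gamma>. \<forall>\<psi>\<in>\<Gamma>. \<forall>f. smooth_map A UNIV f \<longrightarrow>
           br \<phi> (\<lambda>p. f p *\<^sub>R \<psi> p) = (\<lambda>p. \<rho> p (\<phi> p) f *\<^sub>R \<psi> p + f p *\<^sub>R br \<phi> \<psi> p)) \<and>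
        (\<forall>\<phi>\<in>\<Gamma>. br \<phi> \<phi> =
           (\<lambda>p. (1/2) *\<^sub>R rho_star E p (differential (\<lambda>q. metric E q (\<phi> q) (\<phi> q))))) \<and>
        (\<forall>\<phi>\<in>\<Gamma>. \<forall>\<psi>\<in>\<Gamma>. \<forall>p.
           \<rho> p (\<phi> p) (\<lambda>q. metric E q (\<psi> q) (\<psi> q)) = 2 * metric E p (br \<phi> \<psi> p) (\<psi> p)))"

text \<open>Exactness of \<open>0 \<rightarrow> D\<^sup>* \<rightarrow> E \<rightarrow> D \<rightarrow> 0\<close>, in particular \<open>im \<rho> = D\<close>.\<close>

definition generalized_exact :: "('m::topological_space, 'v::real_normed_vector) atlas \<Rightarrow>
    ('m \<Rightarrow> 'm tvec set) \<Rightarrow> ('m, 'e::real_vector) courant set" where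
  "generalized_exact A D =
     {E. courant_algebroid A E \<and>
         (\<forall>p. inj_on (rho_star E p) (dual_space (D p)) \<and>
              rho_star E p ` dual_space (D p) = {e \<in> fibre E p. anchor E p e = 0} \<and>
              anchor E p ` fibre E p = D p)}"

definition courant_iso :: "('m::topological_space, 'v::real_normed_vector) atlas \<Rightarrow>
    ('m, 'e::real_vector) courant \<Rightarrow> ('m, 'f::real_vector) courant \<Rightarrow> bool" where
  "courant_iso A E F \<longleftrightarrow>
     (\<exists>\<Phi>. bundle_map (fibre E) (sections A E) (fibre F) (sections A F) \<Phi> \<and>
          (\<forall>p. bij_betw (\<Phi> p) (fibre E p) (fibre F p)) \<and>
          bundle_map (fibre F) (sections A F) (fibre E) (sections A E)
            (\<lambda>p. inv_into (fibre E p) (\<Phi> p)) \<and>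
          (\<forall>p. \<forall>v\<in>fibre E p. \<forall>w\<in>fibre E p. metric F p (\<Phi> p v) (\<Phi> p w) = metric E p v w) \<and>
          (\<forall>s\<in>sections A E UNIV. \<forall>t\<in>sections A E UNIV.
             bracket F (\<lambda>p. \<Phi> p (s p)) (\<lambda>p. \<Phi> p (t p)) = (\<lambda>p. \<Phi> p (bracket E s t p))) \<and>
          (\<forall>p. \<forall>v\<in>fibre E p. anchor F p (\<Phi> p v) = anchor E p v))"

definition iso_rel :: "('m::topological_space, 'v::real_normed_vector) atlas \<Rightarrow>
    ('m \<Rightarrow> 'm tvec set) \<Rightarrow> (('m, 'e::real_vector) courant \<times> ('m, 'e) courant) set" where
  "iso_rel A D =
     {(E, F). E \<in> generalized_exact A D \<and> F \<in> generalized_exact A D \<and> courant_iso A E F}"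


section \<open>The Severa class\<close>

definition isotropic_splitting :: "('m::topological_space, 'v::real_normed_vector) atlas \<Rightarrow>
    ('m \<Rightarrow> 'm tvec set) \<Rightarrow> ('m, 'e::real_vector) courant \<Rightarrow> ('m \<Rightarrow> 'm tvec \<Rightarrow> 'e) \<Rightarrow> bool" where
  "isotropic_splitting A D E \<sigma> \<longleftrightarrow>
     bundle_map D (D_sections A D) (fibre E) (sections A E) \<sigma> \<and>
     (\<forall>p. \<forall>x\<in>D p. anchor E p (\<sigma> p x) = x) \<and>
     (\<forall>p. \<forall>x\<in>D p. \<forall>y\<in>D p. metric E p (\<sigma> p x) (\<sigma> p y) = 0)"

definition curvature :: "('m::topological_space, 'v::real_normed_vector) atlas \<Rightarrow>
    ('m, 'e::real_vector) courant \<Rightarrow> ('m \<Rightarrow> 'm tvec \<Rightarrow> 'e) \<Rightarrow>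
    ('m \<Rightarrow> 'm tvec) \<Rightarrow> ('m \<Rightarrow> 'm tvec) \<Rightarrow> 'm \<Rightarrow> 'e" where
  "curvature A E \<sigma> X Y p =
     bracket E (\<lambda>q. \<sigma> q (X q)) (\<lambda>q. \<sigma> q (Y q)) p - \<sigma> p (lie_bracket A X Y p)"

text \<open>The curvature takes values in \<open>\<rho>\<^sup>*D\<^sup>*\<close>; it is read as an element of \<open>D\<^sup>*\<close> and evaluated on
  the third argument. The result is tensorial, so the choice of sections extending the arguments
  is immaterial.\<close>

definition severa_form :: "('m::topological_space, 'v::real_normed_vector) atlas \<Rightarrow>
    ('m \<Rightarrow> 'm tvec set) \<Rightarrow> ('m, 'e::real_vector) courant \<Rightarrow> ('m \<Rightarrow> 'm tvec \<Rightarrow> 'e) \<Rightarrow>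
    'm \<Rightarrow> 'm tvec list \<Rightarrow> real" where
  "severa_form A D E \<sigma> p xs =
     (if length xs = 3 \<and> set xs \<subseteq> D p
      then THE y. \<exists>X\<in>D_sections A D UNIV. \<exists>Y\<in>D_sections A D UNIV. \<exists>Z\<in>D_sections A D UNIV.
             xs = [X p, Y p, Z p] \<and>
             y = inv_into (dual_space (D p)) (rho_star E p) (curvature A E \<sigma> X Y p) (Z p)
      else 0)"

definition severa_class :: "('m::topological_space, 'v::real_normed_vector) atlas \<Rightarrow>
    ('m \<Rightarrow> 'm tvec set) \<Rightarrow> ('m, 'e::real_vector) courant \<Rightarrow>
    ('m \<Rightarrow> 'm tvec list \<Rightarrow> real) set" where
  "severa_class A D E =
     (THE c. \<exists>\<sigma>. isotropic_splitting A D E \<sigma> \<and> c = coh_class A D 3 (severa_form A D E \<sigma>))"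

end

theory Submission
  imports Defs
begin

text \<open>For an isotropic splitting \<open>\<sigma>\<close> of \<open>E\<close> the axioms express the bracket on
  \<open>E = \<sigma> D \<oplus> \<rho>\<^sup>* D\<^sup>*\<close> through the bracket of \<open>D\<close> and the 3-form \<open>C\<close>. The Jacobi identity for three
  lifts \<open>\<sigma> X\<close> is \<open>d C = 0\<close>. Two isotropic splittings differ by a 2-form \<open>B\<close>, every \<open>B\<close> occurs, and
  \<open>C\<close> changes by \<open>d B\<close>; so \<open>C\<close> is determined up to exact forms, and if the classes of two algebroids
  agree, then splittings with equal \<open>C\<close> exist and matching them is an isomorphism. An isotropic
  splitting is obtained from local frames by a partition of unity, followed by a correction that kills
  its symmetric part. Conversely, a closed \<open>C\<close> twists the Dorfman bracket of \<open>D \<oplus> D\<^sup>*\<close> into a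
  generalized exact Courant algebroid with class \<open>[C]\<close>.

  Smooth sections are handled through their germs: a bump function extends each germ to a global
  section, and a map of global sections that is linear over smooth functions is pointwise.\<close>

section \<open>Smooth functions on open sets\<close>

lemma frechet_derivative_eqI: "(f has_derivative f') (at x) \<Longrightarrow> frechet_derivative f (at x) = f'"
  by (rule frechet_derivative_at[symmetric])

lemma frechet_derivative_cong_open:
  assumes "open S" "x \<in> S" "\<And>y. y \<in> S \<Longrightarrow> f y = g y" "f differentiable at x"
  shows "g differentiable at x" "frechet_derivative g (at x) = frechet_derivative f (at x)"
proof -
  have "(g has_derivative frechet_derivative f (at x)) (at x)"
    by (rule has_derivative_transform_within_open[OF _ assms(1,2,3)])
      (simp_all add: assms(4) frechet_derivative_works[symmetric])
  then show "g differentiable at x" "frechet_derivative g (at x) = frechet_derivative f (at x)"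
    by (rule differentiableI, rule frechet_derivative_eqI)
qed

lemma Ck_on_cong:
  assumes "open S" "\<And>x. x \<in> S \<Longrightarrow> f x = g x" "Ck_on k f S"
  shows "Ck_on k g S"
  using assms(2,3)
proof (induction k arbitrary: f g)
  case 0
  then show ?case by (auto cong: continuous_on_cong)
next
  case (Suc k)
  have *: "g differentiable at x" "frechet_derivative g (at x) = frechet_derivative f (at x)"
    if "x \<in> S" for x
    using frechet_derivative_cong_open[OF assms(1) that Suc.prems(1)] Suc.prems(2) that by auto
  have "Ck_on k (\<lambda>x. frechet_derivative g (at x) v) S" for v
    by (rule Suc.IH[where f="\<lambda>x. frechet_derivative f (at x) v"]) (use * Suc.prems in auto)
  then show ?case using * by simp
qed

lemma Ck_on_subset: "Ck_on k f S \<Longrightarrow> T \<subseteq> S \<Longrightarrow> Ck_on k f T"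
proof (induction k arbitrary: f)
  case 0
  then show ?case using continuous_on_subset by auto
next
  case (Suc k)
  then show ?case by auto
qed

lemma Ck_on_Suc_imp: "Ck_on (Suc k) f S \<Longrightarrow> Ck_on k f S"
proof (induction k arbitrary: f)
  case 0
  then show ?case
    by (simp add: differentiable_imp_continuous_on differentiable_on_def differentiable_at_withinI)
next
  case (Suc k)
  then show ?case by (metis Ck_on.simps(2))
qed

lemma Ck_on_local:
  assumes "\<And>x. x \<in> S \<Longrightarrow> \<exists>T. open T \<and> x \<in> T \<and> Ck_on k f T"
  shows "Ck_on k f S"
  using assms
proof (induction k arbitrary: f)
  case 0
  have "isCont f x" if "x \<in> S" for x
    using 0[OF that] by (auto simp: continuous_on_eq_continuous_at)
  then show ?case by (simp add: continuous_at_imp_continuous_on)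
next
  case (Suc k)
  have "f differentiable at x" if "x \<in> S" for x using Suc.prems[OF that] by auto
  moreover have "Ck_on k (\<lambda>x. frechet_derivative f (at x) v) S" for v
    by (rule Suc.IH) (use Suc.prems in fastforce)
  ultimately show ?case by simp
qed

lemma Ck_on_const: "Ck_on k (\<lambda>x. c) S"
proof (induction k arbitrary: c)
  case (Suc k)
  then show ?case by (simp add: frechet_derivative_eqI[OF has_derivative_const])
qed simp

lemma Ck_on_bounded_linear_comp:
  assumes "bounded_linear h" "Ck_on k f S" "open S"
  shows "Ck_on k (\<lambda>x. h (f x)) S"
  using assms(2)
proof (induction k arbitrary: f)
  case 0
  then show ?case by (simp add: assms(1) bounded_linear.continuous_on)
next
  case (Suc k)
  have *: "((\<lambda>x. h (f x)) has_derivative (\<lambda>v. h (frechet_derivative f (at x) v))) (at x)"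
    if "x \<in> S" for x
    by (rule bounded_linear.has_derivative[OF assms(1)])
      (use Suc.prems that in \<open>simp add: frechet_derivative_works[symmetric]\<close>)
  have "Ck_on k (\<lambda>x. frechet_derivative (\<lambda>x. h (f x)) (at x) v) S" for v
    by (rule Ck_on_cong[OF assms(3), where f="\<lambda>x. h (frechet_derivative f (at x) v)"])
      (use Suc frechet_derivative_eqI[OF *] in auto)
  then show ?case using differentiableI[OF *] by simp
qed

lemma Ck_on_add:
  assumes "Ck_on k f S" "Ck_on k g S" "open S"
  shows "Ck_on k (\<lambda>x. f x + g x) S"
  using assms(1,2)
proof (induction k arbitrary: f g)
  case 0
  then show ?case by (simp add: continuous_on_add)
next
  case (Suc k)
  have *: "((\<lambda>x. f x + g x) has_derivative
      (\<lambda>v. frechet_derivative f (at x) v + frechet_derivative g (at x) v)) (at x)"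
    if "x \<in> S" for x
    by (rule has_derivative_add) (use Suc.prems that in \<open>simp_all add: frechet_derivative_works[symmetric]\<close>)
  have "Ck_on k (\<lambda>x. frechet_derivative (\<lambda>x. f x + g x) (at x) v) S" for v
    by (rule Ck_on_cong[OF assms(3), where f=
          "\<lambda>x. frechet_derivative f (at x) v + frechet_derivative g (at x) v"])
      (use Suc frechet_derivative_eqI[OF *] in auto)
  then show ?case using differentiableI[OF *] by simp
qed

lemma Ck_on_bilinear:
  assumes "bounded_bilinear pr" "Ck_on k f S" "Ck_on k g S" "open S"
  shows "Ck_on k (\<lambda>x. pr (f x) (g x)) S"
  using assms(2,3)
proof (induction k arbitrary: f g)
  case 0
  then show ?case by (simp add: assms(1) bounded_bilinear.continuous_on)
next
  case (Suc k)
  have *: "((\<lambda>x. pr (f x) (g x)) has_derivative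
      (\<lambda>v. pr (f x) (frechet_derivative g (at x) v) + pr (frechet_derivative f (at x) v) (g x)))
      (at x)" if "x \<in> S" for x
    by (rule bounded_bilinear.FDERIV[OF assms(1)])
      (use Suc.prems that in \<open>simp_all add: frechet_derivative_works[symmetric]\<close>)
  have "Ck_on k (\<lambda>x. frechet_derivative (\<lambda>x. pr (f x) (g x)) (at x) v) S" for v
  proof (rule Ck_on_cong[OF assms(4)])
    show "Ck_on k (\<lambda>x. pr (f x) (frechet_derivative g (at x) v)
        + pr (frechet_derivative f (at x) v) (g x)) S"
      using Suc.prems Ck_on_Suc_imp[OF Suc.prems(1)] Ck_on_Suc_imp[OF Suc.prems(2)]
      by (intro Ck_on_add assms Suc.IH) auto
  qed (use frechet_derivative_eqI[OF *] in auto)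
  then show ?case using differentiableI[OF *] by simp
qed

lemma Ck_on_sum:
  assumes "\<And>i. i \<in> I \<Longrightarrow> Ck_on k (f i) S" "open S"
  shows "Ck_on k (\<lambda>x. \<Sum>i\<in>I. f i x) S"
  using assms(1)
  by (induction I rule: infinite_finite_induct) (auto intro: Ck_on_const Ck_on_add assms)

lemma Ck_on_inverse:
  fixes f :: "'a::real_normed_vector \<Rightarrow> real"
  assumes "Ck_on k f S" "open S" "\<And>x. x \<in> S \<Longrightarrow> f x \<noteq> 0"
  shows "Ck_on k (\<lambda>x. inverse (f x)) S"
  using assms(1)
proof (induction k)
  case 0
  then show ?case using assms by (auto intro: continuous_on_inverse)
next
  case (Suc k)
  have *: "((\<lambda>x. inverse (f x)) has_derivative
      (\<lambda>v. - (inverse (f x) * frechet_derivative f (at x) v * inverse (f x)))) (at x)"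
    if "x \<in> S" for x
    by (rule Deriv.has_derivative_inverse)
      (use Suc.prems that assms(3) in \<open>simp_all add: frechet_derivative_works[symmetric]\<close>)
  have "Ck_on k (\<lambda>x. frechet_derivative (\<lambda>x. inverse (f x)) (at x) v) S" for v
  proof (rule Ck_on_cong[OF assms(2)])
    show "Ck_on k (\<lambda>x. - (inverse (f x) * frechet_derivative f (at x) v * inverse (f x))) S"
      using Suc.prems Ck_on_Suc_imp[OF Suc.prems(1)] Suc.IH
      by (intro Ck_on_bounded_linear_comp[OF bounded_linear_minus[OF bounded_linear_ident]]
          Ck_on_bilinear[OF bounded_bilinear_mult] assms) auto
  qed (use frechet_derivative_eqI[OF *] in auto)
  then show ?case using differentiableI[OF *] by simp
qed

definition onb :: "'v::real_inner set \<Rightarrow> bool" where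
  "onb B \<longleftrightarrow> finite B \<and> (\<forall>x. (\<Sum>b\<in>B. (x \<bullet> b) *\<^sub>R b) = x)"

lemma onb_exists:
  assumes "finite (B::'v::real_inner set)" "span B = UNIV"
  shows "\<exists>C::'v set. onb C"
proof -
  obtain C :: "'v set" where C: "finite C" "span C = UNIV" "pairwise orthogonal C"
    using basis_orthogonal[OF assms(1)] assms(2) by metis
  define N where "N = (\<lambda>x. x /\<^sub>R norm x) ` (C - {0})"
  have inN: "x /\<^sub>R norm x \<in> N" if "x \<in> C" "x \<noteq> 0" for x using that by (auto simp: N_def)
  have finN: "finite N" using C by (simp add: N_def)
  have nn: "b \<bullet> b = 1" if "b \<in> N" for b
    using that by (auto simp: N_def dot_square_norm power2_eq_square divide_simps split: if_splits)
  have oN: "a \<bullet> b = 0" if ab: "a \<in> N" "b \<in> N" "a \<noteq> b" for a b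
  proof -
    obtain x y where xy: "a = x /\<^sub>R norm x" "b = y /\<^sub>R norm y" "x \<in> C" "y \<in> C"
      using ab unfolding N_def by blast
    then have "x \<noteq> y" using ab by auto
    then show ?thesis using xy C(3) by (simp add: pairwise_def orthogonal_def)
  qed
  have spanN: "span N = UNIV"
  proof -
    have "x \<in> span N" if "x \<in> C" for x
    proof (cases "x = 0")
      case False
      then have "norm x *\<^sub>R (x /\<^sub>R norm x) \<in> span N"
        by (intro span_scale span_base inN that)
      then show ?thesis using False by simp
    qed (simp add: span_zero)
    then have "span C \<subseteq> span N" by (intro span_minimal) auto
    then show ?thesis using C by auto
  qed
  have "(\<Sum>b\<in>N. (x \<bullet> b) *\<^sub>R b) = x" for x
  proof -
    have "x \<in> span N" using spanN by auto
    then show ?thesis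
    proof (induction rule: span_induct)
      case base
      show ?case by (auto simp: subspace_def inner_add_left scaleR_add_left sum.distrib
            scaleR_sum_right[symmetric] scaleR_scaleR[symmetric] simp del: scaleR_scaleR)
    next
      case (step a)
      have "(\<Sum>b\<in>N. (a \<bullet> b) *\<^sub>R b) = (\<Sum>b\<in>N. if b = a then a else 0)"
        by (intro sum.cong) (use step oN nn in auto)
      then show ?case using step finN by simp
    qed
  qed
  then show ?thesis using finN by (auto simp: onb_def)
qed

lemma onb_real: "onb {1::real}"
  unfolding onb_def by (auto simp: inner_real_def)

lemma bounded_linear_onb_expand:
  assumes "onb B" "bounded_linear D"
  shows "D x = (\<Sum>b\<in>B. (x \<bullet> b) *\<^sub>R D b)"
proof -
  interpret bounded_linear D by fact
  have "D x = D (\<Sum>b\<in>B. (x \<bullet> b) *\<^sub>R b)" using assms(1) by (simp add: onb_def)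
  then show ?thesis by (simp add: sum scaleR)
qed

lemma frechet_derivative_onb_expand:
  assumes "onb B" "f differentiable at z"
  shows "frechet_derivative f (at z) x = (\<Sum>b\<in>B. (x \<bullet> b) *\<^sub>R frechet_derivative f (at z) b)"
  using bounded_linear_onb_expand[OF assms(1)] assms(2) frechet_derivative_works
    has_derivative_bounded_linear by blast

lemma Ck_on_compose:
  fixes g :: "'a::real_normed_vector \<Rightarrow> 'v::real_inner" and f :: "'v \<Rightarrow> 'w::real_normed_vector"
  assumes "onb (B::'v set)" "Ck_on k f T" "Ck_on k g S" "open S" "open T" "g ` S \<subseteq> T"
  shows "Ck_on k (\<lambda>x. f (g x)) S"
  using assms(2,3)
proof (induction k arbitrary: f)
  case 0
  then show ?case using assms(6) continuous_on_compose2 by auto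
next
  case (Suc k)
  have *: "((\<lambda>x. f (g x)) has_derivative
      (\<lambda>v. frechet_derivative f (at (g x)) (frechet_derivative g (at x) v))) (at x)"
    if "x \<in> S" for x
    by (rule has_derivative_compose[where f=g and g=f])
      (use Suc.prems that assms(6) in \<open>auto simp: frechet_derivative_works[symmetric]\<close>)
  have "Ck_on k (\<lambda>x. frechet_derivative (\<lambda>x. f (g x)) (at x) v) S" for v
  proof (rule Ck_on_cong[OF assms(4)])
    show "Ck_on k (\<lambda>x. \<Sum>b\<in>B. (frechet_derivative g (at x) v \<bullet> b) *\<^sub>R
        frechet_derivative f (at (g x)) b) S"
      using Suc.prems Ck_on_Suc_imp[OF Suc.prems(2)]
      by (intro Ck_on_sum assms(4) Ck_on_bilinear[OF bounded_bilinear_scaleR]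
          Ck_on_bounded_linear_comp[OF bounded_linear_inner_left] Suc.IH) auto
    fix x assume x: "x \<in> S"
    then have "f differentiable at (g x)" using Suc.prems assms(6) by auto
    then show "(\<Sum>b\<in>B. (frechet_derivative g (at x) v \<bullet> b) *\<^sub>R frechet_derivative f (at (g x)) b)
        = frechet_derivative (\<lambda>x. f (g x)) (at x) v"
      by (metis frechet_derivative_onb_expand[OF assms(1)] frechet_derivative_eqI[OF *[OF x]])
  qed
  then show ?case using differentiableI[OF *] by simp
qed

lemma smooth_on_cong: "open S \<Longrightarrow> (\<And>x. x \<in> S \<Longrightarrow> f x = g x) \<Longrightarrow> smooth_on f S \<Longrightarrow> smooth_on g S"
  unfolding smooth_on_def using Ck_on_cong by blast

lemma smooth_on_subset: "smooth_on f S \<Longrightarrow> T \<subseteq> S \<Longrightarrow> smooth_on f T"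
  unfolding smooth_on_def using Ck_on_subset by blast

lemma smooth_on_local:
  "(\<And>x. x \<in> S \<Longrightarrow> \<exists>T. open T \<and> x \<in> T \<and> smooth_on f T) \<Longrightarrow> smooth_on f S"
  unfolding smooth_on_def by (metis Ck_on_local)

lemma smooth_on_const: "smooth_on (\<lambda>x. c) S"
  unfolding smooth_on_def using Ck_on_const by blast

lemma smooth_on_bounded_linear_comp:
  "bounded_linear h \<Longrightarrow> smooth_on f S \<Longrightarrow> open S \<Longrightarrow> smooth_on (\<lambda>x. h (f x)) S"
  by (simp add: smooth_on_def Ck_on_bounded_linear_comp)

lemma smooth_on_add:
  "smooth_on f S \<Longrightarrow> smooth_on g S \<Longrightarrow> open S \<Longrightarrow> smooth_on (\<lambda>x. f x + g x) S"
  by (simp add: smooth_on_def Ck_on_add)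

lemma smooth_on_scaleR:
  "smooth_on f S \<Longrightarrow> smooth_on g S \<Longrightarrow> open S \<Longrightarrow> smooth_on (\<lambda>x. f x *\<^sub>R g x) S"
  by (simp add: smooth_on_def Ck_on_bilinear[OF bounded_bilinear_scaleR])

lemma smooth_on_mult:
  fixes f :: "'a::real_normed_vector \<Rightarrow> real"
  shows "smooth_on f S \<Longrightarrow> smooth_on g S \<Longrightarrow> open S \<Longrightarrow> smooth_on (\<lambda>x. f x * g x) S"
  by (simp add: smooth_on_def Ck_on_bilinear[OF bounded_bilinear_mult])

lemma smooth_on_sum:
  "(\<And>i. i \<in> I \<Longrightarrow> smooth_on (f i) S) \<Longrightarrow> open S \<Longrightarrow> smooth_on (\<lambda>x. \<Sum>i\<in>I. f i x) S"
  by (simp add: smooth_on_def Ck_on_sum)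

lemma smooth_on_inverse:
  fixes f :: "'a::real_normed_vector \<Rightarrow> real"
  shows "smooth_on f S \<Longrightarrow> open S \<Longrightarrow> (\<And>x. x \<in> S \<Longrightarrow> f x \<noteq> 0) \<Longrightarrow> smooth_on (\<lambda>x. inverse (f x)) S"
  by (simp add: smooth_on_def Ck_on_inverse)

lemma smooth_on_compose:
  fixes g :: "'a::real_normed_vector \<Rightarrow> 'v::real_inner" and f :: "'v \<Rightarrow> 'w::real_normed_vector"
  assumes "onb (B::'v set)" "smooth_on f T" "smooth_on g S" "open S" "open T" "g ` S \<subseteq> T"
  shows "smooth_on (\<lambda>x. f (g x)) S"
  using assms Ck_on_compose unfolding smooth_on_def by blast

lemma smooth_on_ident: "smooth_on (\<lambda>x. x) S"
proof -
  have "Ck_on k (\<lambda>x. x) S" for k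
    by (cases k) (simp_all add: frechet_derivative_eqI[OF has_derivative_ident] Ck_on_const
        continuous_on_id)
  then show ?thesis by (simp add: smooth_on_def)
qed

lemma smooth_on_imp_differentiable: "smooth_on f S \<Longrightarrow> x \<in> S \<Longrightarrow> f differentiable at x"
  unfolding smooth_on_def by (metis Ck_on.simps(2))

lemma smooth_on_frechet_derivative:
  "smooth_on f S \<Longrightarrow> smooth_on (\<lambda>x. frechet_derivative f (at x) v) S"
  unfolding smooth_on_def by (metis Ck_on.simps(2))

lemma smooth_on_imp_continuous_on: "smooth_on f S \<Longrightarrow> continuous_on S f"
  unfolding smooth_on_def by (metis Ck_on.simps(1))

lemma smooth_on_componentwise:
  assumes "onb (B::'v::real_inner set)" "\<And>b. b \<in> B \<Longrightarrow> smooth_on (\<lambda>x. g x \<bullet> b) S" "open S"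
  shows "smooth_on (g::'a::real_normed_vector \<Rightarrow> 'v) S"
proof (rule smooth_on_cong[OF assms(3)])
  show "smooth_on (\<lambda>x. \<Sum>b\<in>B. (g x \<bullet> b) *\<^sub>R b) S"
    by (intro smooth_on_sum smooth_on_scaleR smooth_on_const assms)
qed (use assms(1) in \<open>simp add: onb_def\<close>)


subsection \<open>A smooth step function\<close>

definition flat :: "nat \<Rightarrow> real \<Rightarrow> real" where
  "flat n t = (if t \<le> 0 then 0 else inverse t ^ n * exp (- inverse t))"

lemma flat_tendsto_0: "(flat n \<longlongrightarrow> 0) (at 0)"
proof -
  have "((\<lambda>x::real. x ^ n / exp x) \<longlongrightarrow> 0) at_top" by (rule tendsto_power_div_exp_0)
  then have "((\<lambda>t::real. inverse t ^ n / exp (inverse t)) \<longlongrightarrow> 0) (at_right 0)"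
    using filterlim_compose filterlim_inverse_at_top_right by blast
  then have "(flat n \<longlongrightarrow> 0) (at_right 0)"
    by (rule Lim_transform_eventually)
      (auto simp: eventually_at_right_field flat_def exp_minus divide_inverse intro: gt_ex)
  moreover have "(flat n \<longlongrightarrow> 0) (at_left 0)"
    by (rule tendsto_eventually) (auto simp: eventually_at_left_field flat_def intro: lt_ex)
  ultimately show ?thesis by (simp add: filterlim_split_at)
qed

lemma flat_has_derivative:
  "(flat n has_field_derivative (- real n * flat (Suc n) t + flat (n + 2) t)) (at t)"
proof -
  consider "t < 0" | "t = 0" | "t > 0" by linarith
  then show ?thesis
  proof cases
    case 1
    have "((\<lambda>_. 0::real) has_field_derivative 0) (at t)" by simp
    then have "(flat n has_field_derivative 0) (at t)"
      by (rule has_field_derivative_transform_within_open[where S="{..<0}"])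
        (use 1 in \<open>auto simp: flat_def\<close>)
    then show ?thesis using 1 by (simp add: flat_def)
  next
    case 2
    have "((\<lambda>h. (flat n (0 + h) - flat n 0) / h) \<longlongrightarrow> 0) (at 0)"
      by (rule Lim_transform_eventually[OF flat_tendsto_0[of "Suc n"]])
        (auto simp: eventually_at_filter flat_def divide_inverse)
    then show ?thesis using 2 by (simp add: DERIV_def flat_def)
  next
    case 3
    have i: "(inverse has_field_derivative - (inverse t ^ Suc (Suc 0))) (at t)"
      using DERIV_inverse[of t] 3 by simp
    have eq: "real n * (- (u ^ Suc (Suc 0)) * u ^ (n - Suc 0)) * e + e * - (- (u ^ Suc (Suc 0))) * u ^ n
        = - real n * (u ^ Suc n * e) + u ^ (n + 2) * e" for u e :: real
      by (cases n) (simp_all add: algebra_simps)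
    have "((\<lambda>t. inverse t ^ n * exp (- inverse t)) has_field_derivative
        (- real n * flat (Suc n) t + flat (n + 2) t)) (at t)"
      using DERIV_mult[OF DERIV_power[OF i, of n] DERIV_chain2[OF DERIV_exp DERIV_minus[OF i]]] 3
      unfolding eq flat_def by (simp only: if_False not_le[symmetric] simp_thms)
    then show ?thesis
      by (rule has_field_derivative_transform_within_open[where S="{0<..}"])
        (use 3 in \<open>auto simp: flat_def\<close>)
  qed
qed

lemma Ck_on_flat: "Ck_on k (flat n) UNIV"
proof (induction k arbitrary: n)
  case 0
  have "isCont (flat n) t" for t using flat_has_derivative DERIV_isCont by blast
  then show ?case by (simp add: continuous_on_eq_continuous_at)
next
  case (Suc k)
  have *: "(flat n has_derivative (\<lambda>v. (- real n * flat (Suc n) t + flat (n + 2) t) * v)) (at t)"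
    for t using flat_has_derivative by (simp add: has_field_derivative_def)
  have "Ck_on k (\<lambda>t. (- real n * flat (Suc n) t + flat (n + 2) t) * v) UNIV" for v
    by (intro Ck_on_bilinear[OF bounded_bilinear_mult] Ck_on_add Ck_on_const Suc.IH open_UNIV)
  then show ?case using differentiableI[OF *] by (simp add: frechet_derivative_eqI[OF *])
qed

definition step :: "real \<Rightarrow> real" where
  "step t = flat 0 (2 - t) * inverse (flat 0 (2 - t) + flat 0 (t - 1))"

lemma step_smooth: "smooth_on step UNIV"
proof -
  have f: "smooth_on (flat 0) UNIV" unfolding smooth_on_def using Ck_on_flat by blast
  have a: "smooth_on (\<lambda>t::real. 2 - t) UNIV"
    using smooth_on_add[OF smooth_on_const[of "2::real"] smooth_on_bounded_linear_comp[OF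
          bounded_linear_minus[OF bounded_linear_ident] smooth_on_ident], of UNIV] by simp
  have b: "smooth_on (\<lambda>t::real. t - 1) UNIV"
    using smooth_on_add[OF smooth_on_ident smooth_on_const[of "-1"], of UNIV] by simp
  have c: "smooth_on (\<lambda>t. flat 0 (2 - t)) UNIV" "smooth_on (\<lambda>t. flat 0 (t - 1)) UNIV"
    using smooth_on_compose[OF onb_real f a] smooth_on_compose[OF onb_real f b] by auto
  have "flat 0 (2 - t) + flat 0 (t - 1) \<noteq> 0" for t
    by (auto simp: flat_def add_nonneg_eq_0_iff)
  then show ?thesis unfolding step_def[abs_def]
    by (intro smooth_on_mult smooth_on_inverse smooth_on_add c) auto
qed

lemma step_eq_1: "t \<le> 1 \<Longrightarrow> step t = 1" and step_eq_0: "t \<ge> 2 \<Longrightarrow> step t = 0"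
  by (auto simp: step_def flat_def)

section \<open>Smooth functions on a manifold\<close>

locale smooth_mfd =
  fixes A :: "('m::{t2_space, second_countable_topology}, 'v::real_inner) atlas"
  assumes mfd: "smooth_manifold A"
begin

abbreviation sm :: "'m \<Rightarrow> ('m \<Rightarrow> real) \<Rightarrow> bool" where "sm \<equiv> smooth_near A"

definition Bv :: "'v set" where "Bv = (SOME B. onb B)"

lemma onb_Bv: "onb Bv"
proof -
  have "\<exists>B::'v set. finite B \<and> span B = UNIV" using mfd by (simp add: smooth_manifold_def)
  then have "\<exists>B::'v set. onb B" using onb_exists by metis
  then show ?thesis unfolding Bv_def by (rule someI_ex)
qed

lemma finite_Bv: "finite Bv" and onb_expand: "(\<Sum>b\<in>Bv. (x \<bullet> b) *\<^sub>R b) = x"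
  using onb_Bv by (simp_all add: onb_def)

lemma chart_open: "(U, \<phi>) \<in> A \<Longrightarrow> open U"
  and chart_homeo: "(U, \<phi>) \<in> A \<Longrightarrow> homeomorphism U (\<phi> ` U) \<phi> (inv_into U \<phi>)"
  and chart_image_open: "(U, \<phi>) \<in> A \<Longrightarrow> open (\<phi> ` U)"
  and chart_transition: "(U, \<phi>) \<in> A \<Longrightarrow> (V, \<psi>) \<in> A \<Longrightarrow> smooth_on (\<psi> \<circ> inv_into U \<phi>) (\<phi> ` (U \<inter> V))"
  using mfd unfolding smooth_manifold_def by fast+

lemma chart_exists: obtains U \<phi> where "(U, \<phi>) \<in> A" "p \<in> U"
proof -
  have "p \<in> (\<Union>(U, \<phi>)\<in>A. U)" using mfd by (simp add: smooth_manifold_def)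
  then show thesis using that by auto
qed

lemma chart_inv: "(U, \<phi>) \<in> A \<Longrightarrow> p \<in> U \<Longrightarrow> inv_into U \<phi> (\<phi> p) = p"
  using chart_homeo homeomorphism_apply1 by fastforce

lemma chart_image_open_subset:
  assumes "(U, \<phi>) \<in> A" "open W" "W \<subseteq> U"
  shows "open (\<phi> ` W)"
proof -
  have "openin (top_of_set (\<phi> ` U)) (\<phi> ` W)"
    using homeomorphism_imp_open_map[OF chart_homeo[OF assms(1)]] assms(2,3) by (simp add: open_subset)
  then show ?thesis using chart_image_open[OF assms(1)] openin_open_trans by blast
qed

lemma chart_change:
  assumes "(U, \<phi>) \<in> A" "(V, \<psi>) \<in> A" "open W" "W \<subseteq> U" "W \<subseteq> V"
    and "smooth_on (f \<circ> inv_into U \<phi>) (\<phi> ` W)"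
  shows "smooth_on (f \<circ> inv_into V \<psi>) (\<psi> ` W)"
proof (rule smooth_on_cong)
  show "open (\<psi> ` W)" using chart_image_open_subset assms by blast
  show "smooth_on (\<lambda>x. (f \<circ> inv_into U \<phi>) ((\<phi> \<circ> inv_into V \<psi>) x)) (\<psi> ` W)"
  proof (rule smooth_on_compose[OF onb_Bv assms(6)])
    show "smooth_on (\<phi> \<circ> inv_into V \<psi>) (\<psi> ` W)"
      by (rule smooth_on_subset[OF chart_transition[OF assms(2,1)]]) (use assms(4,5) in blast)
    show "(\<phi> \<circ> inv_into V \<psi>) ` \<psi> ` W \<subseteq> \<phi> ` W"
      using assms chart_inv by (auto simp: subset_iff)
  qed (use chart_image_open_subset assms in blast)+
  fix x assume "x \<in> \<psi> ` W"
  then show "(f \<circ> inv_into U \<phi>) ((\<phi> \<circ> inv_into V \<psi>) x) = (f \<circ> inv_into V \<psi>) x"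
    using assms chart_inv by (auto simp: subset_iff)
qed

lemma smooth_map_chart:
  assumes "(U, \<phi>) \<in> A" "open W" "W \<subseteq> U"
  shows "smooth_map A W f \<longleftrightarrow> smooth_on (f \<circ> inv_into U \<phi>) (\<phi> ` W)"
proof
  assume "smooth_map A W f"
  then have "smooth_on (f \<circ> inv_into U \<phi>) (\<phi> ` (W \<inter> U))"
    using assms(1) by (auto simp: smooth_map_def)
  then show "smooth_on (f \<circ> inv_into U \<phi>) (\<phi> ` W)" using assms(3) by (simp add: Int_absorb2)
next
  assume *: "smooth_on (f \<circ> inv_into U \<phi>) (\<phi> ` W)"
  have "smooth_on (f \<circ> inv_into V \<psi>) (\<psi> ` (W \<inter> V))" if "(V, \<psi>) \<in> A" for V \<psi>
    by (rule chart_change[OF assms(1) that], use assms chart_open[OF that] in blast)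
      (use assms smooth_on_subset[OF *, of "\<phi> ` (W \<inter> V)"] in auto)
  then show "smooth_map A W f" by (auto simp: smooth_map_def)
qed

lemma smooth_map_subset: "smooth_map A U f \<Longrightarrow> W \<subseteq> U \<Longrightarrow> smooth_map A W f"
  unfolding smooth_map_def by (fast intro: smooth_on_subset)

lemma smooth_map_local:
  assumes "\<And>p. p \<in> U \<Longrightarrow> \<exists>W. open W \<and> p \<in> W \<and> smooth_map A W f"
  shows "smooth_map A U f"
  unfolding smooth_map_def
proof clarify
  fix V \<psi> assume V: "(V, \<psi>) \<in> A"
  show "smooth_on (f \<circ> inv_into V \<psi>) (\<psi> ` (U \<inter> V))"
  proof (rule smooth_on_local)
    fix x assume "x \<in> \<psi> ` (U \<inter> V)"
    then obtain q where q: "q \<in> U" "q \<in> V" "x = \<psi> q" by auto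
    obtain W where W: "open W" "q \<in> W" "smooth_map A W f" using assms[OF q(1)] by auto
    then have "smooth_on (f \<circ> inv_into V \<psi>) (\<psi> ` (W \<inter> V))" using V by (auto simp: smooth_map_def)
    moreover have "open (\<psi> ` (W \<inter> V))"
      using chart_image_open_subset[OF V] W chart_open[OF V] by blast
    ultimately show "\<exists>T. open T \<and> x \<in> T \<and> smooth_on (f \<circ> inv_into V \<psi>) T"
      using q W by blast
  qed
qed

lemma smooth_map_iff: "open U \<Longrightarrow> smooth_map A U f \<longleftrightarrow> (\<forall>p\<in>U. sm p f)"
  unfolding smooth_near_def using smooth_map_local by blast

lemma sm_chart:
  assumes "(U, \<phi>) \<in> A" "p \<in> U"
  shows "sm p f \<longleftrightarrow> (\<exists>W. open W \<and> p \<in> W \<and> W \<subseteq> U \<and> smooth_on (f \<circ> inv_into U \<phi>) (\<phi> ` W))"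
proof
  assume "sm p f"
  then obtain W where W: "open W" "p \<in> W" "smooth_map A W f" by (auto simp: smooth_near_def)
  then have "smooth_map A (W \<inter> U) f" using smooth_map_subset by blast
  then show "\<exists>W. open W \<and> p \<in> W \<and> W \<subseteq> U \<and> smooth_on (f \<circ> inv_into U \<phi>) (\<phi> ` W)"
    using smooth_map_chart[OF assms(1), of "W \<inter> U"] W assms chart_open[OF assms(1)]
    by (intro exI[of _ "W \<inter> U"]) auto
next
  assume "\<exists>W. open W \<and> p \<in> W \<and> W \<subseteq> U \<and> smooth_on (f \<circ> inv_into U \<phi>) (\<phi> ` W)"
  then show "sm p f" using smooth_map_chart[OF assms(1)] by (auto simp: smooth_near_def)
qed

lemma sm_eventually: "sm p f \<Longrightarrow> \<forall>\<^sub>F q in nhds p. sm q f"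
  unfolding smooth_near_def eventually_nhds by blast

lemma sm_cong:
  assumes "\<forall>\<^sub>F q in nhds p. f q = g q" "sm p f"
  shows "sm p g"
proof -
  obtain U \<phi> where U: "(U, \<phi>) \<in> A" "p \<in> U" by (rule chart_exists)
  obtain W where W: "open W" "p \<in> W" "W \<subseteq> U" "smooth_on (f \<circ> inv_into U \<phi>) (\<phi> ` W)"
    using assms(2) sm_chart[OF U] by auto
  obtain S where S: "open S" "p \<in> S" "\<And>q. q \<in> S \<Longrightarrow> f q = g q"
    using assms(1) by (auto simp: eventually_nhds)
  have "smooth_on (g \<circ> inv_into U \<phi>) (\<phi> ` (W \<inter> S))"
  proof (rule smooth_on_cong)
    show "smooth_on (f \<circ> inv_into U \<phi>) (\<phi> ` (W \<inter> S))" by (rule smooth_on_subset[OF W(4)]) blast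
    show "open (\<phi> ` (W \<inter> S))" using chart_image_open_subset[OF U(1), of "W \<inter> S"] W S by blast
    fix x assume "x \<in> \<phi> ` (W \<inter> S)"
    then show "(f \<circ> inv_into U \<phi>) x = (g \<circ> inv_into U \<phi>) x"
      using S(3) chart_inv[OF U(1)] W(3) by (auto simp: subset_iff)
  qed
  then show ?thesis
    unfolding sm_chart[OF U] using W S by (intro exI[of _ "W \<inter> S"]) auto
qed

lemma sm_cong_iff: "\<forall>\<^sub>F q in nhds p. f q = g q \<Longrightarrow> sm p f \<longleftrightarrow> sm p g"
  using sm_cong[of f g p] sm_cong[of g f p] by (auto simp: eq_commute)

lemma sm_lift2:
  assumes "sm p f" "sm p g"
    and h: "\<And>S f' g'. open S \<Longrightarrow> smooth_on f' S \<Longrightarrow> smooth_on g' (S::'v set) \<Longrightarrow>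
      smooth_on (\<lambda>x. h (f' x) (g' x)) S"
  shows "sm p (\<lambda>q. h (f q) (g q))"
proof -
  obtain U \<phi> where U: "(U, \<phi>) \<in> A" "p \<in> U" by (rule chart_exists)
  obtain W where W: "open W" "p \<in> W" "W \<subseteq> U" "smooth_on (f \<circ> inv_into U \<phi>) (\<phi> ` W)"
    using assms(1) sm_chart[OF U] by auto
  obtain S where S: "open S" "p \<in> S" "S \<subseteq> U" "smooth_on (g \<circ> inv_into U \<phi>) (\<phi> ` S)"
    using assms(2) sm_chart[OF U] by auto
  have "smooth_on (\<lambda>x. h ((f \<circ> inv_into U \<phi>) x) ((g \<circ> inv_into U \<phi>) x)) (\<phi> ` (W \<inter> S))"
  proof (rule h)
    show "open (\<phi> ` (W \<inter> S))" using chart_image_open_subset[OF U(1), of "W \<inter> S"] W S by blast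
    show "smooth_on (f \<circ> inv_into U \<phi>) (\<phi> ` (W \<inter> S))" by (rule smooth_on_subset[OF W(4)]) blast
    show "smooth_on (g \<circ> inv_into U \<phi>) (\<phi> ` (W \<inter> S))" by (rule smooth_on_subset[OF S(4)]) blast
  qed
  then have "smooth_on ((\<lambda>q. h (f q) (g q)) \<circ> inv_into U \<phi>) (\<phi> ` (W \<inter> S))"
    by (simp add: comp_def)
  then show ?thesis
    unfolding sm_chart[OF U] using W S by (intro exI[of _ "W \<inter> S"]) auto
qed

lemma sm_const [simp]: "sm p (\<lambda>q. c)"
proof -
  obtain U \<phi> where U: "(U, \<phi>) \<in> A" "p \<in> U" by (rule chart_exists)
  then show ?thesis unfolding sm_chart[OF U]
    using smooth_on_const[of c] chart_open by (intro exI[of _ U]) (auto simp: comp_def)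
qed

lemma sm_add: "sm p f \<Longrightarrow> sm p g \<Longrightarrow> sm p (\<lambda>q. f q + g q)"
  by (rule sm_lift2) (auto intro: smooth_on_add)

lemma sm_mult: "sm p f \<Longrightarrow> sm p g \<Longrightarrow> sm p (\<lambda>q. f q * g q)"
  by (rule sm_lift2) (auto intro: smooth_on_mult)

lemma sm_minus: "sm p f \<Longrightarrow> sm p (\<lambda>q. - f q)"
  using sm_mult[OF sm_const[of p "-1"]] by simp

lemma sm_diff: "sm p f \<Longrightarrow> sm p g \<Longrightarrow> sm p (\<lambda>q. f q - g q)"
  using sm_add[OF _ sm_minus] by simp

lemma sm_sum: "(\<And>i. i \<in> I \<Longrightarrow> sm p (f i)) \<Longrightarrow> sm p (\<lambda>q. \<Sum>i\<in>I. f i q)"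
  by (induction I rule: infinite_finite_induct) (auto intro: sm_add)

lemma sm_prod: "(\<And>i. i \<in> I \<Longrightarrow> sm p (f i)) \<Longrightarrow> sm p (\<lambda>q. \<Prod>i\<in>I. f i q)"
  by (induction I rule: infinite_finite_induct) (auto intro: sm_mult)

lemma sm_comp_real:
  assumes "sm p f" "smooth_on h UNIV"
  shows "sm p (\<lambda>q. h (f q))"
  by (rule sm_lift2[OF assms(1,1), of "\<lambda>x y. h x"])
    (rule smooth_on_compose[OF onb_real assms(2)], auto)

lemma sm_isCont:
  assumes "sm p f"
  shows "isCont f p"
proof -
  obtain U \<phi> where U: "(U, \<phi>) \<in> A" "p \<in> U" by (rule chart_exists)
  obtain W where W: "open W" "p \<in> W" "W \<subseteq> U" "smooth_on (f \<circ> inv_into U \<phi>) (\<phi> ` W)"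
    using assms sm_chart[OF U] by auto
  have "continuous_on W (\<lambda>q. (f \<circ> inv_into U \<phi>) (\<phi> q))"
    by (rule continuous_on_compose2[OF smooth_on_imp_continuous_on[OF W(4)]
          continuous_on_subset[OF homeomorphism_cont1[OF chart_homeo[OF U(1)]] W(3)]]) simp
  then have "continuous_on W f"
    by (rule continuous_on_eq) (use W(3) chart_inv[OF U(1)] in auto)
  then show ?thesis using W by (simp add: continuous_on_eq_continuous_at)
qed

lemma sm_eventually_nonzero:
  assumes "sm p f" "f p \<noteq> 0"
  shows "\<forall>\<^sub>F q in nhds p. f q \<noteq> 0"
proof -
  have "(f \<longlongrightarrow> f p) (nhds p)"
    using sm_isCont[OF assms(1)] by (simp add: continuous_at tendsto_at_iff_tendsto_nhds)
  then show ?thesis using assms(2) by (rule tendsto_imp_eventually_ne)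
qed

lemma sm_inverse:
  assumes "sm p f" "f p \<noteq> 0"
  shows "sm p (\<lambda>q. inverse (f q))"
proof -
  obtain U \<phi> where U: "(U, \<phi>) \<in> A" "p \<in> U" by (rule chart_exists)
  obtain W where W: "open W" "p \<in> W" "W \<subseteq> U" "smooth_on (f \<circ> inv_into U \<phi>) (\<phi> ` W)"
    using assms sm_chart[OF U] by auto
  obtain S where S: "open S" "p \<in> S" "\<And>q. q \<in> S \<Longrightarrow> f q \<noteq> 0"
    using sm_eventually_nonzero[OF assms] by (auto simp: eventually_nhds)
  have "smooth_on (\<lambda>x. inverse ((f \<circ> inv_into U \<phi>) x)) (\<phi> ` (W \<inter> S))"
  proof (rule smooth_on_inverse)
    show "smooth_on (f \<circ> inv_into U \<phi>) (\<phi> ` (W \<inter> S))" by (rule smooth_on_subset[OF W(4)]) blast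
    show "open (\<phi> ` (W \<inter> S))" using chart_image_open_subset[OF U(1), of "W \<inter> S"] W S by blast
    fix x assume "x \<in> \<phi> ` (W \<inter> S)"
    then show "(f \<circ> inv_into U \<phi>) x \<noteq> 0"
      using S(3) chart_inv[OF U(1)] W(3) by (auto simp: subset_iff)
  qed
  then have "smooth_on ((\<lambda>q. inverse (f q)) \<circ> inv_into U \<phi>) (\<phi> ` (W \<inter> S))"
    by (simp add: comp_def)
  then show ?thesis
    unfolding sm_chart[OF U] using W S by (intro exI[of _ "W \<inter> S"]) auto
qed

lemma sm_chart_comp:
  assumes "(U, \<phi>) \<in> A" "p \<in> U" "smooth_on g (\<phi> ` U)"
  shows "sm p (\<lambda>q. g (\<phi> q))"
  unfolding sm_chart[OF assms(1,2)]
proof (intro exI[of _ U] conjI)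
  show "smooth_on ((\<lambda>q. g (\<phi> q)) \<circ> inv_into U \<phi>) (\<phi> ` U)"
    by (rule smooth_on_cong[OF chart_image_open[OF assms(1)] _ assms(3)])
      (auto simp: chart_inv[OF assms(1)])
qed (use assms chart_open in auto)

lemma sm_coord: "(U, \<phi>) \<in> A \<Longrightarrow> p \<in> U \<Longrightarrow> sm p (\<lambda>q. \<phi> q \<bullet> b)"
  by (rule sm_chart_comp) (auto intro: smooth_on_bounded_linear_comp[OF bounded_linear_inner_left]
      smooth_on_ident chart_image_open)


subsection \<open>Tangent vectors as derivations\<close>

lemma sm_differentiable:
  assumes "sm p f" "(U, \<phi>) \<in> A" "p \<in> U"
  shows "(f \<circ> inv_into U \<phi>) differentiable (at (\<phi> p))"
  using assms(1) unfolding sm_chart[OF assms(2,3)] using smooth_on_imp_differentiable by blast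

lemma sm_has_derivative:
  assumes "sm p f" "(U, \<phi>) \<in> A" "p \<in> U"
  shows "((f \<circ> inv_into U \<phi>) has_derivative frechet_derivative (f \<circ> inv_into U \<phi>) (at (\<phi> p)))
    (at (\<phi> p))"
  using sm_differentiable[OF assms] frechet_derivative_works by blast

lemma chart_tangent_apply:
  "sm p f \<Longrightarrow> chart_tangent A U \<phi> p v f = frechet_derivative (f \<circ> inv_into U \<phi>) (at (\<phi> p)) v"
  by (simp add: chart_tangent_def)

lemma chart_tangent_cong:
  assumes "(U, \<phi>) \<in> A" "p \<in> U" "\<forall>\<^sub>F q in nhds p. f q = g q"
  shows "chart_tangent A U \<phi> p v f = chart_tangent A U \<phi> p v g"
proof (cases "sm p f")
  case True
  obtain S where S: "open S" "p \<in> S" "\<And>q. q \<in> S \<Longrightarrow> f q = g q"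
    using assms(3) by (auto simp: eventually_nhds)
  have "frechet_derivative (g \<circ> inv_into U \<phi>) (at (\<phi> p))
      = frechet_derivative (f \<circ> inv_into U \<phi>) (at (\<phi> p))"
  proof (rule frechet_derivative_cong_open)
    show "open (\<phi> ` (U \<inter> S))"
      using chart_image_open_subset[OF assms(1), of "U \<inter> S"] S chart_open[OF assms(1)] by blast
    show "(f \<circ> inv_into U \<phi>) differentiable at (\<phi> p)" using sm_differentiable True assms by blast
  qed (use assms S chart_inv[OF assms(1)] in auto)
  then show ?thesis using True sm_cong[OF assms(3)] by (simp add: chart_tangent_def)
next
  case False
  then show ?thesis using sm_cong_iff[OF assms(3)] by (simp add: chart_tangent_def)
qed

lemma chart_tangent_change:
  assumes "(U, \<phi>) \<in> A" "(V, \<psi>) \<in> A" "p \<in> U" "p \<in> V"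
  shows "chart_tangent A V \<psi> p w =
    chart_tangent A U \<phi> p (frechet_derivative (\<phi> \<circ> inv_into V \<psi>) (at (\<psi> p)) w)"
proof
  fix f
  show "chart_tangent A V \<psi> p w f =
    chart_tangent A U \<phi> p (frechet_derivative (\<phi> \<circ> inv_into V \<psi>) (at (\<psi> p)) w) f"
  proof (cases "sm p f")
    case True
    let ?g = "\<phi> \<circ> inv_into V \<psi>"
    have d: "(?g has_derivative frechet_derivative ?g (at (\<psi> p))) (at (\<psi> p))"
      using smooth_on_imp_differentiable[OF chart_transition[OF assms(2,1)]] assms
        frechet_derivative_works by blast
    have e: "?g (\<psi> p) = \<phi> p" using chart_inv[OF assms(2,4)] by simp
    have "((\<lambda>x. (f \<circ> inv_into U \<phi>) (?g x)) has_derivative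
        (\<lambda>v. frechet_derivative (f \<circ> inv_into U \<phi>) (at (\<phi> p)) (frechet_derivative ?g (at (\<psi> p)) v)))
        (at (\<psi> p))"
      using has_derivative_compose[OF d, of "f \<circ> inv_into U \<phi>"] sm_has_derivative[OF True assms(1,3)]
      unfolding e by blast
    then have "((f \<circ> inv_into V \<psi>) has_derivative
        (\<lambda>v. frechet_derivative (f \<circ> inv_into U \<phi>) (at (\<phi> p)) (frechet_derivative ?g (at (\<psi> p)) v)))
        (at (\<psi> p))"
    proof (rule has_derivative_transform_within_open)
      show "open (\<psi> ` (U \<inter> V))"
        using chart_image_open_subset[OF assms(2), of "U \<inter> V"] chart_open assms by blast
    qed (use assms chart_inv[OF assms(2)] chart_inv[OF assms(1)] in auto)
    then show ?thesis using True by (simp add: chart_tangent_apply frechet_derivative_eqI)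
  qed (simp add: chart_tangent_def)
qed

lemma tangent_space_chart:
  assumes "(U, \<phi>) \<in> A" "p \<in> U"
  shows "tangent_space A p = range (chart_tangent A U \<phi> p)"
  using assms chart_tangent_change[OF assms(1)] unfolding tangent_space_def by blast

lemma chart_tangent_add:
  assumes "(U, \<phi>) \<in> A" "p \<in> U"
  shows "chart_tangent A U \<phi> p (v + w) = chart_tangent A U \<phi> p v + chart_tangent A U \<phi> p w"
proof
  fix f show "chart_tangent A U \<phi> p (v + w) f = (chart_tangent A U \<phi> p v + chart_tangent A U \<phi> p w) f"
    using linear_add[OF has_derivative_linear[OF sm_has_derivative[OF _ assms]], of f v w]
    by (simp add: chart_tangent_def)
qed

lemma chart_tangent_scaleR:
  assumes "(U, \<phi>) \<in> A" "p \<in> U"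
  shows "chart_tangent A U \<phi> p (c *\<^sub>R v) = c *\<^sub>R chart_tangent A U \<phi> p v"
proof
  fix f show "chart_tangent A U \<phi> p (c *\<^sub>R v) f = (c *\<^sub>R chart_tangent A U \<phi> p v) f"
    using linear_scale[OF has_derivative_linear[OF sm_has_derivative[OF _ assms]], of f c v]
    by (simp add: chart_tangent_def)
qed

lemma tangent_space_subspace: "subspace (tangent_space A p)"
proof -
  obtain U \<phi> where U: "(U, \<phi>) \<in> A" "p \<in> U" by (rule chart_exists)
  have "linear (chart_tangent A U \<phi> p)"
    by (rule linearI) (simp_all add: chart_tangent_add[OF U] chart_tangent_scaleR[OF U])
  then show ?thesis unfolding tangent_space_chart[OF U]
    using linear_subspace_image subspace_UNIV by blast
qed

lemma chart_tangent_coord: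
  assumes "(U, \<phi>) \<in> A" "p \<in> U"
  shows "chart_tangent A U \<phi> p v (\<lambda>q. \<phi> q \<bullet> b) = v \<bullet> b"
proof -
  have "((\<lambda>x. x \<bullet> b) has_derivative (\<lambda>v. v \<bullet> b)) (at (\<phi> p))"
    by (rule bounded_linear_imp_has_derivative[OF bounded_linear_inner_left])
  then have "(((\<lambda>q. \<phi> q \<bullet> b) \<circ> inv_into U \<phi>) has_derivative (\<lambda>v. v \<bullet> b)) (at (\<phi> p))"
    by (rule has_derivative_transform_within_open[OF _ chart_image_open[OF assms(1)]])
      (use assms chart_inv[OF assms(1)] in auto)
  then show ?thesis using sm_coord[OF assms] by (simp add: chart_tangent_apply frechet_derivative_eqI)
qed

lemma chart_tangent_inj:
  assumes "(U, \<phi>) \<in> A" "p \<in> U" "chart_tangent A U \<phi> p v = chart_tangent A U \<phi> p w"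
  shows "v = w"
proof -
  have "v \<bullet> b = w \<bullet> b" for b
    using chart_tangent_coord[OF assms(1,2), of v b] chart_tangent_coord[OF assms(1,2), of w b] assms(3)
    by simp
  then have "(\<Sum>b\<in>Bv. (v \<bullet> b) *\<^sub>R b) = (\<Sum>b\<in>Bv. (w \<bullet> b) *\<^sub>R b)" by simp
  then show ?thesis by (simp only: onb_expand)
qed

lemma tangent_cong:
  assumes "t \<in> tangent_space A p" "\<forall>\<^sub>F q in nhds p. f q = g q"
  shows "t f = t g"
  using assms chart_tangent_cong unfolding tangent_space_def by blast

lemma tangent_not_smooth: "t \<in> tangent_space A p \<Longrightarrow> \<not> sm p f \<Longrightarrow> t f = 0"
  unfolding tangent_space_def by (auto simp: chart_tangent_def)

lemma tangent_const:
  assumes "t \<in> tangent_space A p" shows "t (\<lambda>q. c) = 0"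
  using assms unfolding tangent_space_def
  by (auto simp: chart_tangent_apply comp_def frechet_derivative_eqI[OF has_derivative_const])

lemma tangent_add:
  assumes "t \<in> tangent_space A p" "sm p f" "sm p g"
  shows "t (\<lambda>q. f q + g q) = t f + t g"
proof -
  obtain U \<phi> v where U: "(U, \<phi>) \<in> A" "p \<in> U" and t: "t = chart_tangent A U \<phi> p v"
    using assms(1) unfolding tangent_space_def by auto
  have "frechet_derivative ((\<lambda>q. f q + g q) \<circ> inv_into U \<phi>) (at (\<phi> p)) =
    (\<lambda>v. frechet_derivative (f \<circ> inv_into U \<phi>) (at (\<phi> p)) v
      + frechet_derivative (g \<circ> inv_into U \<phi>) (at (\<phi> p)) v)"
    using frechet_derivative_eqI[OF has_derivative_add[OF sm_has_derivative[OF assms(2) U]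
          sm_has_derivative[OF assms(3) U]]] by (simp add: comp_def)
  then show ?thesis using assms(2,3) by (simp add: t chart_tangent_apply sm_add)
qed

lemma tangent_mult:
  assumes "t \<in> tangent_space A p" "sm p f" "sm p g"
  shows "t (\<lambda>q. f q * g q) = f p * t g + g p * t f"
proof -
  obtain U \<phi> v where U: "(U, \<phi>) \<in> A" "p \<in> U" and t: "t = chart_tangent A U \<phi> p v"
    using assms(1) unfolding tangent_space_def by auto
  have "frechet_derivative ((\<lambda>q. f q * g q) \<circ> inv_into U \<phi>) (at (\<phi> p)) =
    (\<lambda>v. f p * frechet_derivative (g \<circ> inv_into U \<phi>) (at (\<phi> p)) v
      + frechet_derivative (f \<circ> inv_into U \<phi>) (at (\<phi> p)) v * g p)"
    using frechet_derivative_eqI[OF has_derivative_mult[OF sm_has_derivative[OF assms(2) U]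
          sm_has_derivative[OF assms(3) U]]] by (simp add: comp_def chart_inv[OF U])
  then show ?thesis using assms(2,3) by (simp add: t chart_tangent_apply sm_mult)
qed

lemma tangent_cmult: "t \<in> tangent_space A p \<Longrightarrow> sm p f \<Longrightarrow> t (\<lambda>q. c * f q) = c * t f"
  using tangent_mult[of t p "\<lambda>q. c" f] tangent_const[of t p c] by simp

lemma tangent_minus: "t \<in> tangent_space A p \<Longrightarrow> sm p f \<Longrightarrow> t (\<lambda>q. - f q) = - t f"
  using tangent_cmult[of t p f "-1"] by simp

lemma tangent_diff: "t \<in> tangent_space A p \<Longrightarrow> sm p f \<Longrightarrow> sm p g \<Longrightarrow> t (\<lambda>q. f q - g q) = t f - t g"
  using tangent_add[of t p f "\<lambda>q. - g q"] tangent_minus[of t p g] by (simp add: sm_minus)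

lemma tangent_eqI:
  assumes "s \<in> tangent_space A p" "t \<in> tangent_space A p" "\<And>f. sm p f \<Longrightarrow> s f = t f"
  shows "s = t"
  using assms tangent_not_smooth by (metis ext)


subsection \<open>Vector fields\<close>

lemma smooth_map_componentwise:
  assumes "open U" "\<And>b. b \<in> Bv \<Longrightarrow> smooth_map A U (\<lambda>q. g q \<bullet> b)"
  shows "smooth_map A U (g :: 'm \<Rightarrow> 'v)"
  unfolding smooth_map_def
proof clarify
  fix V \<psi> assume V: "(V, \<psi>) \<in> A"
  have "smooth_on (\<lambda>x. (g \<circ> inv_into V \<psi>) x \<bullet> b) (\<psi> ` (U \<inter> V))" if "b \<in> Bv" for b
  proof -
    have "smooth_on ((\<lambda>q. g q \<bullet> b) \<circ> inv_into V \<psi>) (\<psi> ` (U \<inter> V))"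
      using assms(2)[OF that] V by (auto simp: smooth_map_def)
    then show ?thesis by (simp add: comp_def)
  qed
  then show "smooth_on (g \<circ> inv_into V \<psi>) (\<psi> ` (U \<inter> V))"
    using smooth_on_componentwise[OF onb_Bv]
      chart_image_open_subset[OF V, of "U \<inter> V"] chart_open[OF V] assms(1) by blast
qed

lemma vector_fields_iff:
  assumes U: "open U"
  shows "X \<in> vector_fields A U \<longleftrightarrow>
    (\<forall>p\<in>U. X p \<in> tangent_space A p \<and> (\<forall>f. sm p f \<longrightarrow> sm p (\<lambda>q. X q f)))"
proof (intro iffI ballI conjI allI impI)
  fix p assume X: "X \<in> vector_fields A U" and p: "p \<in> U"
  have tg: "X q \<in> tangent_space A q" if "q \<in> U" for q using X that by (auto simp: vector_fields_def)
  show "X p \<in> tangent_space A p" by (rule tg[OF p])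
  fix f assume f: "sm p f"
  obtain V \<phi> where V: "(V, \<phi>) \<in> A" "p \<in> V" by (rule chart_exists)
  define v where "v q = (THE v. X q = chart_tangent A V \<phi> q v)" for q
  have Xv: "X q = chart_tangent A V \<phi> q (v q)" if q: "q \<in> U \<inter> V" for q
  proof -
    obtain w where w: "X q = chart_tangent A V \<phi> q w"
      using tg[of q] q tangent_space_chart[OF V(1), of q] by auto
    then show ?thesis unfolding v_def
      using theI[of "\<lambda>v. X q = chart_tangent A V \<phi> q v" w] chart_tangent_inj[OF V(1), of q w] q
      by (metis IntD2)
  qed
  obtain W where W: "open W" "p \<in> W" "W \<subseteq> V" "smooth_on (f \<circ> inv_into V \<phi>) (\<phi> ` W)"
    using f sm_chart[OF V] by auto
  have smW: "sm q f" if "q \<in> W" for q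
    using W that smooth_map_chart[OF V(1) W(1,3)] smooth_map_iff by blast
  let ?S = "\<phi> ` (U \<inter> W)"
  have opS: "open ?S" using chart_image_open_subset[OF V(1), of "U \<inter> W"] U W by blast
  have "smooth_map A (U \<inter> V) v" using X V by (auto simp: vector_fields_def v_def[abs_def])
  then have "smooth_on (v \<circ> inv_into V \<phi>) (\<phi> ` (U \<inter> V \<inter> V))" using V by (auto simp: smooth_map_def)
  then have sv: "smooth_on (v \<circ> inv_into V \<phi>) ?S" using W by (auto elim!: smooth_on_subset)
  have "smooth_on ((\<lambda>q. X q f) \<circ> inv_into V \<phi>) ?S"
  proof (rule smooth_on_cong[OF opS])
    show "smooth_on (\<lambda>x. \<Sum>b\<in>Bv. ((v \<circ> inv_into V \<phi>) x \<bullet> b) *\<^sub>R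
        frechet_derivative (f \<circ> inv_into V \<phi>) (at x) b) ?S"
      using W by (intro smooth_on_sum smooth_on_scaleR opS sv smooth_on_frechet_derivative
          smooth_on_bounded_linear_comp[OF bounded_linear_inner_left]) (auto elim!: smooth_on_subset)
    fix x assume "x \<in> ?S"
    then obtain q where q: "q \<in> U" "q \<in> W" "x = \<phi> q" by auto
    have "X q f = frechet_derivative (f \<circ> inv_into V \<phi>) (at (\<phi> q)) (v q)"
      using Xv[of q] q W(3) smW by (auto simp: chart_tangent_apply)
    also have "\<dots> = (\<Sum>b\<in>Bv. (v q \<bullet> b) *\<^sub>R frechet_derivative (f \<circ> inv_into V \<phi>) (at (\<phi> q)) b)"
      by (rule frechet_derivative_onb_expand[OF onb_Bv])
        (use sm_differentiable[OF smW V(1)] q W in auto)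
    finally show "(\<Sum>b\<in>Bv. ((v \<circ> inv_into V \<phi>) x \<bullet> b) *\<^sub>R
        frechet_derivative (f \<circ> inv_into V \<phi>) (at x) b) = ((\<lambda>q. X q f) \<circ> inv_into V \<phi>) x"
      using q W(3) chart_inv[OF V(1), of q] by auto
  qed
  then show "sm p (\<lambda>q. X q f)"
    unfolding sm_chart[OF V] using p W U by (intro exI[of _ "U \<inter> W"]) auto
next
  assume R: "\<forall>p\<in>U. X p \<in> tangent_space A p \<and> (\<forall>f. sm p f \<longrightarrow> sm p (\<lambda>q. X q f))"
  have "smooth_map A (U \<inter> V) (\<lambda>p. THE v. X p = chart_tangent A V \<phi> p v)"
    if V: "(V, \<phi>) \<in> A" for V \<phi>
  proof (rule smooth_map_componentwise)
    show "open (U \<inter> V)" using U chart_open[OF V] by blast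
    fix b :: 'v
    have eq: "(THE v. X p = chart_tangent A V \<phi> p v) \<bullet> b = X p (\<lambda>q. \<phi> q \<bullet> b)" if pUV: "p \<in> U \<inter> V" for p
    proof -
      obtain w where w: "X p = chart_tangent A V \<phi> p w"
        using R pUV tangent_space_chart[OF V, of p] by blast
      then have "(THE v. X p = chart_tangent A V \<phi> p v) = w"
        using chart_tangent_inj[OF V, of p] pUV by (intro the_equality) auto
      then show ?thesis using w chart_tangent_coord[OF V, of p w b] pUV by simp
    qed
    show "smooth_map A (U \<inter> V) (\<lambda>p. (THE v. X p = chart_tangent A V \<phi> p v) \<bullet> b)"
      unfolding smooth_map_iff[OF \<open>open (U \<inter> V)\<close>]
    proof
      fix p assume p: "p \<in> U \<inter> V"
      have "sm p (\<lambda>q. X q (\<lambda>q. \<phi> q \<bullet> b))" using R p sm_coord[OF V] by auto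
      then show "sm p (\<lambda>p. (THE v. X p = chart_tangent A V \<phi> p v) \<bullet> b)"
        by (rule sm_cong[rotated])
          (use eq p \<open>open (U \<inter> V)\<close> in \<open>auto simp: eventually_nhds intro!: exI[of _ "U \<inter> V"]\<close>)
    qed
  qed
  then show "X \<in> vector_fields A U" using R by (auto simp: vector_fields_def)
qed


subsection \<open>Bump functions and partitions of unity\<close>

lemma compact_cball_inner: "compact (cball (a::'v) r)"
proof -
  define K where "K B R = {\<Sum>b\<in>B. c b *\<^sub>R b | c. \<forall>b. \<bar>c b\<bar> \<le> R}" for B :: "'v set" and R
  have K: "compact (K B R)" if "finite B" "R \<ge> 0" for B R
    using that(1)
  proof induction
    case empty
    have "K {} R = {0}" using that(2) by (auto simp: K_def intro!: exI[of _ "\<lambda>_. 0"])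
    then show ?case by simp
  next
    case (insert b B)
    have "K (insert b B) R = (\<lambda>(t, x). t *\<^sub>R b + x) ` ({-R..R} \<times> K B R)" (is "?L = ?R")
    proof (intro set_eqI iffI)
      fix x assume "x \<in> ?L"
      then obtain c where "\<forall>b. \<bar>c b\<bar> \<le> R" "x = (\<Sum>b\<in>insert b B. c b *\<^sub>R b)" by (auto simp: K_def)
      then show "x \<in> ?R" using insert.hyps
        by (intro image_eqI[of _ _ "(c b, \<Sum>b\<in>B. c b *\<^sub>R b)"]) (auto simp: K_def abs_le_iff minus_le_iff)
    next
      fix x assume "x \<in> ?R"
      then obtain t c where tc: "\<bar>t\<bar> \<le> R" "\<forall>b. \<bar>c b\<bar> \<le> R" "x = t *\<^sub>R b + (\<Sum>b\<in>B. c b *\<^sub>R b)"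
        by (fastforce simp: K_def abs_le_iff minus_le_iff)
      have "(\<Sum>b'\<in>B. (c(b := t)) b' *\<^sub>R b') = (\<Sum>b\<in>B. c b *\<^sub>R b)"
        using insert.hyps by (intro sum.cong) auto
      then have "x = (\<Sum>b'\<in>insert b B. (c(b := t)) b' *\<^sub>R b')" using tc(3) insert.hyps by simp
      then show "x \<in> ?L" unfolding K_def using tc by fastforce
    qed
    moreover have "compact ?R"
      by (intro compact_continuous_image compact_Times insert.IH)
        (auto intro!: continuous_intros simp: case_prod_beta)
    ultimately show ?case by simp
  qed
  define R where "R = norm a + \<bar>r\<bar>"
  have Bn: "\<bar>x \<bullet> b\<bar> \<le> norm x * (\<Sum>b\<in>Bv. norm b)" if "b \<in> Bv" for x b
  proof -
    have "norm b \<le> (\<Sum>b\<in>Bv. norm b)" by (rule member_le_sum) (use that finite_Bv in auto)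
    then show ?thesis
      using Cauchy_Schwarz_ineq2[of x b] by (meson mult_left_mono norm_ge_zero order_trans)
  qed
  have "cball a r \<subseteq> K Bv (R * (\<Sum>b\<in>Bv. norm b))"
  proof
    fix x assume "x \<in> cball a r"
    then have "norm x \<le> R" unfolding R_def using norm_triangle_sub[of x a]
      by (auto simp: dist_norm norm_minus_commute)
    define c where "c b = (if b \<in> Bv then x \<bullet> b else 0)" for b
    have "\<bar>c b\<bar> \<le> R * (\<Sum>b\<in>Bv. norm b)" for b
    proof (cases "b \<in> Bv")
      case True
      have "norm x * (\<Sum>b\<in>Bv. norm b) \<le> R * (\<Sum>b\<in>Bv. norm b)"
        using \<open>norm x \<le> R\<close> by (intro mult_right_mono) (auto intro: sum_nonneg)
      then show ?thesis using Bn[OF True, of x] True by (simp add: c_def)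
    next
      case False
      then show ?thesis by (auto simp: c_def R_def intro!: mult_nonneg_nonneg sum_nonneg)
    qed
    moreover have "x = (\<Sum>b\<in>Bv. c b *\<^sub>R b)" by (simp add: c_def onb_expand)
    ultimately show "x \<in> K Bv (R * (\<Sum>b\<in>Bv. norm b))" unfolding K_def by blast
  qed
  moreover have "compact (K Bv (R * (\<Sum>b\<in>Bv. norm b)))"
    by (intro K finite_Bv) (auto simp: R_def intro!: mult_nonneg_nonneg sum_nonneg)
  ultimately show ?thesis
    using closed_cball[of a r] compact_Int_closed by (metis inf.absorb2)
qed

lemma bump_exists:
  assumes "open U" "p \<in> U"
  obtains g where "\<And>q. sm q g" "\<forall>\<^sub>F q in nhds p. g q = 1"
    "\<And>q. q \<notin> U \<Longrightarrow> \<forall>\<^sub>F z in nhds q. g z = 0"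
proof -
  obtain V \<phi> where V: "(V, \<phi>) \<in> A" "p \<in> V" by (rule chart_exists)
  have "open (\<phi> ` (U \<inter> V))"
    using chart_image_open_subset[OF V(1), of "U \<inter> V"] chart_open[OF V(1)] assms by blast
  then obtain e where e: "e > 0" "cball (\<phi> p) e \<subseteq> \<phi> ` (U \<inter> V)"
    using assms V open_contains_cball by blast
  define N where "N x = (\<Sum>b\<in>Bv. ((x - \<phi> p) \<bullet> b) * ((x - \<phi> p) \<bullet> b))" for x
  have N: "N x = norm (x - \<phi> p) ^ 2" for x
  proof -
    have "(x - \<phi> p) \<bullet> (x - \<phi> p) = (x - \<phi> p) \<bullet> (\<Sum>b\<in>Bv. ((x - \<phi> p) \<bullet> b) *\<^sub>R b)"
      by (simp add: onb_expand)
    then show ?thesis by (simp add: N_def inner_sum_right power2_norm_eq_inner)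
  qed
  define h where "h x = step (2 / e\<^sup>2 * N x)" for x
  define g where "g q = (if q \<in> V then h (\<phi> q) else 0)" for q
  define K where "K = inv_into V \<phi> ` cball (\<phi> p) e"
  have "continuous_on (cball (\<phi> p) e) (inv_into V \<phi>)"
    using homeomorphism_cont2[OF chart_homeo[OF V(1)]] e(2) by (auto elim!: continuous_on_subset)
  then have "closed K"
    unfolding K_def by (intro compact_imp_closed compact_continuous_image compact_cball_inner)
  have KU: "K \<subseteq> U \<inter> V" using e(2) chart_inv[OF V(1)] by (auto simp: K_def)
  have gK: "g q = 0" if "q \<notin> K" for q
  proof (cases "q \<in> V")
    case True
    have "\<phi> q \<notin> cball (\<phi> p) e"
      using that chart_inv[OF V(1) True] unfolding K_def by (metis image_eqI)
    then have "norm (\<phi> q - \<phi> p) > e" by (simp add: dist_norm norm_minus_commute)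
    then have "N (\<phi> q) \<ge> e\<^sup>2" unfolding N using e(1) by (intro power_mono) auto
    then have "2 / e\<^sup>2 * N (\<phi> q) \<ge> 2" using e(1) by (simp add: field_simps)
    then show ?thesis using True by (simp add: g_def h_def step_eq_0)
  qed (simp add: g_def)
  have out: "\<forall>\<^sub>F z in nhds q. g z = 0" if "q \<notin> K" for q
    using gK that \<open>closed K\<close> by (auto simp: eventually_nhds intro!: exI[of _ "- K"])
  have smN: "sm q (\<lambda>z. N (\<phi> z))" if "q \<in> V" for q
    unfolding N_def inner_diff_left
    by (intro sm_sum sm_mult sm_diff sm_coord[OF V(1) that] sm_const)
  have "sm q g" for q
  proof (cases "q \<in> V")
    case True
    have "sm q (\<lambda>z. h (\<phi> z))"
      unfolding h_def by (intro sm_comp_real[OF _ step_smooth] sm_mult sm_const smN True)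
    then show ?thesis
      by (rule sm_cong[rotated]) (use True chart_open[OF V(1)] in
          \<open>auto simp: g_def eventually_nhds intro!: exI[of _ V]\<close>)
  next
    case False
    then have "q \<notin> K" using KU by auto
    then have "\<forall>\<^sub>F z in nhds q. g z = 0" by (rule out)
    then have "\<forall>\<^sub>F z in nhds q. 0 = g z" by eventually_elim simp
    then show ?thesis by (rule sm_cong) simp
  qed
  moreover have "\<forall>\<^sub>F q in nhds p. g q = 1"
  proof -
    have "continuous_on V (\<lambda>q. N (\<phi> q))"
      using smN sm_isCont chart_open[OF V(1)] by (simp add: continuous_on_eq_continuous_at)
    then have "open {q \<in> V. N (\<phi> q) < e\<^sup>2 / 2}"
      using chart_open[OF V(1)] continuous_open_preimage[of V "\<lambda>q. N (\<phi> q)" "{..<e\<^sup>2 / 2}"]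
      by (simp add: vimage_def Int_def conj_commute)
    moreover have "g q = 1" if "q \<in> {q \<in> V. N (\<phi> q) < e\<^sup>2 / 2}" for q
      using that e(1) by (auto simp: g_def h_def field_simps intro!: step_eq_1)
    moreover have "p \<in> {q \<in> V. N (\<phi> q) < e\<^sup>2 / 2}" using V e(1) by (simp add: N)
    ultimately show ?thesis by (auto simp: eventually_nhds)
  qed
  ultimately show thesis using that out KU by blast
qed

text \<open>With \<open>g i\<close> bump functions equal to 1 on \<open>V i\<close> and \<open>V\<close> covering, the functions
  \<open>h n = g n * (\<Prod>i<n. 1 - g i)\<close> telescope to \<open>1 - (\<Prod>i\<le>m. 1 - g i)\<close>, which is 1 on \<open>V m\<close>. This
  gives local finiteness without paracompactness.\<close>

lemma partition_of_unity:
  assumes "\<And>p. open (U p) \<and> p \<in> U p"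
  obtains h :: "nat \<Rightarrow> 'm \<Rightarrow> real" and c :: "nat \<Rightarrow> 'm" and V :: "nat \<Rightarrow> 'm set" where
    "\<And>n q. sm q (h n)" "\<And>n. open (V n)" "(\<Union>n. V n) = UNIV"
    "\<And>m n q. q \<in> V m \<Longrightarrow> n > m \<Longrightarrow> h n q = 0"
    "\<And>m q. q \<in> V m \<Longrightarrow> (\<Sum>n\<le>m. h n q) = 1"
    "\<And>n q. q \<notin> U (c n) \<Longrightarrow> \<forall>\<^sub>F z in nhds q. h n z = 0"
proof -
  have "\<exists>g. (\<forall>q. sm q g) \<and> (\<forall>\<^sub>F q in nhds p. g q = 1) \<and>
      (\<forall>q. q \<notin> U p \<longrightarrow> (\<forall>\<^sub>F z in nhds q. g z = 0))" for p
    using bump_exists[of "U p" p] assms[of p] by metis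
  then obtain g where g: "\<And>p q. sm q (g p)" "\<And>p. \<forall>\<^sub>F q in nhds p. g p q = 1"
    "\<And>p q. q \<notin> U p \<Longrightarrow> \<forall>\<^sub>F z in nhds q. g p z = 0" by metis
  have "\<exists>V. open V \<and> p \<in> V \<and> (\<forall>q\<in>V. g p q = 1)" for p
    using g(2)[of p] by (auto simp: eventually_nhds)
  then obtain W where W: "\<And>p. open (W p)" "\<And>p. p \<in> W p" "\<And>p q. q \<in> W p \<Longrightarrow> g p q = 1" by metis
  obtain \<F> where F: "\<F> \<subseteq> range W" "countable \<F>" "\<Union>\<F> = \<Union>(range W)"
    using Lindelof[of "range W"] W(1) by blast
  have "\<Union>(range W) = UNIV" using W(2) by auto
  then have "\<F> \<noteq> {}" using F(3) by auto
  then have rF: "range (from_nat_into \<F>) = \<F>" using F(2) by (simp add: range_from_nat_into)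
  then have "\<forall>n. \<exists>p. from_nat_into \<F> n = W p" using F(1) by (metis rangeE rangeI subset_iff)
  then obtain c where c: "\<And>n. from_nat_into \<F> n = W (c n)" by metis
  define h where "h n q = g (c n) q * (\<Prod>i<n. 1 - g (c i) q)" for n q
  have tele: "(\<Sum>n\<le>m. h n q) = 1 - (\<Prod>i\<le>m. 1 - g (c i) q)" for m q
  proof (induction m)
    case (Suc m)
    have "{..<Suc m} = {..m}" by auto
    then show ?case using Suc by (simp add: h_def algebra_simps)
  qed (simp add: h_def)
  have z: "(\<Prod>i\<in>I. 1 - g (c i) q) = 0" if "q \<in> W (c m)" "m \<in> I" "finite I" for I m q
    using W(3)[OF that(1)] that by (intro prod_zero) auto
  show thesis
  proof (rule that[of h "\<lambda>n. W (c n)" c])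
    show "(\<Union>n. W (c n)) = UNIV"
      using rF F(3) \<open>\<Union>(range W) = UNIV\<close> c by (metis (no_types, lifting) image_cong)
    show "sm q (h n)" for n q unfolding h_def by (intro sm_mult sm_prod sm_diff sm_const g(1))
    show "h n q = 0" if "q \<in> W (c m)" "n > m" for m n q
      unfolding h_def using z[OF that(1), of "{..<n}"] that(2) by simp
    show "(\<Sum>n\<le>m. h n q) = 1" if "q \<in> W (c m)" for m q
      unfolding tele using z[OF that, of "{..m}"] by simp
    show "\<forall>\<^sub>F z in nhds q. h n z = 0" if "q \<notin> U (c n)" for n q
      using g(3)[OF that] by eventually_elim (simp add: h_def)
  qed (rule W(1))
qed

end

section \<open>Germs of sections\<close>

lemma sum_fun_apply: "(\<Sum>i\<in>I. f i) x = (\<Sum>i\<in>I. f i x)"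
  by (induction I rule: infinite_finite_induct) simp_all

lemma eventually_nhds_open_iff:
  "open U \<Longrightarrow> (\<forall>p\<in>U. \<forall>\<^sub>F q in nhds p. P q) \<longleftrightarrow> (\<forall>p\<in>U. P p)"
  using eventually_nhds_x_imp_x unfolding eventually_nhds by blast

context smooth_mfd
begin

text \<open>Gaussian elimination over the ring of germs at \<open>p\<close>, for a possibly infinite system of rows:
  a module of rows that is injective at \<open>p\<close> contains the dual basis.\<close>

lemma germ_dual_rows:
  fixes M :: "(nat \<Rightarrow> 'm \<Rightarrow> real) set"
  assumes "\<And>u l. u \<in> M \<Longrightarrow> l < n \<Longrightarrow> sm p (u l)"
    and "\<And>u v. u \<in> M \<Longrightarrow> v \<in> M \<Longrightarrow> (\<lambda>l q. u l q + v l q) \<in> M"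
    and "\<And>f u. sm p f \<Longrightarrow> u \<in> M \<Longrightarrow> (\<lambda>l q. f q * u l q) \<in> M"
    and "\<And>x. (\<And>u. u \<in> M \<Longrightarrow> (\<Sum>l<n. u l p * x l) = 0) \<Longrightarrow> \<forall>l<n. x l = 0"
  shows "\<forall>k<n. \<exists>u\<in>M. \<forall>\<^sub>F q in nhds p. \<forall>l<n. u l q = (if l = k then 1 else 0)"
  using assms
proof (induction n arbitrary: M)
  case (Suc n)
  have "\<exists>u\<in>M. u n p \<noteq> 0"
  proof (rule ccontr)
    assume c: "\<not> (\<exists>u\<in>M. u n p \<noteq> 0)"
    have "\<forall>l<Suc n. (if l = n then 1 else 0::real) = 0"
      by (rule Suc.prems(4)) (use c in simp)
    then show False by auto
  qed
  then obtain u0 where u0: "u0 \<in> M" "u0 n p \<noteq> 0" by auto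
  have smu0: "sm p (u0 l)" if "l \<le> n" for l using Suc.prems(1) u0 that by auto
  have nz: "\<forall>\<^sub>F q in nhds p. u0 n q \<noteq> 0" using sm_eventually_nonzero smu0 u0(2) by blast
  define M' where "M' = {u \<in> M. \<forall>\<^sub>F q in nhds p. u n q = 0}"
  have IH: "\<forall>k<n. \<exists>u\<in>M'. \<forall>\<^sub>F q in nhds p. \<forall>l<n. u l q = (if l = k then 1 else 0)"
  proof (rule Suc.IH)
    show "sm p (u l)" if "u \<in> M'" "l < n" for u l using Suc.prems(1) that by (auto simp: M'_def)
    show "(\<lambda>l q. u l q + v l q) \<in> M'" if uv: "u \<in> M'" "v \<in> M'" for u v
    proof -
      have "\<forall>\<^sub>F q in nhds p. u n q = 0" "\<forall>\<^sub>F q in nhds p. v n q = 0" using uv by (auto simp: M'_def)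
      then have "\<forall>\<^sub>F q in nhds p. u n q + v n q = 0" by eventually_elim simp
      then show ?thesis using Suc.prems(2) uv by (simp add: M'_def)
    qed
    show "(\<lambda>l q. f q * u l q) \<in> M'" if "sm p f" "u \<in> M'" for f u
    proof -
      have "\<forall>\<^sub>F q in nhds p. u n q = 0" using that by (auto simp: M'_def)
      then have "\<forall>\<^sub>F q in nhds p. f q * u n q = 0" by eventually_elim simp
      then show ?thesis using Suc.prems(3) that by (simp add: M'_def)
    qed
    fix x assume x: "\<And>u. u \<in> M' \<Longrightarrow> (\<Sum>l<n. u l p * x l) = 0"
    define y where "y = x(n := - (\<Sum>l<n. u0 l p * x l) / u0 n p)"
    have "(\<Sum>l<Suc n. u l p * y l) = 0" if u: "u \<in> M" for u
    proof -
      define w where "w = (\<lambda>l q. u l q + (- u n q * inverse (u0 n q)) * u0 l q)"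
      have "sm p (\<lambda>q. - u n q * inverse (u0 n q))"
        using Suc.prems(1)[OF u, of n] smu0 u0(2) by (intro sm_mult sm_minus sm_inverse) auto
      then have "w \<in> M" unfolding w_def
        by (intro Suc.prems(2)[OF u] Suc.prems(3)[of "\<lambda>q. - u n q * inverse (u0 n q)"] u0)
      moreover have "\<forall>\<^sub>F q in nhds p. w n q = 0" using nz by eventually_elim (simp add: w_def)
      ultimately have "(\<Sum>l<n. w l p * x l) = 0" by (intro x) (simp add: M'_def)
      moreover have "(\<Sum>l<n. w l p * x l) =
          (\<Sum>l<n. u l p * x l) - u n p * inverse (u0 n p) * (\<Sum>l<n. u0 l p * x l)"
        by (simp add: w_def sum_distrib_left sum_subtractf[symmetric] algebra_simps)
      moreover have "(\<Sum>l<n. u l p * y l) = (\<Sum>l<n. u l p * x l)" by (simp add: y_def)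
      ultimately show ?thesis by (simp add: y_def divide_inverse algebra_simps)
    qed
    then have "\<forall>l<Suc n. y l = 0" by (rule Suc.prems(4))
    then have "y l = 0" if "l < n" for l using that by simp
    then show "\<forall>l<n. x l = 0" unfolding y_def by auto
  qed
  then have "\<forall>k. \<exists>u. k < n \<longrightarrow> u \<in> M' \<and> (\<forall>\<^sub>F q in nhds p. \<forall>l<n. u l q = (if l = k then 1 else 0))"
    by blast
  then have "\<exists>u. \<forall>k. k < n \<longrightarrow> u k \<in> M' \<and> (\<forall>\<^sub>F q in nhds p. \<forall>l<n. u k l q = (if l = k then 1 else 0))"
    by (rule choice)
  then obtain u where u: "\<And>k. k < n \<Longrightarrow> u k \<in> M'"
    "\<And>k. k < n \<Longrightarrow> \<forall>\<^sub>F q in nhds p. \<forall>l<n. u k l q = (if l = k then 1 else 0)" by blast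
  have un: "\<forall>\<^sub>F q in nhds p. u k n q = 0" if "k < n" for k using u(1)[OF that] by (simp add: M'_def)
  have uS: "\<forall>\<^sub>F q in nhds p. \<forall>l<Suc n. u k l q = (if l = k then 1 else 0)" if "k < n" for k
    using u(2)[OF that] un[OF that] by eventually_elim (use that in \<open>auto simp: less_Suc_eq\<close>)
  have w: "(\<lambda>l q. u0 l q - (\<Sum>k<j. u0 k q * u k l q)) \<in> M" if "j \<le> n" for j
    using that
  proof (induction j)
    case 0 then show ?case using u0 by simp
  next
    case (Suc j)
    have "(\<lambda>l q. (u0 l q - (\<Sum>k<j. u0 k q * u k l q)) + (- u0 j q) * u j l q) \<in> M"
      using Suc u(1)[of j] sm_minus[OF smu0]
      by (intro Suc.prems Suc.IH \<open>\<And>u v. u \<in> M \<Longrightarrow> v \<in> M \<Longrightarrow> (\<lambda>l q. u l q + v l q) \<in> M\<close>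
          \<open>\<And>f u. sm p f \<Longrightarrow> u \<in> M \<Longrightarrow> (\<lambda>l q. f q * u l q) \<in> M\<close>) (auto simp: M'_def)
    then show ?case by (simp add: algebra_simps)
  qed
  have "(\<lambda>l q. inverse (u0 n q) * (u0 l q - (\<Sum>k<n. u0 k q * u k l q))) \<in> M"
    by (rule Suc.prems(3)[OF sm_inverse w]) (use smu0 u0 in auto)
  moreover have "\<forall>\<^sub>F q in nhds p. \<forall>l<Suc n. inverse (u0 n q) * (u0 l q - (\<Sum>k<n. u0 k q * u k l q))
      = (if l = n then 1 else 0)"
  proof -
    have "\<forall>\<^sub>F q in nhds p. \<forall>k\<in>{..<n}. \<forall>l<Suc n. u k l q = (if l = k then 1 else 0)"
      using uS by (simp add: eventually_ball_finite_distrib)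
    then show ?thesis
      using nz
    proof eventually_elim
      case (elim q)
      have "(\<Sum>k<n. u0 k q * u k l q) = (\<Sum>k<n. if k = l then u0 k q else 0)" if "l < Suc n" for l
        by (rule sum.cong) (use elim(1) that in auto)
      then show ?case using elim(2) by (auto simp: less_Suc_eq)
    qed
  qed
  ultimately have "\<exists>u\<in>M. \<forall>\<^sub>F q in nhds p. \<forall>l<Suc n. u l q = (if l = n then 1 else 0)"
    by (intro bexI[of _ "\<lambda>l q. inverse (u0 n q) * (u0 l q - (\<Sum>k<n. u0 k q * u k l q))"])
  moreover have "\<exists>u\<in>M. \<forall>\<^sub>F q in nhds p. \<forall>l<Suc n. u l q = (if l = k then 1 else 0)" if "k < n" for k
    using uS[OF that] u(1)[OF that] unfolding M'_def by blast
  ultimately show ?case using less_Suc_eq by blast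
qed simp

lemma smooth_coefficients:
  fixes c :: "nat \<Rightarrow> 'm \<Rightarrow> real"
  assumes "\<And>x. (\<And>u. (\<forall>l<n. sm p (u l)) \<Longrightarrow> sm p (\<lambda>q. \<Sum>l<n. u l q * c l q) \<Longrightarrow>
      (\<Sum>l<n. u l p * x l) = 0) \<Longrightarrow> \<forall>l<n. x l = 0"
    and "k < n"
  shows "sm p (c k)"
proof -
  define M where "M = {u. (\<forall>l<n. sm p (u l)) \<and> sm p (\<lambda>q. \<Sum>l<n. u l q * c l q)}"
  have "\<forall>k<n. \<exists>u\<in>M. \<forall>\<^sub>F q in nhds p. \<forall>l<n. u l q = (if l = k then 1 else 0)"
  proof (rule germ_dual_rows)
    show "(\<lambda>l q. u l q + v l q) \<in> M" if "u \<in> M" "v \<in> M" for u v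
      using that sm_add[of p "\<lambda>q. \<Sum>l<n. u l q * c l q" "\<lambda>q. \<Sum>l<n. v l q * c l q"]
      by (auto simp: M_def sm_add distrib_right sum.distrib)
    show "(\<lambda>l q. f q * u l q) \<in> M" if "sm p f" "u \<in> M" for f u
      using that sm_mult[of p f "\<lambda>q. \<Sum>l<n. u l q * c l q"]
      by (auto simp: M_def sm_mult sum_distrib_left mult.assoc)
  qed (use assms(1) in \<open>auto simp: M_def\<close>)
  then obtain u where u: "u \<in> M" "\<forall>\<^sub>F q in nhds p. \<forall>l<n. u l q = (if l = k then 1 else 0)"
    using assms(2) by blast
  have "\<forall>\<^sub>F q in nhds p. (\<Sum>l<n. u l q * c l q) = c k q"
    using u(2)
  proof eventually_elim
    case (elim q)
    have "(\<Sum>l<n. u l q * c l q) = (\<Sum>l<n. if l = k then c l q else 0)"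
      by (rule sum.cong) (use elim in auto)
    then show ?case using assms(2) by simp
  qed
  then show ?thesis by (rule sm_cong) (use u(1) in \<open>simp add: M_def\<close>)
qed

end

lemma linear_onI:
  "(\<And>x y. x \<in> S \<Longrightarrow> y \<in> S \<Longrightarrow> f (x + y) = f x + f y) \<Longrightarrow>
   (\<And>c x. x \<in> S \<Longrightarrow> f (c *\<^sub>R x) = c *\<^sub>R f x) \<Longrightarrow> linear_on S f"
  by (simp add: linear_on_def)

lemma linear_on_add: "linear_on S f \<Longrightarrow> x \<in> S \<Longrightarrow> y \<in> S \<Longrightarrow> f (x + y) = f x + f y"
  and linear_on_scale: "linear_on S f \<Longrightarrow> x \<in> S \<Longrightarrow> f (c *\<^sub>R x) = c *\<^sub>R f x"
  by (simp_all add: linear_on_def)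

lemma linear_on_zero: "linear_on S f \<Longrightarrow> subspace S \<Longrightarrow> f 0 = 0"
  using linear_on_scale[of S f 0 0] subspace_0 by fastforce

lemma linear_on_minus: "linear_on S f \<Longrightarrow> x \<in> S \<Longrightarrow> f (- x) = - f x"
  using linear_on_scale[of S f x "-1"] by simp

lemma linear_on_diff:
  assumes "linear_on S f" "subspace S" "x \<in> S" "y \<in> S"
  shows "f (x - y) = f x - f y"
  using linear_on_add[OF assms(1,3), of "- y"] linear_on_minus[OF assms(1,4)]
    subspace_neg[OF assms(2,4)] by simp

lemma linear_on_sum:
  assumes "linear_on S f" "subspace S" "\<And>i. i \<in> I \<Longrightarrow> g i \<in> S"
  shows "f (\<Sum>i\<in>I. c i *\<^sub>R g i) = (\<Sum>i\<in>I. c i *\<^sub>R f (g i))"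
  using assms(3)
proof (induction I rule: infinite_finite_induct)
  case (insert i I)
  have "(\<Sum>i\<in>I. c i *\<^sub>R g i) \<in> S" by (intro subspace_sum subspace_scale assms(2)) (simp add: insert.prems)
  then show ?case
    using insert linear_on_add[OF assms(1)] linear_on_scale[OF assms(1)] subspace_scale[OF assms(2)]
    by simp
qed (simp_all add: linear_on_zero[OF assms(1,2)])

text \<open>A vector bundle seen through its fibres \<open>F\<close> and its germs of smooth sections:
  \<open>S p s\<close> says that \<open>s\<close> is a smooth section near \<open>p\<close>.\<close>

locale germ_bundle = smooth_mfd A
  for A :: "('m::{t2_space, second_countable_topology}, 'v::real_inner) atlas" +
  fixes F :: "'m \<Rightarrow> 'a::real_vector set" and S :: "'m \<Rightarrow> ('m \<Rightarrow> 'a) \<Rightarrow> bool" and r :: nat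
  assumes fibre_subspace: "subspace (F p)"
    and S_eventually: "S p s \<Longrightarrow> \<forall>\<^sub>F q in nhds p. S q s"
    and S_mem: "S p s \<Longrightarrow> s p \<in> F p"
    and S_cong: "S p s \<Longrightarrow> \<forall>\<^sub>F q in nhds p. s q = t q \<Longrightarrow> S p t"
    and S_zero: "S p (\<lambda>q. 0)"
    and S_add: "S p s \<Longrightarrow> S p t \<Longrightarrow> S p (\<lambda>q. s q + t q)"
    and S_scale: "sm p f \<Longrightarrow> S p s \<Longrightarrow> S p (\<lambda>q. f q *\<^sub>R s q)"
    and frame_ex: "\<exists>e. (\<forall>\<^sub>F q in nhds p. (\<forall>i<r. S q (e i)) \<and>
        (\<forall>v\<in>F q. \<exists>x. v = (\<Sum>i<r. x i *\<^sub>R e i q)) \<and>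
        (\<forall>x. (\<Sum>i<r. x i *\<^sub>R e i q) = 0 \<longrightarrow> (\<forall>i<r. x i = 0))) \<and>
      (\<forall>s. S p s \<longrightarrow> (\<exists>c. (\<forall>i<r. sm p (c i)) \<and> (\<forall>\<^sub>F q in nhds p. s q = (\<Sum>i<r. c i q *\<^sub>R e i q))))"
begin

definition G where "G = {s. \<forall>p. S p s}"

lemma G_S: "s \<in> G \<Longrightarrow> S p s" by (simp add: G_def)

lemma G_mem: "s \<in> G \<Longrightarrow> s p \<in> F p" by (simp add: G_S S_mem)

lemma S_minus: "S p s \<Longrightarrow> S p (\<lambda>q. - s q)"
  using S_scale[of p "\<lambda>_. -1" s] by simp

lemma S_diff: "S p s \<Longrightarrow> S p t \<Longrightarrow> S p (\<lambda>q. s q - t q)"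
  using S_add[OF _ S_minus] by simp

lemma S_cscale: "S p s \<Longrightarrow> S p (\<lambda>q. c *\<^sub>R s q)"
  using S_scale[of p "\<lambda>_. c" s] by simp

lemma S_sum: "(\<And>i. i \<in> I \<Longrightarrow> S p (s i)) \<Longrightarrow> S p (\<lambda>q. \<Sum>i\<in>I. s i q)"
  by (induction I rule: infinite_finite_induct) (auto intro: S_zero S_add)

lemma G_add: "s \<in> G \<Longrightarrow> t \<in> G \<Longrightarrow> (\<lambda>q. s q + t q) \<in> G"
  and G_diff: "s \<in> G \<Longrightarrow> t \<in> G \<Longrightarrow> (\<lambda>q. s q - t q) \<in> G"
  and G_scale: "(\<And>p. sm p f) \<Longrightarrow> s \<in> G \<Longrightarrow> (\<lambda>q. f q *\<^sub>R s q) \<in> G"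
  and G_cscale: "s \<in> G \<Longrightarrow> (\<lambda>q. c *\<^sub>R s q) \<in> G"
  and G_zero: "(\<lambda>q. 0) \<in> G"
  by (auto simp: G_def intro: S_add S_diff S_scale S_cscale S_minus S_zero)

lemma G_sum: "(\<And>i. i \<in> I \<Longrightarrow> s i \<in> G) \<Longrightarrow> (\<lambda>q. \<Sum>i\<in>I. s i q) \<in> G"
  by (simp add: G_def S_sum)

lemma cutoff:
  assumes "\<And>q. sm q g" "\<And>q. q \<notin> N \<Longrightarrow> \<forall>\<^sub>F z in nhds q. g z = 0" "\<And>q. q \<in> N \<Longrightarrow> S q s"
  shows "(\<lambda>q. g q *\<^sub>R s q) \<in> G"
proof -
  have "S q (\<lambda>q. g q *\<^sub>R s q)" for q
  proof (cases "q \<in> N")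
    case True
    then show ?thesis using assms by (intro S_scale) auto
  next
    case False
    show ?thesis by (rule S_cong[OF S_zero]) (use assms(2)[OF False] in \<open>eventually_elim, simp\<close>)
  qed
  then show ?thesis by (simp add: G_def)
qed

lemma G_extend:
  assumes "S p s"
  obtains t where "t \<in> G" "\<forall>\<^sub>F q in nhds p. t q = s q"
proof -
  obtain N where N: "open N" "p \<in> N" "\<And>q. q \<in> N \<Longrightarrow> S q s"
    using S_eventually[OF assms] by (auto simp: eventually_nhds)
  obtain g where g: "\<And>q. sm q g" "\<forall>\<^sub>F q in nhds p. g q = 1"
    "\<And>q. q \<notin> N \<Longrightarrow> \<forall>\<^sub>F z in nhds q. g z = 0" using bump_exists N by metis
  show thesis
  proof (rule that)
    show "(\<lambda>q. g q *\<^sub>R s q) \<in> G" using cutoff g N by metis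
    show "\<forall>\<^sub>F q in nhds p. g q *\<^sub>R s q = s q" using g(2) by eventually_elim simp
  qed
qed

lemma G_value:
  assumes "v \<in> F p"
  obtains t where "t \<in> G" "t p = v"
proof -
  obtain e where e: "\<forall>\<^sub>F q in nhds p. (\<forall>i<r. S q (e i)) \<and> (\<forall>v\<in>F q. \<exists>x. v = (\<Sum>i<r. x i *\<^sub>R e i q))"
    using frame_ex[of p] by (force elim: eventually_mono)
  then have e: "\<And>i. i < r \<Longrightarrow> S p (e i)" "\<exists>x. v = (\<Sum>i<r. x i *\<^sub>R e i p)"
    using assms eventually_nhds_x_imp_x by blast+
  then obtain x where x: "v = (\<Sum>i<r. x i *\<^sub>R e i p)" by blast
  have "S p (\<lambda>q. \<Sum>i<r. x i *\<^sub>R e i q)" using e by (intro S_sum S_cscale) auto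
  then obtain t where "t \<in> G" "\<forall>\<^sub>F q in nhds p. t q = (\<Sum>i<r. x i *\<^sub>R e i q)" by (rule G_extend)
  then show thesis using that x eventually_nhds_x_imp_x by fastforce
qed

definition gext :: "'m \<Rightarrow> 'a \<Rightarrow> 'm \<Rightarrow> 'a" where
  "gext p v = (SOME t. t \<in> G \<and> t p = v)"

lemma gext: "v \<in> F p \<Longrightarrow> gext p v \<in> G" "v \<in> F p \<Longrightarrow> gext p v p = v"
proof -
  assume "v \<in> F p"
  then obtain t where "t \<in> G \<and> t p = v" using G_value by blast
  then have "gext p v \<in> G \<and> gext p v p = v" unfolding gext_def by (rule someI[of "\<lambda>t. t \<in> G \<and> t p = v"])
  then show "gext p v \<in> G" "gext p v p = v" by auto
qed

lemma additive_sum: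
  assumes add: "\<And>s t. s \<in> G \<Longrightarrow> t \<in> G \<Longrightarrow> T (\<lambda>q. s q + t q) = T s + (T t :: real)"
    and "\<And>i. i \<in> I \<Longrightarrow> s i \<in> G"
  shows "T (\<lambda>q. \<Sum>i\<in>I. s i q) = (\<Sum>i\<in>I. T (s i))"
proof -
  have "T (\<lambda>q. 0) = 0" using add[OF G_zero G_zero] by simp
  then show ?thesis
    using assms(2) by (induction I rule: infinite_finite_induct) (simp_all add: add G_sum)
qed

lemma tensorial:
  assumes add: "\<And>s t. s \<in> G \<Longrightarrow> t \<in> G \<Longrightarrow> T (\<lambda>q. s q + t q) = T s + (T t :: real)"
    and scale: "\<And>f s. (\<And>q. sm q f) \<Longrightarrow> s \<in> G \<Longrightarrow> T (\<lambda>q. f q *\<^sub>R s q) = f p * T s"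
    and st: "s \<in> G" "t \<in> G" "s p = t p"
  shows "T s = T t"
proof -
  define d where "d q = s q + (-1) *\<^sub>R t q" for q
  have dG: "d \<in> G" unfolding d_def[abs_def] by (intro G_add G_cscale st)
  have Td: "T d = T s - T t"
    unfolding d_def[abs_def] using add[OF st(1) G_cscale[OF st(2)], of "-1"] scale[of "\<lambda>_. -1" t] st
    by simp
  obtain e where e: "\<forall>\<^sub>F q in nhds p. (\<forall>i<r. S q (e i)) \<and>
        (\<forall>v\<in>F q. \<exists>x. v = (\<Sum>i<r. x i *\<^sub>R e i q)) \<and>
        (\<forall>x. (\<Sum>i<r. x i *\<^sub>R e i q) = 0 \<longrightarrow> (\<forall>i<r. x i = 0))"
      "\<forall>s. S p s \<longrightarrow> (\<exists>c. (\<forall>i<r. sm p (c i)) \<and> (\<forall>\<^sub>F q in nhds p. s q = (\<Sum>i<r. c i q *\<^sub>R e i q)))"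
    using frame_ex[of p] by blast
  obtain c where c: "\<And>i. i < r \<Longrightarrow> sm p (c i)" "\<forall>\<^sub>F q in nhds p. d q = (\<Sum>i<r. c i q *\<^sub>R e i q)"
    using e(2) G_S[OF dG] by blast
  have cp: "c i p = 0" if "i < r" for i
  proof -
    have "(\<Sum>i<r. c i p *\<^sub>R e i p) = 0"
      using eventually_nhds_x_imp_x[OF c(2)] st(3) by (simp add: d_def)
    then show ?thesis
      using conjunct2[OF conjunct2[OF eventually_nhds_x_imp_x[OF e(1)]], rule_format, of "\<lambda>i. c i p"]
        that by simp
  qed
  have "\<forall>\<^sub>F q in nhds p. \<forall>i\<in>{..<r}. sm q (c i)"
    using c(1) sm_eventually by (simp add: eventually_ball_finite_distrib)
  with e(1) c(2) have "\<forall>\<^sub>F q in nhds p. (\<forall>i<r. S q (e i)) \<and> (\<forall>i<r. sm q (c i)) \<and>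
      d q = (\<Sum>i<r. c i q *\<^sub>R e i q)"
    by eventually_elim auto
  then obtain N where N: "open N" "p \<in> N" "\<And>q i. q \<in> N \<Longrightarrow> i < r \<Longrightarrow> S q (e i)"
    "\<And>q i. q \<in> N \<Longrightarrow> i < r \<Longrightarrow> sm q (c i)" "\<And>q. q \<in> N \<Longrightarrow> d q = (\<Sum>i<r. c i q *\<^sub>R e i q)"
    by (auto simp: eventually_nhds)
  obtain g where g: "\<And>q. sm q g" "\<forall>\<^sub>F q in nhds p. g q = 1"
    "\<And>q. q \<notin> N \<Longrightarrow> \<forall>\<^sub>F z in nhds q. g z = 0" using bump_exists N by metis
  have gp: "g p = 1" using g(2) eventually_nhds_x_imp_x by blast
  have e': "(\<lambda>q. g q *\<^sub>R e i q) \<in> G" if "i < r" for i using cutoff[OF g(1,3)] N(3) that by blast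
  have c': "sm q (\<lambda>q. g q * c i q)" if "i < r" for i q
  proof (cases "q \<in> N")
    case True then show ?thesis using N(4) that g(1) by (intro sm_mult) auto
  next
    case False
    then have "\<forall>\<^sub>F z in nhds q. g z = 0" by (rule g(3))
    then have "\<forall>\<^sub>F z in nhds q. 0 = g z * c i z" by eventually_elim simp
    then show ?thesis by (rule sm_cong) simp
  qed
  have eq: "(\<lambda>q. (g q * g q) *\<^sub>R d q) = (\<lambda>q. \<Sum>i<r. (g q * c i q) *\<^sub>R (g q *\<^sub>R e i q))"
  proof
    fix q show "(g q * g q) *\<^sub>R d q = (\<Sum>i<r. (g q * c i q) *\<^sub>R (g q *\<^sub>R e i q))"
    proof (cases "q \<in> N")
      case True
      then show ?thesis using N(5) by (simp add: scaleR_sum_right ac_simps)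
    next
      case False
      then have "g q = 0" using g(3) eventually_nhds_x_imp_x by blast
      then show ?thesis by simp
    qed
  qed
  have "T d = T (\<lambda>q. (g q * g q) *\<^sub>R d q)" using scale[OF sm_mult[OF g(1) g(1)] dG] gp by simp
  also have "\<dots> = (\<Sum>i<r. T (\<lambda>q. (g q * c i q) *\<^sub>R (g q *\<^sub>R e i q)))"
    unfolding eq by (rule additive_sum[OF add], assumption+) (intro G_scale c' e', simp_all)
  also have "\<dots> = (\<Sum>i<r. (g p * c i p) * T (\<lambda>q. g q *\<^sub>R e i q))"
    by (intro sum.cong refl scale c' e') auto
  also have "\<dots> = 0" using cp by simp
  finally show ?thesis using Td by simp
qed

end


subsection \<open>The bundle \<open>D\<close>\<close>

locale involutive = smooth_mfd A
  for A :: "('m::{t2_space, second_countable_topology}, 'v::real_inner) atlas" +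
  fixes D :: "'m \<Rightarrow> 'm tvec set"
  assumes lie_sub: "lie_subalgebroid A D"
begin

definition SD :: "'m \<Rightarrow> ('m \<Rightarrow> 'm tvec) \<Rightarrow> bool" where
  "SD p X \<longleftrightarrow> (\<forall>\<^sub>F q in nhds p. X q \<in> D q \<and> (\<forall>f. sm q f \<longrightarrow> sm q (\<lambda>z. X z f)))"

definition rD :: nat where
  "rD = (SOME r. \<forall>p. \<exists>U X. open U \<and> p \<in> U \<and> (\<forall>i<r. X i \<in> vector_fields A U) \<and>
        (\<forall>q\<in>U. inj_on (\<lambda>i. X i q) {..<r} \<and> independent ((\<lambda>i. X i q) ` {..<r}) \<and>
               span ((\<lambda>i. X i q) ` {..<r}) = D q))"

lemma frame_raw: "\<exists>U X. open U \<and> p \<in> U \<and> (\<forall>i<rD. X i \<in> vector_fields A U) \<and>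
        (\<forall>q\<in>U. inj_on (\<lambda>i. X i q) {..<rD} \<and> independent ((\<lambda>i. X i q) ` {..<rD}) \<and>
               span ((\<lambda>i. X i q) ` {..<rD}) = D q)"
proof -
  have "\<exists>r::nat. \<forall>p. \<exists>U X. open U \<and> p \<in> U \<and> (\<forall>i<r. X i \<in> vector_fields A U) \<and>
        (\<forall>q\<in>U. inj_on (\<lambda>i. X i q) {..<r} \<and> independent ((\<lambda>i. X i q) ` {..<r}) \<and>
               span ((\<lambda>i. X i q) ` {..<r}) = D q)"
    using lie_sub unfolding lie_subalgebroid_def tangent_subbundle_def by (rule conjunct1)
  then show ?thesis unfolding rD_def by (rule someI2_ex) blast
qed

lemma D_subspace: "subspace (D p)"
  using frame_raw[of p] subspace_span by metis

lemma D_frame: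
  obtains U X where "open U" "p \<in> U" "\<And>i. i < rD \<Longrightarrow> X i \<in> vector_fields A U"
    "\<And>q i. q \<in> U \<Longrightarrow> i < rD \<Longrightarrow> X i q \<in> D q"
    "\<And>q v. q \<in> U \<Longrightarrow> v \<in> D q \<Longrightarrow> \<exists>x. v = (\<Sum>i<rD. x i *\<^sub>R X i q)"
    "\<And>q x i. q \<in> U \<Longrightarrow> (\<Sum>i<rD. x i *\<^sub>R X i q) = 0 \<Longrightarrow> i < rD \<Longrightarrow> x i = 0"
proof -
  obtain U X where U: "open U" "p \<in> U" and Xi: "\<And>i. i < rD \<Longrightarrow> X i \<in> vector_fields A U"
    and X: "\<And>q. q \<in> U \<Longrightarrow> inj_on (\<lambda>i. X i q) {..<rD}"
      "\<And>q. q \<in> U \<Longrightarrow> independent ((\<lambda>i. X i q) ` {..<rD})"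
      "\<And>q. q \<in> U \<Longrightarrow> span ((\<lambda>i. X i q) ` {..<rD}) = D q" using frame_raw[of p] by blast
  show thesis
  proof (rule that[OF U Xi])
    fix q assume q: "q \<in> U"
    show "X i q \<in> D q" if "i < rD" for i
      using X(3)[OF q] that by (metis imageI lessThan_iff span_base)
    show "\<exists>x. v = (\<Sum>i<rD. x i *\<^sub>R X i q)" if "v \<in> D q" for v
    proof -
      have "v \<in> span ((\<lambda>i. X i q) ` {..<rD})" using X(3)[OF q] that by simp
      then obtain u where "v = (\<Sum>w\<in>(\<lambda>i. X i q) ` {..<rD}. u w *\<^sub>R w)"
        by (auto simp: span_finite)
      then have "v = (\<Sum>i<rD. u (X i q) *\<^sub>R X i q)" using X(1)[OF q] by (simp add: sum.reindex)
      then show ?thesis by (intro exI[of _ "\<lambda>i. u (X i q)"])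
    qed
    show "x i = 0" if s: "(\<Sum>i<rD. x i *\<^sub>R X i q) = 0" and i: "i < rD" for x i
    proof -
      define u where "u w = x (inv_into {..<rD} (\<lambda>i. X i q) w)" for w
      have uX: "u (X j q) = x j" if "j < rD" for j
        using inv_into_f_f[OF X(1)[OF q]] that by (simp add: u_def)
      have "(\<Sum>w\<in>(\<lambda>i. X i q) ` {..<rD}. u w *\<^sub>R w) = (\<Sum>i<rD. u (X i q) *\<^sub>R X i q)"
        using X(1)[OF q] by (simp add: sum.reindex)
      also have "\<dots> = 0" using uX s by simp
      finally have "u (X i q) = 0"
        using independentD[OF X(2)[OF q], of "(\<lambda>i. X i q) ` {..<rD}" u "X i q"] i by auto
      then show ?thesis using uX i by simp
    qed
  qed
qed

lemma D_tangent: "D p \<subseteq> tangent_space A p"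
proof
  fix v assume v: "v \<in> D p"
  obtain U X where U: "open U" "p \<in> U" "\<And>i. i < rD \<Longrightarrow> X i \<in> vector_fields A U"
    and "\<And>q i. q \<in> U \<Longrightarrow> i < rD \<Longrightarrow> X i q \<in> D q"
    and U': "\<And>q v. q \<in> U \<Longrightarrow> v \<in> D q \<Longrightarrow> \<exists>x. v = (\<Sum>i<rD. x i *\<^sub>R X i q)"
    and "\<And>q x i. q \<in> U \<Longrightarrow> (\<Sum>i<rD. x i *\<^sub>R X i q) = 0 \<Longrightarrow> i < rD \<Longrightarrow> x i = 0"
    by (rule D_frame[of p]) blast
  obtain x where "v = (\<Sum>i<rD. x i *\<^sub>R X i p)" using U'[OF U(2) v] by blast
  moreover have "X i p \<in> tangent_space A p" if "i < rD" for i
    using U(3)[OF that] U(2) by (auto simp: vector_fields_def)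
  ultimately show "v \<in> tangent_space A p"
    using tangent_space_subspace by (auto intro!: subspace_sum subspace_scale)
qed

lemma D_sections_iff: "open U \<Longrightarrow> X \<in> D_sections A D U \<longleftrightarrow> (\<forall>p\<in>U. SD p X)"
proof -
  assume U: "open U"
  have "X \<in> D_sections A D U \<longleftrightarrow> (\<forall>p\<in>U. X p \<in> D p \<and> (\<forall>f. sm p f \<longrightarrow> sm p (\<lambda>z. X z f)))"
    using D_tangent unfolding D_sections_def vector_fields_iff[OF U] mem_Collect_eq by blast
  also have "\<dots> \<longleftrightarrow> (\<forall>p\<in>U. SD p X)"
    unfolding SD_def eventually_nhds_open_iff[OF U] ..
  finally show ?thesis .
qed

lemma SD_smooth: "SD p X \<Longrightarrow> sm p f \<Longrightarrow> sm p (\<lambda>q. X q f)"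
  unfolding SD_def using eventually_nhds_x_imp_x by fastforce

lemma SD_mem: "SD p X \<Longrightarrow> X p \<in> D p"
  unfolding SD_def using eventually_nhds_x_imp_x by fastforce

lemma SD_eventually: "SD p X \<Longrightarrow> \<forall>\<^sub>F q in nhds p. SD q X"
  unfolding SD_def by (simp add: eventually_eventually)


lemma germ_bundle_D: "germ_bundle A D SD rD"
proof
  fix p
  show "subspace (D p)" by (rule D_subspace)
  show "SD p (\<lambda>q. 0)" using subspace_0[OF D_subspace] by (simp add: SD_def zero_fun_def)
  show "SD p t" if s: "SD p s" "\<forall>\<^sub>F q in nhds p. s q = t q" for s t
  proof -
    have "\<forall>\<^sub>F q in nhds p. \<forall>\<^sub>F z in nhds q. s z = t z" using s(2) by (simp add: eventually_eventually)
    then show ?thesis using s(1) unfolding SD_def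
    proof eventually_elim
      case (elim q)
      have "sm q (\<lambda>z. t z f)" if "sm q f" for f
      proof (rule sm_cong)
        show "\<forall>\<^sub>F z in nhds q. s z f = t z f" using elim(1) by eventually_elim simp
      qed (use elim(2) that in blast)
      then show ?case using elim eventually_nhds_x_imp_x[OF elim(1)] by simp
    qed
  qed
  show "SD p (\<lambda>q. s q + t q)" if "SD p s" "SD p t" for s t
    using that unfolding SD_def
    by eventually_elim (simp add: subspace_add[OF D_subspace] sm_add)
  show "SD p (\<lambda>q. f q *\<^sub>R s q)" if "sm p f" "SD p s" for f s
    using sm_eventually[OF that(1)] that(2) unfolding SD_def
    by eventually_elim (simp add: subspace_scale[OF D_subspace] sm_mult)
  obtain U X where U: "open U" "p \<in> U" "\<And>i. i < rD \<Longrightarrow> X i \<in> vector_fields A U"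
    "\<And>q i. q \<in> U \<Longrightarrow> i < rD \<Longrightarrow> X i q \<in> D q"
    "\<And>q v. q \<in> U \<Longrightarrow> v \<in> D q \<Longrightarrow> \<exists>x. v = (\<Sum>i<rD. x i *\<^sub>R X i q)"
    "\<And>q x i. q \<in> U \<Longrightarrow> (\<Sum>i<rD. x i *\<^sub>R X i q) = 0 \<Longrightarrow> i < rD \<Longrightarrow> x i = 0" by (rule D_frame[of p]) blast
  have SX: "SD q (X i)" if "q \<in> U" "i < rD" for q i
    using D_sections_iff[OF U(1), of "X i"] U(3,4) that by (auto simp: D_sections_def)
  have coeffs: "\<exists>c. (\<forall>i<rD. sm p (c i)) \<and> (\<forall>\<^sub>F q in nhds p. Y q = (\<Sum>i<rD. c i q *\<^sub>R X i q))"
    if Y: "SD p Y" for Y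
  proof -
    have "\<forall>\<^sub>F q in nhds p. q \<in> U" using U by (simp add: eventually_nhds_in_open)
    define c' where "c' q = (SOME x. Y q = (\<Sum>i<rD. x i *\<^sub>R X i q))" for q
    have c': "\<forall>\<^sub>F q in nhds p. Y q = (\<Sum>i<rD. c' q i *\<^sub>R X i q)"
      using \<open>\<forall>\<^sub>F q in nhds p. q \<in> U\<close> SD_eventually[OF Y]
    proof eventually_elim
      case (elim q)
      show ?case unfolding c'_def by (rule someI_ex[OF U(5)[OF elim(1) SD_mem[OF elim(2)]]])
    qed
    have "sm p (\<lambda>q. c' q k)" if "k < rD" for k
    proof (rule smooth_coefficients[where n=rD and c="\<lambda>l q. c' q l" and k=k])
      fix x assume x: "\<And>u. \<forall>l<rD. sm p (u l) \<Longrightarrow> sm p (\<lambda>q. \<Sum>l<rD. u l q * c' q l) \<Longrightarrow>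
        (\<Sum>l<rD. u l p * x l) = 0"
      have "(\<Sum>i<rD. x i *\<^sub>R X i p) = 0"
      proof (rule tangent_eqI)
        fix f assume f: "sm p f"
        have "(\<Sum>l<rD. X l p f * x l) = 0"
        proof (rule x)
          show "\<forall>l<rD. sm p (\<lambda>q. X l q f)" using SD_smooth SX[OF U(2)] f by blast
          have "\<forall>\<^sub>F q in nhds p. Y q f = (\<Sum>l<rD. X l q f * c' q l)"
            using c' by eventually_elim (simp add: sum_fun_apply mult.commute)
          then show "sm p (\<lambda>q. \<Sum>l<rD. X l q f * c' q l)" by (rule sm_cong) (rule SD_smooth[OF Y f])
        qed
        then show "(\<Sum>i<rD. x i *\<^sub>R X i p) f = 0 f" by (simp add: sum_fun_apply mult.commute)
      qed (use D_tangent[of p] U tangent_space_subspace[of p] in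
          \<open>auto intro!: subspace_sum subspace_scale subspace_0\<close>)
      then show "\<forall>l<rD. x l = 0" using U by blast
    qed (rule that)
    then show ?thesis using c' by (intro exI[of _ "\<lambda>i q. c' q i"]) auto
  qed
  show "\<exists>e. (\<forall>\<^sub>F q in nhds p. (\<forall>i<rD. SD q (e i)) \<and>
        (\<forall>v\<in>D q. \<exists>x. v = (\<Sum>i<rD. x i *\<^sub>R e i q)) \<and>
        (\<forall>x. (\<Sum>i<rD. x i *\<^sub>R e i q) = 0 \<longrightarrow> (\<forall>i<rD. x i = 0))) \<and>
      (\<forall>s. SD p s \<longrightarrow> (\<exists>c. (\<forall>i<rD. sm p (c i)) \<and> (\<forall>\<^sub>F q in nhds p. s q = (\<Sum>i<rD. c i q *\<^sub>R e i q))))"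
    by (rule exI[of _ X], intro conjI allI impI coeffs eventually_nhds[THEN iffD2] exI[of _ U])
      (use U SX in auto)
qed (use SD_mem SD_eventually in auto)

sublocale D: germ_bundle A D SD rD
  by (rule germ_bundle_D)

end


subsection \<open>Vector bundles\<close>

lemma linear_on_inv_into:
  assumes "linear_on S f" "subspace S" "bij_betw f S T"
  shows "linear_on T (inv_into S f)"
proof (rule linear_onI)
  have inv: "inv_into S f x \<in> S" "f (inv_into S f x) = x" if "x \<in> T" for x
    using assms(3) that by (auto simp: bij_betw_def inv_into_into f_inv_into_f)
  have left: "inv_into S f (f x) = x" if "x \<in> S" for x
    using assms(3) that by (auto simp: bij_betw_def)
  show "inv_into S f (x + y) = inv_into S f x + inv_into S f y" if "x \<in> T" "y \<in> T" for x y
    using left[OF subspace_add[OF assms(2) inv(1)[OF that(1)] inv(1)[OF that(2)]]]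
      linear_on_add[OF assms(1) inv(1)[OF that(1)] inv(1)[OF that(2)]] inv(2) that by simp
  show "inv_into S f (c *\<^sub>R x) = c *\<^sub>R inv_into S f x" if "x \<in> T" for c x
    using left[OF subspace_scale[OF assms(2) inv(1)[OF that]]]
      linear_on_scale[OF assms(1) inv(1)[OF that]] inv(2) that by metis
qed

definition unit_coord :: "nat \<Rightarrow> nat \<Rightarrow> real" where
  "unit_coord i = (\<lambda>j. if j = i then 1 else 0)"

lemma unit_coord_in: "i < r \<Longrightarrow> unit_coord i \<in> coord_space r"
  by (auto simp: unit_coord_def coord_space_def)

lemma coord_expand: "x \<in> coord_space r \<Longrightarrow> (\<Sum>i<r. x i *\<^sub>R unit_coord i) = x"
  by (rule ext) (auto simp: unit_coord_def coord_space_def sum_fun_apply if_distrib cong: if_cong)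

locale vec_bundle = smooth_mfd A
  for A :: "('m::{t2_space, second_countable_topology}, 'v::real_inner) atlas" +
  fixes E :: "('m, 'e::real_vector, 'z) vbundle_scheme"
  assumes vb: "vector_bundle A E"
begin

definition SE :: "'m \<Rightarrow> ('m \<Rightarrow> 'e) \<Rightarrow> bool" where
  "SE p s \<longleftrightarrow> (\<forall>\<^sub>F q in nhds p. s q \<in> fibre E q \<and>
     (\<forall>V \<tau>. (V, \<tau>) \<in> trivs E \<longrightarrow> q \<in> V \<longrightarrow> (\<forall>i<rk E. sm q (\<lambda>z. \<tau> z (s z) i))))"

lemma E_subspace: "subspace (fibre E p)"
  using vb by (simp add: vector_bundle_def)

lemma triv_open: "(V, \<tau>) \<in> trivs E \<Longrightarrow> open V"
  and triv_linear: "(V, \<tau>) \<in> trivs E \<Longrightarrow> p \<in> V \<Longrightarrow> linear_on (fibre E p) (\<tau> p)"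
  and triv_bij: "(V, \<tau>) \<in> trivs E \<Longrightarrow> p \<in> V \<Longrightarrow> bij_betw (\<tau> p) (fibre E p) (coord_space (rk E))"
  using vb unfolding vector_bundle_def by fast+

lemma triv_smooth:
  assumes "(U, \<tau>) \<in> trivs E" "(V, \<upsilon>) \<in> trivs E" "x \<in> coord_space (rk E)" "i < rk E" "p \<in> U" "p \<in> V"
  shows "sm p (\<lambda>p. \<upsilon> p (inv_into (fibre E p) (\<tau> p) x) i)"
proof -
  have "smooth_map A (U \<inter> V) (\<lambda>p. \<upsilon> p (inv_into (fibre E p) (\<tau> p) x) i)"
    using vb assms unfolding vector_bundle_def by fast
  then show ?thesis using smooth_map_iff[of "U \<inter> V"] triv_open assms by blast
qed

lemma sections_iff: "open U \<Longrightarrow> s \<in> sections A E U \<longleftrightarrow> (\<forall>p\<in>U. SE p s)"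
proof -
  assume U: "open U"
  have "smooth_map A (U \<inter> V) (\<lambda>p. \<tau> p (s p) i) \<longleftrightarrow> (\<forall>p\<in>U. p \<in> V \<longrightarrow> sm p (\<lambda>p. \<tau> p (s p) i))"
    if "(V, \<tau>) \<in> trivs E" for V \<tau> i
    using smooth_map_iff[of "U \<inter> V"] U triv_open[OF that] by auto
  then have "s \<in> sections A E U \<longleftrightarrow> (\<forall>p\<in>U. s p \<in> fibre E p \<and>
     (\<forall>V \<tau>. (V, \<tau>) \<in> trivs E \<longrightarrow> p \<in> V \<longrightarrow> (\<forall>i<rk E. sm p (\<lambda>z. \<tau> z (s z) i))))"
    unfolding sections_def by fast
  also have "\<dots> \<longleftrightarrow> (\<forall>p\<in>U. SE p s)"
    unfolding SE_def eventually_nhds_open_iff[OF U] ..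
  finally show ?thesis .
qed

lemma SE_mem: "SE p s \<Longrightarrow> s p \<in> fibre E p"
  unfolding SE_def using eventually_nhds_x_imp_x by fastforce

lemma SE_eventually: "SE p s \<Longrightarrow> \<forall>\<^sub>F q in nhds p. SE q s"
  unfolding SE_def by (simp add: eventually_eventually)

lemma SE_smooth: "SE p s \<Longrightarrow> (V, \<tau>) \<in> trivs E \<Longrightarrow> p \<in> V \<Longrightarrow> i < rk E \<Longrightarrow> sm p (\<lambda>z. \<tau> z (s z) i)"
  unfolding SE_def using eventually_nhds_x_imp_x by fastforce

text \<open>Closure of the germs under a pointwise operation that the trivializations turn into \<open>h\<close>.\<close>

lemma SE_lift:
  assumes "SE p s" "SE p t" "sm p f"
    and h: "\<And>q. s q \<in> fibre E q \<Longrightarrow> t q \<in> fibre E q \<Longrightarrow> w q \<in> fibre E q"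
    and \<tau>: "\<And>q V \<tau> i. (V, \<tau>) \<in> trivs E \<Longrightarrow> q \<in> V \<Longrightarrow> s q \<in> fibre E q \<Longrightarrow> t q \<in> fibre E q \<Longrightarrow>
      \<tau> q (w q) i = f q * \<tau> q (s q) i + g q * \<tau> q (t q) i"
    and "sm p g"
  shows "SE p w"
  using SE_eventually[OF assms(1)] SE_eventually[OF assms(2)] sm_eventually[OF assms(3)]
    sm_eventually[OF \<open>sm p g\<close>] unfolding SE_def[of p w]
proof eventually_elim
  case (elim q)
  have *: "sm q (\<lambda>z. \<tau> z (w z) i)" if V: "(V, \<tau>) \<in> trivs E" "q \<in> V" "i < rk E" for V \<tau> i
  proof (rule sm_cong)
    show "sm q (\<lambda>z. f z * \<tau> z (s z) i + g z * \<tau> z (t z) i)"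
      using elim SE_smooth V by (intro sm_add sm_mult) auto
    have "\<forall>\<^sub>F z in nhds q. z \<in> V" using V triv_open eventually_nhds_in_open by blast
    with SE_eventually[OF elim(1)] SE_eventually[OF elim(2)]
    show "\<forall>\<^sub>F z in nhds q. f z * \<tau> z (s z) i + g z * \<tau> z (t z) i = \<tau> z (w z) i"
      by eventually_elim (use \<tau> V(1) SE_mem in auto)
  qed
  have "w q \<in> fibre E q" using h SE_mem elim(1,2) by blast
  then show ?case using * by simp
qed

lemma germ_bundle_E: "germ_bundle A (fibre E) SE (rk E)"
proof
  fix p
  show "subspace (fibre E p)" by (rule E_subspace)
  have lin0: "\<tau> q 0 i = 0" if "(V, \<tau>) \<in> trivs E" "q \<in> V" for V \<tau> q i
    using linear_on_zero[OF triv_linear[OF that] E_subspace] by simp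
  show "SE p (\<lambda>q. 0)"
  proof -
    have "sm q (\<lambda>z. \<tau> z 0 i)" if "(V, \<tau>) \<in> trivs E" "q \<in> V" for V \<tau> q i
      by (rule sm_cong[of "\<lambda>_. 0"]) (use lin0[OF that(1)] triv_open that in
          \<open>auto simp: eventually_nhds intro!: exI[of _ V]\<close>)
    then show ?thesis by (simp add: SE_def subspace_0[OF E_subspace])
  qed
  show "SE p t" if s: "SE p s" "\<forall>\<^sub>F q in nhds p. s q = t q" for s t
  proof -
    have "\<forall>\<^sub>F q in nhds p. \<forall>\<^sub>F z in nhds q. s z = t z" using s(2) by (simp add: eventually_eventually)
    then show ?thesis using s(1) unfolding SE_def
    proof eventually_elim
      case (elim q)
      have "sm q (\<lambda>z. \<tau> z (t z) i)" if "(V, \<tau>) \<in> trivs E" "q \<in> V" "i < rk E" for V \<tau> i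
      proof (rule sm_cong)
        show "\<forall>\<^sub>F z in nhds q. \<tau> z (s z) i = \<tau> z (t z) i" using elim(1) by eventually_elim simp
      qed (use elim(2) that in blast)
      then show ?case using elim eventually_nhds_x_imp_x[OF elim(1)] by simp
    qed
  qed
  show "SE p (\<lambda>q. s q + t q)" if st: "SE p s" "SE p t" for s t
    by (rule SE_lift[OF st, of "\<lambda>_. 1" _ "\<lambda>_. 1"])
      (simp_all add: subspace_add[OF E_subspace] linear_on_add[OF triv_linear])
  show "SE p (\<lambda>q. f q *\<^sub>R s q)" if s: "sm p f" "SE p s" for f s
    by (rule SE_lift[OF s(2,2), of f _ "\<lambda>_. 0"])
      (use s in \<open>simp_all add: subspace_scale[OF E_subspace] linear_on_scale[OF triv_linear]\<close>)
  obtain V \<tau> where V: "(V, \<tau>) \<in> trivs E" "p \<in> V"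
  proof -
    have "p \<in> (\<Union>(U, \<tau>)\<in>trivs E. U)" using vb by (simp add: vector_bundle_def)
    then show thesis using that by auto
  qed
  define e where "e i q = inv_into (fibre E q) (\<tau> q) (unit_coord i)" for i q
  have em: "e i q \<in> fibre E q" and te: "\<tau> q (e i q) = unit_coord i" if "q \<in> V" "i < rk E" for q i
    using triv_bij[OF V(1) that(1)] unit_coord_in[OF that(2)] unfolding e_def bij_betw_def
    by (auto simp: inv_into_into f_inv_into_f)
  have Se: "SE q (e i)" if "q \<in> V" "i < rk E" for q i
    unfolding SE_def eventually_nhds
    by (rule exI[of _ V]) (use triv_open[OF V(1)] that em triv_smooth[OF V(1) _ unit_coord_in] in
        \<open>auto simp: e_def\<close>)
  have expand: "v = (\<Sum>i<rk E. \<tau> q v i *\<^sub>R e i q)" if "q \<in> V" "v \<in> fibre E q" for q v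
  proof -
    have inj: "inj_on (\<tau> q) (fibre E q)" and cs: "\<tau> q v \<in> coord_space (rk E)"
      using triv_bij[OF V(1) that(1)] that(2) by (auto simp: bij_betw_def)
    have "\<tau> q (\<Sum>i<rk E. \<tau> q v i *\<^sub>R e i q) = (\<Sum>i<rk E. \<tau> q v i *\<^sub>R \<tau> q (e i q))"
      by (rule linear_on_sum[OF triv_linear[OF V(1) that(1)] E_subspace]) (use em that in auto)
    also have "\<dots> = \<tau> q v" using te that coord_expand[OF cs] by simp
    finally show ?thesis
      using inj_onD[OF inj] that em by (metis (no_types, lifting) E_subspace lessThan_iff subspace_scale subspace_sum)
  qed
  have indep: "x i = 0" if "q \<in> V" "(\<Sum>i<rk E. x i *\<^sub>R e i q) = 0" "i < rk E" for q x i
  proof -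
    have "\<tau> q (\<Sum>i<rk E. x i *\<^sub>R e i q) = (\<Sum>i<rk E. x i *\<^sub>R \<tau> q (e i q))"
      by (rule linear_on_sum[OF triv_linear[OF V(1) that(1)] E_subspace]) (use em that in auto)
    then have "0 = (\<Sum>i<rk E. x i *\<^sub>R unit_coord i)"
      using that(2) te[OF that(1)] linear_on_zero[OF triv_linear[OF V(1) that(1)] E_subspace] by simp
    then have "0 = (\<Sum>j<rk E. x j *\<^sub>R unit_coord j) i" by (metis zero_fun_def)
    also have "\<dots> = (\<Sum>j<rk E. if j = i then x i else 0)"
      by (simp add: sum_fun_apply unit_coord_def if_distrib eq_commute cong: if_cong sum.cong)
    finally show ?thesis using that(3) by simp
  qed
  have coeffs: "\<exists>c. (\<forall>i<rk E. sm p (c i)) \<and> (\<forall>\<^sub>F q in nhds p. s q = (\<Sum>i<rk E. c i q *\<^sub>R e i q))"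
    if s: "SE p s" for s
  proof (intro exI[of _ "\<lambda>i q. \<tau> q (s q) i"] conjI allI impI)
    show "sm p (\<lambda>q. \<tau> q (s q) i)" if "i < rk E" for i using SE_smooth[OF s V that] .
    have "\<forall>\<^sub>F q in nhds p. q \<in> V" using V triv_open eventually_nhds_in_open by blast
    with SE_eventually[OF s] show "\<forall>\<^sub>F q in nhds p. s q = (\<Sum>i<rk E. \<tau> q (s q) i *\<^sub>R e i q)"
      by eventually_elim (use expand SE_mem in blast)
  qed
  show "\<exists>e. (\<forall>\<^sub>F q in nhds p. (\<forall>i<rk E. SE q (e i)) \<and>
        (\<forall>v\<in>fibre E q. \<exists>x. v = (\<Sum>i<rk E. x i *\<^sub>R e i q)) \<and>
        (\<forall>x. (\<Sum>i<rk E. x i *\<^sub>R e i q) = 0 \<longrightarrow> (\<forall>i<rk E. x i = 0))) \<and>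
      (\<forall>s. SE p s \<longrightarrow> (\<exists>c. (\<forall>i<rk E. sm p (c i)) \<and>
         (\<forall>\<^sub>F q in nhds p. s q = (\<Sum>i<rk E. c i q *\<^sub>R e i q))))"
    by (rule exI[of _ e], intro conjI allI impI coeffs eventually_nhds[THEN iffD2] exI[of _ V])
      (use V triv_open Se expand indep in \<open>auto, blast?\<close>)
qed (use SE_mem SE_eventually in auto)

sublocale E: germ_bundle A "fibre E" SE "rk E"
  by (rule germ_bundle_E)

end

section \<open>Lie brackets and forms\<close>

context involutive
begin

abbreviation smf :: "('m \<Rightarrow> real) \<Rightarrow> bool" where "smf f \<equiv> \<forall>q. sm q f"
abbreviation lb where "lb \<equiv> lie_bracket A"

lemma G_D_sections: "X \<in> D.G \<longleftrightarrow> X \<in> D_sections A D UNIV"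
  by (simp add: D.G_def D_sections_iff)

lemma D_sections_UNIV: "D_sections A D UNIV = D.G"
  using G_D_sections by blast

lemma G_tangent: "X \<in> D.G \<Longrightarrow> X p \<in> tangent_space A p"
  using D.G_mem D_tangent by blast

lemma act_smooth: "X \<in> D.G \<Longrightarrow> sm p f \<Longrightarrow> sm p (\<lambda>q. X q f)"
  using SD_smooth D.G_S by blast

lemma act_add: "X \<in> D.G \<Longrightarrow> sm p f \<Longrightarrow> sm p g \<Longrightarrow> X p (\<lambda>q. f q + g q) = X p f + X p g"
  by (rule tangent_add[OF G_tangent])

lemma act_diff: "X \<in> D.G \<Longrightarrow> sm p f \<Longrightarrow> sm p g \<Longrightarrow> X p (\<lambda>q. f q - g q) = X p f - X p g"
  by (rule tangent_diff[OF G_tangent])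

lemma act_minus: "X \<in> D.G \<Longrightarrow> sm p f \<Longrightarrow> X p (\<lambda>q. - f q) = - X p f"
  by (rule tangent_minus[OF G_tangent])

lemma act_cmult: "X \<in> D.G \<Longrightarrow> sm p f \<Longrightarrow> X p (\<lambda>q. c * f q) = c * X p f"
  by (rule tangent_cmult[OF G_tangent])

lemma act_mult: "X \<in> D.G \<Longrightarrow> sm p f \<Longrightarrow> sm p g \<Longrightarrow>
    X p (\<lambda>q. f q * g q) = f p * X p g + g p * X p f"
  by (rule tangent_mult[OF G_tangent])

lemma act_zero: "X \<in> D.G \<Longrightarrow> X p (\<lambda>q. 0) = 0"
  using tangent_const G_tangent by blast

lemma lb_G: "X \<in> D.G \<Longrightarrow> Y \<in> D.G \<Longrightarrow> lb X Y \<in> D.G"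
  using lie_sub by (simp add: G_D_sections lie_subalgebroid_def)

lemma lb_apply: "sm p f \<Longrightarrow> lb X Y p f = X p (\<lambda>q. Y q f) - Y p (\<lambda>q. X q f)"
  by (simp add: lie_bracket_def)

lemma G_eqI:
  assumes "\<And>p. X p \<in> tangent_space A p" "\<And>p. Y p \<in> tangent_space A p"
    "\<And>p f. sm p f \<Longrightarrow> X p f = Y p f"
  shows "X = Y"
  by (rule ext, rule tangent_eqI) (use assms in auto)

lemma lb_skew: "lb X Y = (\<lambda>p. - lb Y X p)"
  by (intro ext) (simp add: lie_bracket_def)

lemma lb_add: "X \<in> D.G \<Longrightarrow> Y \<in> D.G \<Longrightarrow> Z \<in> D.G \<Longrightarrow>
    lb X (\<lambda>q. Y q + Z q) = (\<lambda>p. lb X Y p + lb X Z p)"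
  by (rule G_eqI) (auto simp: lb_apply act_add[of X] act_smooth[of Y] act_smooth[of Z]
      intro!: G_tangent lb_G D.G_add)

lemma lb_scale: "X \<in> D.G \<Longrightarrow> Y \<in> D.G \<Longrightarrow> smf f \<Longrightarrow>
    lb X (\<lambda>q. f q *\<^sub>R Y q) = (\<lambda>p. f p *\<^sub>R lb X Y p + X p f *\<^sub>R Y p)"
  by (rule G_eqI) (auto simp: lb_apply act_mult[of X] act_smooth[of Y] act_smooth[of X] algebra_simps
      intro!: G_tangent lb_G D.G_add D.G_scale)

lemma lb_add_left: "X \<in> D.G \<Longrightarrow> Y \<in> D.G \<Longrightarrow> Z \<in> D.G \<Longrightarrow>
    lb (\<lambda>q. Y q + Z q) X = (\<lambda>p. lb Y X p + lb Z X p)"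
  using lb_add[of X Y Z] lb_skew[of _ X] by auto

lemma lb_scale_left: "X \<in> D.G \<Longrightarrow> Y \<in> D.G \<Longrightarrow> smf f \<Longrightarrow>
    lb (\<lambda>q. f q *\<^sub>R Y q) X = (\<lambda>p. f p *\<^sub>R lb Y X p + (- X p f) *\<^sub>R Y p)"
  using lb_scale[of X Y f] lb_skew[of _ X] by auto

lemma lb_jacobi:
  assumes "X \<in> D.G" "Y \<in> D.G" "Z \<in> D.G"
  shows "lb X (lb Y Z) = (\<lambda>p. lb (lb X Y) Z p + lb Y (lb X Z) p)"
proof (rule G_eqI)
  fix p f assume f: "sm p f"
  have *: "X p (\<lambda>q. lb Y Z q f) = X p (\<lambda>q. Y q (\<lambda>z. Z z f)) - X p (\<lambda>q. Z q (\<lambda>z. Y z f))"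
    if "X \<in> D.G" "Y \<in> D.G" "Z \<in> D.G" for X Y Z
  proof -
    have "\<forall>\<^sub>F q in nhds p. lb Y Z q f = Y q (\<lambda>z. Z z f) - Z q (\<lambda>z. Y z f)"
      using sm_eventually[OF f] by eventually_elim (simp add: lb_apply)
    then have "X p (\<lambda>q. lb Y Z q f) = X p (\<lambda>q. Y q (\<lambda>z. Z z f) - Z q (\<lambda>z. Y z f))"
      by (rule tangent_cong[OF G_tangent[OF that(1)]])
    then show ?thesis using act_diff[OF that(1)] act_smooth[OF that(2)] act_smooth[OF that(3)] f by simp
  qed
  note s = act_smooth[OF assms(1) f] act_smooth[OF assms(2) f] act_smooth[OF assms(3) f]
    act_smooth[OF lb_G[OF assms(1,2)] f] act_smooth[OF lb_G[OF assms(1,3)] f]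
    act_smooth[OF lb_G[OF assms(2,3)] f]
  show "lb X (lb Y Z) p f = (lb (lb X Y) Z p + lb Y (lb X Z) p) f"
    using assms f s by (simp add: lb_apply *)
qed (use assms in \<open>auto intro!: G_tangent lb_G D.G_add\<close>)

lemma forms_iff: "\<omega> \<in> forms A D k \<longleftrightarrow>
   (\<forall>p xs. \<not> (length xs = k \<and> set xs \<subseteq> D p) \<longrightarrow> \<omega> p xs = 0) \<and>
   (\<forall>p xs. length xs = k \<and> set xs \<subseteq> D p \<longrightarrow>
      (\<forall>i<k. linear_on (D p) (\<lambda>x. \<omega> p (xs[i := x]))) \<and> (\<not> distinct xs \<longrightarrow> \<omega> p xs = 0)) \<and>
   (\<forall>p Xs. length Xs = k \<and> (\<forall>X\<in>set Xs. SD p X) \<longrightarrow> sm p (\<lambda>q. \<omega> q (map (\<lambda>X. X q) Xs)))"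
proof -
  have "(\<forall>U Xs. open U \<and> length Xs = k \<and> set Xs \<subseteq> D_sections A D U \<longrightarrow>
            smooth_map A U (\<lambda>p. \<omega> p (map (\<lambda>X. X p) Xs))) \<longleftrightarrow>
    (\<forall>p Xs. length Xs = k \<and> (\<forall>X\<in>set Xs. SD p X) \<longrightarrow> sm p (\<lambda>q. \<omega> q (map (\<lambda>X. X q) Xs)))"
  proof (intro iffI allI impI; elim conjE)
    fix p Xs
    assume *: "\<forall>U Xs. open U \<and> length Xs = k \<and> set Xs \<subseteq> D_sections A D U \<longrightarrow>
            smooth_map A U (\<lambda>p. \<omega> p (map (\<lambda>X. X p) Xs))" and l: "length Xs = k" "\<forall>X\<in>set Xs. SD p X"
    have "\<forall>\<^sub>F q in nhds p. \<forall>X\<in>set Xs. SD q X"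
      using l SD_eventually by (simp add: eventually_ball_finite_distrib)
    then obtain U where "open U" "p \<in> U" "\<And>q X. q \<in> U \<Longrightarrow> X \<in> set Xs \<Longrightarrow> SD q X"
      by (auto simp: eventually_nhds)
    moreover from this have "set Xs \<subseteq> D_sections A D U" by (auto simp: D_sections_iff)
    ultimately show "sm p (\<lambda>q. \<omega> q (map (\<lambda>X. X q) Xs))"
      using * l(1) smooth_map_iff[of U "\<lambda>q. \<omega> q (map (\<lambda>X. X q) Xs)"] by auto
  next
    fix U Xs
    assume *: "\<forall>p Xs. length Xs = k \<and> (\<forall>X\<in>set Xs. SD p X) \<longrightarrow> sm p (\<lambda>q. \<omega> q (map (\<lambda>X. X q) Xs))"
      and U: "open U" "length Xs = k" "set Xs \<subseteq> D_sections A D U"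
    show "smooth_map A U (\<lambda>p. \<omega> p (map (\<lambda>X. X p) Xs))"
      unfolding smooth_map_iff[OF U(1)] using * U(2,3) D_sections_iff[OF U(1)] by blast
  qed
  then show ?thesis unfolding forms_def by simp
qed

lemma form_off: "\<omega> \<in> forms A D k \<Longrightarrow> \<not> (length xs = k \<and> set xs \<subseteq> D p) \<Longrightarrow> \<omega> p xs = 0"
  by (simp add: forms_iff)

lemma form_linear: "\<omega> \<in> forms A D k \<Longrightarrow> length xs = k \<Longrightarrow> set xs \<subseteq> D p \<Longrightarrow> i < k \<Longrightarrow>
    linear_on (D p) (\<lambda>x. \<omega> p (xs[i := x]))"
  by (simp add: forms_iff)

lemma form_alt: "\<omega> \<in> forms A D k \<Longrightarrow> \<not> distinct xs \<Longrightarrow> \<omega> p xs = 0"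
  by (cases "length xs = k \<and> set xs \<subseteq> D p") (simp_all add: forms_iff)

lemma form_smooth: "\<omega> \<in> forms A D k \<Longrightarrow> length Xs = k \<Longrightarrow> (\<And>X. X \<in> set Xs \<Longrightarrow> SD p X) \<Longrightarrow>
    sm p (\<lambda>q. \<omega> q (map (\<lambda>X. X q) Xs))"
  by (simp add: forms_iff)

lemma form2_linear:
  assumes "\<omega> \<in> forms A D 2" "x \<in> D p" "y \<in> D p"
  shows "linear_on (D p) (\<lambda>z. \<omega> p [z, y])" "linear_on (D p) (\<lambda>z. \<omega> p [x, z])"
proof -
  have "linear_on (D p) (\<lambda>z. \<omega> p ([x, y][i := z]))" if "i < 2" for i
    by (rule form_linear[OF assms(1)]) (use assms(2,3) that in auto)
  from this[of 0] this[of "Suc 0"] show "linear_on (D p) (\<lambda>z. \<omega> p [z, y])"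
    "linear_on (D p) (\<lambda>z. \<omega> p [x, z])" by simp_all
qed

lemma form2_skew:
  assumes "\<omega> \<in> forms A D 2" "x \<in> D p" "y \<in> D p"
  shows "\<omega> p [x, y] = - \<omega> p [y, x]"
proof -
  have s: "x + y \<in> D p" using assms subspace_add[OF D_subspace] by blast
  show ?thesis
    using linear_on_add[OF form2_linear(1)[OF assms(1) s s] assms(2,3)]
      linear_on_add[OF form2_linear(2)[OF assms(1,2) s] assms(2,3)]
      linear_on_add[OF form2_linear(2)[OF assms(1,3) s] assms(2,3)]
      form_alt[OF assms(1), of "[x + y, x + y]" p] form_alt[OF assms(1), of "[x, x]" p]
      form_alt[OF assms(1), of "[y, y]" p] by simp
qed

lemma form3_linear:
  assumes "\<omega> \<in> forms A D 3" "x \<in> D p" "y \<in> D p" "z \<in> D p"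
  shows "linear_on (D p) (\<lambda>w. \<omega> p [w, y, z])" "linear_on (D p) (\<lambda>w. \<omega> p [x, w, z])"
    "linear_on (D p) (\<lambda>w. \<omega> p [x, y, w])"
proof -
  have "linear_on (D p) (\<lambda>w. \<omega> p ([x, y, z][i := w]))" if "i < 3" for i
    by (rule form_linear[OF assms(1)]) (use assms(2-4) that in auto)
  from this[of 0] this[of "Suc 0"] this[of "Suc (Suc 0)"] show "linear_on (D p) (\<lambda>w. \<omega> p [w, y, z])"
    "linear_on (D p) (\<lambda>w. \<omega> p [x, w, z])" "linear_on (D p) (\<lambda>w. \<omega> p [x, y, w])" by simp_all
qed

lemma form3_skew:
  assumes "\<omega> \<in> forms A D 3" "x \<in> D p" "y \<in> D p" "z \<in> D p"
  shows "\<omega> p [x, y, z] = - \<omega> p [y, x, z]" "\<omega> p [x, y, z] = - \<omega> p [x, z, y]"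
proof -
  have s: "x + y \<in> D p" "y + z \<in> D p" using assms subspace_add[OF D_subspace] by blast+
  show "\<omega> p [x, y, z] = - \<omega> p [y, x, z]"
    using linear_on_add[OF form3_linear(1)[OF assms(1) s(1) s(1) assms(4)] assms(2,3)]
      linear_on_add[OF form3_linear(2)[OF assms(1,2) s(1) assms(4)] assms(2,3)]
      linear_on_add[OF form3_linear(2)[OF assms(1,3) s(1) assms(4)] assms(2,3)]
      form_alt[OF assms(1), of "[x + y, x + y, z]" p] form_alt[OF assms(1), of "[x, x, z]" p]
      form_alt[OF assms(1), of "[y, y, z]" p] by simp
  show "\<omega> p [x, y, z] = - \<omega> p [x, z, y]"
    using linear_on_add[OF form3_linear(2)[OF assms(1,2) s(2) s(2)] assms(3,4)]
      linear_on_add[OF form3_linear(3)[OF assms(1,2,3) s(2)] assms(3,4)]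
      linear_on_add[OF form3_linear(3)[OF assms(1,2,4) s(2)] assms(3,4)]
      form_alt[OF assms(1), of "[x, y + z, y + z]" p] form_alt[OF assms(1), of "[x, y, y]" p]
      form_alt[OF assms(1), of "[x, z, z]" p] by simp
qed


subsection \<open>Cartan's formula in degrees 2 and 3\<close>

definition alt2 :: "(('m \<Rightarrow> 'm tvec) \<Rightarrow> ('m \<Rightarrow> 'm tvec) \<Rightarrow> 'm \<Rightarrow> real) \<Rightarrow> bool" where
  "alt2 w \<longleftrightarrow> (\<forall>X\<in>D.G. \<forall>Y\<in>D.G. smf (w X Y) \<and> w X Y = (\<lambda>p. - w Y X p) \<and>
     (\<forall>X'\<in>D.G. w (\<lambda>q. X q + X' q) Y = (\<lambda>p. w X Y p + w X' Y p)) \<and>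
     (\<forall>f. smf f \<longrightarrow> w (\<lambda>q. f q *\<^sub>R X q) Y = (\<lambda>p. f p * w X Y p)))"

definition alt3 :: "(('m \<Rightarrow> 'm tvec) \<Rightarrow> ('m \<Rightarrow> 'm tvec) \<Rightarrow> ('m \<Rightarrow> 'm tvec) \<Rightarrow> 'm \<Rightarrow> real) \<Rightarrow> bool" where
  "alt3 w \<longleftrightarrow> (\<forall>X\<in>D.G. \<forall>Y\<in>D.G. \<forall>Z\<in>D.G. smf (w X Y Z) \<and>
     w X Y Z = (\<lambda>p. - w Y X Z p) \<and> w X Y Z = (\<lambda>p. - w X Z Y p) \<and>
     (\<forall>X'\<in>D.G. w (\<lambda>q. X q + X' q) Y Z = (\<lambda>p. w X Y Z p + w X' Y Z p)) \<and>
     (\<forall>f. smf f \<longrightarrow> w (\<lambda>q. f q *\<^sub>R X q) Y Z = (\<lambda>p. f p * w X Y Z p)))"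

lemma alt2_smooth: "alt2 w \<Longrightarrow> X \<in> D.G \<Longrightarrow> Y \<in> D.G \<Longrightarrow> sm p (w X Y)"
  unfolding alt2_def by blast

lemma alt2_skew: "alt2 w \<Longrightarrow> X \<in> D.G \<Longrightarrow> Y \<in> D.G \<Longrightarrow> w X Y = (\<lambda>p. - w Y X p)"
  unfolding alt2_def by blast

lemma alt2_add: "alt2 w \<Longrightarrow> X \<in> D.G \<Longrightarrow> X' \<in> D.G \<Longrightarrow> Y \<in> D.G \<Longrightarrow>
    w (\<lambda>q. X q + X' q) Y = (\<lambda>p. w X Y p + w X' Y p)"
  unfolding alt2_def by blast

lemma alt2_scale: "alt2 w \<Longrightarrow> X \<in> D.G \<Longrightarrow> Y \<in> D.G \<Longrightarrow> smf f \<Longrightarrow>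
    w (\<lambda>q. f q *\<^sub>R X q) Y = (\<lambda>p. f p * w X Y p)"
  unfolding alt2_def by blast

lemma alt2_add2: "alt2 w \<Longrightarrow> X \<in> D.G \<Longrightarrow> X' \<in> D.G \<Longrightarrow> Y \<in> D.G \<Longrightarrow>
    w Y (\<lambda>q. X q + X' q) = (\<lambda>p. w Y X p + w Y X' p)"
  using alt2_add[of w X X' Y] alt2_skew[of w Y] by (simp add: D.G_add)

lemma alt2_scale2: "alt2 w \<Longrightarrow> X \<in> D.G \<Longrightarrow> Y \<in> D.G \<Longrightarrow> smf f \<Longrightarrow>
    w Y (\<lambda>q. f q *\<^sub>R X q) = (\<lambda>p. f p * w Y X p)"
  using alt2_scale[of w X Y f] alt2_skew[of w Y] by (simp add: D.G_scale)

lemma alt3_smooth: "alt3 w \<Longrightarrow> X \<in> D.G \<Longrightarrow> Y \<in> D.G \<Longrightarrow> Z \<in> D.G \<Longrightarrow> sm p (w X Y Z)"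
  unfolding alt3_def by blast

lemma alt3_skew12: "alt3 w \<Longrightarrow> X \<in> D.G \<Longrightarrow> Y \<in> D.G \<Longrightarrow> Z \<in> D.G \<Longrightarrow> w X Y Z = (\<lambda>p. - w Y X Z p)"
  unfolding alt3_def by blast

lemma alt3_skew23: "alt3 w \<Longrightarrow> X \<in> D.G \<Longrightarrow> Y \<in> D.G \<Longrightarrow> Z \<in> D.G \<Longrightarrow> w X Y Z = (\<lambda>p. - w X Z Y p)"
  unfolding alt3_def by blast

lemma alt3_add: "alt3 w \<Longrightarrow> X \<in> D.G \<Longrightarrow> X' \<in> D.G \<Longrightarrow> Y \<in> D.G \<Longrightarrow> Z \<in> D.G \<Longrightarrow>
    w (\<lambda>q. X q + X' q) Y Z = (\<lambda>p. w X Y Z p + w X' Y Z p)"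
  unfolding alt3_def by blast

lemma alt3_scale: "alt3 w \<Longrightarrow> X \<in> D.G \<Longrightarrow> Y \<in> D.G \<Longrightarrow> Z \<in> D.G \<Longrightarrow> smf f \<Longrightarrow>
    w (\<lambda>q. f q *\<^sub>R X q) Y Z = (\<lambda>p. f p * w X Y Z p)"
  unfolding alt3_def by blast

lemma alt3_add2: "alt3 w \<Longrightarrow> X \<in> D.G \<Longrightarrow> X' \<in> D.G \<Longrightarrow> Y \<in> D.G \<Longrightarrow> Z \<in> D.G \<Longrightarrow>
    w Y (\<lambda>q. X q + X' q) Z = (\<lambda>p. w Y X Z p + w Y X' Z p)"
  using alt3_add[of w X X' Y Z] alt3_skew12[of w Y _ Z] by (simp add: D.G_add)

lemma alt3_scale2: "alt3 w \<Longrightarrow> X \<in> D.G \<Longrightarrow> Y \<in> D.G \<Longrightarrow> Z \<in> D.G \<Longrightarrow> smf f \<Longrightarrow>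
    w Y (\<lambda>q. f q *\<^sub>R X q) Z = (\<lambda>p. f p * w Y X Z p)"
  using alt3_scale[of w X Y Z f] alt3_skew12[of w Y _ Z] by (simp add: D.G_scale)

definition d2 where "d2 w X Y Z p = X p (w Y Z) - Y p (w X Z) + Z p (w X Y)
  - w (lb X Y) Z p + w (lb X Z) Y p - w (lb Y Z) X p"

definition d3 where "d3 w X Y Z W p = X p (w Y Z W) - Y p (w X Z W) + Z p (w X Y W) - W p (w X Y Z)
  - w (lb X Y) Z W p + w (lb X Z) Y W p - w (lb X W) Y Z p
  - w (lb Y Z) X W p + w (lb Y W) X Z p - w (lb Z W) X Y p"

lemma d2_swap12:
  assumes w: "alt2 w" and G: "X \<in> D.G" "Y \<in> D.G" "Z \<in> D.G"
  shows "d2 w X Y Z p = - d2 w Y X Z p"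
proof -
  have "Z p (w X Y) = - Z p (w Y X)"
    by (subst alt2_skew[OF w G(1,2)], rule act_minus[OF G(3) alt2_smooth[OF w G(2,1)]])
  moreover have "w (lb X Y) Z p = - w (lb Y X) Z p"
    by (subst lb_skew) (use alt2_scale[OF w lb_G[OF G(2,1)] G(3), of "\<lambda>_. -1"] in simp)
  ultimately show ?thesis by (simp add: d2_def)
qed

lemma d2_swap23:
  assumes w: "alt2 w" and G: "X \<in> D.G" "Y \<in> D.G" "Z \<in> D.G"
  shows "d2 w X Y Z p = - d2 w X Z Y p"
proof -
  have "X p (w Y Z) = - X p (w Z Y)"
    by (subst alt2_skew[OF w G(2,3)], rule act_minus[OF G(1) alt2_smooth[OF w G(3,2)]])
  moreover have "w (lb Y Z) X p = - w (lb Z Y) X p"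
    by (subst lb_skew) (use alt2_scale[OF w lb_G[OF G(3,2)] G(1), of "\<lambda>_. -1"] in simp)
  ultimately show ?thesis by (simp add: d2_def)
qed

lemma d2_tensorial1:
  assumes w: "alt2 w" and G: "X \<in> D.G" "X' \<in> D.G" "Y \<in> D.G" "Z \<in> D.G" and eq: "X p = X' p"
  shows "d2 w X Y Z p = d2 w X' Y Z p"
proof (rule D.tensorial[where T="\<lambda>X. d2 w X Y Z p", OF _ _ G(1,2) eq])
  fix X X' assume X: "X \<in> D.G" "X' \<in> D.G"
  show "d2 w (\<lambda>q. X q + X' q) Y Z p = d2 w X Y Z p + d2 w X' Y Z p"
    using X G w by (simp add: d2_def alt2_add alt2_add2 lb_add_left lb_G act_add alt2_smooth)
next
  fix f X assume f: "\<And>q. sm q f" and X: "X \<in> D.G"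
  have "w (lb (\<lambda>q. f q *\<^sub>R X q) Y) Z = (\<lambda>p. f p * w (lb X Y) Z p + (- Y p f) * w X Z p)"
    if "Y \<in> D.G" "Z \<in> D.G" for Y Z
  proof -
    have "smf (\<lambda>p. - Y p f)" using act_smooth[OF that(1)] f by (intro allI sm_minus) auto
    then have s: "w (\<lambda>q. (- Y q f) *\<^sub>R X q) Z = (\<lambda>p. (- Y p f) * w X Z p)"
      and sG: "(\<lambda>q. (- Y q f) *\<^sub>R X q) \<in> D.G"
      using alt2_scale[OF w X that(2)] D.G_scale[OF _ X] by blast+
    have s': "w (\<lambda>q. f q *\<^sub>R lb X Y q) Z = (\<lambda>p. f p * w (lb X Y) Z p)"
      and sG': "(\<lambda>q. f q *\<^sub>R lb X Y q) \<in> D.G"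
      using alt2_scale[OF w lb_G[OF X that(1)] that(2)] D.G_scale[OF _ lb_G[OF X that(1)]] f by blast+
    show ?thesis unfolding lb_scale_left[OF that(1) X allI[OF f]] alt2_add[OF w sG' sG that(2)] s s' ..
  qed
  then show "d2 w (\<lambda>q. f q *\<^sub>R X q) Y Z p = f p * d2 w X Y Z p"
    using X f G alt2_scale[OF w X _ allI[OF f]] alt2_scale2[OF w X _ allI[OF f]]
      act_mult[OF G(3) f alt2_smooth[OF w X G(4)]] act_mult[OF G(4) f alt2_smooth[OF w X G(3)]]
    by (simp add: d2_def lb_G) (simp add: algebra_simps)
qed

lemma d2_tensorial:
  assumes w: "alt2 w" and G: "X \<in> D.G" "Y \<in> D.G" "Z \<in> D.G" "X' \<in> D.G" "Y' \<in> D.G" "Z' \<in> D.G"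
    and eq: "X p = X' p" "Y p = Y' p" "Z p = Z' p"
  shows "d2 w X Y Z p = d2 w X' Y' Z' p"
proof -
  note s = d2_swap12[OF w] d2_swap23[OF w] and t = d2_tensorial1[OF w]
  have 2: "d2 w X Y Z p = d2 w X Y' Z p" if "X \<in> D.G" "Y \<in> D.G" "Y' \<in> D.G" "Z \<in> D.G"
    "Y p = Y' p" for X Y Y' Z
    using s(1)[of X Y Z p] s(1)[of X Y' Z p] t[of Y Y' X Z] that by simp
  have 3: "d2 w X Y Z p = d2 w X Y Z' p" if "X \<in> D.G" "Y \<in> D.G" "Z \<in> D.G" "Z' \<in> D.G"
    "Z p = Z' p" for X Y Z Z'
    using s(2)[of X Y Z p] s(2)[of X Y Z' p] 2[of X Z Z' Y] that by simp
  have "d2 w X Y Z p = d2 w X' Y Z p" using t G eq by blast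
  also have "\<dots> = d2 w X' Y' Z p" using 2 G eq by blast
  also have "\<dots> = d2 w X' Y' Z' p" using 3 G eq by blast
  finally show ?thesis .
qed

lemma alt3_lb_skew:
  assumes w: "alt3 w" and G: "X \<in> D.G" "Y \<in> D.G" "Z \<in> D.G" "W \<in> D.G"
  shows "w (lb X Y) Z W p = - w (lb Y X) Z W p"
  by (subst lb_skew) (use alt3_scale[OF w lb_G[OF G(2,1)] G(3,4), of "\<lambda>_. -1"] in simp)

lemma act_alt3_skew12:
  assumes w: "alt3 w" and G: "X \<in> D.G" "Y \<in> D.G" "Z \<in> D.G" "W \<in> D.G"
  shows "W p (w X Y Z) = - W p (w Y X Z)"
  by (subst alt3_skew12[OF w G(1,2,3)], rule act_minus[OF G(4) alt3_smooth[OF w G(2,1,3)]])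

lemma act_alt3_skew23:
  assumes w: "alt3 w" and G: "X \<in> D.G" "Y \<in> D.G" "Z \<in> D.G" "W \<in> D.G"
  shows "W p (w X Y Z) = - W p (w X Z Y)"
  by (subst alt3_skew23[OF w G(1,2,3)], rule act_minus[OF G(4) alt3_smooth[OF w G(1,3,2)]])

lemma d3_swap12:
  assumes w: "alt3 w" and G: "X \<in> D.G" "Y \<in> D.G" "Z \<in> D.G" "W \<in> D.G"
  shows "d3 w X Y Z W p = - d3 w Y X Z W p"
  using alt3_lb_skew[OF w G(1,2,3,4), of p] act_alt3_skew12[OF w G(1,2,4,3), of p]
    act_alt3_skew12[OF w G(1,2,3,4), of p] alt3_skew23[OF w lb_G[OF G(3,4)] G(1,2)]
  by (simp add: d3_def)

lemma d3_swap23: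
  assumes w: "alt3 w" and G: "X \<in> D.G" "Y \<in> D.G" "Z \<in> D.G" "W \<in> D.G"
  shows "d3 w X Y Z W p = - d3 w X Z Y W p"
  using alt3_lb_skew[OF w G(2,3,1,4), of p] act_alt3_skew12[OF w G(2,3,4,1), of p]
    act_alt3_skew23[OF w G(1,2,3,4), of p] alt3_skew23[OF w lb_G[OF G(1,4)] G(2,3)]
  by (simp add: d3_def)

lemma d3_swap34:
  assumes w: "alt3 w" and G: "X \<in> D.G" "Y \<in> D.G" "Z \<in> D.G" "W \<in> D.G"
  shows "d3 w X Y Z W p = - d3 w X Y W Z p"
  using alt3_lb_skew[OF w G(3,4,1,2), of p] act_alt3_skew23[OF w G(2,3,4,1), of p]
    act_alt3_skew23[OF w G(1,3,4,2), of p] alt3_skew23[OF w lb_G[OF G(1,2)] G(3,4)]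
  by (simp add: d3_def)

lemma d3_tensorial1:
  assumes w: "alt3 w" and G: "X \<in> D.G" "X' \<in> D.G" "Y \<in> D.G" "Z \<in> D.G" "W \<in> D.G" and eq: "X p = X' p"
  shows "d3 w X Y Z W p = d3 w X' Y Z W p"
proof (rule D.tensorial[where T="\<lambda>X. d3 w X Y Z W p", OF _ _ G(1,2) eq])
  fix X X' assume X: "X \<in> D.G" "X' \<in> D.G"
  show "d3 w (\<lambda>q. X q + X' q) Y Z W p = d3 w X Y Z W p + d3 w X' Y Z W p"
    using X G w by (simp add: d3_def alt3_add alt3_add2 lb_add_left lb_G act_add alt3_smooth)
next
  fix f X assume f: "\<And>q. sm q f" and X: "X \<in> D.G"
  have "w (lb (\<lambda>q. f q *\<^sub>R X q) Y) Z W = (\<lambda>p. f p * w (lb X Y) Z W p + (- Y p f) * w X Z W p)"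
    if "Y \<in> D.G" "Z \<in> D.G" "W \<in> D.G" for Y Z W
  proof -
    have "smf (\<lambda>p. - Y p f)" using act_smooth[OF that(1)] f by (intro allI sm_minus) auto
    then have s: "w (\<lambda>q. (- Y q f) *\<^sub>R X q) Z W = (\<lambda>p. (- Y p f) * w X Z W p)"
      and sG: "(\<lambda>q. (- Y q f) *\<^sub>R X q) \<in> D.G"
      using alt3_scale[OF w X that(2,3)] D.G_scale[OF _ X] by blast+
    have s': "w (\<lambda>q. f q *\<^sub>R lb X Y q) Z W = (\<lambda>p. f p * w (lb X Y) Z W p)"
      and sG': "(\<lambda>q. f q *\<^sub>R lb X Y q) \<in> D.G"
      using alt3_scale[OF w lb_G[OF X that(1)] that(2,3)] D.G_scale[OF _ lb_G[OF X that(1)]] f by blast+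
    show ?thesis unfolding lb_scale_left[OF that(1) X allI[OF f]] alt3_add[OF w sG' sG that(2,3)] s s' ..
  qed
  then show "d3 w (\<lambda>q. f q *\<^sub>R X q) Y Z W p = f p * d3 w X Y Z W p"
    using X f G alt3_scale[OF w X _ _ allI[OF f]] alt3_scale2[OF w X _ _ allI[OF f]]
      act_mult[OF G(3) f alt3_smooth[OF w X G(4,5)]] act_mult[OF G(4) f alt3_smooth[OF w X G(3,5)]]
      act_mult[OF G(5) f alt3_smooth[OF w X G(3,4)]]
    by (simp add: d3_def lb_G) (simp add: algebra_simps)
qed

lemma d3_tensorial:
  assumes w: "alt3 w" and G: "X \<in> D.G" "Y \<in> D.G" "Z \<in> D.G" "W \<in> D.G"
      "X' \<in> D.G" "Y' \<in> D.G" "Z' \<in> D.G" "W' \<in> D.G"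
    and eq: "X p = X' p" "Y p = Y' p" "Z p = Z' p" "W p = W' p"
  shows "d3 w X Y Z W p = d3 w X' Y' Z' W' p"
proof -
  note s = d3_swap12[OF w] d3_swap23[OF w] d3_swap34[OF w] and t = d3_tensorial1[OF w]
  have 2: "d3 w X Y Z W p = d3 w X Y' Z W p" if "X \<in> D.G" "Y \<in> D.G" "Y' \<in> D.G" "Z \<in> D.G" "W \<in> D.G"
    "Y p = Y' p" for X Y Y' Z W
    using s(1)[of X Y Z W p] s(1)[of X Y' Z W p] t[of Y Y' X Z W] that by simp
  have 3: "d3 w X Y Z W p = d3 w X Y Z' W p" if "X \<in> D.G" "Y \<in> D.G" "Z \<in> D.G" "Z' \<in> D.G" "W \<in> D.G"
    "Z p = Z' p" for X Y Z Z' W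
    using s(2)[of X Y Z W p] s(2)[of X Y Z' W p] 2[of X Z Z' Y W] that by simp
  have 4: "d3 w X Y Z W p = d3 w X Y Z W' p" if "X \<in> D.G" "Y \<in> D.G" "Z \<in> D.G" "W \<in> D.G" "W' \<in> D.G"
    "W p = W' p" for X Y Z W W'
    using s(3)[of X Y Z W p] s(3)[of X Y Z W' p] 3[of X Y W W' Z] that by simp
  have "d3 w X Y Z W p = d3 w X' Y Z W p" using t G eq by blast
  also have "\<dots> = d3 w X' Y' Z W p" using 2 G eq by blast
  also have "\<dots> = d3 w X' Y' Z' W p" using 3 G eq by blast
  also have "\<dots> = d3 w X' Y' Z' W' p" using 4 G eq by blast
  finally show ?thesis .
qed

definition ev2 :: "('m \<Rightarrow> 'm tvec list \<Rightarrow> real) \<Rightarrow> ('m \<Rightarrow> 'm tvec) \<Rightarrow> ('m \<Rightarrow> 'm tvec) \<Rightarrow> 'm \<Rightarrow> real" where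
  "ev2 \<omega> X Y = (\<lambda>q. \<omega> q [X q, Y q])"

definition ev3 :: "('m \<Rightarrow> 'm tvec list \<Rightarrow> real) \<Rightarrow> ('m \<Rightarrow> 'm tvec) \<Rightarrow> ('m \<Rightarrow> 'm tvec) \<Rightarrow>
    ('m \<Rightarrow> 'm tvec) \<Rightarrow> 'm \<Rightarrow> real" where
  "ev3 \<omega> X Y Z = (\<lambda>q. \<omega> q [X q, Y q, Z q])"

lemma alt2_ev2:
  assumes w: "\<omega> \<in> forms A D 2"
  shows "alt2 (ev2 \<omega>)"
  unfolding alt2_def
proof (intro ballI conjI allI impI ext)
  fix X Y p assume G: "X \<in> D.G" "Y \<in> D.G"
  note m = D.G_mem[OF G(1)] D.G_mem[OF G(2)]
  show "sm p (ev2 \<omega> X Y)" using form_smooth[OF w, of "[X, Y]" p] G D.G_S by (auto simp: ev2_def)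
  show "ev2 \<omega> X Y p = - ev2 \<omega> Y X p" using form2_skew[OF w m] by (simp add: ev2_def)
  show "ev2 \<omega> (\<lambda>q. X q + X' q) Y p = ev2 \<omega> X Y p + ev2 \<omega> X' Y p" if "X' \<in> D.G" for X'
    using linear_on_add[OF form2_linear(1)[OF w m] m(1) D.G_mem[OF that]] by (simp add: ev2_def)
  show "ev2 \<omega> (\<lambda>q. f q *\<^sub>R X q) Y p = f p * ev2 \<omega> X Y p" for f
    using linear_on_scale[OF form2_linear(1)[OF w m] m(1)] by (simp add: ev2_def)
qed

lemma alt3_ev3:
  assumes w: "\<omega> \<in> forms A D 3"
  shows "alt3 (ev3 \<omega>)"
  unfolding alt3_def
proof (intro ballI conjI allI impI ext)
  fix X Y Z p assume G: "X \<in> D.G" "Y \<in> D.G" "Z \<in> D.G"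
  note m = D.G_mem[OF G(1)] D.G_mem[OF G(2)] D.G_mem[OF G(3)]
  show "sm p (ev3 \<omega> X Y Z)" using form_smooth[OF w, of "[X, Y, Z]" p] G D.G_S by (auto simp: ev3_def)
  show "ev3 \<omega> X Y Z p = - ev3 \<omega> Y X Z p" "ev3 \<omega> X Y Z p = - ev3 \<omega> X Z Y p"
    using form3_skew[OF w m] by (simp_all add: ev3_def)
  show "ev3 \<omega> (\<lambda>q. X q + X' q) Y Z p = ev3 \<omega> X Y Z p + ev3 \<omega> X' Y Z p" if "X' \<in> D.G" for X'
    using linear_on_add[OF form3_linear(1)[OF w m] m(1) D.G_mem[OF that]] by (simp add: ev3_def)
  show "ev3 \<omega> (\<lambda>q. f q *\<^sub>R X q) Y Z p = f p * ev3 \<omega> X Y Z p" for f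
    using linear_on_scale[OF form3_linear(1)[OF w m] m(1)] by (simp add: ev3_def)
qed

lemma cartan2: "cartan A \<omega> [X, Y, Z] p = d2 (ev2 \<omega>) X Y Z p"
  by (simp add: cartan_def d2_def ev2_def omit_def eval_nat_numeral lessThan_Suc)

lemma cartan3: "cartan A \<omega> [X, Y, Z, W] p = d3 (ev3 \<omega>) X Y Z W p"
  by (simp add: cartan_def d3_def ev3_def omit_def eval_nat_numeral lessThan_Suc)

lemma ext_d2:
  assumes w: "\<omega> \<in> forms A D 2" and G: "X \<in> D.G" "Y \<in> D.G" "Z \<in> D.G"
  shows "ext_d A D 2 \<omega> p [X p, Y p, Z p] = d2 (ev2 \<omega>) X Y Z p"
proof -
  have "(THE y. \<exists>Xs. length Xs = Suc 2 \<and> set Xs \<subseteq> D_sections A D UNIV \<and>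
      map (\<lambda>X. X p) Xs = [X p, Y p, Z p] \<and> y = cartan A \<omega> Xs p) = d2 (ev2 \<omega>) X Y Z p"
  proof (rule the_equality)
    show "\<exists>Xs. length Xs = Suc 2 \<and> set Xs \<subseteq> D_sections A D UNIV \<and>
      map (\<lambda>X. X p) Xs = [X p, Y p, Z p] \<and> d2 (ev2 \<omega>) X Y Z p = cartan A \<omega> Xs p"
      using G by (intro exI[of _ "[X, Y, Z]"]) (simp add: cartan2 G_D_sections)
    fix y assume "\<exists>Xs. length Xs = Suc 2 \<and> set Xs \<subseteq> D_sections A D UNIV \<and>
      map (\<lambda>X. X p) Xs = [X p, Y p, Z p] \<and> y = cartan A \<omega> Xs p"
    then show "y = d2 (ev2 \<omega>) X Y Z p"
    proof (elim exE conjE)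
    fix Xs assume Xs: "length Xs = Suc 2" "set Xs \<subseteq> D_sections A D UNIV"
      "map (\<lambda>X. X p) Xs = [X p, Y p, Z p]" "y = cartan A \<omega> Xs p"
    obtain X' Y' Z' where l: "Xs = [X', Y', Z']"
      using Xs(1) by (auto simp: eval_nat_numeral length_Suc_conv)
    show "y = d2 (ev2 \<omega>) X Y Z p"
      using d2_tensorial[OF alt2_ev2[OF w] _ _ _ G, of X' Y' Z' p] Xs G_D_sections unfolding l by (simp add: cartan2)
    qed
  qed
  then show ?thesis using G D.G_mem by (simp add: ext_d_def)
qed

lemma ext_d3:
  assumes w: "\<omega> \<in> forms A D 3" and G: "X \<in> D.G" "Y \<in> D.G" "Z \<in> D.G" "W \<in> D.G"
  shows "ext_d A D 3 \<omega> p [X p, Y p, Z p, W p] = d3 (ev3 \<omega>) X Y Z W p"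
proof -
  have "(THE y. \<exists>Xs. length Xs = Suc 3 \<and> set Xs \<subseteq> D_sections A D UNIV \<and>
      map (\<lambda>X. X p) Xs = [X p, Y p, Z p, W p] \<and> y = cartan A \<omega> Xs p) = d3 (ev3 \<omega>) X Y Z W p"
  proof (rule the_equality)
    show "\<exists>Xs. length Xs = Suc 3 \<and> set Xs \<subseteq> D_sections A D UNIV \<and>
      map (\<lambda>X. X p) Xs = [X p, Y p, Z p, W p] \<and> d3 (ev3 \<omega>) X Y Z W p = cartan A \<omega> Xs p"
      using G by (intro exI[of _ "[X, Y, Z, W]"]) (simp add: cartan3 G_D_sections)
    fix y assume "\<exists>Xs. length Xs = Suc 3 \<and> set Xs \<subseteq> D_sections A D UNIV \<and>
      map (\<lambda>X. X p) Xs = [X p, Y p, Z p, W p] \<and> y = cartan A \<omega> Xs p"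
    then show "y = d3 (ev3 \<omega>) X Y Z W p"
    proof (elim exE conjE)
    fix Xs assume Xs: "length Xs = Suc 3" "set Xs \<subseteq> D_sections A D UNIV"
      "map (\<lambda>X. X p) Xs = [X p, Y p, Z p, W p]" "y = cartan A \<omega> Xs p"
    obtain X' Y' Z' W' where l: "Xs = [X', Y', Z', W']"
      using Xs(1) by (auto simp: eval_nat_numeral length_Suc_conv)
    show "y = d3 (ev3 \<omega>) X Y Z W p"
      using d3_tensorial[OF alt3_ev3[OF w] _ _ _ _ G, of X' Y' Z' W' p] Xs G_D_sections unfolding l
      by (simp add: cartan3)
    qed
  qed
  then show ?thesis using G D.G_mem by (simp add: ext_d_def)
qed

lemma ext_d_off: "\<not> (length xs = Suc k \<and> set xs \<subseteq> D p) \<Longrightarrow> ext_d A D k \<omega> p xs = 0"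
  unfolding ext_d_def by (rule if_not_P)

lemma form_eqI3:
  assumes "\<And>p xs. \<not> (length xs = 3 \<and> set xs \<subseteq> D p) \<Longrightarrow> \<omega> p xs = \<eta> p xs"
    "\<And>p X Y Z. X \<in> D.G \<Longrightarrow> Y \<in> D.G \<Longrightarrow> Z \<in> D.G \<Longrightarrow> \<omega> p [X p, Y p, Z p] = \<eta> p [X p, Y p, Z p]"
  shows "\<omega> = (\<eta> :: 'm \<Rightarrow> 'm tvec list \<Rightarrow> real)"
proof (intro ext)
  fix p xs show "\<omega> p xs = \<eta> p xs"
  proof (cases "length xs = 3 \<and> set xs \<subseteq> D p")
    case True
    then obtain x y z where "xs = [x, y, z]" "x \<in> D p" "y \<in> D p" "z \<in> D p"
      by (auto simp: eval_nat_numeral length_Suc_conv)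
    then show ?thesis
      using assms(2)[of "D.gext p x" "D.gext p y" "D.gext p z" p] by (simp add: D.gext)
  qed (rule assms(1))
qed

lemma closed3_iff: "\<omega> \<in> closed_forms A D 3 \<longleftrightarrow> \<omega> \<in> forms A D 3 \<and>
  (\<forall>X\<in>D.G. \<forall>Y\<in>D.G. \<forall>Z\<in>D.G. \<forall>W\<in>D.G. \<forall>p. d3 (ev3 \<omega>) X Y Z W p = 0)"
proof -
  have "ext_d A D 3 \<omega> = 0 \<longleftrightarrow> (\<forall>X\<in>D.G. \<forall>Y\<in>D.G. \<forall>Z\<in>D.G. \<forall>W\<in>D.G. \<forall>p. d3 (ev3 \<omega>) X Y Z W p = 0)"
    if w: "\<omega> \<in> forms A D 3"
  proof
    assume "ext_d A D 3 \<omega> = 0"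
    then show "\<forall>X\<in>D.G. \<forall>Y\<in>D.G. \<forall>Z\<in>D.G. \<forall>W\<in>D.G. \<forall>p. d3 (ev3 \<omega>) X Y Z W p = 0"
      using ext_d3[OF w, symmetric] by simp
  next
    assume *: "\<forall>X\<in>D.G. \<forall>Y\<in>D.G. \<forall>Z\<in>D.G. \<forall>W\<in>D.G. \<forall>p. d3 (ev3 \<omega>) X Y Z W p = 0"
    have "ext_d A D 3 \<omega> p xs = 0" for p xs
    proof (cases "length xs = Suc 3 \<and> set xs \<subseteq> D p")
      case True
      then obtain x y z v where "xs = [x, y, z, v]" "x \<in> D p" "y \<in> D p" "z \<in> D p" "v \<in> D p"
        by (auto simp: eval_nat_numeral length_Suc_conv)
      then show ?thesis
        using ext_d3[OF w, of "D.gext p x" "D.gext p y" "D.gext p z" "D.gext p v" p] *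
        by (simp add: D.gext)
    qed (rule ext_d_off)
    then show "ext_d A D 3 \<omega> = 0" by (simp add: fun_eq_iff)
  qed
  then show ?thesis by (auto simp: closed_forms_def)
qed


subsection \<open>Cohomology classes in degree 3\<close>

lemma forms_lin:
  assumes "\<omega> \<in> forms A D k" "\<eta> \<in> forms A D k"
  shows "(\<lambda>p xs. a * \<omega> p xs + b * \<eta> p xs) \<in> forms A D k"
  using assms unfolding forms_iff by (auto simp: linear_on_def algebra_simps intro!: sm_add sm_mult)

lemma ext_d2_lin:
  assumes w: "\<omega> \<in> forms A D 2" "\<eta> \<in> forms A D 2"
  shows "ext_d A D 2 (\<lambda>p xs. a * \<omega> p xs + b * \<eta> p xs) =
    (\<lambda>p xs. a * ext_d A D 2 \<omega> p xs + b * ext_d A D 2 \<eta> p xs)"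
proof (rule form_eqI3)
  fix p xs assume "\<not> (length xs = 3 \<and> set xs \<subseteq> D p)"
  then show "ext_d A D 2 (\<lambda>p xs. a * \<omega> p xs + b * \<eta> p xs) p xs =
      a * ext_d A D 2 \<omega> p xs + b * ext_d A D 2 \<eta> p xs"
    using ext_d_off[of xs 2 p] by simp
next
  fix p X Y Z assume G: "X \<in> D.G" "Y \<in> D.G" "Z \<in> D.G"
  have *: "X p (ev2 (\<lambda>p xs. a * \<omega> p xs + b * \<eta> p xs) Y Z) = a * X p (ev2 \<omega> Y Z) + b * X p (ev2 \<eta> Y Z)"
    if "X \<in> D.G" "Y \<in> D.G" "Z \<in> D.G" for X Y Z
    using act_add[OF that(1), of p "\<lambda>q. a * ev2 \<omega> Y Z q" "\<lambda>q. b * ev2 \<eta> Y Z q"] that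
      alt2_smooth[OF alt2_ev2] w by (simp add: sm_mult act_cmult) (simp add: ev2_def)
  show "ext_d A D 2 (\<lambda>p xs. a * \<omega> p xs + b * \<eta> p xs) p [X p, Y p, Z p] =
      a * ext_d A D 2 \<omega> p [X p, Y p, Z p] + b * ext_d A D 2 \<eta> p [X p, Y p, Z p]"
    unfolding ext_d2[OF forms_lin[OF w] G] ext_d2[OF w(1) G] ext_d2[OF w(2) G] d2_def
      *[OF G(1,2,3)] *[OF G(2,1,3)] *[OF G(3,1,2)]
    by (simp add: ev2_def algebra_simps)
qed

lemma exact3: "\<omega> \<in> exact_forms A D 3 \<longleftrightarrow> (\<exists>B\<in>forms A D 2. \<omega> = ext_d A D 2 B)"
  unfolding exact_forms_def numeral_3_eq_3 numeral_2_eq_2 by auto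

lemma zero_form: "(\<lambda>p xs. 0) \<in> forms A D k"
  by (simp add: forms_iff linear_on_def)

lemma equiv_cohomologous: "equiv (closed_forms A D 3) (cohomologous A D 3)"
proof (rule equivI)
  show "cohomologous A D 3 \<subseteq> closed_forms A D 3 \<times> closed_forms A D 3"
    by (auto simp: cohomologous_def)
  have "0 = ext_d A D 2 (\<lambda>p xs. 0)"
    using ext_d2_lin[OF zero_form zero_form, of 0 0] by (simp add: zero_fun_def)
  then have "0 \<in> exact_forms A D 3" using zero_form by (auto simp: exact3)
  then show "refl_on (closed_forms A D 3) (cohomologous A D 3)"
    by (auto simp: refl_on_def cohomologous_def)
  show "sym (cohomologous A D 3)"
  proof (rule symI)
    fix \<omega> \<eta> assume "(\<omega>, \<eta>) \<in> cohomologous A D 3"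
    then obtain B where B: "B \<in> forms A D 2" "\<eta> - \<omega> = ext_d A D 2 B"
      and c: "\<omega> \<in> closed_forms A D 3" "\<eta> \<in> closed_forms A D 3"
      by (auto simp: cohomologous_def exact3)
    have "\<omega> - \<eta> = - ext_d A D 2 B" using B(2)[symmetric] by simp
    also have "\<dots> = ext_d A D 2 (\<lambda>p xs. (-1) * B p xs + 0 * B p xs)"
      unfolding ext_d2_lin[OF B(1) B(1)] by (simp add: fun_eq_iff)
    finally show "(\<eta>, \<omega>) \<in> cohomologous A D 3"
      using c forms_lin[OF B(1) B(1), of "-1" 0] by (auto simp: cohomologous_def exact3)
  qed
  show "trans (cohomologous A D 3)"
  proof (rule transI)
    fix \<omega> \<eta> \<zeta> assume "(\<omega>, \<eta>) \<in> cohomologous A D 3" "(\<eta>, \<zeta>) \<in> cohomologous A D 3"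
    then obtain B B' where B: "B \<in> forms A D 2" "\<eta> - \<omega> = ext_d A D 2 B"
      "B' \<in> forms A D 2" "\<zeta> - \<eta> = ext_d A D 2 B'"
      and c: "\<omega> \<in> closed_forms A D 3" "\<zeta> \<in> closed_forms A D 3"
      by (auto simp: cohomologous_def exact3)
    have "\<zeta> - \<omega> = ext_d A D 2 B + ext_d A D 2 B'" using B(2,4)[symmetric] by simp
    also have "\<dots> = ext_d A D 2 (\<lambda>p xs. 1 * B p xs + 1 * B' p xs)"
      unfolding ext_d2_lin[OF B(1,3)] by (simp add: fun_eq_iff)
    finally show "(\<omega>, \<zeta>) \<in> cohomologous A D 3"
      using c forms_lin[OF B(1,3), of 1 1] by (auto simp: cohomologous_def exact3)
  qed
qed

lemma coh_class_eq_iff: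
  "\<omega> \<in> closed_forms A D 3 \<Longrightarrow> \<eta> \<in> closed_forms A D 3 \<Longrightarrow>
    coh_class A D 3 \<omega> = coh_class A D 3 \<eta> \<longleftrightarrow> \<eta> - \<omega> \<in> exact_forms A D 3"
  unfolding coh_class_def using eq_equiv_class_iff[OF equiv_cohomologous, of \<omega> \<eta>]
  by (auto simp: cohomologous_def)

end

context smooth_mfd
begin

lemma sm_extend:
  assumes "sm p f"
  obtains f' where "\<And>q. sm q f'" "\<forall>\<^sub>F q in nhds p. f' q = f q"
proof -
  obtain N where N: "open N" "p \<in> N" "\<And>q. q \<in> N \<Longrightarrow> sm q f"
    using sm_eventually[OF assms] by (auto simp: eventually_nhds)
  obtain g where g: "\<And>q. sm q g" "\<forall>\<^sub>F q in nhds p. g q = 1"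
    "\<And>q. q \<notin> N \<Longrightarrow> \<forall>\<^sub>F z in nhds q. g z = 0" using bump_exists N by metis
  show thesis
  proof (rule that)
    show "sm q (\<lambda>q. g q * f q)" for q
    proof (cases "q \<in> N")
      case False
      have "\<forall>\<^sub>F z in nhds q. 0 = g z * f z" using g(3)[OF False] by eventually_elim simp
      then show ?thesis by (rule sm_cong) simp
    qed (use N g in \<open>auto intro: sm_mult\<close>)
    show "\<forall>\<^sub>F q in nhds p. g q * f q = f q" using g(2) by eventually_elim simp
  qed
qed

end

context germ_bundle
begin

lemma frame_coefficients:
  assumes e: "\<And>i. i < r \<Longrightarrow> S p (e i)"
    and indep: "\<And>x. (\<Sum>i<r. x i *\<^sub>R e i p) = 0 \<Longrightarrow> \<forall>i<r. x i = 0"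
    and s: "S p s" "\<forall>\<^sub>F q in nhds p. s q = (\<Sum>i<r. c i q *\<^sub>R e i q)" and k: "k < r"
  shows "sm p (c k)"
proof -
  obtain e' where e': "\<forall>\<^sub>F q in nhds p. (\<forall>i<r. S q (e' i)) \<and>
        (\<forall>v\<in>F q. \<exists>x. v = (\<Sum>i<r. x i *\<^sub>R e' i q)) \<and>
        (\<forall>x. (\<Sum>i<r. x i *\<^sub>R e' i q) = 0 \<longrightarrow> (\<forall>i<r. x i = 0))"
      "\<And>s. S p s \<Longrightarrow> \<exists>c. (\<forall>i<r. sm p (c i)) \<and> (\<forall>\<^sub>F q in nhds p. s q = (\<Sum>i<r. c i q *\<^sub>R e' i q))"
    using frame_ex[of p] by blast
  have "\<forall>i. \<exists>a. i < r \<longrightarrow> (\<forall>j<r. sm p (a j)) \<and> (\<forall>\<^sub>F q in nhds p. e i q = (\<Sum>j<r. a j q *\<^sub>R e' j q))"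
    using e'(2)[OF e] by blast
  then obtain a where a: "\<And>i j. i < r \<Longrightarrow> j < r \<Longrightarrow> sm p (a i j)"
    "\<And>i. i < r \<Longrightarrow> \<forall>\<^sub>F q in nhds p. e i q = (\<Sum>j<r. a i j q *\<^sub>R e' j q)"
    by (subst (asm) choice_iff) blast
  obtain b where b: "\<And>j. j < r \<Longrightarrow> sm p (b j)" "\<forall>\<^sub>F q in nhds p. s q = (\<Sum>j<r. b j q *\<^sub>R e' j q)"
    using e'(2)[OF s(1)] by blast
  have "\<forall>\<^sub>F q in nhds p. \<forall>i\<in>{..<r}. e i q = (\<Sum>j<r. a i j q *\<^sub>R e' j q)"
    using a(2) by (simp add: eventually_ball_finite_distrib)
  with e'(1) s(2) b(2) have cb: "\<forall>\<^sub>F q in nhds p. \<forall>j<r. (\<Sum>i<r. c i q * a i j q) = b j q"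
  proof eventually_elim
    case (elim q)
    have "(\<Sum>i<r. c i q *\<^sub>R e i q) = (\<Sum>i<r. \<Sum>j<r. (c i q * a i j q) *\<^sub>R e' j q)"
      using elim(4) by (simp add: scaleR_sum_right)
    also have "\<dots> = (\<Sum>j<r. (\<Sum>i<r. c i q * a i j q) *\<^sub>R e' j q)"
      by (subst sum.swap) (simp add: scaleR_sum_left)
    finally have "(\<Sum>j<r. ((\<Sum>i<r. c i q * a i j q) - b j q) *\<^sub>R e' j q) = 0"
      using elim(2,3) by (simp add: scaleR_diff_left sum_subtractf)
    then show ?case
      using conjunct2[OF conjunct2[OF elim(1)], rule_format,
          of "\<lambda>j. (\<Sum>i<r. c i q * a i j q) - b j q"] by simp
  qed
  show ?thesis
  proof (rule smooth_coefficients[where n=r and c=c, OF _ k])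
    fix x assume x: "\<And>u. \<forall>l<r. sm p (u l) \<Longrightarrow> sm p (\<lambda>q. \<Sum>l<r. u l q * c l q) \<Longrightarrow>
      (\<Sum>l<r. u l p * x l) = 0"
    have z: "(\<Sum>i<r. a i j p * x i) = 0" if j: "j < r" for j
    proof (rule x)
      show "\<forall>l<r. sm p (a l j)" using a(1) j by blast
      have "\<forall>\<^sub>F q in nhds p. b j q = (\<Sum>l<r. a l j q * c l q)"
        using cb by eventually_elim (use j in \<open>simp add: mult.commute\<close>)
      then show "sm p (\<lambda>q. \<Sum>l<r. a l j q * c l q)" by (rule sm_cong) (rule b(1)[OF j])
    qed
    have "(\<Sum>i<r. x i *\<^sub>R e i p) = (\<Sum>i<r. \<Sum>j<r. (a i j p * x i) *\<^sub>R e' j p)"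
      using a(2) eventually_nhds_x_imp_x by (force simp: scaleR_sum_right mult.commute intro!: sum.cong)
    also have "\<dots> = (\<Sum>j<r. (\<Sum>i<r. a i j p * x i) *\<^sub>R e' j p)"
      by (subst sum.swap) (simp add: scaleR_sum_left)
    also have "\<dots> = 0" using z by simp
    finally show "\<forall>l<r. x l = 0" by (rule indep)
  qed
qed

lemma local_frame:
  obtains U e c where "open U" "p \<in> U" "\<And>q i. q \<in> U \<Longrightarrow> i < r \<Longrightarrow> S q (e i)"
    "\<And>q v. q \<in> U \<Longrightarrow> v \<in> F q \<Longrightarrow> v = (\<Sum>i<r. c q v i *\<^sub>R e i q)"
    "\<And>q x. q \<in> U \<Longrightarrow> (\<Sum>i<r. x i *\<^sub>R e i q) = 0 \<Longrightarrow> \<forall>i<r. x i = 0"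
    "\<And>q i. q \<in> U \<Longrightarrow> i < r \<Longrightarrow> linear_on (F q) (\<lambda>v. c q v i :: real)"
    "\<And>q s i. q \<in> U \<Longrightarrow> S q s \<Longrightarrow> i < r \<Longrightarrow> sm q (\<lambda>z. c z (s z) i)"
proof -
  obtain e where "\<forall>\<^sub>F q in nhds p. (\<forall>i<r. S q (e i)) \<and>
        (\<forall>v\<in>F q. \<exists>x. v = (\<Sum>i<r. x i *\<^sub>R e i q)) \<and>
        (\<forall>x. (\<Sum>i<r. x i *\<^sub>R e i q) = 0 \<longrightarrow> (\<forall>i<r. x i = 0))"
    using frame_ex[of p] by blast
  then obtain U where U: "open U" "p \<in> U" and e: "\<And>q i. q \<in> U \<Longrightarrow> i < r \<Longrightarrow> S q (e i)"
    and span: "\<And>q v. q \<in> U \<Longrightarrow> v \<in> F q \<Longrightarrow> \<exists>x. v = (\<Sum>i<r. x i *\<^sub>R e i q)"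
    and indep: "\<And>q x. q \<in> U \<Longrightarrow> (\<Sum>i<r. x i *\<^sub>R e i q) = 0 \<Longrightarrow> \<forall>i<r. x i = 0"
    by (auto simp: eventually_nhds)
  define c where "c q v = (SOME x. v = (\<Sum>i<r. x i *\<^sub>R e i q))" for q v
  have c: "v = (\<Sum>i<r. c q v i *\<^sub>R e i q)" if "q \<in> U" "v \<in> F q" for q v
    unfolding c_def by (rule someI_ex[OF span[OF that]])
  have uniq: "c q v i = x i" if "q \<in> U" "v \<in> F q" "v = (\<Sum>i<r. x i *\<^sub>R e i q)" "i < r" for q v x i
  proof -
    have "(\<Sum>i<r. (c q v i - x i) *\<^sub>R e i q) = 0"
      using c[OF that(1,2)] that(3) by (simp add: scaleR_diff_left sum_subtractf)
    then show ?thesis using indep[OF that(1)] that(4) by fastforce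
  qed
  show thesis
  proof (rule that[OF U e c indep])
    fix q i assume q: "q \<in> U" and i: "i < r"
    show "linear_on (F q) (\<lambda>v. c q v i)"
    proof (rule linear_onI)
      fix v w assume vw: "v \<in> F q" "w \<in> F q"
      have "v + w = (\<Sum>i<r. (c q v i + c q w i) *\<^sub>R e i q)"
        unfolding scaleR_add_left sum.distrib by (simp only: c[OF q vw(1), symmetric] c[OF q vw(2), symmetric])
      then show "c q (v + w) i = c q v i + c q w i"
        by (rule uniq[OF q subspace_add[OF fibre_subspace vw] _ i])
    next
      fix a v assume v: "v \<in> F q"
      have *: "a *\<^sub>R v = (\<Sum>i<r. (a * c q v i) *\<^sub>R e i q)"
        using arg_cong[OF c[OF q v], of "\<lambda>w. a *\<^sub>R w"] by (simp only: scaleR_sum_right scaleR_scaleR)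
      show "c q (a *\<^sub>R v) i = a *\<^sub>R c q v i"
        unfolding real_scaleR_def by (rule uniq[OF q subspace_scale[OF fibre_subspace v] * i])
    qed
    fix s assume s: "S q s"
    show "sm q (\<lambda>z. c z (s z) i)"
    proof (rule frame_coefficients[where c="\<lambda>i z. c z (s z) i" and e=e, OF _ _ s _ i])
      have "\<forall>\<^sub>F z in nhds q. z \<in> U" using U q eventually_nhds_in_open by blast
      with S_eventually[OF s] show "\<forall>\<^sub>F z in nhds q. s z = (\<Sum>i<r. c z (s z) i *\<^sub>R e i z)"
        by eventually_elim (use c S_mem in blast)
    qed (use e indep q in auto)
  qed
qed

end


section \<open>Generalized exact Courant algebroids\<close>

locale gexact = involutive A D
  for A :: "('m::{t2_space, second_countable_topology}, 'v::real_inner) atlas"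
    and D :: "'m \<Rightarrow> 'm tvec set" +
  fixes E :: "('m, 'e::real_vector) courant"
  assumes ge: "E \<in> generalized_exact A D"
begin

lemma ca: "courant_algebroid A E"
  using ge by (simp add: generalized_exact_def)

sublocale vec_bundle A E
  by unfold_locales (use ca in \<open>simp add: courant_algebroid_def\<close>)

abbreviation br where "br \<equiv> bracket E"
abbreviation rh where "rh \<equiv> anchor E"
abbreviation me where "me \<equiv> metric E"
abbreviation rs where "rs \<equiv> rho_star E"

definition ms :: "('m \<Rightarrow> 'e) \<Rightarrow> ('m \<Rightarrow> 'e) \<Rightarrow> 'm \<Rightarrow> real" where
  "ms s t = (\<lambda>q. me q (s q) (t q))"

definition an :: "('m \<Rightarrow> 'e) \<Rightarrow> 'm \<Rightarrow> 'm tvec" where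
  "an s = (\<lambda>q. rh q (s q))"

lemma sections_G: "sections A E UNIV = E.G"
  by (auto simp: E.G_def sections_iff)

lemma me_linear: "v \<in> fibre E p \<Longrightarrow> linear_on (fibre E p) (me p v)"
  and me_sym: "v \<in> fibre E p \<Longrightarrow> w \<in> fibre E p \<Longrightarrow> me p v w = me p w v"
  and me_nondeg: "v \<in> fibre E p \<Longrightarrow> (\<And>w. w \<in> fibre E p \<Longrightarrow> me p v w = 0) \<Longrightarrow> v = 0"
  using ca unfolding courant_algebroid_def pseudo_metric_def by blast+

lemma me_linear_left: "v \<in> fibre E p \<Longrightarrow> linear_on (fibre E p) (\<lambda>w. me p w v)"
  using me_linear[of v p] me_sym[of _ p v] subspace_add[OF E_subspace, of _ p]
    subspace_scale[OF E_subspace, of _ p] by (simp add: linear_on_def)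

lemma SE_nbhd:
  assumes "SE p s"
  obtains U where "open U" "p \<in> U" "s \<in> sections A E U"
proof -
  obtain U where "open U" "p \<in> U" "\<forall>q\<in>U. SE q s"
    using SE_eventually[OF assms] by (auto simp: eventually_nhds)
  then show thesis using that sections_iff by blast
qed

lemma sections_subset: "open U \<Longrightarrow> open W \<Longrightarrow> W \<subseteq> U \<Longrightarrow> s \<in> sections A E U \<Longrightarrow> s \<in> sections A E W"
  by (auto simp: sections_iff)

lemma ms_smooth:
  assumes "SE p s" "SE p t"
  shows "sm p (ms s t)"
proof -
  obtain U where U: "open U" "p \<in> U" "s \<in> sections A E U" using SE_nbhd[OF assms(1)] .
  obtain W where W: "open W" "p \<in> W" "t \<in> sections A E W" using SE_nbhd[OF assms(2)] .
  have o: "open (U \<inter> W)" using U W by blast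
  have "smooth_map A (U \<inter> W) (\<lambda>p. me p (s p) (t p))"
    using ca sections_subset[OF U(1) o _ U(3)] sections_subset[OF W(1) o _ W(3)] o
    unfolding courant_algebroid_def pseudo_metric_def by blast
  then show ?thesis using smooth_map_iff[OF o] U W by (auto simp: ms_def)
qed

lemma rh_linear: "linear_on (fibre E p) (rh p)"
  using ca unfolding courant_algebroid_def bundle_map_def by blast

lemma rh_image: "rh p ` fibre E p = D p"
  using ge by (simp add: generalized_exact_def)

lemma rh_mem: "v \<in> fibre E p \<Longrightarrow> rh p v \<in> D p"
  using rh_image by blast

lemma an_SD:
  assumes "SE p s"
  shows "SD p (an s)"
proof -
  obtain U where U: "open U" "p \<in> U" "s \<in> sections A E U" using SE_nbhd[OF assms] .
  have "an s \<in> vector_fields A U"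
    using ca U unfolding courant_algebroid_def bundle_map_def an_def by blast
  moreover have "an s q \<in> D q" if "q \<in> U" for q
    using rh_mem U sections_iff SE_mem that by (auto simp: an_def)
  ultimately have "an s \<in> D_sections A D U" by (simp add: D_sections_def)
  then show ?thesis using D_sections_iff U by blast
qed

lemma an_G: "s \<in> E.G \<Longrightarrow> an s \<in> D.G"
  by (simp add: D.G_def E.G_S an_SD)

lemma br_G: "s \<in> E.G \<Longrightarrow> t \<in> E.G \<Longrightarrow> br s t \<in> E.G"
  using ca unfolding courant_algebroid_def Let_def sections_G by blast

lemma br_linear: "s \<in> E.G \<Longrightarrow> linear_on E.G (br s)" "s \<in> E.G \<Longrightarrow> linear_on E.G (\<lambda>t. br t s)"
  using ca unfolding courant_algebroid_def Let_def sections_G by blast+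

lemma br_jacobi: "s \<in> E.G \<Longrightarrow> t \<in> E.G \<Longrightarrow> u \<in> E.G \<Longrightarrow> br s (br t u) = br (br s t) u + br t (br s u)"
  using ca unfolding courant_algebroid_def Let_def sections_G by blast

lemma br_leibniz: "s \<in> E.G \<Longrightarrow> t \<in> E.G \<Longrightarrow> smf f \<Longrightarrow>
    br s (\<lambda>p. f p *\<^sub>R t p) = (\<lambda>p. an s p f *\<^sub>R t p + f p *\<^sub>R br s t p)"
  using ca unfolding courant_algebroid_def Let_def sections_G an_def
  by (simp add: smooth_map_iff)

lemma br_diag: "s \<in> E.G \<Longrightarrow> br s s = (\<lambda>p. (1/2) *\<^sub>R rs p (differential (ms s s)))"
  using ca unfolding courant_algebroid_def Let_def sections_G ms_def by blast

lemma br_metric: "s \<in> E.G \<Longrightarrow> t \<in> E.G \<Longrightarrow> an s p (ms t t) = 2 * me p (br s t p) (t p)"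
  using ca unfolding courant_algebroid_def Let_def sections_G ms_def an_def by blast

lemma br_add: "s \<in> E.G \<Longrightarrow> t \<in> E.G \<Longrightarrow> u \<in> E.G \<Longrightarrow> br s (\<lambda>q. t q + u q) = (\<lambda>q. br s t q + br s u q)"
  using linear_on_add[OF br_linear(1), of s t u] by (simp add: plus_fun_def)

lemma br_add_left: "s \<in> E.G \<Longrightarrow> t \<in> E.G \<Longrightarrow> u \<in> E.G \<Longrightarrow> br (\<lambda>q. t q + u q) s = (\<lambda>q. br t s q + br u s q)"
  using linear_on_add[OF br_linear(2), of s t u] by (simp add: plus_fun_def)

lemma me_add: "u \<in> fibre E p \<Longrightarrow> v \<in> fibre E p \<Longrightarrow> w \<in> fibre E p \<Longrightarrow> me p u (v + w) = me p u v + me p u w"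
  and me_scale: "u \<in> fibre E p \<Longrightarrow> v \<in> fibre E p \<Longrightarrow> me p u (c *\<^sub>R v) = c * me p u v"
  and me_add_left: "u \<in> fibre E p \<Longrightarrow> v \<in> fibre E p \<Longrightarrow> w \<in> fibre E p \<Longrightarrow> me p (v + w) u = me p v u + me p w u"
  and me_scale_left: "u \<in> fibre E p \<Longrightarrow> v \<in> fibre E p \<Longrightarrow> me p (c *\<^sub>R v) u = c * me p v u"
  using linear_on_add[OF me_linear] linear_on_scale[OF me_linear]
    linear_on_add[OF me_linear_left] linear_on_scale[OF me_linear_left] by auto

lemma me_diff: "u \<in> fibre E p \<Longrightarrow> v \<in> fibre E p \<Longrightarrow> w \<in> fibre E p \<Longrightarrow> me p u (v - w) = me p u v - me p u w"
  and me_diff_left: "u \<in> fibre E p \<Longrightarrow> v \<in> fibre E p \<Longrightarrow> w \<in> fibre E p \<Longrightarrow> me p (v - w) u = me p v u - me p w u"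
  using linear_on_diff[OF me_linear E_subspace] linear_on_diff[OF me_linear_left E_subspace] by auto


subsection \<open>The dual of the anchor\<close>

lemma dual_frame:
  obtains e s where "\<forall>\<^sub>F q in nhds p. (\<forall>i<rk E. SE q (e i) \<and> SE q (s i)) \<and>
    (\<forall>v\<in>fibre E q. \<exists>x. v = (\<Sum>i<rk E. x i *\<^sub>R e i q)) \<and>
    (\<forall>k<rk E. \<forall>l<rk E. me q (s k q) (e l q) = (if l = k then 1 else 0))"
proof -
  obtain U e c where U: "open U" "p \<in> U" and e: "\<And>q i. q \<in> U \<Longrightarrow> i < rk E \<Longrightarrow> SE q (e i)"
    and span: "\<And>q v. q \<in> U \<Longrightarrow> v \<in> fibre E q \<Longrightarrow> v = (\<Sum>i<rk E. c q v i *\<^sub>R e i q)"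
    and indep: "\<And>q x. q \<in> U \<Longrightarrow> (\<Sum>i<rk E. x i *\<^sub>R e i q) = 0 \<Longrightarrow> \<forall>i<rk E. x i = 0"
    by (rule E.local_frame[of p]) blast
  define M where "M = {u. \<exists>s. SE p s \<and> (\<forall>\<^sub>F q in nhds p. \<forall>l<rk E. u l q = me q (s q) (e l q))}"
  have inU: "\<forall>\<^sub>F q in nhds p. q \<in> U" using U eventually_nhds_in_open by blast
  have "\<forall>k<rk E. \<exists>u\<in>M. \<forall>\<^sub>F q in nhds p. \<forall>l<rk E. u l q = (if l = k then 1 else 0)"
  proof (rule germ_dual_rows)
    fix u l assume "u \<in> M" "l < rk E"
    then obtain s where s: "SE p s" "\<forall>\<^sub>F q in nhds p. \<forall>l<rk E. u l q = me q (s q) (e l q)"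
      by (auto simp: M_def)
    have "\<forall>\<^sub>F q in nhds p. ms s (e l) q = u l q"
      using s(2) by eventually_elim (use \<open>l < rk E\<close> in \<open>simp add: ms_def\<close>)
    then show "sm p (u l)" by (rule sm_cong) (intro ms_smooth s e U \<open>l < rk E\<close>)
  next
    fix u v assume "u \<in> M" "v \<in> M"
    then obtain s t where s: "SE p s" "\<forall>\<^sub>F q in nhds p. \<forall>l<rk E. u l q = me q (s q) (e l q)"
      and t: "SE p t" "\<forall>\<^sub>F q in nhds p. \<forall>l<rk E. v l q = me q (t q) (e l q)" by (auto simp: M_def)
    have "\<forall>\<^sub>F q in nhds p. \<forall>l<rk E. u l q + v l q = me q (s q + t q) (e l q)"
      using s(2) t(2) SE_eventually[OF s(1)] SE_eventually[OF t(1)] inU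
      by eventually_elim (use e SE_mem in \<open>simp add: me_add_left\<close>)
    then show "(\<lambda>l q. u l q + v l q) \<in> M" using E.S_add[OF s(1) t(1)] by (auto simp: M_def)
  next
    fix f u assume f: "sm p f" and "u \<in> M"
    then obtain s where s: "SE p s" "\<forall>\<^sub>F q in nhds p. \<forall>l<rk E. u l q = me q (s q) (e l q)"
      by (auto simp: M_def)
    have "\<forall>\<^sub>F q in nhds p. \<forall>l<rk E. f q * u l q = me q (f q *\<^sub>R s q) (e l q)"
      using s(2) SE_eventually[OF s(1)] inU
      by eventually_elim (use e SE_mem in \<open>simp add: me_scale_left\<close>)
    then show "(\<lambda>l q. f q * u l q) \<in> M" using E.S_scale[OF f s(1)] by (auto simp: M_def)
  next
    fix x assume x: "\<And>u. u \<in> M \<Longrightarrow> (\<Sum>l<rk E. u l p * x l) = 0"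
    have em: "e l p \<in> fibre E p" if "l < rk E" for l using e[OF U(2) that] SE_mem by blast
    have w: "(\<Sum>l<rk E. x l *\<^sub>R e l p) \<in> fibre E p" (is "?w \<in> _")
      using em by (intro subspace_sum subspace_scale E_subspace) auto
    have "me p ?w v = 0" if v: "v \<in> fibre E p" for v
    proof -
      obtain s where s: "s \<in> E.G" "s p = v" using E.G_value[OF v] .
      have "(\<lambda>l q. me q (s q) (e l q)) \<in> M" using E.G_S[OF s(1), of p]
        unfolding M_def by (intro CollectI exI[of _ s] conjI) simp_all
      from x[OF this] have "(\<Sum>l<rk E. x l *\<^sub>R me p v (e l p)) = 0" using s by (simp add: mult.commute)
      then have "me p v ?w = 0"
        using linear_on_sum[OF me_linear[OF v] E_subspace, of "{..<rk E}" "\<lambda>l. e l p" x] em by simp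
      then show ?thesis using me_sym v w by simp
    qed
    then have "?w = 0" using me_nondeg w by blast
    then show "\<forall>l<rk E. x l = 0" using indep U by blast
  qed
  then have "\<forall>k. \<exists>s. k < rk E \<longrightarrow> SE p s \<and>
      (\<forall>\<^sub>F q in nhds p. \<forall>l<rk E. me q (s q) (e l q) = (if l = k then 1 else 0))"
  proof (intro allI)
    fix k assume *: "\<forall>k<rk E. \<exists>u\<in>M. \<forall>\<^sub>F q in nhds p. \<forall>l<rk E. u l q = (if l = k then 1 else 0)"
    show "\<exists>s. k < rk E \<longrightarrow> SE p s \<and>
      (\<forall>\<^sub>F q in nhds p. \<forall>l<rk E. me q (s q) (e l q) = (if l = k then 1 else 0))"
    proof (cases "k < rk E")
      case True
      then obtain u s where "SE p s" "\<forall>\<^sub>F q in nhds p. \<forall>l<rk E. u l q = me q (s q) (e l q)"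
        "\<forall>\<^sub>F q in nhds p. \<forall>l<rk E. u l q = (if l = k then 1 else 0)" using * by (auto simp: M_def)
      moreover from this(2,3) have "\<forall>\<^sub>F q in nhds p. \<forall>l<rk E. me q (s q) (e l q) = (if l = k then 1 else 0)"
        by eventually_elim simp
      ultimately show ?thesis by blast
    qed simp
  qed
  then obtain s where s: "\<And>k. k < rk E \<Longrightarrow> SE p (s k)"
    "\<And>k. k < rk E \<Longrightarrow> \<forall>\<^sub>F q in nhds p. \<forall>l<rk E. me q (s k q) (e l q) = (if l = k then 1 else 0)"
    by (subst (asm) choice_iff) blast
  have "\<forall>\<^sub>F q in nhds p. \<forall>k\<in>{..<rk E}. SE q (s k)"
    using s(1) SE_eventually by (simp add: eventually_ball_finite_distrib)
  moreover have "\<forall>\<^sub>F q in nhds p. \<forall>k\<in>{..<rk E}. \<forall>l<rk E. me q (s k q) (e l q) = (if l = k then 1 else 0)"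
    using s(2) by (simp add: eventually_ball_finite_distrib)
  ultimately have "\<forall>\<^sub>F q in nhds p. (\<forall>i<rk E. SE q (e i) \<and> SE q (s i)) \<and>
    (\<forall>v\<in>fibre E q. \<exists>x. v = (\<Sum>i<rk E. x i *\<^sub>R e i q)) \<and>
    (\<forall>k<rk E. \<forall>l<rk E. me q (s k q) (e l q) = (if l = k then 1 else 0))"
    using inU
  proof eventually_elim
    case (elim q)
    have "\<forall>v\<in>fibre E q. \<exists>x. v = (\<Sum>i<rk E. x i *\<^sub>R e i q)" using span[OF elim(3)] by blast
    then show ?case using elim(1,2) e[OF elim(3)] by simp
  qed
  then show thesis by (rule that)
qed

lemma me_eqI:
  assumes "v \<in> fibre E p" "w \<in> fibre E p" "\<And>u. u \<in> fibre E p \<Longrightarrow> me p v u = me p w u"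
  shows "v = w"
proof -
  have "v - w = 0"
    by (rule me_nondeg) (use assms subspace_diff[OF E_subspace] in \<open>auto simp: me_diff_left\<close>)
  then show ?thesis by simp
qed

lemma rs_eqI:
  assumes "e \<in> fibre E p" "\<And>w. w \<in> fibre E p \<Longrightarrow> me p e w = \<alpha> (rh p w)"
  shows "rs p \<alpha> = e"
  unfolding rho_star_def by (rule the_equality) (use assms in \<open>auto intro!: me_eqI\<close>)

text \<open>The formula for \<open>rs\<close> in terms of dual frames gives its existence and its smoothness at once.\<close>

lemma rs_frame:
  assumes fr: "(\<forall>i<rk E. SE q (e i) \<and> SE q (s i)) \<and>
    (\<forall>v\<in>fibre E q. \<exists>x. v = (\<Sum>i<rk E. x i *\<^sub>R e i q)) \<and>
    (\<forall>k<rk E. \<forall>l<rk E. me q (s k q) (e l q) = (if l = k then 1 else 0))"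
    and \<alpha>: "linear_on (D q) \<alpha>"
  shows "rs q \<alpha> = (\<Sum>k<rk E. \<alpha> (rh q (e k q)) *\<^sub>R s k q)" (is "_ = ?u")
    and "rs q \<alpha> \<in> fibre E q" and "w \<in> fibre E q \<Longrightarrow> me q (rs q \<alpha>) w = \<alpha> (rh q w)"
proof -
  have em: "e k q \<in> fibre E q" and sm: "s k q \<in> fibre E q" if "k < rk E" for k
    using fr that SE_mem by blast+
  have u: "?u \<in> fibre E q" using sm by (intro subspace_sum subspace_scale E_subspace) auto
  have ul: "me q ?u (e l q) = \<alpha> (rh q (e l q))" if l: "l < rk E" for l
  proof -
    have "me q ?u (e l q) = (\<Sum>k<rk E. \<alpha> (rh q (e k q)) *\<^sub>R me q (s k q) (e l q))"
      by (rule linear_on_sum[OF me_linear_left[OF em[OF l]] E_subspace]) (use sm in auto)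
    also have "\<dots> = (\<Sum>k<rk E. if k = l then \<alpha> (rh q (e k q)) else 0)"
      by (rule sum.cong) (use fr l in auto)
    finally show ?thesis using l by simp
  qed
  have uw: "me q ?u w = \<alpha> (rh q w)" if w: "w \<in> fibre E q" for w
  proof -
    obtain x where x: "w = (\<Sum>i<rk E. x i *\<^sub>R e i q)" using fr w by blast
    have "me q ?u w = (\<Sum>i<rk E. x i *\<^sub>R me q ?u (e i q))"
      unfolding x by (rule linear_on_sum[OF me_linear[OF u] E_subspace]) (use em in auto)
    also have "\<dots> = (\<Sum>i<rk E. x i *\<^sub>R \<alpha> (rh q (e i q)))" using ul by simp
    also have "\<dots> = \<alpha> (\<Sum>i<rk E. x i *\<^sub>R rh q (e i q))"
      by (rule linear_on_sum[OF \<alpha> D_subspace, symmetric]) (use em rh_mem in auto)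
    also have "(\<Sum>i<rk E. x i *\<^sub>R rh q (e i q)) = rh q w"
      unfolding x by (rule linear_on_sum[OF rh_linear E_subspace, symmetric]) (use em in auto)
    finally show ?thesis .
  qed
  show "rs q \<alpha> = ?u" by (rule rs_eqI[OF u uw])
  then show "rs q \<alpha> \<in> fibre E q" "w \<in> fibre E q \<Longrightarrow> me q (rs q \<alpha>) w = \<alpha> (rh q w)"
    using u uw by simp_all
qed

lemma rs_mem: "linear_on (D p) \<alpha> \<Longrightarrow> rs p \<alpha> \<in> fibre E p"
  and rs_me: "linear_on (D p) \<alpha> \<Longrightarrow> w \<in> fibre E p \<Longrightarrow> me p (rs p \<alpha>) w = \<alpha> (rh p w)"
proof -
  obtain e s where "\<forall>\<^sub>F q in nhds p. (\<forall>i<rk E. SE q (e i) \<and> SE q (s i)) \<and>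
    (\<forall>v\<in>fibre E q. \<exists>x. v = (\<Sum>i<rk E. x i *\<^sub>R e i q)) \<and>
    (\<forall>k<rk E. \<forall>l<rk E. me q (s k q) (e l q) = (if l = k then 1 else 0))" by (rule dual_frame)
  from rs_frame[OF eventually_nhds_x_imp_x[OF this]]
  show "linear_on (D p) \<alpha> \<Longrightarrow> rs p \<alpha> \<in> fibre E p"
    "linear_on (D p) \<alpha> \<Longrightarrow> w \<in> fibre E p \<Longrightarrow> me p (rs p \<alpha>) w = \<alpha> (rh p w)" by blast+
qed

lemma rs_smooth:
  assumes lin: "\<And>q. linear_on (D q) (\<alpha> q)" and sm: "\<And>X. SD p X \<Longrightarrow> sm p (\<lambda>q. \<alpha> q (X q))"
  shows "SE p (\<lambda>q. rs q (\<alpha> q))"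
proof -
  obtain e s where fr: "\<forall>\<^sub>F q in nhds p. (\<forall>i<rk E. SE q (e i) \<and> SE q (s i)) \<and>
    (\<forall>v\<in>fibre E q. \<exists>x. v = (\<Sum>i<rk E. x i *\<^sub>R e i q)) \<and>
    (\<forall>k<rk E. \<forall>l<rk E. me q (s k q) (e l q) = (if l = k then 1 else 0))" by (rule dual_frame)
  have "SE p (\<lambda>q. \<Sum>k<rk E. \<alpha> q (an (e k) q) *\<^sub>R s k q)"
    using eventually_nhds_x_imp_x[OF fr] by (intro E.S_sum E.S_scale sm an_SD) auto
  moreover have "\<forall>\<^sub>F q in nhds p. (\<Sum>k<rk E. \<alpha> q (an (e k) q) *\<^sub>R s k q) = rs q (\<alpha> q)"
    using fr by eventually_elim (simp add: rs_frame(1)[OF _ lin] an_def)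
  ultimately show ?thesis by (rule E.S_cong)
qed

lemma linear_on_if: "linear_on (D p) \<alpha> \<Longrightarrow> (\<lambda>x. if x \<in> D p then \<alpha> x else 0) \<in> dual_space (D p)"
  by (simp add: dual_space_def linear_on_def subspace_add[OF D_subspace] subspace_scale[OF D_subspace])

lemma rs_dual: "rs p (\<lambda>x. if x \<in> D p then \<alpha> x else 0) = rs p \<alpha>"
  unfolding rho_star_def by (simp add: rh_mem cong: conj_cong)

lemma rh_rs: "linear_on (D p) \<alpha> \<Longrightarrow> rh p (rs p \<alpha>) = 0"
proof -
  assume "linear_on (D p) \<alpha>"
  then have "rs p \<alpha> \<in> rs p ` dual_space (D p)"
    unfolding rs_dual[of p \<alpha>, symmetric] by (intro imageI linear_on_if)
  then show ?thesis using ge by (simp add: generalized_exact_def)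
qed

lemma ker_rs:
  assumes "v \<in> fibre E p" "rh p v = 0"
  obtains \<alpha> where "\<alpha> \<in> dual_space (D p)" "v = rs p \<alpha>"
proof -
  have "v \<in> rs p ` dual_space (D p)" using ge assms by (simp add: generalized_exact_def)
  then show thesis using that by blast
qed

lemma ker_isotropic:
  assumes "v \<in> fibre E p" "rh p v = 0" "w \<in> fibre E p" "rh p w = 0"
  shows "me p v w = 0"
proof -
  obtain \<alpha> where a: "\<alpha> \<in> dual_space (D p)" "v = rs p \<alpha>" using ker_rs[OF assms(1,2)] .
  then have "linear_on (D p) \<alpha>" by (simp add: dual_space_def)
  then show ?thesis using rs_me[of p \<alpha> w] linear_on_zero[OF _ D_subspace] assms a by simp
qed


subsection \<open>Consequences of the axioms\<close>

lemma differential_linear: "linear_on (D p) (differential f)"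
  by (simp add: linear_on_def differential_def)

lemma an_mem: "s \<in> E.G \<Longrightarrow> an s p \<in> D p"
  using rh_mem E.G_mem by (simp add: an_def)

lemma an_diff: "s \<in> E.G \<Longrightarrow> t \<in> E.G \<Longrightarrow> an (\<lambda>q. s q - t q) = (\<lambda>q. an s q - an t q)"
  using linear_on_diff[OF rh_linear E_subspace] E.G_mem
  by (auto simp: an_def)

lemma ms_G: "s \<in> E.G \<Longrightarrow> t \<in> E.G \<Longrightarrow> sm p (ms s t)"
  by (simp add: ms_smooth E.G_S)

lemma ms_sym: "s \<in> E.G \<Longrightarrow> t \<in> E.G \<Longrightarrow> ms s t = ms t s"
  using me_sym E.G_mem by (auto simp: ms_def)

lemma ms_add: "s \<in> E.G \<Longrightarrow> t \<in> E.G \<Longrightarrow> u \<in> E.G \<Longrightarrow> ms u (\<lambda>q. s q + t q) = (\<lambda>q. ms u s q + ms u t q)"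
  and ms_add_left: "s \<in> E.G \<Longrightarrow> t \<in> E.G \<Longrightarrow> u \<in> E.G \<Longrightarrow> ms (\<lambda>q. s q + t q) u = (\<lambda>q. ms s u q + ms t u q)"
  and ms_diff_left: "s \<in> E.G \<Longrightarrow> t \<in> E.G \<Longrightarrow> u \<in> E.G \<Longrightarrow> ms (\<lambda>q. s q - t q) u = (\<lambda>q. ms s u q - ms t u q)"
  using me_add me_add_left me_diff_left E.G_mem by (auto simp: ms_def)

lemma br_sym:
  assumes "s \<in> E.G" "t \<in> E.G" "u \<in> E.G"
  shows "ms (br s t) u p + ms (br t s) u p = an u p (ms s t)"
proof -
  have diag: "2 * ms (br s s) u p = an u p (ms s s)" if "s \<in> E.G" for s
    unfolding br_diag[OF that] ms_def
    using me_scale_left[OF E.G_mem[OF assms(3)] rs_mem[OF differential_linear], of p "1/2" "ms s s"]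
      rs_me[OF differential_linear E.G_mem[OF assms(3)], of p "ms s s"]
    by (simp add: differential_def an_def ms_def)
  have st: "(\<lambda>q. s q + t q) \<in> E.G" using assms E.G_add by blast
  have "ms (br (\<lambda>q. s q + t q) (\<lambda>q. s q + t q)) u p =
      ms (br s s) u p + ms (br s t) u p + (ms (br t s) u p + ms (br t t) u p)"
    using assms st by (simp add: br_add br_add_left br_G ms_add_left E.G_add)
  moreover have "ms (\<lambda>q. s q + t q) (\<lambda>q. s q + t q) = (\<lambda>q. (ms s s q + ms t t q) + 2 * ms s t q)"
    using assms st ms_sym[of t s] by (intro ext) (simp add: ms_add ms_add_left)
  moreover have "an u p (\<lambda>q. (ms s s q + ms t t q) + 2 * ms s t q) =
      an u p (ms s s) + an u p (ms t t) + 2 * an u p (ms s t)"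
    using act_add[OF an_G[OF assms(3)], of p "\<lambda>q. ms s s q + ms t t q" "\<lambda>q. 2 * ms s t q"]
      act_add[OF an_G[OF assms(3)], of p "ms s s" "ms t t"] act_cmult[OF an_G[OF assms(3)], of p "ms s t" 2]
      ms_G assms by (simp add: sm_add sm_mult)
  ultimately show ?thesis using diag[OF st] diag[OF assms(1)] diag[OF assms(2)] by simp
qed

lemma br_inv:
  assumes "s \<in> E.G" "t \<in> E.G" "u \<in> E.G"
  shows "an s p (ms t u) = ms (br s t) u p + ms t (br s u) p"
proof -
  have tu: "(\<lambda>q. t q + u q) \<in> E.G" using assms E.G_add by blast
  have d: "an s p (ms t t) = 2 * ms (br s t) t p" if "t \<in> E.G" for t
    using br_metric[OF assms(1) that] by (simp add: ms_def)
  have "ms (\<lambda>q. t q + u q) (\<lambda>q. t q + u q) = (\<lambda>q. (ms t t q + ms u u q) + 2 * ms t u q)"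
    using assms tu ms_sym[of u t] by (intro ext) (simp add: ms_add ms_add_left)
  moreover have "an s p (\<lambda>q. (ms t t q + ms u u q) + 2 * ms t u q) =
      an s p (ms t t) + an s p (ms u u) + 2 * an s p (ms t u)"
    using act_add[OF an_G[OF assms(1)], of p "\<lambda>q. ms t t q + ms u u q" "\<lambda>q. 2 * ms t u q"]
      act_add[OF an_G[OF assms(1)], of p "ms t t" "ms u u"] act_cmult[OF an_G[OF assms(1)], of p "ms t u" 2]
      ms_G assms by (simp add: sm_add sm_mult)
  moreover have "ms (br s (\<lambda>q. t q + u q)) (\<lambda>q. t q + u q) p =
      ms (br s t) t p + ms (br s t) u p + (ms (br s u) t p + ms (br s u) u p)"
    using assms tu by (simp add: br_add br_G ms_add_left ms_add)
  ultimately show ?thesis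
    using d[OF tu] d[OF assms(2)] d[OF assms(3)] ms_sym[OF assms(2) br_G[OF assms(1,3)]] by simp
qed

lemma anchor_hom:
  assumes st: "s \<in> E.G" "t \<in> E.G"
  shows "an (br s t) = lb (an s) (an t)"
proof
  fix p
  note G = an_G[OF st(1)] an_G[OF st(2)]
  show "an (br s t) p = lb (an s) (an t) p"
  proof (cases "\<exists>v\<in>fibre E p. v \<noteq> 0")
    case False
    then have "fibre E p = {0}" using subspace_0[OF E_subspace] by blast
    then have "D p = {0}" using rh_image[of p] linear_on_zero[OF rh_linear E_subspace] by auto
    then show ?thesis using an_mem[OF br_G[OF st], of p] D.G_mem[OF lb_G[OF G], of p] by simp
  next
    case True
    then obtain v where v: "v \<in> fibre E p" "v \<noteq> 0" by blast
    obtain u where u: "u \<in> E.G" "u p = v" using E.G_value[OF v(1)] .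
    show ?thesis
    proof (rule tangent_eqI[OF G_tangent[OF an_G[OF br_G[OF st]]] G_tangent[OF lb_G[OF G]]])
      fix f assume "sm p f"
      then obtain f' where f': "\<And>q. sm q f'" "\<forall>\<^sub>F q in nhds p. f' q = f q" by (rule sm_extend) blast
      let ?X = "an s" and ?Y = "an t"
      have X': "smf (\<lambda>q. ?X q f')" and Y': "smf (\<lambda>q. ?Y q f')" using act_smooth G f'(1) by blast+
      have fu: "(\<lambda>q. f' q *\<^sub>R u q) \<in> E.G" using E.G_scale f'(1) u(1) by blast
      have L': "br s (br t (\<lambda>q. f' q *\<^sub>R u q)) p = an s p (\<lambda>q. an t q f') *\<^sub>R u p + an t p f' *\<^sub>R br s u p
          + (an s p f' *\<^sub>R br t u p + f' p *\<^sub>R br s (br t u) p)"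
        if "s \<in> E.G" "t \<in> E.G" "smf (\<lambda>q. an t q f')" for s t
      proof -
        have "br s (br t (\<lambda>q. f' q *\<^sub>R u q)) = br s (\<lambda>q. an t q f' *\<^sub>R u q + f' q *\<^sub>R br t u q)"
          using br_leibniz[OF that(2) u(1)] f'(1) by simp
        also have "\<dots> = (\<lambda>q. br s (\<lambda>q. an t q f' *\<^sub>R u q) q + br s (\<lambda>q. f' q *\<^sub>R br t u q) q)"
          using that f'(1) u(1) by (intro br_add E.G_scale br_G) auto
        finally show ?thesis
          using br_leibniz[OF that(1) u(1) that(3)] br_leibniz[OF that(1) br_G[OF that(2) u(1)]] f'(1)
          by simp
      qed
      have "br s (br t (\<lambda>q. f' q *\<^sub>R u q)) p =
          br (br s t) (\<lambda>q. f' q *\<^sub>R u q) p + br t (br s (\<lambda>q. f' q *\<^sub>R u q)) p"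
        using br_jacobi[OF st fu] by simp
      moreover have "br s (br t u) p = br (br s t) u p + br t (br s u) p"
        using br_jacobi[OF st u(1)] by simp
      moreover have "br (br s t) (\<lambda>q. f' q *\<^sub>R u q) p = an (br s t) p f' *\<^sub>R u p + f' p *\<^sub>R br (br s t) u p"
        using br_leibniz[OF br_G[OF st] u(1)] f'(1) by simp
      ultimately have "(?X p (\<lambda>q. ?Y q f') - ?Y p (\<lambda>q. ?X q f')) *\<^sub>R u p = an (br s t) p f' *\<^sub>R u p"
        using L'[OF st Y'] L'[OF st(2,1) X'] by (simp add: algebra_simps)
      then have "an (br s t) p f' = lb ?X ?Y p f'" using v u lb_apply[OF f'(1)] by auto
      then show "an (br s t) p f = lb ?X ?Y p f"
        using tangent_cong[OF G_tangent f'(2)] an_G[OF br_G[OF st]] lb_G[OF G] by metis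
    qed
  qed
qed

end

context involutive
begin

lemma alt3_tensorial:
  assumes w: "alt3 w" and G: "X \<in> D.G" "Y \<in> D.G" "Z \<in> D.G" "X' \<in> D.G" "Y' \<in> D.G" "Z' \<in> D.G"
    and eq: "X p = X' p" "Y p = Y' p" "Z p = Z' p"
  shows "w X Y Z p = w X' Y' Z' p"
proof -
  have 1: "w X Y Z p = w X' Y Z p" if "X \<in> D.G" "X' \<in> D.G" "Y \<in> D.G" "Z \<in> D.G" "X p = X' p" for X X' Y Z
    by (rule D.tensorial[where T="\<lambda>X. w X Y Z p", OF _ _ that(1,2,5)])
      (use w that in \<open>simp_all add: alt3_add[OF w] alt3_scale[OF w]\<close>)
  have 2: "w X Y Z p = w X Y' Z p" if "X \<in> D.G" "Y \<in> D.G" "Y' \<in> D.G" "Z \<in> D.G" "Y p = Y' p" for X Y Y' Z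
    using fun_cong[OF alt3_skew12[OF w, of X Y Z], of p] fun_cong[OF alt3_skew12[OF w, of X Y' Z], of p]
      1[of Y Y' X Z] that by simp
  have 3: "w X Y Z p = w X Y Z' p" if "X \<in> D.G" "Y \<in> D.G" "Z \<in> D.G" "Z' \<in> D.G" "Z p = Z' p" for X Y Z Z'
    using fun_cong[OF alt3_skew23[OF w, of X Y Z], of p] fun_cong[OF alt3_skew23[OF w, of X Y Z'], of p]
      2[of X Z Z' Y] that by simp
  have "w X Y Z p = w X' Y Z p" by (rule 1) (use G eq in auto)
  also have "\<dots> = w X' Y' Z p" by (rule 2) (use G eq in auto)
  also have "\<dots> = w X' Y' Z' p" by (rule 3) (use G eq in auto)
  finally show ?thesis .
qed

lemma alt3_form:
  assumes w: "alt3 w" and off: "\<And>p xs. \<not> (length xs = 3 \<and> set xs \<subseteq> D p) \<Longrightarrow> \<omega> p xs = 0"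
    and on: "\<And>p X Y Z. X \<in> D.G \<Longrightarrow> Y \<in> D.G \<Longrightarrow> Z \<in> D.G \<Longrightarrow> \<omega> p [X p, Y p, Z p] = w X Y Z p"
  shows "\<omega> \<in> forms A D 3"
  unfolding forms_iff
proof (intro conjI allI impI; (elim conjE)?)
  fix p xs assume "\<not> (length xs = 3 \<and> set xs \<subseteq> D p)"
  then show "\<omega> p xs = 0" by (rule off)
next
  have val: "\<omega> p [x, y, z] = w (D.gext p x) (D.gext p y) (D.gext p z) p"
    if "x \<in> D p" "y \<in> D p" "z \<in> D p" for p x y z
    using on[of "D.gext p x" "D.gext p y" "D.gext p z" p] that by (simp add: D.gext)
  have sk: "\<omega> p [x, y, z] = - \<omega> p [y, x, z]" "\<omega> p [x, y, z] = - \<omega> p [x, z, y]"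
    if "x \<in> D p" "y \<in> D p" "z \<in> D p" for p x y z
    using that val fun_cong[OF alt3_skew12[OF w], of "D.gext p x" "D.gext p y" "D.gext p z" p]
      fun_cong[OF alt3_skew23[OF w], of "D.gext p x" "D.gext p y" "D.gext p z" p] by (simp_all add: D.gext)
  have lin: "linear_on (D p) (\<lambda>x. \<omega> p [x, y, z])" if "y \<in> D p" "z \<in> D p" for p y z
  proof (rule linear_onI)
    note G = D.gext(1)[OF that(1)] D.gext(1)[OF that(2)]
    fix x x' assume x: "x \<in> D p" "x' \<in> D p"
    note Gx = D.gext(1)[OF x(1)] D.gext(1)[OF x(2)]
    show "\<omega> p [x + x', y, z] = \<omega> p [x, y, z] + \<omega> p [x', y, z]"
      using on[OF D.G_add[OF Gx] G, of p] alt3_add[OF w Gx G] val[OF x(1) that] val[OF x(2) that] x that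
      by (simp add: D.gext)
  next
    note G = D.gext(1)[OF that(1)] D.gext(1)[OF that(2)]
    fix a x assume x: "x \<in> D p"
    note Gx = D.gext(1)[OF x]
    show "\<omega> p [a *\<^sub>R x, y, z] = a *\<^sub>R \<omega> p [x, y, z]"
      using on[OF D.G_cscale[OF Gx] G, of p a] alt3_scale[OF w Gx G, of "\<lambda>_. a"] val[OF x that] x that
      by (simp add: D.gext)
  qed
  have lin2: "linear_on (D p) (\<lambda>x. \<omega> p [y, x, z])" if "y \<in> D p" "z \<in> D p" for p y z
    using lin[OF that] sk(1)[OF that(1) _ that(2)] subspace_add[OF D_subspace] subspace_scale[OF D_subspace]
    by (simp add: linear_on_def)
  have lin3: "linear_on (D p) (\<lambda>x. \<omega> p [y, z, x])" if "y \<in> D p" "z \<in> D p" for p y z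
    using lin2[OF that] sk(2)[OF that] subspace_add[OF D_subspace] subspace_scale[OF D_subspace]
    by (simp add: linear_on_def)
  fix p xs assume "length xs = 3" "set xs \<subseteq> D p"
  then obtain x y z where xs: "xs = [x, y, z]" "x \<in> D p" "y \<in> D p" "z \<in> D p"
    by (auto simp: eval_nat_numeral length_Suc_conv)
  show "linear_on (D p) (\<lambda>x. \<omega> p (xs[i := x]))" if "i < 3" for i
  proof -
    have "i = 0 \<or> i = Suc 0 \<or> i = Suc (Suc 0)" using that by auto
    then show ?thesis using lin lin2 lin3 xs by auto
  qed
  show "\<omega> p xs = 0" if "\<not> distinct xs"
    using that xs(1) sk(1)[OF xs(2-4)] sk(2)[OF xs(2-4)] sk(1)[OF xs(2,4,3)] by auto
next
  fix p Xs assume Xs: "length Xs = 3" "\<forall>X\<in>set Xs. SD p X"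
  then obtain X Y Z where l: "Xs = [X, Y, Z]" by (auto simp: eval_nat_numeral length_Suc_conv)
  obtain X' where X': "X' \<in> D.G" "\<forall>\<^sub>F q in nhds p. X' q = X q" using D.G_extend Xs l by (metis list.set_intros(1))
  obtain Y' where Y': "Y' \<in> D.G" "\<forall>\<^sub>F q in nhds p. Y' q = Y q"
    using D.G_extend Xs l by (metis list.set_intros)
  obtain Z' where Z': "Z' \<in> D.G" "\<forall>\<^sub>F q in nhds p. Z' q = Z q"
    using D.G_extend Xs l by (metis list.set_intros)
  have "\<forall>\<^sub>F q in nhds p. w X' Y' Z' q = \<omega> q (map (\<lambda>X. X q) Xs)"
    using X'(2) Y'(2) Z'(2)
  proof eventually_elim
    case (elim q)
    then show ?case using on[OF X'(1) Y'(1) Z'(1), of q] l by simp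
  qed
  then show "sm p (\<lambda>q. \<omega> q (map (\<lambda>X. X q) Xs))"
    by (rule sm_cong) (rule alt3_smooth[OF w X'(1) Y'(1) Z'(1)])
qed

lemma lb_zero_left: "Z \<in> D.G \<Longrightarrow> lb (\<lambda>q. 0) Z = (\<lambda>q. 0)"
  by (intro ext) (simp add: lie_bracket_def act_zero)

lemma d3_cong:
  assumes "\<And>X Y Z. X \<in> D.G \<Longrightarrow> Y \<in> D.G \<Longrightarrow> Z \<in> D.G \<Longrightarrow> w X Y Z = w' X Y Z"
    and "X \<in> D.G" "Y \<in> D.G" "Z \<in> D.G" "W \<in> D.G"
  shows "d3 w X Y Z W p = d3 w' X Y Z W p"
  unfolding d3_def using assms by (simp add: lb_G)

end

lemma bundle_map_iff_germs:
  assumes P: "\<And>U s. open U \<Longrightarrow> s \<in> \<Gamma>F U \<longleftrightarrow> (\<forall>p\<in>U. P p s)"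
    and Q: "\<And>U s. open U \<Longrightarrow> s \<in> \<Gamma>G U \<longleftrightarrow> (\<forall>p\<in>U. Q p s)"
    and ev: "\<And>p s. P p s \<Longrightarrow> \<forall>\<^sub>F q in nhds p. P q s"
  shows "bundle_map F \<Gamma>F G \<Gamma>G \<Phi> \<longleftrightarrow> (\<forall>p. linear_on (F p) (\<Phi> p) \<and> \<Phi> p ` F p \<subseteq> G p) \<and>
    (\<forall>p s. P p s \<longrightarrow> Q p (\<lambda>q. \<Phi> q (s q)))"
proof -
  have "(\<forall>U. open U \<longrightarrow> (\<forall>s\<in>\<Gamma>F U. (\<lambda>p. \<Phi> p (s p)) \<in> \<Gamma>G U)) \<longleftrightarrow>
      (\<forall>p s. P p s \<longrightarrow> Q p (\<lambda>q. \<Phi> q (s q)))"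
  proof (intro iffI allI impI ballI)
    fix p s assume *: "\<forall>U. open U \<longrightarrow> (\<forall>s\<in>\<Gamma>F U. (\<lambda>p. \<Phi> p (s p)) \<in> \<Gamma>G U)" and s: "P p s"
    obtain U where U: "open U" "p \<in> U" "\<forall>q\<in>U. P q s" using ev[OF s] by (auto simp: eventually_nhds)
    have "s \<in> \<Gamma>F U" using P[OF U(1)] U(3) by blast
    then have "(\<lambda>p. \<Phi> p (s p)) \<in> \<Gamma>G U" using * U(1) by blast
    then show "Q p (\<lambda>q. \<Phi> q (s q))" using Q[OF U(1)] U by blast
  next
    fix U s assume *: "\<forall>p s. P p s \<longrightarrow> Q p (\<lambda>q. \<Phi> q (s q))" and U: "open U" "s \<in> \<Gamma>F U"
    have "\<forall>p\<in>U. P p s" using P[OF U(1)] U(2) by blast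
    then have "\<forall>p\<in>U. Q p (\<lambda>q. \<Phi> q (s q))" using * by simp
    then show "(\<lambda>p. \<Phi> p (s p)) \<in> \<Gamma>G U" by (simp add: Q[OF U(1)])
  qed
  then show ?thesis unfolding bundle_map_def by (rule arg_cong)
qed

context gexact
begin

definition splitting :: "('m \<Rightarrow> 'm tvec \<Rightarrow> 'e) \<Rightarrow> bool" where
  "splitting \<sigma> \<longleftrightarrow> (\<forall>p. linear_on (D p) (\<sigma> p)) \<and> (\<forall>p. \<forall>x\<in>D p. \<sigma> p x \<in> fibre E p \<and> rh p (\<sigma> p x) = x) \<and>
     (\<forall>p X. SD p X \<longrightarrow> SE p (\<lambda>q. \<sigma> q (X q)))"

lemma isotropic_splitting_iff: "isotropic_splitting A D E \<sigma> \<longleftrightarrow>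
    splitting \<sigma> \<and> (\<forall>p. \<forall>x\<in>D p. \<forall>y\<in>D p. me p (\<sigma> p x) (\<sigma> p y) = 0)"
proof -
  have "bundle_map D (D_sections A D) (fibre E) (sections A E) \<sigma> \<longleftrightarrow>
      (\<forall>p. linear_on (D p) (\<sigma> p) \<and> \<sigma> p ` D p \<subseteq> fibre E p) \<and>
      (\<forall>p X. SD p X \<longrightarrow> SE p (\<lambda>q. \<sigma> q (X q)))"
    by (rule bundle_map_iff_germs[OF D_sections_iff sections_iff SD_eventually])
  then show ?thesis unfolding isotropic_splitting_def splitting_def by (auto simp: image_subset_iff)
qed

end

locale gexact_split = gexact A D E
  for A :: "('m::{t2_space, second_countable_topology}, 'v::real_inner) atlas"
    and D :: "'m \<Rightarrow> 'm tvec set" and E :: "('m, 'e::real_vector) courant" +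
  fixes \<sigma> :: "'m \<Rightarrow> 'm tvec \<Rightarrow> 'e"
  assumes iso_spl: "isotropic_splitting A D E \<sigma>"
begin

definition sg :: "('m \<Rightarrow> 'm tvec) \<Rightarrow> 'm \<Rightarrow> 'e" where
  "sg X = (\<lambda>q. \<sigma> q (X q))"

definition C :: "('m \<Rightarrow> 'm tvec) \<Rightarrow> ('m \<Rightarrow> 'm tvec) \<Rightarrow> ('m \<Rightarrow> 'm tvec) \<Rightarrow> 'm \<Rightarrow> real" where
  "C X Y Z = ms (br (sg X) (sg Y)) (sg Z)"

lemma s_linear: "linear_on (D p) (\<sigma> p)"
  and s_mem: "x \<in> D p \<Longrightarrow> \<sigma> p x \<in> fibre E p"
  and rh_s: "x \<in> D p \<Longrightarrow> rh p (\<sigma> p x) = x"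
  and s_smooth: "SD p X \<Longrightarrow> SE p (\<lambda>q. \<sigma> q (X q))"
  and s_iso: "x \<in> D p \<Longrightarrow> y \<in> D p \<Longrightarrow> me p (\<sigma> p x) (\<sigma> p y) = 0"
  using iso_spl by (simp_all add: isotropic_splitting_iff splitting_def)

lemma sg_G: "X \<in> D.G \<Longrightarrow> sg X \<in> E.G"
  by (simp add: E.G_def sg_def s_smooth D.G_S)

lemma an_sg: "X \<in> D.G \<Longrightarrow> an (sg X) = X"
  by (auto simp: an_def sg_def rh_s D.G_mem)

lemma ms_sg: "X \<in> D.G \<Longrightarrow> Y \<in> D.G \<Longrightarrow> ms (sg X) (sg Y) = (\<lambda>q. 0)"
  by (auto simp: ms_def sg_def s_iso D.G_mem)

lemma sg_add: "X \<in> D.G \<Longrightarrow> Y \<in> D.G \<Longrightarrow> sg (\<lambda>q. X q + Y q) = (\<lambda>q. sg X q + sg Y q)"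
  using linear_on_add[OF s_linear] D.G_mem by (auto simp: sg_def)

lemma sg_scale: "X \<in> D.G \<Longrightarrow> sg (\<lambda>q. f q *\<^sub>R X q) = (\<lambda>q. f q *\<^sub>R sg X q)"
  using linear_on_scale[OF s_linear] D.G_mem by (auto simp: sg_def)

lemma ker_me:
  assumes "v \<in> fibre E p" "rh p v = 0" "w \<in> fibre E p"
  shows "me p v w = me p v (\<sigma> p (rh p w))"
proof -
  have s: "\<sigma> p (rh p w) \<in> fibre E p" using s_mem rh_mem assms(3) by blast
  have "rh p (w - \<sigma> p (rh p w)) = 0"
    using linear_on_diff[OF rh_linear E_subspace assms(3) s] rh_s rh_mem assms(3) by simp
  then have "me p v (w - \<sigma> p (rh p w)) = 0"
    using ker_isotropic assms subspace_diff[OF E_subspace assms(3) s] by blast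
  then show ?thesis using me_diff[OF assms(1,3) s] by simp
qed

lemma fibre_eqI:
  assumes "v \<in> fibre E p" "w \<in> fibre E p" "rh p v = rh p w"
    and "\<And>z. z \<in> D p \<Longrightarrow> me p v (\<sigma> p z) = me p w (\<sigma> p z)"
  shows "v = w"
proof -
  have d: "v - w \<in> fibre E p" using subspace_diff[OF E_subspace] assms by blast
  have k: "rh p (v - w) = 0" using linear_on_diff[OF rh_linear E_subspace assms(1,2)] assms(3) by simp
  have "v - w = 0"
  proof (rule me_nondeg[OF d])
    fix u assume u: "u \<in> fibre E p"
    then show "me p (v - w) u = 0"
      using ker_me[OF d k u] assms rh_mem s_mem by (simp add: me_diff_left)
  qed
  then show ?thesis by simp
qed

lemma G_eqI_E:
  assumes "s \<in> E.G" "t \<in> E.G" "an s = an t" "\<And>Z. Z \<in> D.G \<Longrightarrow> ms s (sg Z) = ms t (sg Z)"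
  shows "s = t"
proof
  fix p show "s p = t p"
  proof (rule fibre_eqI)
    show "s p \<in> fibre E p" "t p \<in> fibre E p" using E.G_mem assms by auto
    show "rh p (s p) = rh p (t p)" using fun_cong[OF assms(3), of p] by (simp add: an_def)
    fix z assume z: "z \<in> D p"
    show "me p (s p) (\<sigma> p z) = me p (t p) (\<sigma> p z)"
      using fun_cong[OF assms(4)[OF D.gext(1)[OF z]], of p] D.gext(2)[OF z] by (simp add: ms_def sg_def)
  qed
qed

lemma ms_ker: "s \<in> E.G \<Longrightarrow> u \<in> E.G \<Longrightarrow> an s p = 0 \<Longrightarrow> ms s u p = ms s (sg (an u)) p"
  using ker_me[of "s p" p "u p"] E.G_mem by (simp add: ms_def an_def sg_def)

text \<open>The Dorfman bracket twisted by \<open>C\<close>, read off from the axioms.\<close>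

lemma bracket_formula:
  assumes s: "s \<in> E.G" and t: "t \<in> E.G" and Z: "Z \<in> D.G"
  shows "ms (br s t) (sg Z) p = C (an s) (an t) Z p + an s p (ms t (sg Z)) - ms t (sg (lb (an s) Z)) p
    - an t p (ms s (sg Z)) + ms s (sg (lb (an t) Z)) p + Z p (ms s (sg (an t)))"
proof -
  define X Y where "X = an s" and "Y = an t"
  have G: "X \<in> D.G" "Y \<in> D.G" using an_G s t by (simp_all add: X_def Y_def)
  note S = sg_G[OF G(1)] sg_G[OF G(2)] sg_G[OF Z]
  define a b where "a = (\<lambda>q. s q - sg X q)" and "b = (\<lambda>q. t q - sg Y q)"
  have ab: "a \<in> E.G" "b \<in> E.G" using E.G_diff s t S by (simp_all add: a_def b_def)
  have k: "an a = (\<lambda>q. 0)" "an b = (\<lambda>q. 0)"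
    using an_diff[OF s S(1)] an_diff[OF t S(2)] an_sg[OF G(1)] an_sg[OF G(2)]
    by (auto simp: a_def b_def X_def Y_def)
  have ma: "ms a (sg W) = ms s (sg W)" "ms b (sg W) = ms t (sg W)" if "W \<in> D.G" for W
    using ms_diff_left[OF s S(1) sg_G[OF that]] ms_diff_left[OF t S(2) sg_G[OF that]]
      ms_sg[OF G(1) that] ms_sg[OF G(2) that] by (simp_all add: a_def b_def)
  have st: "s = (\<lambda>q. sg X q + a q)" "t = (\<lambda>q. sg Y q + b q)" by (simp_all add: a_def b_def)
  have "br s t = br s (\<lambda>q. sg Y q + b q)" using st(2) by simp
  also have "\<dots> = (\<lambda>q. br s (sg Y) q + br s b q)" by (rule br_add[OF s S(2) ab(2)])
  also have "br s (sg Y) = br (\<lambda>q. sg X q + a q) (sg Y)" using st(1) by simp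
  also have "\<dots> = (\<lambda>q. br (sg X) (sg Y) q + br a (sg Y) q)" by (rule br_add_left[OF S(2,1) ab(1)])
  also have "br s b = br (\<lambda>q. sg X q + a q) b" using st(1) by simp
  also have "\<dots> = (\<lambda>q. br (sg X) b q + br a b q)" by (rule br_add_left[OF ab(2) S(1) ab(1)])
  finally have br: "br s t = (\<lambda>q. (br (sg X) (sg Y) q + br a (sg Y) q) + (br (sg X) b q + br a b q))" .
  have 1: "ms (br s t) (sg Z) p = ms (br (sg X) (sg Y)) (sg Z) p + ms (br a (sg Y)) (sg Z) p
      + (ms (br (sg X) b) (sg Z) p + ms (br a b) (sg Z) p)"
    unfolding br by (simp add: ms_add_left br_G S ab E.G_add)
  have 2: "X p (ms b (sg Z)) = ms (br (sg X) b) (sg Z) p + ms b (sg (lb X Z)) p"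
    using br_inv[OF S(1) ab(2) S(3), of p] ms_ker[OF ab(2) br_G[OF S(1,3)], of p] k
      anchor_hom[OF S(1,3)] an_sg G Z by simp
  have 3: "Y p (ms a (sg Z)) = ms (br (sg Y) a) (sg Z) p + ms a (sg (lb Y Z)) p"
    using br_inv[OF S(2) ab(1) S(3), of p] ms_ker[OF ab(1) br_G[OF S(2,3)], of p] k
      anchor_hom[OF S(2,3)] an_sg G Z by simp
  have 4: "ms (br a (sg Y)) (sg Z) p + ms (br (sg Y) a) (sg Z) p = Z p (ms a (sg Y))"
    using br_sym[OF ab(1) S(2,3), of p] an_sg[OF Z] by simp
  have 5: "ms (br a b) (sg Z) p = 0"
  proof -
    have "an (br a (sg Z)) p = 0"
      using anchor_hom[OF ab(1) S(3)] k an_sg[OF Z] lb_zero_left[OF Z] by simp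
    moreover have "rh p (b p) = 0" using fun_cong[OF k(2), of p] by (simp add: an_def)
    ultimately have "ms b (br a (sg Z)) p = 0"
      using ker_isotropic[of "b p" p "br a (sg Z) p"] E.G_mem[OF ab(2)] E.G_mem[OF br_G[OF ab(1) S(3)]]
      by (simp add: ms_def an_def)
    then show ?thesis using br_inv[OF ab S(3), of p] k by simp
  qed
  show ?thesis
    unfolding X_def[symmetric] Y_def[symmetric]
    using 1 2 3 4 5 ma[OF Z] ma(1)[OF G(2)] ma(2)[OF lb_G[OF G(1) Z]] ma(1)[OF lb_G[OF G(2) Z]]
    by (simp add: C_def)
qed

lemma C_alt3: "alt3 C"
proof -
  have sk12: "C X Y Z p = - C Y X Z p" if "X \<in> D.G" "Y \<in> D.G" "Z \<in> D.G" for X Y Z p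
    using br_sym[of "sg X" "sg Y" "sg Z" p] that by (simp add: C_def sg_G ms_sg an_sg act_zero)
  have sk23: "C X Y Z p = - C X Z Y p" if "X \<in> D.G" "Y \<in> D.G" "Z \<in> D.G" for X Y Z p
    using br_inv[of "sg X" "sg Y" "sg Z" p] that ms_sym[of "sg Y" "br (sg X) (sg Z)"]
    by (simp add: C_def sg_G ms_sg an_sg act_zero br_G)
  show ?thesis unfolding alt3_def
  proof (intro ballI conjI allI impI ext)
    fix X Y Z p assume G: "X \<in> D.G" "Y \<in> D.G" "Z \<in> D.G"
    note S = sg_G[OF G(1)] sg_G[OF G(2)] sg_G[OF G(3)]
    show "sm p (C X Y Z)" unfolding C_def by (intro ms_G br_G sg_G G)
    show "C X Y Z p = - C Y X Z p" "C X Y Z p = - C X Z Y p" using sk12 sk23 G by blast+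
    show "C (\<lambda>q. X q + X' q) Y Z p = C X Y Z p + C X' Y Z p" if "X' \<in> D.G" for X'
      using G that S sg_G[OF that] by (simp add: C_def sg_add br_add_left ms_add_left br_G)
    show "C (\<lambda>q. f q *\<^sub>R X q) Y Z p = f p * C X Y Z p" if f: "smf f" for f
    proof -
      have fX: "(\<lambda>q. f q *\<^sub>R X q) \<in> D.G" using D.G_scale f G by blast
      have m: "br (sg Y) (sg X) p \<in> fibre E p" "sg X p \<in> fibre E p" "sg Z p \<in> fibre E p"
        using E.G_mem br_G S by blast+
      have "C Y (\<lambda>q. f q *\<^sub>R X q) Z p = me p (Y p f *\<^sub>R sg X p + f p *\<^sub>R br (sg Y) (sg X) p) (sg Z p)"
        by (simp add: C_def sg_scale[OF G(1)] br_leibniz[OF S(2,1) f] an_sg[OF G(2)] ms_def)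
      also have "\<dots> = Y p f * me p (sg X p) (sg Z p) + f p * me p (br (sg Y) (sg X) p) (sg Z p)"
        using m subspace_scale[OF E_subspace] by (simp add: me_add_left me_scale_left)
      also have "\<dots> = f p * C Y X Z p"
        using fun_cong[OF ms_sg[OF G(1,3)], of p] by (simp add: ms_def C_def)
      finally show ?thesis using sk12[OF fX G(2,3), of p] sk12[OF G, of p] by simp
    qed
  qed
qed

abbreviation sev where "sev \<equiv> severa_form A D E \<sigma>"

lemma curvature_dual:
  assumes G: "X \<in> D.G" "Y \<in> D.G" "Z \<in> D.G"
  shows "inv_into (dual_space (D p)) (rs p) (curvature A E \<sigma> X Y p) (Z p) = C X Y Z p"
proof -
  note S = sg_G[OF G(1)] sg_G[OF G(2)] sg_G[OF G(3)]
  have c: "curvature A E \<sigma> X Y p = br (sg X) (sg Y) p - sg (lb X Y) p"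
    by (simp add: curvature_def sg_def)
  have L: "lb X Y \<in> D.G" using lb_G G by blast
  have m: "br (sg X) (sg Y) p \<in> fibre E p" "sg (lb X Y) p \<in> fibre E p" "sg Z p \<in> fibre E p"
    using E.G_mem br_G S sg_G[OF L] by blast+
  have "rh p (curvature A E \<sigma> X Y p) = an (br (sg X) (sg Y)) p - an (sg (lb X Y)) p"
    unfolding c using linear_on_diff[OF rh_linear E_subspace m(1,2)] by (simp add: an_def)
  also have "\<dots> = 0" using anchor_hom[OF S(1,2)] an_sg G L by simp
  finally obtain \<alpha> where \<alpha>: "\<alpha> \<in> dual_space (D p)" "curvature A E \<sigma> X Y p = rs p \<alpha>"
    using ker_rs[of "curvature A E \<sigma> X Y p" p] c subspace_diff[OF E_subspace m(1,2)] by metis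
  have "inj_on (rs p) (dual_space (D p))" using ge by (simp add: generalized_exact_def)
  then have "inv_into (dual_space (D p)) (rs p) (curvature A E \<sigma> X Y p) = \<alpha>" using \<alpha> by simp
  moreover have "\<alpha> (Z p) = me p (rs p \<alpha>) (sg Z p)"
    using rs_me[of p \<alpha> "sg Z p"] \<alpha>(1) m(3) rh_s[OF D.G_mem[OF G(3)]] by (simp add: dual_space_def sg_def)
  moreover have "me p (rs p \<alpha>) (sg Z p) = C X Y Z p - ms (sg (lb X Y)) (sg Z) p"
    unfolding \<alpha>(2)[symmetric] c using me_diff_left[OF m(3,1,2)] by (simp add: C_def ms_def)
  ultimately show ?thesis using ms_sg[OF L G(3)] by simp
qed

lemma sev_value:
  assumes G: "X \<in> D.G" "Y \<in> D.G" "Z \<in> D.G"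
  shows "sev p [X p, Y p, Z p] = C X Y Z p"
proof -
  have "(THE y. \<exists>X'\<in>D.G. \<exists>Y'\<in>D.G. \<exists>Z'\<in>D.G. [X p, Y p, Z p] = [X' p, Y' p, Z' p] \<and>
      y = inv_into (dual_space (D p)) (rs p) (curvature A E \<sigma> X' Y' p) (Z' p)) = C X Y Z p"
  proof (rule the_equality)
    show "\<exists>X'\<in>D.G. \<exists>Y'\<in>D.G. \<exists>Z'\<in>D.G. [X p, Y p, Z p] = [X' p, Y' p, Z' p] \<and>
      C X Y Z p = inv_into (dual_space (D p)) (rs p) (curvature A E \<sigma> X' Y' p) (Z' p)"
      by (rule bexI[OF _ G(1)], rule bexI[OF _ G(2)], rule bexI[OF _ G(3)]) (simp add: curvature_dual G)
    fix y assume "\<exists>X'\<in>D.G. \<exists>Y'\<in>D.G. \<exists>Z'\<in>D.G. [X p, Y p, Z p] = [X' p, Y' p, Z' p] \<and>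
      y = inv_into (dual_space (D p)) (rs p) (curvature A E \<sigma> X' Y' p) (Z' p)"
    then show "y = C X Y Z p"
    proof (elim bexE conjE)
      fix X' Y' Z' assume G': "X' \<in> D.G" "Y' \<in> D.G" "Z' \<in> D.G"
        and "[X p, Y p, Z p] = [X' p, Y' p, Z' p]"
        and y: "y = inv_into (dual_space (D p)) (rs p) (curvature A E \<sigma> X' Y' p) (Z' p)"
      then have "C X' Y' Z' p = C X Y Z p" by (intro alt3_tensorial[OF C_alt3 G' G]) auto
      then show ?thesis using y curvature_dual[OF G'] by simp
    qed
  qed
  then show ?thesis using G D.G_mem by (simp add: severa_form_def D_sections_UNIV)
qed

lemma sev_off: "\<not> (length xs = 3 \<and> set xs \<subseteq> D p) \<Longrightarrow> sev p xs = 0"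
  unfolding severa_form_def by (rule if_not_P)

lemma sev_form: "sev \<in> forms A D 3"
  by (rule alt3_form[OF C_alt3 sev_off sev_value])

lemma ev3_sev: "X \<in> D.G \<Longrightarrow> Y \<in> D.G \<Longrightarrow> Z \<in> D.G \<Longrightarrow> ev3 sev X Y Z = C X Y Z"
  by (auto simp: ev3_def sev_value)

lemma C_closed:
  assumes G: "X \<in> D.G" "Y \<in> D.G" "Z \<in> D.G" "W \<in> D.G"
  shows "d3 C X Y Z W p = 0"
proof -
  note S = sg_G[OF G(1)] sg_G[OF G(2)] sg_G[OF G(3)] sg_G[OF G(4)]
  have an2: "an (br (sg X) (sg Y)) = lb X Y" if "X \<in> D.G" "Y \<in> D.G" for X Y
    using anchor_hom[OF sg_G sg_G] that by (simp add: an_sg)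
  have L: "ms (br (sg X) (br (sg Y) (sg Z))) (sg W) p =
      C X (lb Y Z) W p + X p (C Y Z W) - C Y Z (lb X W) p"
    if G: "X \<in> D.G" "Y \<in> D.G" "Z \<in> D.G" "W \<in> D.G" for X Y Z W
    using bracket_formula[OF sg_G[OF G(1)] br_G[OF sg_G[OF G(2)] sg_G[OF G(3)]] G(4), of p] G
    by (simp add: an2 an_sg ms_sg lb_G act_zero C_def[symmetric])
  have R: "ms (br (br (sg X) (sg Y)) (sg Z)) (sg W) p =
      C (lb X Y) Z W p - Z p (C X Y W) + C X Y (lb Z W) p + W p (C X Y Z)"
    using bracket_formula[OF br_G[OF S(1,2)] S(3) G(4), of p] G
    by (simp add: an2 an_sg ms_sg lb_G act_zero C_def[symmetric])
  have J: "ms (br (sg X) (br (sg Y) (sg Z))) (sg W) p =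
      ms (br (br (sg X) (sg Y)) (sg Z)) (sg W) p + ms (br (sg Y) (br (sg X) (sg Z))) (sg W) p"
    using br_jacobi[OF S(1-3)] ms_add_left[OF br_G[OF br_G[OF S(1,2)] S(3)] br_G[OF S(2) br_G[OF S(1,3)]] S(4)]
    by (simp add: plus_fun_def)
  note sk = fun_cong[OF alt3_skew12[OF C_alt3], of _ _ _ p] fun_cong[OF alt3_skew23[OF C_alt3], of _ _ _ p]
  have "C Y Z (lb X W) p = C (lb X W) Y Z p" "C X Z (lb Y W) p = C (lb Y W) X Z p"
      "C X Y (lb Z W) p = C (lb Z W) X Y p" "C X (lb Y Z) W p = - C (lb Y Z) X W p"
      "C Y (lb X Z) W p = - C (lb X Z) Y W p"
    using sk(2)[of Y Z "lb X W"] sk(1)[of Y "lb X W" Z] sk(2)[of X Z "lb Y W"] sk(1)[of X "lb Y W" Z]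
      sk(2)[of X Y "lb Z W"] sk(1)[of X "lb Z W" Y] sk(1)[of X "lb Y Z" W] sk(1)[of Y "lb X Z" W] G lb_G
    by auto
  then show ?thesis using J L[OF G] L[OF G(2,1,3,4)] R by (simp add: d3_def)
qed

lemma sev_closed: "sev \<in> closed_forms A D 3"
  unfolding closed3_iff using sev_form d3_cong[OF ev3_sev] C_closed by simp

end


subsection \<open>Change of splitting\<close>

locale two_splittings = S: gexact_split A D E \<sigma> + S': gexact_split A D E \<sigma>'
  for A :: "('m::{t2_space, second_countable_topology}, 'v::real_inner) atlas"
    and D :: "'m \<Rightarrow> 'm tvec set" and E :: "('m, 'e::real_vector) courant"
    and \<sigma> \<sigma>' :: "'m \<Rightarrow> 'm tvec \<Rightarrow> 'e"
begin

definition B :: "'m \<Rightarrow> 'm tvec list \<Rightarrow> real" where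
  "B p xs = (if length xs = 2 \<and> set xs \<subseteq> D p then metric E p (\<sigma>' p (xs ! 0)) (\<sigma> p (xs ! 1)) else 0)"

lemma B_value: "x \<in> D p \<Longrightarrow> y \<in> D p \<Longrightarrow> B p [x, y] = metric E p (\<sigma>' p x) (\<sigma> p y)"
  by (simp add: B_def)

lemma B_skew:
  assumes x: "x \<in> D p" and y: "y \<in> D p"
  shows "B p [x, y] = - B p [y, x]"
proof -
  note m = S.s_mem[OF x] S.s_mem[OF y] S'.s_mem[OF x] S'.s_mem[OF y]
  have k: "S.rh p (\<sigma>' p x - \<sigma> p x) = 0" "S.rh p (\<sigma>' p y - \<sigma> p y) = 0"
    using linear_on_diff[OF S.rh_linear S.E_subspace] m S.rh_s S'.rh_s x y by simp_all
  have "S.me p (\<sigma>' p x - \<sigma> p x) (\<sigma>' p y - \<sigma> p y) = 0"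
    using S.ker_isotropic k m subspace_diff[OF S.E_subspace] by blast
  then have "S.me p (\<sigma>' p x) (\<sigma> p y) + S.me p (\<sigma> p x) (\<sigma>' p y) = 0"
    using m S.s_iso[OF x y] S'.s_iso[OF x y] subspace_diff[OF S.E_subspace]
    by (simp add: S.me_diff S.me_diff_left)
  then show ?thesis using B_value x y S.me_sym[OF m(1,4)] by simp
qed

lemma B_form: "B \<in> forms A D 2"
  unfolding S.forms_iff
proof (intro conjI allI impI; (elim conjE)?)
  fix p xs assume "\<not> (length xs = 2 \<and> set xs \<subseteq> D p)"
  then show "B p xs = 0" unfolding B_def by (rule if_not_P)
next
  have lin: "linear_on (D p) (\<lambda>x. B p [x, y])" if y: "y \<in> D p" for p y
    using y by (simp add: linear_on_def B_value subspace_add[OF S.D_subspace] subspace_scale[OF S.D_subspace]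
      linear_on_add[OF S'.s_linear] linear_on_scale[OF S'.s_linear] S.me_add_left S.me_scale_left
      S.s_mem S'.s_mem)
  have lin2: "linear_on (D p) (\<lambda>x. B p [y, x])" if y: "y \<in> D p" for p y
    using y by (simp add: linear_on_def B_value subspace_add[OF S.D_subspace] subspace_scale[OF S.D_subspace]
      linear_on_add[OF S.s_linear] linear_on_scale[OF S.s_linear] S.me_add S.me_scale S.s_mem S'.s_mem)
  fix p xs assume "length xs = 2" "set xs \<subseteq> D p"
  then obtain x y where xs: "xs = [x, y]" "x \<in> D p" "y \<in> D p"
    by (auto simp: eval_nat_numeral length_Suc_conv)
  show "linear_on (D p) (\<lambda>x. B p (xs[i := x]))" if "i < 2" for i
  proof -
    have "i = 0 \<or> i = Suc 0" using that by auto
    then show ?thesis using lin lin2 xs by auto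
  qed
  show "B p xs = 0" if "\<not> distinct xs"
    using that xs B_skew[of x p y] by auto
next
  fix p Xs assume Xs: "length Xs = 2" "\<forall>X\<in>set Xs. S.SD p X"
  then obtain X Y where l: "Xs = [X, Y]" by (auto simp: eval_nat_numeral length_Suc_conv)
  have SX: "S.SD p X" "S.SD p Y" using Xs l by auto
  have "\<forall>\<^sub>F q in nhds p. S.ms (\<lambda>q. \<sigma>' q (X q)) (\<lambda>q. \<sigma> q (Y q)) q = B q (map (\<lambda>X. X q) Xs)"
    using S.SD_eventually[OF SX(1)] S.SD_eventually[OF SX(2)]
    by eventually_elim (use l S.SD_mem B_value in \<open>simp add: S.ms_def\<close>)
  then show "S.sm p (\<lambda>q. B q (map (\<lambda>X. X q) Xs))"
    by (rule S.sm_cong) (intro S.ms_smooth S.s_smooth S'.s_smooth SX)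
qed

lemma C_change:
  assumes G: "X \<in> S.D.G" "Y \<in> S.D.G" "Z \<in> S.D.G"
  shows "S'.C X Y Z p = S.C X Y Z p + S.d2 (S.ev2 B) X Y Z p"
proof -
  note S' = S'.sg_G[OF G(1)] S'.sg_G[OF G(2)] S'.sg_G[OF G(3)]
  note an' = S'.an_sg[OF G(1)] S'.an_sg[OF G(2)] S'.an_sg[OF G(3)]
  have Bm: "S.ms (S'.sg X) (S.sg Y) = S.ev2 B X Y" if "X \<in> S.D.G" "Y \<in> S.D.G" for X Y
    using that S.D.G_mem by (auto simp: S.ms_def S.ev2_def B_value S.sg_def S'.sg_def)
  define w where "w = S.br (S'.sg X) (S'.sg Y)"
  have w: "w \<in> S.E.G" "S.an w = S.lb X Y"
    using S.br_G S.anchor_hom S' an' by (simp_all add: w_def)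
  define a where "a = (\<lambda>q. S'.sg Z q - S.sg Z q)"
  have a: "a \<in> S.E.G" "S.an a = (\<lambda>q. 0)"
    using S.E.G_diff[OF S'(3) S.sg_G[OF G(3)]] S.an_diff[OF S'(3) S.sg_G[OF G(3)]] an' S.an_sg[OF G(3)]
    by (simp_all add: a_def)
  have ma: "S.ms a (S.sg (S.lb X Y)) = S.ev2 B Z (S.lb X Y)"
    unfolding a_def using S.ms_diff_left[OF S'(3) S.sg_G[OF G(3)] S.sg_G[OF S.lb_G[OF G(1,2)]]]
      S.ms_sg[OF G(3) S.lb_G[OF G(1,2)]] Bm[OF G(3) S.lb_G[OF G(1,2)]] by simp
  have "S'.C X Y Z p = S.ms w (\<lambda>q. S.sg Z q + a q) p"
    by (simp add: S'.C_def w_def a_def)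
  also have "\<dots> = S.ms w (S.sg Z) p + S.ms w a p"
    using S.ms_add[OF S.sg_G[OF G(3)] a(1) w(1)] by simp
  also have "S.ms w a p = S.ev2 B Z (S.lb X Y) p"
    using S.ms_ker[OF a(1) w(1), of p] S.ms_sym[OF w(1) a(1)] a(2) w(2) ma by simp
  also have "S.ms w (S.sg Z) p = S.C X Y Z p + X p (S.ev2 B Y Z) - S.ev2 B Y (S.lb X Z) p
      - Y p (S.ev2 B X Z) + S.ev2 B X (S.lb Y Z) p + Z p (S.ev2 B X Y)"
    unfolding w_def using S.bracket_formula[OF S'(1,2) G(3), of p] an' Bm G S.lb_G by simp
  finally show ?thesis
    using fun_cong[OF S.alt2_skew[OF S.alt2_ev2[OF B_form]], of Z "S.lb X Y" p]
      fun_cong[OF S.alt2_skew[OF S.alt2_ev2[OF B_form]], of Y "S.lb X Z" p]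
      fun_cong[OF S.alt2_skew[OF S.alt2_ev2[OF B_form]], of X "S.lb Y Z" p] G S.lb_G
    by (simp add: S.d2_def)
qed

lemma sev_change: "S'.sev - S.sev = ext_d A D 2 B"
proof (rule S.form_eqI3)
  fix p xs assume "\<not> (length xs = 3 \<and> set xs \<subseteq> D p)"
  then show "(S'.sev - S.sev) p xs = ext_d A D 2 B p xs"
    using S.sev_off[of xs p] S'.sev_off[of xs p] S.ext_d_off[of xs 2 p] by simp
next
  fix p X Y Z assume "X \<in> S.D.G" "Y \<in> S.D.G" "Z \<in> S.D.G"
  then show "(S'.sev - S.sev) p [X p, Y p, Z p] = ext_d A D 2 B p [X p, Y p, Z p]"
    using C_change[of X Y Z p] by (simp add: S.sev_value S'.sev_value S.ext_d2[OF B_form])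
qed

lemma coh_class_change: "coh_class A D 3 S.sev = coh_class A D 3 S'.sev"
  unfolding S.coh_class_eq_iff[OF S.sev_closed S'.sev_closed] S.exact3 using sev_change B_form by blast

end

lemma (in gexact_split) severa_class_eq: "severa_class A D E = coh_class A D 3 sev"
  unfolding severa_class_def
proof (rule the_equality)
  show "\<exists>\<sigma>'. isotropic_splitting A D E \<sigma>' \<and> coh_class A D 3 sev = coh_class A D 3 (severa_form A D E \<sigma>')"
    using iso_spl by blast
  fix c assume "\<exists>\<sigma>'. isotropic_splitting A D E \<sigma>' \<and> c = coh_class A D 3 (severa_form A D E \<sigma>')"
  then obtain \<sigma>' where s: "isotropic_splitting A D E \<sigma>'" "c = coh_class A D 3 (severa_form A D E \<sigma>')" by blast
  interpret T: two_splittings A D E \<sigma> \<sigma>'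
    by (intro two_splittings.intro gexact_split.intro gexact_split_axioms.intro gexact_axioms iso_spl s)
  show "c = coh_class A D 3 sev" using s(2) T.coh_class_change by simp
qed

subsection \<open>Existence of isotropic splittings\<close>

context gexact
begin

lemma splitting_linear: "splitting \<sigma> \<Longrightarrow> linear_on (D p) (\<sigma> p)"
  and splitting_mem: "splitting \<sigma> \<Longrightarrow> x \<in> D p \<Longrightarrow> \<sigma> p x \<in> fibre E p"
  and splitting_rh: "splitting \<sigma> \<Longrightarrow> x \<in> D p \<Longrightarrow> rh p (\<sigma> p x) = x"
  and splitting_smooth: "splitting \<sigma> \<Longrightarrow> SD p X \<Longrightarrow> SE p (\<lambda>q. \<sigma> q (X q))"
  by (simp_all add: splitting_def)

lemma local_splitting:
  "\<exists>U \<sigma>. open U \<and> p \<in> U \<and> (\<forall>q\<in>U. linear_on (D q) (\<sigma> q) \<and>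
     (\<forall>x\<in>D q. \<sigma> q x \<in> fibre E q \<and> rh q (\<sigma> q x) = x) \<and>
     (\<forall>X. SD q X \<longrightarrow> SE q (\<lambda>z. \<sigma> z (X z))))"
proof -
  obtain U e c where U: "open U" "p \<in> U" and e: "\<And>q i. q \<in> U \<Longrightarrow> i < rD \<Longrightarrow> SD q (e i)"
    and span: "\<And>q v. q \<in> U \<Longrightarrow> v \<in> D q \<Longrightarrow> v = (\<Sum>i<rD. c q v i *\<^sub>R e i q)"
    and indep: "\<And>q x. q \<in> U \<Longrightarrow> (\<Sum>i<rD. x i *\<^sub>R e i q) = 0 \<Longrightarrow> \<forall>i<rD. x i = 0"
    and lin: "\<And>q i. q \<in> U \<Longrightarrow> i < rD \<Longrightarrow> linear_on (D q) (\<lambda>v. c q v i)"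
    and csm: "\<And>q s i. q \<in> U \<Longrightarrow> SD q s \<Longrightarrow> i < rD \<Longrightarrow> sm q (\<lambda>z. c z (s z) i)"
    by (rule D.local_frame[of p]) blast
  have inU: "\<forall>\<^sub>F q in nhds p. q \<in> U" using U eventually_nhds_in_open by blast
  define M where "M = {u. (\<forall>l<rD. sm p (u l)) \<and>
    (\<exists>s. SE p s \<and> (\<forall>\<^sub>F q in nhds p. an s q = (\<Sum>l<rD. u l q *\<^sub>R e l q)))}"
  have "\<forall>k<rD. \<exists>u\<in>M. \<forall>\<^sub>F q in nhds p. \<forall>l<rD. u l q = (if l = k then 1 else 0)"
  proof (rule germ_dual_rows)
    show "sm p (u l)" if "u \<in> M" "l < rD" for u l using that by (simp add: M_def)
  next
    fix u v assume "u \<in> M" "v \<in> M"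
    then obtain s t where s: "\<forall>l<rD. sm p (u l)" "SE p s" "\<forall>\<^sub>F q in nhds p. an s q = (\<Sum>l<rD. u l q *\<^sub>R e l q)"
      and t: "\<forall>l<rD. sm p (v l)" "SE p t" "\<forall>\<^sub>F q in nhds p. an t q = (\<Sum>l<rD. v l q *\<^sub>R e l q)"
      by (auto simp: M_def)
    have "\<forall>\<^sub>F q in nhds p. an (\<lambda>q. s q + t q) q = (\<Sum>l<rD. (u l q + v l q) *\<^sub>R e l q)"
      using s(3) t(3) SE_eventually[OF s(2)] SE_eventually[OF t(2)]
    proof eventually_elim
      case (elim q)
      have "an (\<lambda>q. s q + t q) q = an s q + an t q"
        using linear_on_add[OF rh_linear SE_mem[OF elim(3)] SE_mem[OF elim(4)]] by (simp add: an_def)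
      then show ?case using elim(1,2) by (simp add: scaleR_add_left sum.distrib)
    qed
    then show "(\<lambda>l q. u l q + v l q) \<in> M"
      unfolding M_def using s(1) t(1) E.S_add[OF s(2) t(2)] by (auto simp: sm_add)
  next
    fix f u assume f: "sm p f" and "u \<in> M"
    then obtain s where s: "\<forall>l<rD. sm p (u l)" "SE p s" "\<forall>\<^sub>F q in nhds p. an s q = (\<Sum>l<rD. u l q *\<^sub>R e l q)"
      by (auto simp: M_def)
    have "\<forall>\<^sub>F q in nhds p. an (\<lambda>q. f q *\<^sub>R s q) q = (\<Sum>l<rD. (f q * u l q) *\<^sub>R e l q)"
      using s(3) SE_eventually[OF s(2)]
    proof eventually_elim
      case (elim q)
      have "an (\<lambda>q. f q *\<^sub>R s q) q = f q *\<^sub>R an s q"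
        using linear_on_scale[OF rh_linear SE_mem[OF elim(2)]] by (simp add: an_def)
      then show ?case using elim(1) by (simp add: scaleR_sum_right)
    qed
    then show "(\<lambda>l q. f q * u l q) \<in> M"
      unfolding M_def using f s(1) E.S_scale[OF f s(2)] by (auto simp: sm_mult)
  next
    fix x assume x: "\<And>u. u \<in> M \<Longrightarrow> (\<Sum>l<rD. u l p * x l) = 0"
    show "\<forall>l<rD. x l = 0"
    proof (intro allI impI)
      fix k assume k: "k < rD"
      have "e k p \<in> D p" using SD_mem[OF e[OF U(2) k]] .
      then have "e k p \<in> rh p ` fibre E p" using rh_image[of p] by simp
      then obtain v where v: "v \<in> fibre E p" "rh p v = e k p" by (metis imageE)
      obtain s where s: "s \<in> E.G" "s p = v" using E.G_value[OF v(1)] .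
      have S: "SD p (an s)" using an_SD[OF E.G_S[OF s(1)]] .
      define u where "u l q = c q (an s q) l" for l q
      have "\<forall>\<^sub>F q in nhds p. an s q = (\<Sum>l<rD. u l q *\<^sub>R e l q)"
        using inU SD_eventually[OF S] by eventually_elim (use span SD_mem in \<open>unfold u_def, blast\<close>)
      moreover have "sm p (u l)" if "l < rD" for l unfolding u_def by (rule csm[OF U(2) S that])
      ultimately have "u \<in> M" unfolding M_def using E.G_S[OF s(1)] by blast
      then have 0: "(\<Sum>l<rD. u l p * x l) = 0" by (rule x)
      have "an s p = e k p" using s v by (simp add: an_def)
      then have e1: "(\<Sum>l<rD. u l p *\<^sub>R e l p) = e k p"
        using span[OF U(2) an_mem[OF s(1)]] by (simp add: u_def)
      have "(\<Sum>l<rD. (if l = k then 1 else 0) *\<^sub>R e l p) = (\<Sum>l<rD. if l = k then e l p else 0)"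
        by (rule sum.cong) auto
      then have e2: "(\<Sum>l<rD. (if l = k then 1 else 0) *\<^sub>R e l p) = e k p" using k by simp
      have "(\<Sum>l<rD. (u l p - (if l = k then 1 else 0)) *\<^sub>R e l p) = 0"
        unfolding scaleR_diff_left sum_subtractf e1 e2 by simp
      then have "\<forall>l<rD. u l p - (if l = k then 1 else 0) = 0" by (rule indep[OF U(2)])
      then have "(\<Sum>l<rD. u l p * x l) = (\<Sum>l<rD. if l = k then x l else 0)"
        by (intro sum.cong) auto
      then show "x k = 0" using 0 k by simp
    qed
  qed
  then have "\<forall>k. \<exists>s. k < rD \<longrightarrow> SE p s \<and> (\<forall>\<^sub>F q in nhds p. an s q = e k q)"
  proof (intro allI)
    fix k assume *: "\<forall>k<rD. \<exists>u\<in>M. \<forall>\<^sub>F q in nhds p. \<forall>l<rD. u l q = (if l = k then 1 else 0)"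
    show "\<exists>s. k < rD \<longrightarrow> SE p s \<and> (\<forall>\<^sub>F q in nhds p. an s q = e k q)"
    proof (cases "k < rD")
      case True
      then obtain u s where s: "SE p s" "\<forall>\<^sub>F q in nhds p. an s q = (\<Sum>l<rD. u l q *\<^sub>R e l q)"
        "\<forall>\<^sub>F q in nhds p. \<forall>l<rD. u l q = (if l = k then 1 else 0)" using * by (auto simp: M_def)
      from s(2,3) have "\<forall>\<^sub>F q in nhds p. an s q = e k q"
      proof eventually_elim
        case (elim q)
        have "(\<Sum>l<rD. u l q *\<^sub>R e l q) = (\<Sum>l<rD. if l = k then e l q else 0)"
          by (rule sum.cong) (use elim(2) in auto)
        then show ?case using elim(1) True by simp
      qed
      then show ?thesis using s(1) by blast
    qed simp
  qed
  then obtain s where s: "\<And>k. k < rD \<Longrightarrow> SE p (s k)" "\<And>k. k < rD \<Longrightarrow> \<forall>\<^sub>F q in nhds p. an (s k) q = e k q"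
    by (subst (asm) choice_iff) blast
  have "\<forall>\<^sub>F q in nhds p. \<forall>k\<in>{..<rD}. SE q (s k)"
    using s(1) SE_eventually by (simp add: eventually_ball_finite_distrib)
  moreover have "\<forall>\<^sub>F q in nhds p. \<forall>k\<in>{..<rD}. an (s k) q = e k q"
    using s(2) by (simp add: eventually_ball_finite_distrib)
  ultimately have "\<forall>\<^sub>F q in nhds p. q \<in> U \<and> (\<forall>k<rD. SE q (s k) \<and> an (s k) q = e k q)"
    using inU by eventually_elim auto
  then obtain V where V: "open V" "p \<in> V" "\<And>q. q \<in> V \<Longrightarrow> q \<in> U"
    "\<And>q k. q \<in> V \<Longrightarrow> k < rD \<Longrightarrow> SE q (s k)" "\<And>q k. q \<in> V \<Longrightarrow> k < rD \<Longrightarrow> an (s k) q = e k q"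
    by (auto simp: eventually_nhds)
  define \<sigma> where "\<sigma> q x = (\<Sum>k<rD. c q x k *\<^sub>R s k q)" for q x
  show ?thesis
  proof (intro exI[of _ V] exI[of _ \<sigma>] conjI ballI allI impI V(1,2))
    fix q assume q: "q \<in> V"
    have sm: "s k q \<in> fibre E q" if "k < rD" for k using SE_mem V(4)[OF q that] by blast
    show "linear_on (D q) (\<sigma> q)"
      using lin[OF V(3)[OF q]] unfolding \<sigma>_def
      by (simp add: linear_on_def scaleR_add_left sum.distrib scaleR_sum_right)
    show "\<sigma> q x \<in> fibre E q" for x
      unfolding \<sigma>_def using sm by (intro subspace_sum subspace_scale E_subspace) auto
    show "rh q (\<sigma> q x) = x" if "x \<in> D q" for x
    proof -
      have "rh q (\<sigma> q x) = (\<Sum>k<rD. c q x k *\<^sub>R rh q (s k q))"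
        unfolding \<sigma>_def by (rule linear_on_sum[OF rh_linear E_subspace]) (use sm in auto)
      also have "\<dots> = (\<Sum>k<rD. c q x k *\<^sub>R e k q)" using V(5)[OF q] by (simp add: an_def)
      finally show ?thesis using span[OF V(3)[OF q] that] by simp
    qed
    show "SE q (\<lambda>z. \<sigma> z (X z))" if "SD q X" for X
      unfolding \<sigma>_def using csm[OF V(3)[OF q] that] V(4)[OF q] by (intro E.S_sum E.S_scale) auto
  qed
qed

lemma splitting_exists: "\<exists>\<sigma>. splitting \<sigma>"
proof -
  have "\<exists>U. \<forall>p. \<exists>\<sigma>. open (U p) \<and> p \<in> U p \<and> (\<forall>q\<in>U p. linear_on (D q) (\<sigma> q) \<and>
     (\<forall>x\<in>D q. \<sigma> q x \<in> fibre E q \<and> rh q (\<sigma> q x) = x) \<and>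
     (\<forall>X. SD q X \<longrightarrow> SE q (\<lambda>z. \<sigma> z (X z))))"
    by (rule choice, rule allI, rule local_splitting)
  then obtain U where "\<forall>p. \<exists>\<sigma>. open (U p) \<and> p \<in> U p \<and> (\<forall>q\<in>U p. linear_on (D q) (\<sigma> q) \<and>
     (\<forall>x\<in>D q. \<sigma> q x \<in> fibre E q \<and> rh q (\<sigma> q x) = x) \<and>
     (\<forall>X. SD q X \<longrightarrow> SE q (\<lambda>z. \<sigma> z (X z))))" by (rule exE)
  then have "\<exists>\<sigma>. \<forall>p. open (U p) \<and> p \<in> U p \<and> (\<forall>q\<in>U p. linear_on (D q) (\<sigma> p q) \<and>
     (\<forall>x\<in>D q. \<sigma> p q x \<in> fibre E q \<and> rh q (\<sigma> p q x) = x) \<and>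
     (\<forall>X. SD q X \<longrightarrow> SE q (\<lambda>z. \<sigma> p z (X z))))" by (rule choice)
  then obtain \<sigma>' where Q: "\<forall>p. open (U p) \<and> p \<in> U p \<and> (\<forall>q\<in>U p. linear_on (D q) (\<sigma>' p q) \<and>
     (\<forall>x\<in>D q. \<sigma>' p q x \<in> fibre E q \<and> rh q (\<sigma>' p q x) = x) \<and>
     (\<forall>X. SD q X \<longrightarrow> SE q (\<lambda>z. \<sigma>' p z (X z))))" by (rule exE)
  have U: "open (U p)" "p \<in> U p" for p using Q by simp_all
  have lin': "linear_on (D q) (\<sigma>' p q)" if "q \<in> U p" for p q using Q that by simp
  have mem': "\<sigma>' p q x \<in> fibre E q" if "q \<in> U p" "x \<in> D q" for p q x using Q that by simp
  have rh': "rh q (\<sigma>' p q x) = x" if "q \<in> U p" "x \<in> D q" for p q x using Q that by simp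
  have sm': "SE q (\<lambda>z. \<sigma>' p z (X z))" if "q \<in> U p" "SD q X" for p q X using Q that by simp
  obtain h :: "nat \<Rightarrow> 'm \<Rightarrow> real" and c V where h: "\<And>n q. sm q (h n)" and V: "\<And>n. open (V n)" "(\<Union>n. V n) = UNIV"
    and h0: "\<And>m n q. q \<in> V m \<Longrightarrow> n > m \<Longrightarrow> h n q = 0"
    and h1: "\<And>m q. q \<in> V m \<Longrightarrow> (\<Sum>n\<le>m. h n q) = 1"
    and hs: "\<And>n q. q \<notin> U (c n) \<Longrightarrow> \<forall>\<^sub>F z in nhds q. h n z = 0"
    by (rule partition_of_unity[of U, OF conjI[OF U]]) blast
  define N where "N q = (LEAST m. q \<in> V m)" for q
  have N: "q \<in> V (N q)" for q
  proof -
    have "\<exists>m. q \<in> V m" using V(2) by blast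
    then show ?thesis unfolding N_def by (rule LeastI_ex)
  qed
  define \<sigma> where "\<sigma> q x = (\<Sum>n\<le>N q. h n q *\<^sub>R \<sigma>' (c n) q x)" for q x
  have \<sigma>V: "\<sigma> q x = (\<Sum>n\<le>m. h n q *\<^sub>R \<sigma>' (c n) q x)" if "q \<in> V m" for q x m
  proof -
    have "N q \<le> m" unfolding N_def by (rule Least_le[of "\<lambda>m. q \<in> V m", OF that])
    then show ?thesis unfolding \<sigma>_def using h0[OF N]
      by (intro sum.mono_neutral_left) auto
  qed
  have hz: "h n q = 0" if "q \<notin> U (c n)" for n q using hs[OF that] eventually_nhds_x_imp_x by blast
  have hlin: "linear_on (D q) (\<lambda>x. h n q *\<^sub>R \<sigma>' (c n) q x)" for n q
    using lin'[of q "c n"] hz[of q n] by (cases "q \<in> U (c n)") (simp_all add: linear_on_def scaleR_add_right)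
  have hmem: "h n q *\<^sub>R \<sigma>' (c n) q x \<in> fibre E q" if "x \<in> D q" for n q x
    using mem'[of q "c n" x] hz[of q n] that subspace_scale[OF E_subspace] subspace_0[OF E_subspace]
    by (cases "q \<in> U (c n)") simp_all
  have hrh: "rh q (h n q *\<^sub>R \<sigma>' (c n) q x) = h n q *\<^sub>R x" if "x \<in> D q" for n q x
    using linear_on_scale[OF rh_linear mem'[of q "c n" x]] rh'[of q "c n" x] hz[of q n] that
      linear_on_zero[OF rh_linear E_subspace] by (cases "q \<in> U (c n)") simp_all
  have "splitting \<sigma>"
    unfolding splitting_def
  proof (intro conjI allI ballI impI)
    fix p
    show "linear_on (D p) (\<sigma> p)"
      using hlin[of p] unfolding \<sigma>_def linear_on_def by (simp add: sum.distrib scaleR_sum_right)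
    fix x assume x: "x \<in> D p"
    show "\<sigma> p x \<in> fibre E p" unfolding \<sigma>_def by (intro subspace_sum E_subspace hmem x)
    have "rh p (\<sigma> p x) = (\<Sum>n\<le>N p. 1 *\<^sub>R rh p (h n p *\<^sub>R \<sigma>' (c n) p x))"
      using linear_on_sum[OF rh_linear E_subspace, of "{..N p}" "\<lambda>n. h n p *\<^sub>R \<sigma>' (c n) p x" p "\<lambda>_. 1"] hmem[OF x]
      by (simp add: \<sigma>_def)
    also have "\<dots> = (\<Sum>n\<le>N p. h n p) *\<^sub>R x" using hrh[OF x] by (simp add: scaleR_sum_left)
    finally show "rh p (\<sigma> p x) = x" using h1[OF N] by simp
  next
    fix p X assume X: "SD p X"
    have "SE p (\<lambda>q. h n q *\<^sub>R \<sigma>' (c n) q (X q))" for n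
    proof (cases "p \<in> U (c n)")
      case True
      then show ?thesis by (intro E.S_scale h sm' X)
    next
      case False
      show ?thesis by (rule E.S_cong[OF E.S_zero]) (use hs[OF False] in \<open>eventually_elim, simp\<close>)
    qed
    then have "SE p (\<lambda>q. \<Sum>n\<le>N p. h n q *\<^sub>R \<sigma>' (c n) q (X q))" by (intro E.S_sum)
    moreover have "\<forall>\<^sub>F q in nhds p. (\<Sum>n\<le>N p. h n q *\<^sub>R \<sigma>' (c n) q (X q)) = \<sigma> q (X q)"
      using eventually_nhds_in_open[OF V(1) N[of p]] by eventually_elim (simp add: \<sigma>V)
    ultimately show "SE p (\<lambda>q. \<sigma> q (X q))" by (rule E.S_cong)
  qed
  then show ?thesis by blast
qed

lemma splitting_shift:
  assumes \<sigma>: "splitting \<sigma>"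
    and lin: "\<And>p x. x \<in> D p \<Longrightarrow> linear_on (D p) (b p x)"
    and lin2: "\<And>p y. y \<in> D p \<Longrightarrow> linear_on (D p) (\<lambda>x. b p x y)"
    and sm: "\<And>p X Y. SD p X \<Longrightarrow> SD p Y \<Longrightarrow> sm p (\<lambda>q. b q (X q) (Y q))"
  defines "\<sigma>' \<equiv> \<lambda>p x. \<sigma> p x + rs p (b p x)"
  shows "splitting \<sigma>'"
    and "x \<in> D p \<Longrightarrow> y \<in> D p \<Longrightarrow> me p (\<sigma>' p x) (\<sigma> p y) = me p (\<sigma> p x) (\<sigma> p y) + b p x y"
    and "x \<in> D p \<Longrightarrow> y \<in> D p \<Longrightarrow> me p (\<sigma>' p x) (\<sigma>' p y) = me p (\<sigma> p x) (\<sigma> p y) + b p x y + b p y x"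
proof -
  note sl = splitting_linear[OF \<sigma>] and smm = splitting_mem[OF \<sigma>] and sr = splitting_rh[OF \<sigma>]
  have rm: "rs p (b p x) \<in> fibre E p" if "x \<in> D p" for p x using rs_mem lin[OF that] by blast
  have rl: "linear_on (D p) (\<lambda>x. rs p (b p x))" for p
  proof (rule linear_onI)
    fix x y assume x: "x \<in> D p" "y \<in> D p"
    show "rs p (b p (x + y)) = rs p (b p x) + rs p (b p y)"
    proof (rule rs_eqI)
      show "rs p (b p x) + rs p (b p y) \<in> fibre E p" using rm x subspace_add[OF E_subspace] by blast
      show "me p (rs p (b p x) + rs p (b p y)) w = b p (x + y) (rh p w)" if w: "w \<in> fibre E p" for w
        using me_add_left[OF w rm rm] rs_me[OF lin w] linear_on_add[OF lin2[OF rh_mem[OF w]]] x by simp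
    qed
  next
    fix a x assume x: "x \<in> D p"
    show "rs p (b p (a *\<^sub>R x)) = a *\<^sub>R rs p (b p x)"
    proof (rule rs_eqI)
      show "a *\<^sub>R rs p (b p x) \<in> fibre E p" using rm x subspace_scale[OF E_subspace] by blast
      show "me p (a *\<^sub>R rs p (b p x)) w = b p (a *\<^sub>R x) (rh p w)" if w: "w \<in> fibre E p" for w
        using me_scale_left[OF w rm] rs_me[OF lin w] linear_on_scale[OF lin2[OF rh_mem[OF w]]] x by simp
    qed
  qed
  have m1: "me p (rs p (b p x)) (\<sigma> p y) = b p x y" if "x \<in> D p" "y \<in> D p" for p x y
    using rs_me[OF lin[OF that(1)] smm[OF that(2)]] sr[OF that(2)] by simp
  show "splitting \<sigma>'"
    unfolding splitting_def
  proof (intro conjI allI ballI impI)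
    fix p
    show "linear_on (D p) (\<sigma>' p)"
      using sl[of p] rl[of p] unfolding \<sigma>'_def linear_on_def by (simp add: scaleR_add_right)
    fix x assume x: "x \<in> D p"
    show "\<sigma>' p x \<in> fibre E p" unfolding \<sigma>'_def using smm[OF x] rm[OF x] subspace_add[OF E_subspace] by blast
    show "rh p (\<sigma>' p x) = x"
      unfolding \<sigma>'_def using linear_on_add[OF rh_linear smm[OF x] rm[OF x]] sr[OF x] rh_rs[OF lin[OF x]] by simp
  next
    fix p X assume X: "SD p X"
    obtain X' where X': "X' \<in> D.G" "\<forall>\<^sub>F q in nhds p. X' q = X q" using D.G_extend[OF X] .
    have "SE p (\<lambda>q. \<sigma> q (X' q) + rs q (b q (X' q)))"
      by (rule E.S_add[OF splitting_smooth[OF \<sigma> D.G_S[OF X'(1)]]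
            rs_smooth[OF lin[OF D.G_mem[OF X'(1)]] sm[OF D.G_S[OF X'(1)]]]])
    moreover have "\<forall>\<^sub>F q in nhds p. \<sigma> q (X' q) + rs q (b q (X' q)) = \<sigma>' q (X q)"
      using X'(2) by eventually_elim (simp add: \<sigma>'_def)
    ultimately show "SE p (\<lambda>q. \<sigma>' q (X q))" by (rule E.S_cong)
  qed
  assume x: "x \<in> D p" and y: "y \<in> D p"
  show 1: "me p (\<sigma>' p x) (\<sigma> p y) = me p (\<sigma> p x) (\<sigma> p y) + b p x y"
    unfolding \<sigma>'_def using me_add_left[OF smm[OF y] smm[OF x] rm[OF x]] m1[OF x y] by simp
  have "me p (rs p (b p x)) (rs p (b p y)) = 0"
    using ker_isotropic rm x y rh_rs lin by blast
  moreover have "me p (\<sigma> p x) (rs p (b p y)) = b p y x" using me_sym[OF smm[OF x] rm[OF y]] m1[OF y x] by simp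
  ultimately have "me p (\<sigma>' p x) (rs p (b p y)) = b p y x"
    unfolding \<sigma>'_def using me_add_left[OF rm[OF y] smm[OF x] rm[OF x]] by simp
  moreover have "\<sigma>' p x \<in> fibre E p"
    unfolding \<sigma>'_def using smm[OF x] rm[OF x] subspace_add[OF E_subspace] by blast
  ultimately show "me p (\<sigma>' p x) (\<sigma>' p y) = me p (\<sigma> p x) (\<sigma> p y) + b p x y + b p y x"
    using me_add[OF _ smm[OF y] rm[OF y]] 1 by (simp add: \<sigma>'_def)
qed

lemma isotropic_splitting_exists: "\<exists>\<sigma>. isotropic_splitting A D E \<sigma>"
proof -
  obtain \<sigma> where \<sigma>: "splitting \<sigma>" using splitting_exists by blast
  define b where "b p x y = - (1/2) * me p (\<sigma> p x) (\<sigma> p y)" for p x y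
  note sl = linear_on_add[OF splitting_linear[OF \<sigma>]] linear_on_scale[OF splitting_linear[OF \<sigma>]]
    and sm = splitting_mem[OF \<sigma>]
  have 1: "linear_on (D p) (b p x)" if "x \<in> D p" for p x
    using that sl sm by (simp add: linear_on_def b_def me_add me_scale distrib_left)
  have 2: "linear_on (D p) (\<lambda>x. b p x y)" if "y \<in> D p" for p y
    using that sl sm by (simp add: linear_on_def b_def me_add_left me_scale_left add_divide_distrib)
  have 3: "sm p (\<lambda>q. b q (X q) (Y q))" if "SD p X" "SD p Y" for p X Y
    using ms_smooth[OF splitting_smooth[OF \<sigma> that(1)] splitting_smooth[OF \<sigma> that(2)]]
    unfolding b_def ms_def by (intro sm_mult sm_const)
  have 4: "me p (\<sigma> p x) (\<sigma> p y) + b p x y + b p y x = 0" if "x \<in> D p" "y \<in> D p" for p x y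
    using me_sym[OF sm sm] that by (simp add: b_def)
  show ?thesis
  proof (intro exI)
    show "isotropic_splitting A D E (\<lambda>p x. \<sigma> p x + rs p (b p x))"
      unfolding isotropic_splitting_iff
    proof (intro conjI allI ballI)
      show "splitting (\<lambda>p x. \<sigma> p x + rs p (b p x))" by (rule splitting_shift(1)[OF \<sigma> 1 2 3])
      fix p x y assume xy: "x \<in> D p" "y \<in> D p"
      have "me p (\<sigma> p x + rs p (b p x)) (\<sigma> p y + rs p (b p y)) =
          me p (\<sigma> p x) (\<sigma> p y) + b p x y + b p y x"
        by (rule splitting_shift(3)[OF \<sigma> 1 2 3 xy])
      then show "me p (\<sigma> p x + rs p (b p x)) (\<sigma> p y + rs p (b p y)) = 0" using 4[OF xy] by simp
    qed
  qed
qed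

end

lemma (in gexact_split) shift_by_form:
  assumes B: "B \<in> forms A D 2"
  obtains \<sigma>' where "isotropic_splitting A D E \<sigma>'" "severa_form A D E \<sigma>' - sev = ext_d A D 2 B"
proof -
  define b where "b p x y = B p [x, y]" for p x y
  have \<sigma>: "splitting \<sigma>" using iso_spl by (simp add: isotropic_splitting_iff)
  have 1: "linear_on (D p) (b p x)" if "x \<in> D p" for p x
    unfolding b_def using form2_linear(2)[OF B that that] .
  have 2: "linear_on (D p) (\<lambda>x. b p x y)" if "y \<in> D p" for p y
    unfolding b_def using form2_linear(1)[OF B that that] .
  have 3: "sm p (\<lambda>q. b q (X q) (Y q))" if "SD p X" "SD p Y" for p X Y
    using form_smooth[OF B, of "[X, Y]" p] that by (auto simp: b_def)
  define \<sigma>' where "\<sigma>' = (\<lambda>p x. \<sigma> p x + rs p (b p x))"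
  have sh1: "splitting \<sigma>'" unfolding \<sigma>'_def by (rule splitting_shift(1)[OF \<sigma> 1 2 3])
  have sh2: "me p (\<sigma>' p x) (\<sigma> p y) = me p (\<sigma> p x) (\<sigma> p y) + b p x y" if "x \<in> D p" "y \<in> D p" for p x y
    unfolding \<sigma>'_def by (rule splitting_shift(2)[OF \<sigma> 1 2 3 that])
  have sh3: "me p (\<sigma>' p x) (\<sigma>' p y) = me p (\<sigma> p x) (\<sigma> p y) + b p x y + b p y x"
    if "x \<in> D p" "y \<in> D p" for p x y
    unfolding \<sigma>'_def by (rule splitting_shift(3)[OF \<sigma> 1 2 3 that])
  have iso': "isotropic_splitting A D E \<sigma>'"
    unfolding isotropic_splitting_iff
  proof (intro conjI allI ballI sh1)
    fix p x y assume xy: "x \<in> D p" "y \<in> D p"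
    show "me p (\<sigma>' p x) (\<sigma>' p y) = 0"
      using sh3[OF xy] s_iso[OF xy] form2_skew[OF B xy] by (simp add: b_def)
  qed
  interpret T: two_splittings A D E \<sigma> \<sigma>'
    by (intro two_splittings.intro gexact_split.intro gexact_split_axioms.intro gexact_axioms iso_spl iso')
  have "T.B = B"
  proof (intro ext)
    fix p xs show "T.B p xs = B p xs"
    proof (cases "length xs = 2 \<and> set xs \<subseteq> D p")
      case True
      then obtain x y where xs: "xs = [x, y]" "x \<in> D p" "y \<in> D p"
        by (auto simp: eval_nat_numeral length_Suc_conv)
      show ?thesis unfolding xs(1)
        using T.B_value[OF xs(2,3)] sh2[OF xs(2,3)] s_iso[OF xs(2,3)] by (simp add: b_def)
    next
      case False
      have "T.B p xs = 0" unfolding T.B_def by (rule if_not_P[OF False])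
      then show ?thesis using form_off[OF B False] by simp
    qed
  qed
  then show thesis using that[OF iso'] T.sev_change by simp
qed


subsection \<open>Isomorphisms\<close>

lemma (in gexact_split) me_formula:
  assumes v: "v \<in> fibre E p" and w: "w \<in> fibre E p"
  shows "me p v w = me p v (\<sigma> p (rh p w)) + me p w (\<sigma> p (rh p v))"
proof -
  let ?sv = "\<sigma> p (rh p v)" and ?sw = "\<sigma> p (rh p w)"
  have m: "?sv \<in> fibre E p" "?sw \<in> fibre E p" using s_mem rh_mem v w by blast+
  have d: "v - ?sv \<in> fibre E p" using subspace_diff[OF E_subspace v m(1)] .
  have "rh p (v - ?sv) = 0" using linear_on_diff[OF rh_linear E_subspace v m(1)] rh_s rh_mem[OF v] by simp
  then have "me p (v - ?sv) w = me p (v - ?sv) ?sw" by (rule ker_me[OF d _ w])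
  then show ?thesis
    using s_iso[OF rh_mem[OF v] rh_mem[OF w]] me_sym[OF w m(1)] me_diff_left[OF w v m(1)]
      me_diff_left[OF m(2) v m(1)] by simp
qed

locale two_split_algebroids = E: gexact_split A D E \<sigma> + F: gexact_split A D F \<tau>
  for A :: "('m::{t2_space, second_countable_topology}, 'v::real_inner) atlas"
    and D :: "'m \<Rightarrow> 'm tvec set" and E :: "('m, 'e::real_vector) courant"
    and F :: "('m, 'f::real_vector) courant"
    and \<sigma> :: "'m \<Rightarrow> 'm tvec \<Rightarrow> 'e" and \<tau> :: "'m \<Rightarrow> 'm tvec \<Rightarrow> 'f"
begin

definition \<Phi> :: "'m \<Rightarrow> 'e \<Rightarrow> 'f" where
  "\<Phi> p v = \<tau> p (anchor E p v) + rho_star F p (\<lambda>y. metric E p v (\<sigma> p y))"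

lemma dual_linear: "v \<in> fibre E p \<Longrightarrow> linear_on (D p) (\<lambda>y. metric E p v (\<sigma> p y))"
  by (simp add: linear_on_def linear_on_add[OF E.s_linear] linear_on_scale[OF E.s_linear]
      E.me_add E.me_scale E.s_mem)

lemma \<Phi>_mem: "v \<in> fibre E p \<Longrightarrow> \<Phi> p v \<in> fibre F p"
  unfolding \<Phi>_def using F.s_mem E.rh_mem F.rs_mem dual_linear subspace_add[OF F.E_subspace] by metis

lemma \<Phi>_anchor: "v \<in> fibre E p \<Longrightarrow> anchor F p (\<Phi> p v) = anchor E p v"
  unfolding \<Phi>_def using linear_on_add[OF F.rh_linear F.s_mem F.rs_mem] E.rh_mem dual_linear
    F.rh_s F.rh_rs by simp

lemma \<Phi>_dual: "v \<in> fibre E p \<Longrightarrow> y \<in> D p \<Longrightarrow> metric F p (\<Phi> p v) (\<tau> p y) = metric E p v (\<sigma> p y)"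
  unfolding \<Phi>_def using F.me_add_left[OF F.s_mem F.s_mem F.rs_mem] F.s_iso E.rh_mem dual_linear
    F.rs_me[OF dual_linear F.s_mem] F.rh_s by simp

lemma \<Phi>_linear: "linear_on (fibre E p) (\<Phi> p)"
proof (rule linear_onI)
  fix v w assume v: "v \<in> fibre E p" "w \<in> fibre E p"
  have s: "v + w \<in> fibre E p" using subspace_add[OF E.E_subspace v] .
  show "\<Phi> p (v + w) = \<Phi> p v + \<Phi> p w"
  proof (rule F.fibre_eqI)
    show "\<Phi> p (v + w) \<in> fibre F p" "\<Phi> p v + \<Phi> p w \<in> fibre F p"
      using \<Phi>_mem s v subspace_add[OF F.E_subspace] by blast+
    show "F.rh p (\<Phi> p (v + w)) = F.rh p (\<Phi> p v + \<Phi> p w)"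
      using linear_on_add[OF F.rh_linear \<Phi>_mem \<Phi>_mem] linear_on_add[OF E.rh_linear] \<Phi>_anchor v s by simp
    show "F.me p (\<Phi> p (v + w)) (\<tau> p z) = F.me p (\<Phi> p v + \<Phi> p w) (\<tau> p z)" if z: "z \<in> D p" for z
      using F.me_add_left[OF F.s_mem[OF z] \<Phi>_mem \<Phi>_mem] E.me_add_left[OF E.s_mem[OF z] v] \<Phi>_dual v s z by simp
  qed
next
  fix a v assume v: "v \<in> fibre E p"
  have s: "a *\<^sub>R v \<in> fibre E p" using subspace_scale[OF E.E_subspace v] .
  show "\<Phi> p (a *\<^sub>R v) = a *\<^sub>R \<Phi> p v"
  proof (rule F.fibre_eqI)
    show "\<Phi> p (a *\<^sub>R v) \<in> fibre F p" "a *\<^sub>R \<Phi> p v \<in> fibre F p"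
      using \<Phi>_mem s v subspace_scale[OF F.E_subspace] by blast+
    show "F.rh p (\<Phi> p (a *\<^sub>R v)) = F.rh p (a *\<^sub>R \<Phi> p v)"
      using linear_on_scale[OF F.rh_linear \<Phi>_mem] linear_on_scale[OF E.rh_linear] \<Phi>_anchor v s by simp
    show "F.me p (\<Phi> p (a *\<^sub>R v)) (\<tau> p z) = F.me p (a *\<^sub>R \<Phi> p v) (\<tau> p z)" if z: "z \<in> D p" for z
      using F.me_scale_left[OF F.s_mem[OF z] \<Phi>_mem] E.me_scale_left[OF E.s_mem[OF z] v] \<Phi>_dual v s z by simp
  qed
qed

lemma \<Phi>_smooth:
  assumes "E.SE p s"
  shows "F.SE p (\<lambda>q. \<Phi> q (s q))"
proof -
  obtain t where t: "t \<in> E.E.G" "\<forall>\<^sub>F q in nhds p. t q = s q" using E.E.G_extend[OF assms] .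
  have "F.SE p (\<lambda>q. \<tau> q (E.an t q))" by (rule F.s_smooth[OF E.an_SD[OF E.E.G_S[OF t(1)]]])
  moreover have "F.SE p (\<lambda>q. rho_star F q (\<lambda>y. metric E q (t q) (\<sigma> q y)))"
  proof (rule F.rs_smooth[OF dual_linear[OF E.E.G_mem[OF t(1)]]])
    fix X assume X: "E.SD p X"
    show "E.sm p (\<lambda>q. metric E q (t q) (\<sigma> q (X q)))"
      using E.ms_smooth[OF E.E.G_S[OF t(1)] E.s_smooth[OF X]] by (simp add: E.ms_def)
  qed
  ultimately have "F.SE p (\<lambda>q. \<Phi> q (t q))" unfolding \<Phi>_def E.an_def by (rule F.E.S_add)
  then show ?thesis by (rule F.E.S_cong) (use t(2) in \<open>eventually_elim, simp\<close>)
qed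

lemma \<Phi>_metric:
  assumes "v \<in> fibre E p" "w \<in> fibre E p"
  shows "metric F p (\<Phi> p v) (\<Phi> p w) = metric E p v w"
  using E.me_formula[OF assms] F.me_formula[OF \<Phi>_mem[OF assms(1)] \<Phi>_mem[OF assms(2)]]
    \<Phi>_anchor \<Phi>_dual assms E.rh_mem by simp

lemma \<Phi>_bracket:
  assumes C: "\<And>X Y Z. X \<in> E.D.G \<Longrightarrow> Y \<in> E.D.G \<Longrightarrow> Z \<in> E.D.G \<Longrightarrow> E.C X Y Z = F.C X Y Z"
    and s: "s \<in> E.E.G" and t: "t \<in> E.E.G"
  shows "bracket F (\<lambda>p. \<Phi> p (s p)) (\<lambda>p. \<Phi> p (t p)) = (\<lambda>p. \<Phi> p (bracket E s t p))"
proof -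
  have G: "(\<lambda>p. \<Phi> p (s p)) \<in> F.E.G" if "s \<in> E.E.G" for s
    using that \<Phi>_smooth by (simp add: E.E.G_def F.E.G_def)
  have an: "F.an (\<lambda>p. \<Phi> p (s p)) = E.an s" if "s \<in> E.E.G" for s
    using \<Phi>_anchor[OF E.E.G_mem[OF that]] by (simp add: E.an_def F.an_def)
  have du: "F.ms (\<lambda>p. \<Phi> p (s p)) (F.sg Z) = E.ms s (E.sg Z)" if "s \<in> E.E.G" "Z \<in> E.D.G" for s Z
    using \<Phi>_dual[OF E.E.G_mem[OF that(1)] E.D.G_mem[OF that(2)]]
    by (simp add: E.ms_def F.ms_def E.sg_def F.sg_def)
  note st = E.br_G[OF s t]
  note aG = E.an_G[OF s] E.an_G[OF t]
  show ?thesis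
  proof (rule F.G_eqI_E[OF F.br_G[OF G[OF s] G[OF t]] G[OF st]])
    show "F.an (bracket F (\<lambda>p. \<Phi> p (s p)) (\<lambda>p. \<Phi> p (t p))) = F.an (\<lambda>p. \<Phi> p (bracket E s t p))"
      unfolding an[OF st] F.anchor_hom[OF G[OF s] G[OF t]] an[OF s] an[OF t] E.anchor_hom[OF s t] ..
    fix Z assume Z: "Z \<in> E.D.G"
    show "F.ms (bracket F (\<lambda>p. \<Phi> p (s p)) (\<lambda>p. \<Phi> p (t p))) (F.sg Z) =
        F.ms (\<lambda>p. \<Phi> p (bracket E s t p)) (F.sg Z)"
    proof
      fix p
      show "F.ms (bracket F (\<lambda>p. \<Phi> p (s p)) (\<lambda>p. \<Phi> p (t p))) (F.sg Z) p =
          F.ms (\<lambda>p. \<Phi> p (bracket E s t p)) (F.sg Z) p"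
        unfolding du[OF st Z] F.bracket_formula[OF G[OF s] G[OF t] Z] an[OF s] an[OF t]
          E.bracket_formula[OF s t Z] du[OF s Z] du[OF t Z] du[OF t E.lb_G[OF aG(1) Z]]
          du[OF s E.lb_G[OF aG(2) Z]] du[OF s aG(2)] C[OF aG Z] ..
    qed
  qed
qed

end

locale two_split_algebroids_rev = two_split_algebroids A D E F \<sigma> \<tau> +
    R: two_split_algebroids A D F E \<tau> \<sigma>
  for A :: "('m::{t2_space, second_countable_topology}, 'v::real_inner) atlas"
    and D :: "'m \<Rightarrow> 'm tvec set" and E :: "('m, 'e::real_vector) courant"
    and F :: "('m, 'f::real_vector) courant"
    and \<sigma> :: "'m \<Rightarrow> 'm tvec \<Rightarrow> 'e" and \<tau> :: "'m \<Rightarrow> 'm tvec \<Rightarrow> 'f"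
begin

lemma R_\<Phi>: "v \<in> fibre E p \<Longrightarrow> R.\<Phi> p (\<Phi> p v) = v"
  using R.\<Phi>_mem[OF \<Phi>_mem] R.\<Phi>_anchor[OF \<Phi>_mem] R.\<Phi>_dual[OF \<Phi>_mem] \<Phi>_anchor \<Phi>_dual
  by (intro E.fibre_eqI) simp_all

lemma \<Phi>_R: "v \<in> fibre F p \<Longrightarrow> \<Phi> p (R.\<Phi> p v) = v"
  using \<Phi>_mem[OF R.\<Phi>_mem] \<Phi>_anchor[OF R.\<Phi>_mem] \<Phi>_dual[OF R.\<Phi>_mem] R.\<Phi>_anchor R.\<Phi>_dual
  by (intro F.fibre_eqI) simp_all

lemma \<Phi>_bij: "bij_betw (\<Phi> p) (fibre E p) (fibre F p)"
  by (rule bij_betw_byWitness[where f'="R.\<Phi> p"]) (auto simp: R_\<Phi> \<Phi>_R \<Phi>_mem R.\<Phi>_mem)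

lemma inv_\<Phi>: "v \<in> fibre F p \<Longrightarrow> inv_into (fibre E p) (\<Phi> p) v = R.\<Phi> p v"
  using inv_into_f_f[of "\<Phi> p" "fibre E p" "R.\<Phi> p v"] \<Phi>_bij[of p] R.\<Phi>_mem \<Phi>_R
  by (simp add: bij_betw_def)

lemma iso:
  assumes C: "\<And>X Y Z. X \<in> E.D.G \<Longrightarrow> Y \<in> E.D.G \<Longrightarrow> Z \<in> E.D.G \<Longrightarrow> E.C X Y Z = F.C X Y Z"
  shows "courant_iso A E F"
  unfolding courant_iso_def
proof (intro exI[of _ \<Phi>] conjI allI ballI)
  show "bundle_map (fibre E) (sections A E) (fibre F) (sections A F) \<Phi>"
  proof -
    have "bundle_map (fibre E) (sections A E) (fibre F) (sections A F) \<Phi> \<longleftrightarrow>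
        (\<forall>p. linear_on (fibre E p) (\<Phi> p) \<and> \<Phi> p ` fibre E p \<subseteq> fibre F p) \<and>
        (\<forall>p s. E.SE p s \<longrightarrow> F.SE p (\<lambda>q. \<Phi> q (s q)))"
      by (rule bundle_map_iff_germs[OF E.sections_iff F.sections_iff E.SE_eventually])
    then show ?thesis using \<Phi>_linear \<Phi>_mem \<Phi>_smooth by auto
  qed
  have sm: "E.SE p (\<lambda>q. inv_into (fibre E q) (\<Phi> q) (s q))" if s: "F.SE p s" for p s
  proof (rule E.E.S_cong[OF R.\<Phi>_smooth[OF s]])
    show "\<forall>\<^sub>F q in nhds p. R.\<Phi> q (s q) = inv_into (fibre E q) (\<Phi> q) (s q)"
      using F.SE_eventually[OF s] by eventually_elim (simp add: inv_\<Phi> F.SE_mem)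
  qed
  show "bundle_map (fibre F) (sections A F) (fibre E) (sections A E) (\<lambda>p. inv_into (fibre E p) (\<Phi> p))"
  proof -
    have "bundle_map (fibre F) (sections A F) (fibre E) (sections A E) (\<lambda>p. inv_into (fibre E p) (\<Phi> p)) \<longleftrightarrow>
        (\<forall>p. linear_on (fibre F p) (inv_into (fibre E p) (\<Phi> p)) \<and>
          inv_into (fibre E p) (\<Phi> p) ` fibre F p \<subseteq> fibre E p) \<and>
        (\<forall>p s. F.SE p s \<longrightarrow> E.SE p (\<lambda>q. inv_into (fibre E q) (\<Phi> q) (s q)))"
      by (rule bundle_map_iff_germs[OF F.sections_iff E.sections_iff F.SE_eventually])
    then show ?thesis
      using linear_on_inv_into[OF \<Phi>_linear E.E_subspace \<Phi>_bij] sm inv_\<Phi> R.\<Phi>_mem by auto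
  qed
  fix s t assume "s \<in> sections A E UNIV" "t \<in> sections A E UNIV"
  then show "bracket F (\<lambda>p. \<Phi> p (s p)) (\<lambda>p. \<Phi> p (t p)) = (\<lambda>p. \<Phi> p (bracket E s t p))"
    by (intro \<Phi>_bracket C) (simp_all add: E.sections_G)
qed (simp_all add: \<Phi>_bij \<Phi>_metric \<Phi>_anchor)

end

lemma (in gexact_split) severa_class_iso:
  assumes F: "F \<in> generalized_exact A D" and iso: "courant_iso A E F"
  shows "severa_class A D F = severa_class A D E"
proof -
  interpret F: gexact A D F by unfold_locales (rule F)
  obtain \<Phi> where bm: "bundle_map (fibre E) (sections A E) (fibre F) (sections A F) \<Phi>"
    and met: "\<And>p v w. v \<in> fibre E p \<Longrightarrow> w \<in> fibre E p \<Longrightarrow> metric F p (\<Phi> p v) (\<Phi> p w) = me p v w"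
    and brk: "\<And>s t. s \<in> E.G \<Longrightarrow> t \<in> E.G \<Longrightarrow>
      bracket F (\<lambda>p. \<Phi> p (s p)) (\<lambda>p. \<Phi> p (t p)) = (\<lambda>p. \<Phi> p (br s t p))"
    and anc: "\<And>p v. v \<in> fibre E p \<Longrightarrow> anchor F p (\<Phi> p v) = rh p v"
    using iso unfolding courant_iso_def sections_G by blast
  have bm': "(\<forall>p. linear_on (fibre E p) (\<Phi> p) \<and> \<Phi> p ` fibre E p \<subseteq> fibre F p) \<and>
      (\<forall>p s. SE p s \<longrightarrow> F.SE p (\<lambda>q. \<Phi> q (s q)))"
  proof -
    have "bundle_map (fibre E) (sections A E) (fibre F) (sections A F) \<Phi> \<longleftrightarrow>
        (\<forall>p. linear_on (fibre E p) (\<Phi> p) \<and> \<Phi> p ` fibre E p \<subseteq> fibre F p) \<and>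
        (\<forall>p s. SE p s \<longrightarrow> F.SE p (\<lambda>q. \<Phi> q (s q)))"
      by (rule bundle_map_iff_germs[OF sections_iff F.sections_iff SE_eventually])
    then show ?thesis using bm by simp
  qed
  define \<tau> where "\<tau> p x = \<Phi> p (\<sigma> p x)" for p x
  have iso_t: "isotropic_splitting A D F \<tau>"
    unfolding F.isotropic_splitting_iff F.splitting_def
  proof (intro conjI allI ballI impI)
    fix p
    show "linear_on (D p) (\<tau> p)"
      using bm' s_linear[of p] s_mem by (simp add: linear_on_def \<tau>_def)
    show "\<tau> p x \<in> fibre F p" if "x \<in> D p" for x using bm' s_mem[OF that] by (auto simp: \<tau>_def)
    show "anchor F p (\<tau> p x) = x" if "x \<in> D p" for x using anc[OF s_mem[OF that]] rh_s[OF that] by (simp add: \<tau>_def)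
    show "metric F p (\<tau> p x) (\<tau> p y) = 0" if "x \<in> D p" "y \<in> D p" for x y
      using met[OF s_mem s_mem] s_iso that by (simp add: \<tau>_def)
    show "F.SE p (\<lambda>q. \<tau> q (X q))" if "SD p X" for X
      using bm' s_smooth[OF that] by (simp add: \<tau>_def)
  qed
  interpret T: gexact_split A D F \<tau> by unfold_locales (rule iso_t)
  have "T.C X Y Z = C X Y Z" if "X \<in> D.G" "Y \<in> D.G" "Z \<in> D.G" for X Y Z
  proof -
    have tsg: "T.sg X = (\<lambda>q. \<Phi> q (sg X q))" for X by (simp add: T.sg_def sg_def \<tau>_def)
    show ?thesis
      unfolding T.C_def C_def tsg brk[OF sg_G[OF that(1)] sg_G[OF that(2)]] ms_def F.ms_def
      using met E.G_mem br_G sg_G that by simp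
  qed
  then have "T.sev = sev"
    using T.sev_off sev_off T.sev_value sev_value by (intro form_eqI3) simp_all
  then show ?thesis using T.severa_class_eq severa_class_eq by simp
qed

context involutive
begin

lemma severa_class_coh:
  assumes "E \<in> generalized_exact A D"
  obtains \<sigma> where "gexact_split A D E \<sigma>" "severa_form A D E \<sigma> \<in> closed_forms A D 3"
    "severa_class A D E = coh_class A D 3 (severa_form A D E \<sigma>)"
proof -
  interpret E: gexact A D E by unfold_locales (rule assms)
  obtain \<sigma> where s: "isotropic_splitting A D E \<sigma>" using E.isotropic_splitting_exists by blast
  interpret S: gexact_split A D E \<sigma> by unfold_locales (rule s)
  show thesis using that S.gexact_split_axioms S.sev_closed S.severa_class_eq gexact_split_def by blast
qed

lemma courant_iso_iff:
  fixes E :: "('m, 'e::real_vector) courant" and F :: "('m, 'f::real_vector) courant"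
  assumes E: "E \<in> generalized_exact A D" and F: "F \<in> generalized_exact A D"
  shows "courant_iso A E F \<longleftrightarrow> severa_class A D E = severa_class A D F"
proof
  obtain \<sigma> where "gexact_split A D E \<sigma>" using severa_class_coh[OF E] .
  then interpret S: gexact_split A D E \<sigma> .
  assume "courant_iso A E F"
  then show "severa_class A D E = severa_class A D F" using S.severa_class_iso[OF F] by simp
next
  assume eq: "severa_class A D E = severa_class A D F"
  obtain \<sigma> where "gexact_split A D E \<sigma>" using severa_class_coh[OF E] .
  then interpret S: gexact_split A D E \<sigma> .
  obtain \<tau> where "gexact_split A D F \<tau>" using severa_class_coh[OF F] .
  then interpret T: gexact_split A D F \<tau> .
  have "coh_class A D 3 T.sev = coh_class A D 3 S.sev" using eq S.severa_class_eq T.severa_class_eq by simp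
  then obtain B where B: "B \<in> forms A D 2" "S.sev - T.sev = ext_d A D 2 B"
    using coh_class_eq_iff[OF T.sev_closed S.sev_closed] exact3 by blast
  obtain \<tau>' where t: "isotropic_splitting A D F \<tau>'" "severa_form A D F \<tau>' - T.sev = ext_d A D 2 B"
    using T.shift_by_form[OF B(1)] .
  interpret T': gexact_split A D F \<tau>' by unfold_locales (rule t)
  have sev: "T'.sev = S.sev" using t(2) B(2) by (metis diff_add_cancel)
  interpret R: two_split_algebroids_rev A D E F \<sigma> \<tau>' by unfold_locales
  show "courant_iso A E F"
  proof (rule R.iso)
    fix X Y Z assume G: "X \<in> D.G" "Y \<in> D.G" "Z \<in> D.G"
    show "S.C X Y Z = T'.C X Y Z" using S.ev3_sev[OF G] T'.ev3_sev[OF G] sev by simp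
  qed
qed

end

section \<open>The standard Courant algebroid of a closed 3-form\<close>

context involutive
begin

lemma lb_self: "lb X X = (\<lambda>p. 0)"
  by (intro ext) (simp add: lie_bracket_def)

lemma dual_linear_on: "\<alpha> \<in> dual_space (D p) \<Longrightarrow> linear_on (D p) \<alpha>"
  and dual_off: "\<alpha> \<in> dual_space (D p) \<Longrightarrow> x \<notin> D p \<Longrightarrow> \<alpha> x = 0"
  by (simp_all add: dual_space_def)

lemma dual_eqI: "\<alpha> \<in> dual_space (D p) \<Longrightarrow> \<beta> \<in> dual_space (D p) \<Longrightarrow> (\<And>x. x \<in> D p \<Longrightarrow> \<alpha> x = \<beta> x) \<Longrightarrow> \<alpha> = \<beta>"
  by (rule ext) (metis dual_off)

lemma dual_subspace: "subspace (dual_space (D p))"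
  by (auto simp: subspace_def dual_space_def linear_on_def algebra_simps)

lemma dual_restrict: "linear_on (D p) \<alpha> \<Longrightarrow> (\<lambda>x. if x \<in> D p then \<alpha> x else 0) \<in> dual_space (D p)"
  by (simp add: dual_space_def linear_on_def subspace_add[OF D_subspace] subspace_scale[OF D_subspace])

definition tensor_at :: "(('m \<Rightarrow> 'm tvec) \<Rightarrow> 'm \<Rightarrow> real) \<Rightarrow> 'm \<Rightarrow> 'm tvec \<Rightarrow> real" where
  "tensor_at T p z = (if z \<in> D p then T (D.gext p z) p else 0)"

lemma tensor_at:
  assumes add: "\<And>X Y. X \<in> D.G \<Longrightarrow> Y \<in> D.G \<Longrightarrow> T (\<lambda>q. X q + Y q) = (\<lambda>p. T X p + T Y p)"
    and scale: "\<And>f X. smf f \<Longrightarrow> X \<in> D.G \<Longrightarrow> T (\<lambda>q. f q *\<^sub>R X q) = (\<lambda>p. f p * T X p)"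
  shows tensor_at_value: "Z \<in> D.G \<Longrightarrow> tensor_at T p (Z p) = T Z p"
    and tensor_at_dual: "tensor_at T p \<in> dual_space (D p)"
    and tensor_at_smooth: "(\<And>Z p. Z \<in> D.G \<Longrightarrow> sm p (T Z)) \<Longrightarrow> SD p X \<Longrightarrow> sm p (\<lambda>q. tensor_at T q (X q))"
proof -
  have val: "tensor_at T p (Z p) = T Z p" if Z: "Z \<in> D.G" for Z p
  proof -
    have m: "Z p \<in> D p" using D.G_mem[OF Z] .
    have "T (D.gext p (Z p)) p = T Z p"
      by (rule D.tensorial[where T="\<lambda>X. T X p", OF _ _ D.gext(1)[OF m] Z D.gext(2)[OF m]])
        (simp_all add: add scale)
    then show ?thesis using m by (simp add: tensor_at_def)
  qed
  then show "Z \<in> D.G \<Longrightarrow> tensor_at T p (Z p) = T Z p" by blast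
  show "tensor_at T p \<in> dual_space (D p)"
  proof -
    have "linear_on (D p) (tensor_at T p)"
    proof (rule linear_onI)
      fix x y assume x: "x \<in> D p" "y \<in> D p"
      note g = D.gext[OF x(1)] D.gext[OF x(2)]
      show "tensor_at T p (x + y) = tensor_at T p x + tensor_at T p y"
        using val[OF D.G_add[OF g(1,3)], of p] val[OF g(1), of p] val[OF g(3), of p] add[OF g(1,3)] g by simp
    next
      fix a x assume x: "x \<in> D p"
      note g = D.gext[OF x]
      show "tensor_at T p (a *\<^sub>R x) = a *\<^sub>R tensor_at T p x"
        using val[OF D.G_cscale[OF g(1)], of p a] val[OF g(1), of p] scale[of "\<lambda>_. a", OF _ g(1)] g by simp
    qed
    then show ?thesis by (simp add: dual_space_def tensor_at_def)
  qed
  assume sm: "\<And>Z p. Z \<in> D.G \<Longrightarrow> sm p (T Z)" and X: "SD p X"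
  obtain X' where X': "X' \<in> D.G" "\<forall>\<^sub>F q in nhds p. X' q = X q" using D.G_extend[OF X] .
  have "\<forall>\<^sub>F q in nhds p. T X' q = tensor_at T q (X q)"
    using X'(2) by eventually_elim (use val[OF X'(1)] in metis)
  then show "sm p (\<lambda>q. tensor_at T q (X q))" by (rule sm_cong) (rule sm[OF X'(1)])
qed

definition framed :: "'m set \<Rightarrow> (nat \<Rightarrow> 'm \<Rightarrow> 'm tvec) \<Rightarrow> ('m \<Rightarrow> 'm tvec \<Rightarrow> nat \<Rightarrow> real) \<Rightarrow> bool" where
  "framed U e c \<longleftrightarrow> open U \<and> (\<forall>q\<in>U. (\<forall>i<rD. SD q (e i)) \<and> (\<forall>v\<in>D q. v = (\<Sum>i<rD. c q v i *\<^sub>R e i q)) \<and>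
     (\<forall>i<rD. linear_on (D q) (\<lambda>v. c q v i)) \<and> (\<forall>s. SD q s \<longrightarrow> (\<forall>i<rD. sm q (\<lambda>z. c z (s z) i))) \<and>
     (\<forall>i<rD. \<forall>j<rD. c q (e j q) i = (if i = j then 1 else 0)))"

lemma framed_exists: "\<exists>U e c. framed U e c \<and> p \<in> U"
proof -
  obtain U e c where U: "open U" "p \<in> U" and e: "\<And>q i. q \<in> U \<Longrightarrow> i < rD \<Longrightarrow> SD q (e i)"
    and span: "\<And>q v. q \<in> U \<Longrightarrow> v \<in> D q \<Longrightarrow> v = (\<Sum>i<rD. c q v i *\<^sub>R e i q)"
    and indep: "\<And>q x. q \<in> U \<Longrightarrow> (\<Sum>i<rD. x i *\<^sub>R e i q) = 0 \<Longrightarrow> \<forall>i<rD. x i = 0"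
    and lin: "\<And>q i. q \<in> U \<Longrightarrow> i < rD \<Longrightarrow> linear_on (D q) (\<lambda>v. c q v i)"
    and csm: "\<And>q s i. q \<in> U \<Longrightarrow> SD q s \<Longrightarrow> i < rD \<Longrightarrow> sm q (\<lambda>z. c z (s z) i)"
    by (rule D.local_frame[of p]) blast
  have "c q (e j q) i = (if i = j then 1 else 0)" if q: "q \<in> U" and i: "i < rD" and j: "j < rD" for q i j
  proof -
    have e1: "(\<Sum>l<rD. c q (e j q) l *\<^sub>R e l q) = e j q" using span[OF q SD_mem[OF e[OF q j]]] by simp
    have "(\<Sum>l<rD. (if l = j then 1 else 0) *\<^sub>R e l q) = (\<Sum>l<rD. if l = j then e l q else 0)"
      by (rule sum.cong) auto
    then have e2: "(\<Sum>l<rD. (if l = j then 1 else 0) *\<^sub>R e l q) = e j q" using j by simp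
    have "(\<Sum>l<rD. (c q (e j q) l - (if l = j then 1 else 0)) *\<^sub>R e l q) = 0"
      unfolding scaleR_diff_left sum_subtractf e1 e2 by simp
    then have "\<forall>l<rD. c q (e j q) l - (if l = j then 1 else 0) = 0" by (rule indep[OF q])
    then show ?thesis using i by auto
  qed
  then have "framed U e c" unfolding framed_def using U(1) e span lin csm by simp
  then show ?thesis using U(2) by blast
qed

lemma framed_props:
  assumes "framed U e c" "q \<in> U"
  shows framed_SD: "i < rD \<Longrightarrow> SD q (e i)" and framed_span: "v \<in> D q \<Longrightarrow> v = (\<Sum>i<rD. c q v i *\<^sub>R e i q)"
    and framed_lin: "i < rD \<Longrightarrow> linear_on (D q) (\<lambda>v. c q v i)"
    and framed_smooth: "SD q X \<Longrightarrow> i < rD \<Longrightarrow> sm q (\<lambda>z. c z (X z) i)"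
    and framed_delta: "i < rD \<Longrightarrow> j < rD \<Longrightarrow> c q (e j q) i = (if i = j then 1 else 0)"
proof -
  have g: "(\<forall>i<rD. SD q (e i)) \<and> (\<forall>v\<in>D q. v = (\<Sum>i<rD. c q v i *\<^sub>R e i q)) \<and>
     (\<forall>i<rD. linear_on (D q) (\<lambda>v. c q v i)) \<and> (\<forall>s. SD q s \<longrightarrow> (\<forall>i<rD. sm q (\<lambda>z. c z (s z) i))) \<and>
     (\<forall>i<rD. \<forall>j<rD. c q (e j q) i = (if i = j then 1 else 0))" using assms unfolding framed_def by blast
  show "i < rD \<Longrightarrow> SD q (e i)" using g by simp
  show "v \<in> D q \<Longrightarrow> v = (\<Sum>i<rD. c q v i *\<^sub>R e i q)" using g by blast
  show "i < rD \<Longrightarrow> linear_on (D q) (\<lambda>v. c q v i)" using g by simp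
  show "SD q X \<Longrightarrow> i < rD \<Longrightarrow> sm q (\<lambda>z. c z (X z) i)" using g by simp
  show "i < rD \<Longrightarrow> j < rD \<Longrightarrow> c q (e j q) i = (if i = j then 1 else 0)" using g by simp
qed

lemma framed_open: "framed U e c \<Longrightarrow> open U" by (simp add: framed_def)

lemma framed_mem: "framed U e c \<Longrightarrow> q \<in> U \<Longrightarrow> i < rD \<Longrightarrow> e i q \<in> D q"
  using framed_SD SD_mem by blast

lemma dual_expand:
  assumes g: "framed U e c" "q \<in> U" and \<alpha>: "\<alpha> \<in> dual_space (D q)" and x: "x \<in> D q"
  shows "\<alpha> x = (\<Sum>i<rD. c q x i * \<alpha> (e i q))"
proof -
  have "\<alpha> x = \<alpha> (\<Sum>i<rD. c q x i *\<^sub>R e i q)" using arg_cong[OF framed_span[OF g x], of \<alpha>] .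
  also have "\<dots> = (\<Sum>i<rD. c q x i *\<^sub>R \<alpha> (e i q))"
    by (rule linear_on_sum[OF dual_linear_on[OF \<alpha>] D_subspace]) (use framed_mem[OF g] in auto)
  finally show ?thesis by simp
qed

end

text \<open>\<open>J p x \<alpha>\<close> is the pair \<open>(x, \<alpha>)\<close> of \<open>D \<oplus> D\<^sup>*\<close>, coded in the ambient space \<open>'e\<close> of the fibres.\<close>

locale standard_algebroid = involutive A D
  for A :: "('m::{t2_space, second_countable_topology}, 'v::real_inner) atlas"
    and D :: "'m \<Rightarrow> 'm tvec set" +
  fixes W :: "'m \<Rightarrow> 'm tvec list \<Rightarrow> real"
    and J :: "'m \<Rightarrow> 'm tvec \<Rightarrow> ('m tvec \<Rightarrow> real) \<Rightarrow> 'e::real_vector"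
  assumes W: "W \<in> closed_forms A D 3"
    and J_add: "x \<in> D p \<Longrightarrow> y \<in> D p \<Longrightarrow> \<alpha> \<in> dual_space (D p) \<Longrightarrow> \<beta> \<in> dual_space (D p) \<Longrightarrow>
      J p (x + y) (\<alpha> + \<beta>) = J p x \<alpha> + J p y \<beta>"
    and J_scale: "x \<in> D p \<Longrightarrow> \<alpha> \<in> dual_space (D p) \<Longrightarrow> J p (a *\<^sub>R x) (a *\<^sub>R \<alpha>) = a *\<^sub>R J p x \<alpha>"
    and J_inj: "x \<in> D p \<Longrightarrow> y \<in> D p \<Longrightarrow> \<alpha> \<in> dual_space (D p) \<Longrightarrow> \<beta> \<in> dual_space (D p) \<Longrightarrow>
      J p x \<alpha> = J p y \<beta> \<Longrightarrow> x = y \<and> \<alpha> = \<beta>"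
begin

definition fib :: "'m \<Rightarrow> 'e set" where
  "fib p = {J p x \<alpha> | x \<alpha>. x \<in> D p \<and> \<alpha> \<in> dual_space (D p)}"

definition pr :: "'m \<Rightarrow> 'e \<Rightarrow> 'm tvec \<times> ('m tvec \<Rightarrow> real)" where
  "pr p v = (SOME z. fst z \<in> D p \<and> snd z \<in> dual_space (D p) \<and> v = J p (fst z) (snd z))"

definition pr1 :: "'m \<Rightarrow> 'e \<Rightarrow> 'm tvec" where "pr1 p v = fst (pr p v)"
definition pr2 :: "'m \<Rightarrow> 'e \<Rightarrow> 'm tvec \<Rightarrow> real" where "pr2 p v = snd (pr p v)"

lemma pr_props:
  assumes "v \<in> fib p"
  shows pr1_mem: "pr1 p v \<in> D p" and pr2_mem: "pr2 p v \<in> dual_space (D p)"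
    and J_pr: "J p (pr1 p v) (pr2 p v) = v"
proof -
  have "\<exists>z. fst z \<in> D p \<and> snd z \<in> dual_space (D p) \<and> v = J p (fst z) (snd z)"
    using assms by (auto simp: fib_def)
  then have "fst (pr p v) \<in> D p \<and> snd (pr p v) \<in> dual_space (D p) \<and> v = J p (fst (pr p v)) (snd (pr p v))"
    unfolding pr_def by (rule someI_ex)
  then show "pr1 p v \<in> D p" "pr2 p v \<in> dual_space (D p)" "J p (pr1 p v) (pr2 p v) = v"
    by (simp_all add: pr1_def pr2_def)
qed

lemma J_fib: "x \<in> D p \<Longrightarrow> \<alpha> \<in> dual_space (D p) \<Longrightarrow> J p x \<alpha> \<in> fib p"
  by (auto simp: fib_def)

lemma pr_J:
  assumes "x \<in> D p" "\<alpha> \<in> dual_space (D p)"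
  shows "pr1 p (J p x \<alpha>) = x" "pr2 p (J p x \<alpha>) = \<alpha>"
  using J_inj[OF pr1_mem[OF J_fib[OF assms]] assms(1) pr2_mem[OF J_fib[OF assms]] assms(2)
      J_pr[OF J_fib[OF assms]]] by auto

lemma fib_add:
  assumes "v \<in> fib p" "w \<in> fib p"
  shows "v + w \<in> fib p" "pr1 p (v + w) = pr1 p v + pr1 p w" "pr2 p (v + w) = pr2 p v + pr2 p w"
proof -
  note m = pr1_mem[OF assms(1)] pr1_mem[OF assms(2)] pr2_mem[OF assms(1)] pr2_mem[OF assms(2)]
  have e: "v + w = J p (pr1 p v + pr1 p w) (pr2 p v + pr2 p w)"
    using J_add[OF m] J_pr[OF assms(1)] J_pr[OF assms(2)] by simp
  have m': "pr1 p v + pr1 p w \<in> D p" "pr2 p v + pr2 p w \<in> dual_space (D p)"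
    using m subspace_add[OF D_subspace] subspace_add[OF dual_subspace] by blast+
  show "v + w \<in> fib p" unfolding e by (rule J_fib[OF m'])
  show "pr1 p (v + w) = pr1 p v + pr1 p w" "pr2 p (v + w) = pr2 p v + pr2 p w"
    unfolding e using pr_J[OF m'] by simp_all
qed

lemma fib_scale:
  assumes "v \<in> fib p"
  shows "a *\<^sub>R v \<in> fib p" "pr1 p (a *\<^sub>R v) = a *\<^sub>R pr1 p v" "pr2 p (a *\<^sub>R v) = a *\<^sub>R pr2 p v"
proof -
  note m = pr1_mem[OF assms] pr2_mem[OF assms]
  have e: "a *\<^sub>R v = J p (a *\<^sub>R pr1 p v) (a *\<^sub>R pr2 p v)"
    using J_scale[OF m] J_pr[OF assms] by simp
  have m': "a *\<^sub>R pr1 p v \<in> D p" "a *\<^sub>R pr2 p v \<in> dual_space (D p)"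
    using m subspace_scale[OF D_subspace] subspace_scale[OF dual_subspace] by blast+
  show "a *\<^sub>R v \<in> fib p" unfolding e by (rule J_fib[OF m'])
  show "pr1 p (a *\<^sub>R v) = a *\<^sub>R pr1 p v" "pr2 p (a *\<^sub>R v) = a *\<^sub>R pr2 p v"
    unfolding e using pr_J[OF m'] by simp_all
qed

lemma dual0: "(\<lambda>x. 0) \<in> dual_space (D p)"
  by (simp add: dual_space_def linear_on_def)

lemma D0: "0 \<in> D p" using subspace_0[OF D_subspace] .

lemma fib_subspace: "subspace (fib p)"
proof -
  have "0 *\<^sub>R J p 0 (\<lambda>x. 0) \<in> fib p" by (rule fib_scale(1)[OF J_fib[OF D0 dual0]])
  then have z: "0 \<in> fib p" by simp
  show ?thesis unfolding subspace_def
  proof (intro conjI ballI allI)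
    show "0 \<in> fib p" by (rule z)
    show "x + y \<in> fib p" if "x \<in> fib p" "y \<in> fib p" for x y by (rule fib_add(1)[OF that])
    show "c *\<^sub>R x \<in> fib p" if "x \<in> fib p" for c x by (rule fib_scale(1)[OF that])
  qed
qed

lemma fib_eqI:
  assumes "v \<in> fib p" "w \<in> fib p" "pr1 p v = pr1 p w" "\<And>z. z \<in> D p \<Longrightarrow> pr2 p v z = pr2 p w z"
  shows "v = w"
proof -
  have "pr2 p v = pr2 p w"
    by (rule dual_eqI[OF pr2_mem[OF assms(1)] pr2_mem[OF assms(2)]]) (rule assms(4))
  then show ?thesis using J_pr[OF assms(1)] J_pr[OF assms(2)] assms(3) by metis
qed

definition std_chart :: "(nat \<Rightarrow> 'm \<Rightarrow> 'm tvec) \<Rightarrow> ('m \<Rightarrow> 'm tvec \<Rightarrow> nat \<Rightarrow> real) \<Rightarrow> 'm \<Rightarrow> 'e \<Rightarrow> nat \<Rightarrow> real" where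
  "std_chart e c q v i = (if i < rD then c q (pr1 q v) i
     else if i < 2 * rD then pr2 q v (e (i - rD) q) else 0)"

definition fpart :: "('m \<Rightarrow> 'e) \<Rightarrow> ('m \<Rightarrow> 'm tvec) \<Rightarrow> 'm \<Rightarrow> real" where
  "fpart s Z = (\<lambda>q. pr2 q (s q) (Z q))"

definition vpart :: "('m \<Rightarrow> 'e) \<Rightarrow> 'm \<Rightarrow> 'm tvec" where
  "vpart s = (\<lambda>q. pr1 q (s q))"

definition dorfman :: "('m \<Rightarrow> 'e) \<Rightarrow> ('m \<Rightarrow> 'e) \<Rightarrow> ('m \<Rightarrow> 'm tvec) \<Rightarrow> 'm \<Rightarrow> real" where
  "dorfman s t Z = (\<lambda>p. ev3 W (vpart s) (vpart t) Z p + vpart s p (fpart t Z) - fpart t (lb (vpart s) Z) p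
     - vpart t p (fpart s Z) + fpart s (lb (vpart t) Z) p + Z p (fpart s (vpart t)))"

definition E0 :: "('m, 'e) courant" where
  "E0 = \<lparr>fibre = fib, rk = 2 * rD, trivs = {(U, std_chart e c) | U e c. framed U e c},
     metric = (\<lambda>p v w. pr2 p v (pr1 p w) + pr2 p w (pr1 p v)),
     bracket = (\<lambda>s t p. J p (lb (vpart s) (vpart t) p) (tensor_at (dorfman s t) p)),
     anchor = pr1\<rparr>"

lemma E0_simps [simp]: "fibre E0 = fib" "rk E0 = 2 * rD" "trivs E0 = {(U, std_chart e c) | U e c. framed U e c}"
  "metric E0 = (\<lambda>p v w. pr2 p v (pr1 p w) + pr2 p w (pr1 p v))"
  "bracket E0 = (\<lambda>s t p. J p (lb (vpart s) (vpart t) p) (tensor_at (dorfman s t) p))" "anchor E0 = pr1"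
  by (simp_all add: E0_def)

definition std_chart_inv :: "(nat \<Rightarrow> 'm \<Rightarrow> 'm tvec) \<Rightarrow> ('m \<Rightarrow> 'm tvec \<Rightarrow> nat \<Rightarrow> real) \<Rightarrow> 'm \<Rightarrow> (nat \<Rightarrow> real) \<Rightarrow> 'e" where
  "std_chart_inv e c q x = J q (\<Sum>i<rD. x i *\<^sub>R e i q)
     (\<lambda>y. if y \<in> D q then \<Sum>i<rD. x (rD + i) * c q y i else 0)"

lemma std_chart_inv_parts:
  assumes g: "framed U e c" "q \<in> U"
  shows "(\<Sum>i<rD. x i *\<^sub>R e i q) \<in> D q"
    "(\<lambda>y. if y \<in> D q then \<Sum>i<rD. x (rD + i) * c q y i else 0) \<in> dual_space (D q)"
proof -
  show "(\<Sum>i<rD. x i *\<^sub>R e i q) \<in> D q"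
    by (intro subspace_sum subspace_scale D_subspace framed_mem[OF g]) auto
  have "linear_on (D q) (\<lambda>y. \<Sum>i<rD. x (rD + i) * c q y i)"
    using framed_lin[OF g] by (simp add: linear_on_def distrib_left sum.distrib sum_distrib_left mult.left_commute)
  then show "(\<lambda>y. if y \<in> D q then \<Sum>i<rD. x (rD + i) * c q y i else 0) \<in> dual_space (D q)"
    by (rule dual_restrict)
qed

lemma std_chart_inv_fib: "framed U e c \<Longrightarrow> q \<in> U \<Longrightarrow> std_chart_inv e c q x \<in> fib q"
  unfolding std_chart_inv_def by (intro J_fib std_chart_inv_parts)

lemma std_chart_inv_pr:
  assumes g: "framed U e c" "q \<in> U"
  shows "pr1 q (std_chart_inv e c q x) = (\<Sum>i<rD. x i *\<^sub>R e i q)"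
    "pr2 q (std_chart_inv e c q x) = (\<lambda>y. if y \<in> D q then \<Sum>i<rD. x (rD + i) * c q y i else 0)"
  unfolding std_chart_inv_def by (rule pr_J[OF std_chart_inv_parts[OF g]])+

lemma std_chart_std_chart_inv:
  assumes g: "framed U e c" "q \<in> U" and x: "x \<in> coord_space (2 * rD)"
  shows "std_chart e c q (std_chart_inv e c q x) = x"
proof
  fix i
  consider "i < rD" | "rD \<le> i" "i < 2 * rD" | "2 * rD \<le> i" by linarith
  then show "std_chart e c q (std_chart_inv e c q x) i = x i"
  proof cases
    case 1
    have "c q (\<Sum>j<rD. x j *\<^sub>R e j q) i = (\<Sum>j<rD. x j *\<^sub>R c q (e j q) i)"
      by (rule linear_on_sum[OF framed_lin[OF g 1] D_subspace]) (use framed_mem[OF g] in auto)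
    also have "\<dots> = (\<Sum>j<rD. if j = i then x i else 0)"
      by (rule sum.cong) (use framed_delta[OF g] 1 in auto)
    finally show ?thesis using 1 by (simp add: std_chart_def std_chart_inv_pr[OF g])
  next
    case 2
    then have i: "i - rD < rD" by simp
    have "(\<Sum>j<rD. x (rD + j) * c q (e (i - rD) q) j) = (\<Sum>j<rD. if j = i - rD then x i else 0)"
      by (rule sum.cong) (use framed_delta[OF g] 2 i in auto)
    then show ?thesis using 2 i framed_mem[OF g i] by (simp add: std_chart_def std_chart_inv_pr[OF g])
  next
    case 3
    then show ?thesis using x by (simp add: std_chart_def coord_space_def)
  qed
qed

lemma std_chart_inv_std_chart:
  assumes g: "framed U e c" "q \<in> U" and v: "v \<in> fib q"
  shows "std_chart_inv e c q (std_chart e c q v) = v"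
proof (rule fib_eqI[OF std_chart_inv_fib[OF g] v])
  show "pr1 q (std_chart_inv e c q (std_chart e c q v)) = pr1 q v"
    unfolding std_chart_inv_pr[OF g] using framed_span[OF g pr1_mem[OF v]] by (simp add: std_chart_def)
  show "pr2 q (std_chart_inv e c q (std_chart e c q v)) z = pr2 q v z" if "z \<in> D q" for z
    unfolding std_chart_inv_pr[OF g] using dual_expand[OF g pr2_mem[OF v] that] that
    by (simp add: std_chart_def mult.commute)
qed

lemma std_chart_coord: "std_chart e c q v \<in> coord_space (2 * rD)"
  by (simp add: std_chart_def coord_space_def)

lemma std_chart_linear:
  assumes g: "framed U e c" "q \<in> U"
  shows "linear_on (fib q) (std_chart e c q)"
proof (rule linear_onI)
  show "std_chart e c q (v + w) = std_chart e c q v + std_chart e c q w" if "v \<in> fib q" "w \<in> fib q" for v w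
    using fib_add(2,3)[OF that] linear_on_add[OF framed_lin[OF g]] pr1_mem that
    by (intro ext) (simp add: std_chart_def)
  show "std_chart e c q (a *\<^sub>R v) = a *\<^sub>R std_chart e c q v" if "v \<in> fib q" for a v
    using fib_scale(2,3)[OF that] linear_on_scale[OF framed_lin[OF g]] pr1_mem that
    by (intro ext) (simp add: std_chart_def)
qed

lemma std_chart_bij: "framed U e c \<Longrightarrow> q \<in> U \<Longrightarrow> bij_betw (std_chart e c q) (fib q) (coord_space (2 * rD))"
  by (rule bij_betw_byWitness[where f'="std_chart_inv e c q"]) (auto simp: std_chart_std_chart_inv std_chart_inv_std_chart std_chart_coord std_chart_inv_fib)

lemma std_chart_inv: "framed U e c \<Longrightarrow> q \<in> U \<Longrightarrow> x \<in> coord_space (2 * rD) \<Longrightarrow>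
    inv_into (fib q) (std_chart e c q) x = std_chart_inv e c q x"
  using inv_into_f_f[of "std_chart e c q" "fib q" "std_chart_inv e c q x"] std_chart_bij[of U e c q] std_chart_inv_fib std_chart_std_chart_inv
  by (simp add: bij_betw_def)

lemma std_chart_smooth:
  assumes g: "framed U e c" "q \<in> U" and s: "\<forall>\<^sub>F z in nhds q. s z \<in> fib z"
    and a: "SD q (vpart s)" and d: "\<And>X. SD q X \<Longrightarrow> sm q (fpart s X)" and i: "i < 2 * rD"
  shows "sm q (\<lambda>z. std_chart e c z (s z) i)"
proof (cases "i < rD")
  case True
  then show ?thesis using framed_smooth[OF g a True] by (simp add: std_chart_def vpart_def)
next
  case False
  then have "sm q (fpart s (e (i - rD)))" using i by (intro d framed_SD[OF g]) auto
  then show ?thesis using False i by (simp add: std_chart_def fpart_def)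
qed

lemma E0_bundle: "vector_bundle A E0"
  unfolding vector_bundle_def
proof (intro conjI allI)
  show "subspace (fibre E0 p)" for p by (simp add: fib_subspace)
  show "(\<Union>(U, \<tau>)\<in>trivs E0. U) = UNIV" using framed_exists by fastforce
  show "\<forall>(U, \<tau>)\<in>trivs E0. open U \<and> (\<forall>p\<in>U. linear_on (fibre E0 p) (\<tau> p) \<and>
      bij_betw (\<tau> p) (fibre E0 p) (coord_space (rk E0)))"
    using framed_open std_chart_linear std_chart_bij by auto
  show "\<forall>(U, \<tau>)\<in>trivs E0. \<forall>(V, \<upsilon>)\<in>trivs E0. \<forall>x\<in>coord_space (rk E0). \<forall>i<rk E0.
        smooth_map A (U \<inter> V) (\<lambda>p. \<upsilon> p (inv_into (fibre E0 p) (\<tau> p) x) i)"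
  proof clarsimp
    fix U e c V e' c' x i
    assume g: "framed U e c" and g': "framed V e' c'" and x: "x \<in> coord_space (2 * rD)" and i: "i < 2 * rD"
    have o: "open (U \<inter> V)" using framed_open g g' by blast
    show "smooth_map A (U \<inter> V) (\<lambda>p. std_chart e' c' p (inv_into (fib p) (std_chart e c p) x) i)"
      unfolding smooth_map_iff[OF o]
    proof
      fix p assume p: "p \<in> U \<inter> V"
      have U: "\<forall>\<^sub>F q in nhds p. q \<in> U" using p framed_open[OF g] eventually_nhds_in_open by blast
      have "sm p (\<lambda>q. std_chart e' c' q (std_chart_inv e c q x) i)"
      proof (rule std_chart_smooth[OF g'])
        show "p \<in> V" using p by blast
        show "\<forall>\<^sub>F z in nhds p. std_chart_inv e c z x \<in> fib z" using U by eventually_elim (rule std_chart_inv_fib[OF g])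
        have "SD p (\<lambda>q. \<Sum>i<rD. x i *\<^sub>R e i q)"
          by (intro D.S_sum D.S_cscale framed_SD[OF g]) (use p in auto)
        then show "SD p (vpart (\<lambda>q. std_chart_inv e c q x))"
          by (rule D.S_cong) (use U in \<open>eventually_elim, simp add: vpart_def std_chart_inv_pr[OF g]\<close>)
        fix X assume X: "SD p X"
        have "sm p (\<lambda>q. \<Sum>j<rD. x (rD + j) * c q (X q) j)"
          using framed_smooth[OF g _ X] p by (intro sm_sum sm_mult sm_const) auto
        moreover have "\<forall>\<^sub>F q in nhds p. (\<Sum>j<rD. x (rD + j) * c q (X q) j) = fpart (\<lambda>q. std_chart_inv e c q x) X q"
          using U SD_eventually[OF X] by eventually_elim (simp add: fpart_def std_chart_inv_pr[OF g] SD_mem)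
        ultimately show "sm p (fpart (\<lambda>q. std_chart_inv e c q x) X)" by (rule sm_cong[rotated])
      qed (rule i)
      moreover have "\<forall>\<^sub>F q in nhds p. std_chart e' c' q (std_chart_inv e c q x) i = std_chart e' c' q (inv_into (fib q) (std_chart e c q) x) i"
        using U by eventually_elim (simp add: std_chart_inv[OF g _ x])
      ultimately show "sm p (\<lambda>q. std_chart e' c' q (inv_into (fib q) (std_chart e c q) x) i)" by (rule sm_cong[rotated])
    qed
  qed
qed

sublocale E0: vec_bundle A E0
  by unfold_locales (rule E0_bundle)

lemma SE0_D:
  assumes s: "E0.SE p s"
  shows "s p \<in> fib p" "SD p (vpart s)" "SD p X \<Longrightarrow> sm p (fpart s X)"
proof -
  show "s p \<in> fib p" using E0.SE_mem[OF s] by simp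
  have sf: "\<forall>\<^sub>F q in nhds p. s q \<in> fib q"
    using E0.SE_eventually[OF s] by eventually_elim (drule E0.SE_mem, simp)
  obtain U e c where g: "framed U e c" and p: "p \<in> U" using framed_exists by blast
  have U: "\<forall>\<^sub>F q in nhds p. q \<in> U" using p framed_open[OF g] eventually_nhds_in_open by blast
  have sm: "sm p (\<lambda>q. std_chart e c q (s q) i)" if "i < 2 * rD" for i
    using E0.SE_smooth[OF s _ p, of "std_chart e c" i] g that by auto
  have c: "sm p (\<lambda>q. c q (vpart s q) i)" if "i < rD" for i
    using sm[of i] that by (simp add: std_chart_def vpart_def)
  have d: "sm p (fpart s (e i))" if "i < rD" for i
    using sm[of "rD + i"] that by (simp add: std_chart_def fpart_def)
  have "SD p (\<lambda>q. \<Sum>i<rD. c q (vpart s q) i *\<^sub>R e i q)"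
    by (intro D.S_sum D.S_scale c framed_SD[OF g p]) auto
  then show "SD p (vpart s)"
  proof (rule D.S_cong)
    show "\<forall>\<^sub>F q in nhds p. (\<Sum>i<rD. c q (vpart s q) i *\<^sub>R e i q) = vpart s q"
      using U sf by eventually_elim (use framed_span[OF g _ pr1_mem] in \<open>simp add: vpart_def\<close>)
  qed
  assume X: "SD p X"
  have "sm p (\<lambda>q. \<Sum>i<rD. c q (X q) i * fpart s (e i) q)"
    using framed_smooth[OF g p X] d by (intro sm_sum sm_mult) auto
  moreover have "\<forall>\<^sub>F q in nhds p. (\<Sum>i<rD. c q (X q) i * fpart s (e i) q) = fpart s X q"
    using U sf SD_eventually[OF X]
    by eventually_elim (simp add: fpart_def dual_expand[OF g _ pr2_mem SD_mem, symmetric])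
  ultimately show "sm p (fpart s X)" by (rule sm_cong[rotated])
qed

lemma SE0_I:
  assumes "\<And>q. s q \<in> fib q" "\<And>q. SD q (vpart s)" "\<And>q X. SD q X \<Longrightarrow> sm q (fpart s X)"
  shows "s \<in> E0.E.G"
proof -
  have "E0.SE p s" for p
  proof -
    have ts: "sm q (\<lambda>z. std_chart e c z (s z) i)" if "framed U e c" "q \<in> U" "i < 2 * rD" for U e c q i
      by (rule std_chart_smooth[OF that(1,2) always_eventually assms(2,3) that(3)]) (use assms(1) in auto)
    show ?thesis
      unfolding E0.SE_def by (rule always_eventually) (use assms(1) ts in auto)
  qed
  then show ?thesis by (simp add: E0.E.G_def)
qed

lemma sections_E0: "sections A E0 UNIV = E0.E.G"
  by (auto simp: E0.E.G_def E0.sections_iff)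

lemma G_fib: "s \<in> E0.E.G \<Longrightarrow> s p \<in> fib p"
  and vpart_G: "s \<in> E0.E.G \<Longrightarrow> vpart s \<in> D.G"
  and fpart_smooth: "s \<in> E0.E.G \<Longrightarrow> Z \<in> D.G \<Longrightarrow> sm p (fpart s Z)"
proof -
  assume s: "s \<in> E0.E.G"
  show "s p \<in> fib p" by (rule SE0_D(1)[OF E0.E.G_S[OF s]])
  show "vpart s \<in> D.G" unfolding D.G_def using SE0_D(2)[OF E0.E.G_S[OF s]] by blast
  show "sm p (fpart s Z)" if "Z \<in> D.G" by (rule SE0_D(3)[OF E0.E.G_S[OF s] D.G_S[OF that]])
qed

lemma G0_eqI:
  assumes "\<And>p. s p \<in> fib p" "\<And>p. t p \<in> fib p" "vpart s = vpart t" "\<And>Z. Z \<in> D.G \<Longrightarrow> fpart s Z = fpart t Z"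
  shows "s = t"
proof
  fix p show "s p = t p"
  proof (rule fib_eqI[OF assms(1,2)])
    show "pr1 p (s p) = pr1 p (t p)" using fun_cong[OF assms(3), of p] by (simp add: vpart_def)
    fix z assume z: "z \<in> D p"
    show "pr2 p (s p) z = pr2 p (t p) z"
      using fun_cong[OF assms(4)[OF D.gext(1)[OF z]], of p] D.gext(2)[OF z] by (simp add: fpart_def)
  qed
qed

lemma fpart_add: "s \<in> E0.E.G \<Longrightarrow> X \<in> D.G \<Longrightarrow> Y \<in> D.G \<Longrightarrow> fpart s (\<lambda>q. X q + Y q) = (\<lambda>q. fpart s X q + fpart s Y q)"
  using linear_on_add[OF dual_linear_on[OF pr2_mem[OF G_fib]]] D.G_mem by (auto simp: fpart_def)

lemma fpart_scale: "s \<in> E0.E.G \<Longrightarrow> X \<in> D.G \<Longrightarrow> fpart s (\<lambda>q. f q *\<^sub>R X q) = (\<lambda>q. f q * fpart s X q)"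
  using linear_on_scale[OF dual_linear_on[OF pr2_mem[OF G_fib]]] D.G_mem by (auto simp: fpart_def)

lemma vpart_add: "s \<in> E0.E.G \<Longrightarrow> t \<in> E0.E.G \<Longrightarrow> vpart (\<lambda>q. s q + t q) = (\<lambda>q. vpart s q + vpart t q)"
  and fpart_add_left: "s \<in> E0.E.G \<Longrightarrow> t \<in> E0.E.G \<Longrightarrow> fpart (\<lambda>q. s q + t q) Z = (\<lambda>q. fpart s Z q + fpart t Z q)"
  using fib_add(2,3) G_fib by (auto simp: vpart_def fpart_def)

lemma vpart_scale: "s \<in> E0.E.G \<Longrightarrow> vpart (\<lambda>q. f q *\<^sub>R s q) = (\<lambda>q. f q *\<^sub>R vpart s q)"
  and fpart_scale_left: "s \<in> E0.E.G \<Longrightarrow> fpart (\<lambda>q. f q *\<^sub>R s q) Z = (\<lambda>q. f q * fpart s Z q)"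
  using fib_scale(2,3) G_fib by (auto simp: vpart_def fpart_def)

lemma W_form: "W \<in> forms A D 3" and W_d3: "X \<in> D.G \<Longrightarrow> Y \<in> D.G \<Longrightarrow> Z \<in> D.G \<Longrightarrow> U \<in> D.G \<Longrightarrow>
    d3 (ev3 W) X Y Z U p = 0"
  using W unfolding closed3_iff by blast+

abbreviation w where "w \<equiv> ev3 W"

lemma w_alt: "alt3 w" by (rule alt3_ev3[OF W_form])

lemma dorfman_add:
  assumes s: "s \<in> E0.E.G" and t: "t \<in> E0.E.G" and X: "X \<in> D.G" and Y: "Y \<in> D.G"
  shows "dorfman s t (\<lambda>q. X q + Y q) = (\<lambda>p. dorfman s t X p + dorfman s t Y p)"
proof
  fix p
  note a = vpart_G[OF s] vpart_G[OF t]
  have w3: "w (vpart s) (vpart t) (\<lambda>q. X q + Y q) p = w (vpart s) (vpart t) X p + w (vpart s) (vpart t) Y p"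
    using fun_cong[OF alt3_skew23[OF w_alt a D.G_add[OF X Y]], of p] fun_cong[OF alt3_skew23[OF w_alt a X], of p]
      fun_cong[OF alt3_skew23[OF w_alt a Y], of p] fun_cong[OF alt3_add2[OF w_alt X Y a], of p] by simp
  show "dorfman s t (\<lambda>q. X q + Y q) p = dorfman s t X p + dorfman s t Y p"
    unfolding dorfman_def w3 lb_add[OF a(1) X Y] lb_add[OF a(2) X Y] fpart_add[OF t X Y] fpart_add[OF s X Y]
      fpart_add[OF t lb_G[OF a(1) X] lb_G[OF a(1) Y]] fpart_add[OF s lb_G[OF a(2) X] lb_G[OF a(2) Y]]
      act_add[OF a(1) fpart_smooth[OF t X] fpart_smooth[OF t Y]] act_add[OF a(2) fpart_smooth[OF s X] fpart_smooth[OF s Y]]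
    by simp
qed

lemma dorfman_scale:
  assumes s: "s \<in> E0.E.G" and t: "t \<in> E0.E.G" and f: "smf f" and X: "X \<in> D.G"
  shows "dorfman s t (\<lambda>q. f q *\<^sub>R X q) = (\<lambda>p. f p * dorfman s t X p)"
proof
  fix p
  note a = vpart_G[OF s] vpart_G[OF t]
  have fX: "(\<lambda>q. f q *\<^sub>R X q) \<in> D.G" using D.G_scale f X by blast
  have f': "sm q f" for q using f by blast
  have w3: "w (vpart s) (vpart t) (\<lambda>q. f q *\<^sub>R X q) p = f p * w (vpart s) (vpart t) X p"
    using fun_cong[OF alt3_skew23[OF w_alt a fX], of p] fun_cong[OF alt3_skew23[OF w_alt a X], of p]
      fun_cong[OF alt3_scale2[OF w_alt X a f], of p] by simp
  have L: "fpart t (lb Y (\<lambda>q. f q *\<^sub>R X q)) p = f p * fpart t (lb Y X) p + Y p f * fpart t X p"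
    if "t \<in> E0.E.G" "Y \<in> D.G" for t Y
    unfolding lb_scale[OF that(2) X f]
    using fun_cong[OF fpart_add[OF that(1) D.G_scale[OF f' lb_G[OF that(2) X]] D.G_scale[OF act_smooth[OF that(2) f'] X]], of p]
      fun_cong[OF fpart_scale[OF that(1) lb_G[OF that(2) X], of f], of p]
      fun_cong[OF fpart_scale[OF that(1) X, of "\<lambda>q. Y q f"], of p] by simp
  show "dorfman s t (\<lambda>q. f q *\<^sub>R X q) p = f p * dorfman s t X p"
    unfolding dorfman_def w3 L[OF t a(1)] L[OF s a(2)] fpart_scale[OF t X] fpart_scale[OF s X]
      act_mult[OF a(1) f' fpart_smooth[OF t X]] act_mult[OF a(2) f' fpart_smooth[OF s X]]
    by (simp add: algebra_simps)
qed

lemma dorfman_smooth: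
  assumes s: "s \<in> E0.E.G" and t: "t \<in> E0.E.G" and Z: "Z \<in> D.G"
  shows "sm p (dorfman s t Z)"
proof -
  note a = vpart_G[OF s] vpart_G[OF t]
  show ?thesis
    unfolding dorfman_def
    by (intro sm_add sm_diff alt3_smooth[OF w_alt a Z] act_smooth[OF a(1) fpart_smooth[OF t Z]]
      fpart_smooth[OF t lb_G[OF a(1) Z]] act_smooth[OF a(2) fpart_smooth[OF s Z]]
      fpart_smooth[OF s lb_G[OF a(2) Z]] act_smooth[OF Z fpart_smooth[OF s a(2)]])
qed

abbreviation br where "br \<equiv> bracket E0"

lemma br_parts:
  assumes s: "s \<in> E0.E.G" and t: "t \<in> E0.E.G"
  shows br_G: "br s t \<in> E0.E.G" and vpart_br: "vpart (br s t) = lb (vpart s) (vpart t)"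
    and fpart_br: "Z \<in> D.G \<Longrightarrow> fpart (br s t) Z = dorfman s t Z"
proof -
  have L: "lb (vpart s) (vpart t) \<in> D.G" using lb_G vpart_G s t by blast
  have T1: "tensor_at (dorfman s t) p (Z p) = dorfman s t Z p" if "Z \<in> D.G" for Z p
    by (rule tensor_at_value[OF dorfman_add[OF s t] dorfman_scale[OF s t] that])
  have T2: "tensor_at (dorfman s t) p \<in> dual_space (D p)" for p
    by (rule tensor_at_dual[OF dorfman_add[OF s t] dorfman_scale[OF s t]])
  have T3: "sm p (\<lambda>q. tensor_at (dorfman s t) q (X q))" if "SD p X" for p X
    by (rule tensor_at_smooth[OF dorfman_add[OF s t] dorfman_scale[OF s t] dorfman_smooth[OF s t] that])
  have m: "lb (vpart s) (vpart t) p \<in> D p" "tensor_at (dorfman s t) p \<in> dual_space (D p)" for p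
    using D.G_mem[OF L] T2 by blast+
  show 1: "vpart (br s t) = lb (vpart s) (vpart t)" using pr_J(1)[OF m] by (simp add: vpart_def)
  have 2: "fpart (br s t) Z = (\<lambda>q. tensor_at (dorfman s t) q (Z q))" for Z using pr_J(2)[OF m] by (simp add: fpart_def)
  show "fpart (br s t) Z = dorfman s t Z" if "Z \<in> D.G" unfolding 2 using T1[OF that] by blast
  show "br s t \<in> E0.E.G"
  proof (rule SE0_I)
    show "br s t q \<in> fib q" for q using J_fib[OF m] by simp
    show "SD q (vpart (br s t))" for q unfolding 1 using D.G_S[OF L] .
    show "sm q (fpart (br s t) X)" if "SD q X" for q X
      unfolding 2 by (rule T3[OF that])
  qed
qed

lemma dorfman_add_right:
  assumes "s \<in> E0.E.G" "t \<in> E0.E.G" "u \<in> E0.E.G" "Z \<in> D.G"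
  shows "dorfman s (\<lambda>q. t q + u q) Z = (\<lambda>p. dorfman s t Z p + dorfman s u Z p)"
proof
  fix p
  note a = vpart_G[OF assms(1)] vpart_G[OF assms(2)] vpart_G[OF assms(3)]
  show "dorfman s (\<lambda>q. t q + u q) Z p = dorfman s t Z p + dorfman s u Z p"
    unfolding dorfman_def vpart_add[OF assms(2,3)] fpart_add_left[OF assms(2,3)] alt3_add2[OF w_alt a(2,3,1) assms(4)]
      lb_add_left[OF assms(4) a(2,3)] fpart_add[OF assms(1) lb_G[OF a(2) assms(4)] lb_G[OF a(3) assms(4)]]
      fpart_add[OF assms(1) a(2,3)]
      act_add[OF a(1) fpart_smooth[OF assms(2,4)] fpart_smooth[OF assms(3,4)]]
      act_add[OF assms(4) fpart_smooth[OF assms(1) a(2)] fpart_smooth[OF assms(1) a(3)]]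
    by simp
qed

lemma dorfman_add_left:
  assumes "s \<in> E0.E.G" "t \<in> E0.E.G" "u \<in> E0.E.G" "Z \<in> D.G"
  shows "dorfman (\<lambda>q. t q + u q) s Z = (\<lambda>p. dorfman t s Z p + dorfman u s Z p)"
proof
  fix p
  note a = vpart_G[OF assms(1)] vpart_G[OF assms(2)] vpart_G[OF assms(3)]
  show "dorfman (\<lambda>q. t q + u q) s Z p = dorfman t s Z p + dorfman u s Z p"
    unfolding dorfman_def vpart_add[OF assms(2,3)] fpart_add_left[OF assms(2,3)] alt3_add[OF w_alt a(2,3,1) assms(4)]
      lb_add_left[OF assms(4) a(2,3)] fpart_add[OF assms(1) lb_G[OF a(2) assms(4)] lb_G[OF a(3) assms(4)]]
      act_add[OF a(1) fpart_smooth[OF assms(2,4)] fpart_smooth[OF assms(3,4)]]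
      act_add[OF assms(4) fpart_smooth[OF assms(2) a(1)] fpart_smooth[OF assms(3) a(1)]]
    by simp
qed

lemma dorfman_leibniz:
  assumes s: "s \<in> E0.E.G" and t: "t \<in> E0.E.G" and f: "smf f" and Z: "Z \<in> D.G"
  shows "dorfman s (\<lambda>q. f q *\<^sub>R t q) Z = (\<lambda>p. vpart s p f * fpart t Z p + f p * dorfman s t Z p)"
proof
  fix p
  note a = vpart_G[OF s] vpart_G[OF t]
  have f': "sm q f" for q using f by blast
  have fz: "sm q (\<lambda>q. - Z q f)" for q using sm_minus[OF act_smooth[OF Z f']] .
  have L: "fpart s (lb (\<lambda>q. f q *\<^sub>R vpart t q) Z) p = f p * fpart s (lb (vpart t) Z) p - Z p f * fpart s (vpart t) p"
    unfolding lb_scale_left[OF Z a(2) f]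
    using fun_cong[OF fpart_add[OF s D.G_scale[OF f' lb_G[OF a(2) Z]] D.G_scale[OF fz a(2)]], of p]
      fun_cong[OF fpart_scale[OF s lb_G[OF a(2) Z], of f], of p]
      fun_cong[OF fpart_scale[OF s a(2), of "\<lambda>q. - Z q f"], of p] by simp
  show "dorfman s (\<lambda>q. f q *\<^sub>R t q) Z p = vpart s p f * fpart t Z p + f p * dorfman s t Z p"
    unfolding dorfman_def vpart_scale[OF t] fpart_scale_left[OF t] alt3_scale2[OF w_alt a(2,1) Z f] L
      fpart_scale[OF s a(2)] act_mult[OF a(1) f' fpart_smooth[OF t Z]] act_mult[OF Z f' fpart_smooth[OF s a(2)]]
    by (simp add: algebra_simps)
qed

lemma act_dorfman:
  assumes s: "s \<in> E0.E.G" and t: "t \<in> E0.E.G" and Z: "Z \<in> D.G" and X: "X \<in> D.G"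
  shows "X p (dorfman s t Z) = X p (w (vpart s) (vpart t) Z) + X p (\<lambda>q. vpart s q (fpart t Z)) - X p (fpart t (lb (vpart s) Z))
     - X p (\<lambda>q. vpart t q (fpart s Z)) + X p (fpart s (lb (vpart t) Z)) + X p (\<lambda>q. Z q (fpart s (vpart t)))"
proof -
  note a = vpart_G[OF s] vpart_G[OF t]
  note sm = alt3_smooth[OF w_alt a Z, of p] act_smooth[OF a(1) fpart_smooth[OF t Z], of p]
    fpart_smooth[OF t lb_G[OF a(1) Z], of p] act_smooth[OF a(2) fpart_smooth[OF s Z], of p]
    fpart_smooth[OF s lb_G[OF a(2) Z], of p] act_smooth[OF Z fpart_smooth[OF s a(2)], of p]
  show ?thesis
    unfolding dorfman_def using sm
    by (simp add: act_add[OF X] act_diff[OF X] sm_add sm_diff)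
qed

lemma dorfman_jacobi:
  assumes s: "s \<in> E0.E.G" and t: "t \<in> E0.E.G" and u: "u \<in> E0.E.G" and Z: "Z \<in> D.G"
  shows "dorfman s (br t u) Z p = dorfman (br s t) u Z p + dorfman t (br s u) Z p"
proof -
  define X Y U where "X = vpart s" and "Y = vpart t" and "U = vpart u"
  have G: "X \<in> D.G" "Y \<in> D.G" "U \<in> D.G" using vpart_G s t u by (simp_all add: X_def Y_def U_def)
  have l: "dorfman s (br t u) Z p = w X (lb Y U) Z p + X p (dorfman t u Z) - dorfman t u (lb X Z) p
     - lb Y U p (fpart s Z) + fpart s (lb (lb Y U) Z) p + Z p (fpart s (lb Y U))"
    unfolding dorfman_def[of s "br t u"] vpart_br[OF t u] fpart_br[OF t u Z]
      fpart_br[OF t u lb_G[OF vpart_G[OF s] Z]] X_def Y_def U_def by simp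
  have r1: "dorfman (br s t) u Z p = w (lb X Y) U Z p + lb X Y p (fpart u Z) - fpart u (lb (lb X Y) Z) p
     - U p (dorfman s t Z) + dorfman s t (lb U Z) p + Z p (dorfman s t U)"
    unfolding dorfman_def[of "br s t" u] vpart_br[OF s t] fpart_br[OF s t Z] fpart_br[OF s t lb_G[OF vpart_G[OF u] Z]]
      fpart_br[OF s t vpart_G[OF u]] X_def Y_def U_def by simp
  have r2: "dorfman t (br s u) Z p = w Y (lb X U) Z p + Y p (dorfman s u Z) - dorfman s u (lb Y Z) p
     - lb X U p (fpart t Z) + fpart t (lb (lb X U) Z) p + Z p (fpart t (lb X U))"
    unfolding dorfman_def[of t "br s u"] vpart_br[OF s u] fpart_br[OF s u Z]
      fpart_br[OF s u lb_G[OF vpart_G[OF t] Z]] X_def Y_def U_def by simp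
  note ad = act_dorfman[OF t u Z G(1), of p, folded Y_def U_def] act_dorfman[OF s t Z G(3), of p, folded X_def Y_def]
    act_dorfman[OF s t G(3) Z, of p, folded X_def Y_def] act_dorfman[OF s u Z G(2), of p, folded X_def U_def]
  have dp: "dorfman t u (lb X Z) p = w Y U (lb X Z) p + Y p (fpart u (lb X Z)) - fpart u (lb Y (lb X Z)) p
     - U p (fpart t (lb X Z)) + fpart t (lb U (lb X Z)) p + lb X Z p (fpart t U)"
    "dorfman s t (lb U Z) p = w X Y (lb U Z) p + X p (fpart t (lb U Z)) - fpart t (lb X (lb U Z)) p
     - Y p (fpart s (lb U Z)) + fpart s (lb Y (lb U Z)) p + lb U Z p (fpart s Y)"
    "dorfman s u (lb Y Z) p = w X U (lb Y Z) p + X p (fpart u (lb Y Z)) - fpart u (lb X (lb Y Z)) p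
     - U p (fpart s (lb Y Z)) + fpart s (lb U (lb Y Z)) p + lb Y Z p (fpart s U)"
    unfolding dorfman_def X_def Y_def U_def by simp_all
  have ja: "fpart v (lb X (lb Y Z)) p = fpart v (lb (lb X Y) Z) p + fpart v (lb Y (lb X Z)) p"
    if "v \<in> E0.E.G" "X \<in> D.G" "Y \<in> D.G" "Z \<in> D.G" for v X Y Z
    unfolding lb_jacobi[OF that(2-4)]
    using fun_cong[OF fpart_add[OF that(1) lb_G[OF lb_G[OF that(2,3)] that(4)] lb_G[OF that(3) lb_G[OF that(2,4)]]], of p]
    by simp
  note jas = ja[OF u G(1,2) Z] ja[OF t G(1,3) Z] ja[OF s G(2,3) Z]
  note la = lb_apply[OF fpart_smooth[OF s Z], of Y U p] lb_apply[OF fpart_smooth[OF u Z], of X Y p]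
    lb_apply[OF fpart_smooth[OF t Z], of X U p] lb_apply[OF fpart_smooth[OF t G(3)], of X Z p]
    lb_apply[OF fpart_smooth[OF s G(2)], of U Z p] lb_apply[OF fpart_smooth[OF s G(3)], of Y Z p]
  note wsk = fun_cong[OF alt3_skew12[OF w_alt], of _ _ _ p] fun_cong[OF alt3_skew23[OF w_alt], of _ _ _ p]
  have ws: "w X (lb Y U) Z p = - w (lb Y U) X Z p" "w Y (lb X U) Z p = - w (lb X U) Y Z p"
      "w Y U (lb X Z) p = w (lb X Z) Y U p" "w X Y (lb U Z) p = w (lb U Z) X Y p"
      "w X U (lb Y Z) p = w (lb Y Z) X U p"
    using wsk(1)[of X "lb Y U" Z] wsk(1)[of Y "lb X U" Z] wsk(2)[of Y U "lb X Z"] wsk(1)[of Y "lb X Z" U]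
      wsk(2)[of X Y "lb U Z"] wsk(1)[of X "lb U Z" Y] wsk(2)[of X U "lb Y Z"] wsk(1)[of X "lb Y Z" U] G Z lb_G
    by auto
  have d: "d3 w X Y U Z p = 0" by (rule W_d3[OF G Z])
  have eW: "w X (lb Y U) Z p + X p (w Y U Z) - w Y U (lb X Z) p =
      w (lb X Y) U Z p - U p (w X Y Z) + w X Y (lb U Z) p + Z p (w X Y U)
      + w Y (lb X U) Z p + Y p (w X U Z) - w X U (lb Y Z) p"
    using d unfolding d3_def ws by linarith
  have eS: "- lb Y U p (fpart s Z) + fpart s (lb (lb Y U) Z) p =
      U p (\<lambda>q. Y q (fpart s Z)) - U p (\<lambda>q. Z q (fpart s Y)) + fpart s (lb Y (lb U Z)) p + lb U Z p (fpart s Y)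
      - Z p (\<lambda>q. Y q (fpart s U)) + Z p (\<lambda>q. U q (fpart s Y)) - Y p (\<lambda>q. U q (fpart s Z)) + Y p (\<lambda>q. Z q (fpart s U))
      - fpart s (lb U (lb Y Z)) p - lb Y Z p (fpart s U)"
    unfolding la jas(3) by linarith
  have eT: "- X p (\<lambda>q. U q (fpart t Z)) + X p (\<lambda>q. Z q (fpart t U)) - fpart t (lb U (lb X Z)) p - lb X Z p (fpart t U) =
      - U p (\<lambda>q. X q (fpart t Z)) - fpart t (lb X (lb U Z)) p + Z p (\<lambda>q. X q (fpart t U))
      - lb X U p (fpart t Z) + fpart t (lb (lb X U) Z) p"
    unfolding la jas(2) by linarith
  have eU: "X p (\<lambda>q. Y q (fpart u Z)) + fpart u (lb Y (lb X Z)) p =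
      lb X Y p (fpart u Z) - fpart u (lb (lb X Y) Z) p + Y p (\<lambda>q. X q (fpart u Z)) + fpart u (lb X (lb Y Z)) p"
    unfolding la jas(1) by linarith
  show ?thesis
    unfolding l r1 r2 ad dp using eW eS eT eU by linarith
qed

lemma me_vpart: "metric E0 p (s p) (t p) = fpart s (vpart t) p + fpart t (vpart s) p"
  by (simp add: fpart_def vpart_def)

lemma rho_star_E0:
  assumes \<alpha>: "linear_on (D p) \<alpha>"
  shows "rho_star E0 p \<alpha> = J p 0 (\<lambda>x. if x \<in> D p then \<alpha> x else 0)"
proof -
  let ?\<alpha> = "\<lambda>x. if x \<in> D p then \<alpha> x else 0"
  note m = D0[of p] dual_restrict[OF \<alpha>]
  show ?thesis
    unfolding rho_star_def
  proof (rule the_equality)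
    show "J p 0 ?\<alpha> \<in> fibre E0 p \<and> (\<forall>w\<in>fibre E0 p. metric E0 p (J p 0 ?\<alpha>) w = \<alpha> (anchor E0 p w))"
      using J_fib[OF m] pr_J[OF m] pr1_mem linear_on_zero[OF dual_linear_on[OF pr2_mem] D_subspace] by simp
    fix e assume e: "e \<in> fibre E0 p \<and> (\<forall>w\<in>fibre E0 p. metric E0 p e w = \<alpha> (anchor E0 p w))"
    have ef: "e \<in> fib p" using e by simp
    have em: "pr2 p e x + \<beta> (pr1 p e) = \<alpha> x" if "x \<in> D p" "\<beta> \<in> dual_space (D p)" for x \<beta>
      using e J_fib[OF that] pr_J[OF that] by force
    have z: "\<beta> (pr1 p e) = 0" if "\<beta> \<in> dual_space (D p)" for \<beta>
      using em[OF D0 that] em[OF D0 dual0] by simp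
    obtain U f c where g: "framed U f c" "p \<in> U" using framed_exists by blast
    have "c p (pr1 p e) i = 0" if "i < rD" for i
      using z[OF dual_restrict[OF framed_lin[OF g that]]] pr1_mem[OF ef] by simp
    then have p0: "pr1 p e = 0" using framed_span[OF g pr1_mem[OF ef]] by simp
    show "e = J p 0 ?\<alpha>"
    proof (rule fib_eqI[OF ef J_fib[OF m]])
      show "pr1 p e = pr1 p (J p 0 ?\<alpha>)" using p0 pr_J[OF m] by simp
      show "pr2 p e x = pr2 p (J p 0 ?\<alpha>) x" if "x \<in> D p" for x
        using em[OF that dual0] that pr_J[OF m] by simp
    qed
  qed
qed

lemma E0_pseudo_metric: "pseudo_metric A E0"
  unfolding pseudo_metric_def
proof (intro conjI allI ballI impI)
  fix p v assume "v \<in> fibre E0 p"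
  then have v: "v \<in> fib p" by simp
  show "linear_on (fibre E0 p) (metric E0 p v)"
    using fib_add(2,3) fib_scale(2,3) pr1_mem linear_on_add[OF dual_linear_on[OF pr2_mem[OF v]]]
      linear_on_scale[OF dual_linear_on[OF pr2_mem[OF v]]] by (simp add: linear_on_def algebra_simps)
  show "metric E0 p v w = metric E0 p w v" for w by simp
  assume "\<forall>w\<in>fibre E0 p. metric E0 p v w = 0"
  then have em: "pr2 p v x + \<beta> (pr1 p v) = 0" if "x \<in> D p" "\<beta> \<in> dual_space (D p)" for x \<beta>
    using J_fib[OF that] pr_J[OF that] by force
  have "v = rho_star E0 p (\<lambda>x. 0)"
    unfolding rho_star_def
  proof (rule the_equality[symmetric])
    show "v \<in> fibre E0 p \<and> (\<forall>w\<in>fibre E0 p. metric E0 p v w = 0)"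
      using v em pr1_mem pr2_mem by simp
    fix e assume e: "e \<in> fibre E0 p \<and> (\<forall>w\<in>fibre E0 p. metric E0 p e w = 0)"
    have ez: "pr1 p e = 0 \<and> (\<forall>x\<in>D p. pr2 p e x = 0)" if ef: "e \<in> fib p"
      and em: "\<And>x \<beta>. x \<in> D p \<Longrightarrow> \<beta> \<in> dual_space (D p) \<Longrightarrow> pr2 p e x + \<beta> (pr1 p e) = 0" for e
    proof -
      obtain U f c where g: "framed U f c" "p \<in> U" using framed_exists by blast
      have z: "\<beta> (pr1 p e) = 0" if "\<beta> \<in> dual_space (D p)" for \<beta>
        using em[OF D0 that] em[OF D0 dual0] by simp
      have "c p (pr1 p e) i = 0" if "i < rD" for i
        using z[OF dual_restrict[OF framed_lin[OF g that]]] pr1_mem[OF ef] by simp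
      then have "pr1 p e = 0" using framed_span[OF g pr1_mem[OF ef]] by simp
      then show ?thesis using em[OF _ dual0] by simp
    qed
    have ef: "e \<in> fib p" using e by simp
    have em': "pr2 p e x + \<beta> (pr1 p e) = 0" if "x \<in> D p" "\<beta> \<in> dual_space (D p)" for x \<beta>
      using e J_fib[OF that] pr_J[OF that] by force
    have "pr1 p e = 0 \<and> (\<forall>x\<in>D p. pr2 p e x = 0)" by (rule ez[OF ef]) (rule em')
    moreover have "pr1 p v = 0 \<and> (\<forall>x\<in>D p. pr2 p v x = 0)" by (rule ez[OF v]) (rule em)
    ultimately show "e = v" by (intro fib_eqI[OF ef v]) auto
  qed
  also have "\<dots> = J p 0 (\<lambda>x. 0)" using rho_star_E0[of p "\<lambda>x. 0"] by (simp add: linear_on_def)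
  also have "\<dots> = 0"
  proof -
    have z: "(\<lambda>x. 0::real) = (0 :: 'm tvec \<Rightarrow> real)" by (simp add: zero_fun_def)
    show ?thesis using J_scale[OF D0 dual0, of p 0] unfolding z scaleR_zero_left .
  qed
  finally show "v = 0" .
next
  fix U s t assume U: "open U" and s: "s \<in> sections A E0 U" and t: "t \<in> sections A E0 U"
  show "smooth_map A U (\<lambda>p. metric E0 p (s p) (t p))"
    unfolding smooth_map_iff[OF U] me_vpart
  proof
    fix p assume "p \<in> U"
    then have "E0.SE p s" "E0.SE p t" using s t E0.sections_iff[OF U] by blast+
    then show "sm p (\<lambda>p. fpart s (vpart t) p + fpart t (vpart s) p)" using SE0_D by (intro sm_add) auto
  qed
qed

lemma E0_anchor: "bundle_map (fibre E0) (sections A E0) (tangent_space A) (vector_fields A) (anchor E0)"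
  unfolding bundle_map_def
proof (intro conjI allI ballI impI)
  fix p
  show "linear_on (fibre E0 p) (anchor E0 p)" using fib_add(2) fib_scale(2) by (simp add: linear_on_def)
  show "anchor E0 p ` fibre E0 p \<subseteq> tangent_space A p" using pr1_mem D_tangent by auto
next
  fix U s assume U: "open U" and s: "s \<in> sections A E0 U"
  have "vpart s \<in> D_sections A D U"
    unfolding D_sections_iff[OF U] using s SE0_D(2) E0.sections_iff[OF U] by blast
  then show "(\<lambda>p. anchor E0 p (s p)) \<in> vector_fields A U" by (simp add: D_sections_def vpart_def)
qed

lemma E0_courant: "courant_algebroid A E0"
  unfolding courant_algebroid_def Let_def sections_E0
proof (intro conjI ballI allI impI E0_bundle E0_pseudo_metric E0_anchor)
  fix s assume s: "s \<in> E0.E.G"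
  note a = vpart_G[OF s]
  show "linear_on E0.E.G (br s)"
  proof (rule linear_onI)
    fix t u assume t: "t \<in> E0.E.G" and u: "u \<in> E0.E.G"
    have tu: "(\<lambda>q. t q + u q) \<in> E0.E.G" by (rule E0.E.G_add[OF t u])
    have "br s (\<lambda>q. t q + u q) = (\<lambda>q. br s t q + br s u q)"
    proof (rule G0_eqI)
      show "vpart (br s (\<lambda>q. t q + u q)) = vpart (\<lambda>q. br s t q + br s u q)"
        unfolding vpart_br[OF s tu] vpart_add[OF br_G[OF s t] br_G[OF s u]] vpart_add[OF t u] vpart_br[OF s t] vpart_br[OF s u]
        by (rule lb_add[OF a vpart_G[OF t] vpart_G[OF u]])
      show "fpart (br s (\<lambda>q. t q + u q)) Z = fpart (\<lambda>q. br s t q + br s u q) Z" if Z: "Z \<in> D.G" for Z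
        unfolding fpart_br[OF s tu Z] fpart_add_left[OF br_G[OF s t] br_G[OF s u]] fpart_br[OF s t Z] fpart_br[OF s u Z]
        by (rule dorfman_add_right[OF s t u Z])
    qed (intro G_fib E0.E.G_add br_G s t u tu)+
    then show "br s (t + u) = br s t + br s u" by (simp add: plus_fun_def)
  next
    fix c t assume t: "t \<in> E0.E.G"
    have ct: "(\<lambda>q. c *\<^sub>R t q) \<in> E0.E.G" by (rule E0.E.G_cscale[OF t])
    have "br s (\<lambda>q. c *\<^sub>R t q) = (\<lambda>q. c *\<^sub>R br s t q)"
    proof (rule G0_eqI)
      show "vpart (br s (\<lambda>q. c *\<^sub>R t q)) = vpart (\<lambda>q. c *\<^sub>R br s t q)"
        unfolding vpart_br[OF s ct] vpart_scale[OF br_G[OF s t]] vpart_scale[OF t] vpart_br[OF s t]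
        using lb_scale[OF a vpart_G[OF t], of "\<lambda>_. c"] tangent_const[OF G_tangent[OF a]] by simp
      show "fpart (br s (\<lambda>q. c *\<^sub>R t q)) Z = fpart (\<lambda>q. c *\<^sub>R br s t q) Z" if Z: "Z \<in> D.G" for Z
        unfolding fpart_br[OF s ct Z] fpart_scale_left[OF br_G[OF s t]] fpart_br[OF s t Z]
        using dorfman_leibniz[OF s t _ Z, of "\<lambda>_. c"] tangent_const[OF G_tangent[OF a]] by simp
    qed (intro G_fib E0.E.G_cscale br_G s t ct)+
    then show "br s (c *\<^sub>R t) = c *\<^sub>R br s t" by (simp add: scaleR_fun_def)
  qed
  show "linear_on E0.E.G (\<lambda>t. br t s)"
  proof (rule linear_onI)
    fix t u assume t: "t \<in> E0.E.G" and u: "u \<in> E0.E.G"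
    have tu: "(\<lambda>q. t q + u q) \<in> E0.E.G" by (rule E0.E.G_add[OF t u])
    have "br (\<lambda>q. t q + u q) s = (\<lambda>q. br t s q + br u s q)"
    proof (rule G0_eqI)
      show "vpart (br (\<lambda>q. t q + u q) s) = vpart (\<lambda>q. br t s q + br u s q)"
        unfolding vpart_br[OF tu s] vpart_add[OF br_G[OF t s] br_G[OF u s]] vpart_add[OF t u] vpart_br[OF t s] vpart_br[OF u s]
        by (rule lb_add_left[OF a vpart_G[OF t] vpart_G[OF u]])
      show "fpart (br (\<lambda>q. t q + u q) s) Z = fpart (\<lambda>q. br t s q + br u s q) Z" if Z: "Z \<in> D.G" for Z
        unfolding fpart_br[OF tu s Z] fpart_add_left[OF br_G[OF t s] br_G[OF u s]] fpart_br[OF t s Z] fpart_br[OF u s Z]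
        by (rule dorfman_add_left[OF s t u Z])
    qed (intro G_fib E0.E.G_add br_G s t u tu)+
    then show "br (t + u) s = br t s + br u s" by (simp add: plus_fun_def)
  next
    fix c t assume t: "t \<in> E0.E.G"
    have ct: "(\<lambda>q. c *\<^sub>R t q) \<in> E0.E.G" by (rule E0.E.G_cscale[OF t])
    have at: "vpart t \<in> D.G" by (rule vpart_G[OF t])
    have "br (\<lambda>q. c *\<^sub>R t q) s = (\<lambda>q. c *\<^sub>R br t s q)"
    proof (rule G0_eqI)
      have lc: "lb (\<lambda>q. c *\<^sub>R vpart t q) Y = (\<lambda>q. c *\<^sub>R lb (vpart t) Y q)" if "Y \<in> D.G" for Y
        using lb_scale_left[OF that at, of "\<lambda>_. c"] tangent_const[OF G_tangent[OF that]] by simp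
      show "vpart (br (\<lambda>q. c *\<^sub>R t q) s) = vpart (\<lambda>q. c *\<^sub>R br t s q)"
        unfolding vpart_br[OF ct s] vpart_scale[OF br_G[OF t s]] vpart_scale[OF t] vpart_br[OF t s] by (rule lc[OF a])
      show "fpart (br (\<lambda>q. c *\<^sub>R t q) s) Z = fpart (\<lambda>q. c *\<^sub>R br t s q) Z" if Z: "Z \<in> D.G" for Z
        unfolding fpart_br[OF ct s Z] fpart_scale_left[OF br_G[OF t s]] fpart_br[OF t s Z]
        unfolding dorfman_def vpart_scale[OF t] fpart_scale_left[OF t] lc[OF Z] fpart_scale[OF s lb_G[OF at Z]]
          alt3_scale[OF w_alt at a Z, of "\<lambda>_. c", simplified]
        using act_cmult[OF a fpart_smooth[OF t Z]] act_cmult[OF Z fpart_smooth[OF t a]]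
        by (simp add: algebra_simps)
    qed (intro G_fib E0.E.G_cscale br_G s t ct)+
    then show "br (c *\<^sub>R t) s = c *\<^sub>R br t s" by (simp add: scaleR_fun_def)
  qed
  have ss: "fpart (br s s) Z = (\<lambda>p. Z p (fpart s (vpart s)))" if Z: "Z \<in> D.G" for Z
    using alt3_skew12[OF w_alt a a Z] unfolding fpart_br[OF s s Z] dorfman_def by (simp add: fun_eq_iff)
  have f: "(\<lambda>q. metric E0 q (s q) (s q)) = (\<lambda>q. 2 * fpart s (vpart s) q)" by (simp only: me_vpart[of _ s s] mult_2)
  let ?f = "\<lambda>q. 2 * fpart s (vpart s) q"
  define r where "r = (\<lambda>p. (1/2) *\<^sub>R rho_star E0 p (differential ?f))"
  have lin: "linear_on (D p) (differential ?f)" for p by (simp add: linear_on_def differential_def)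
  note m = D0 dual_restrict[OF lin]
  have r: "r p = (1/2) *\<^sub>R J p 0 (\<lambda>x. if x \<in> D p then differential ?f x else 0)" for p
    unfolding r_def rho_star_E0[OF lin] ..
  have r_fib: "r p \<in> fib p" and r1: "pr1 p (r p) = 0" for p
    unfolding r using fib_scale[OF J_fib[OF m]] pr_J[OF m] by simp_all
  have r2: "pr2 p (r p) (Z p) = Z p (fpart s (vpart s))" if Z: "Z \<in> D.G" for Z p
    unfolding r using fib_scale(3)[OF J_fib[OF m]] pr_J(2)[OF m] D.G_mem[OF Z]
      act_cmult[OF Z fpart_smooth[OF s a], of p 2] by (simp add: differential_def)
  have "br s s = r"
  proof (rule G0_eqI[OF G_fib[OF br_G[OF s s]] r_fib])
    show "vpart (br s s) = vpart r" unfolding vpart_br[OF s s] lb_self by (simp add: vpart_def r1)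
    show "fpart (br s s) Z = fpart r Z" if Z: "Z \<in> D.G" for Z
      unfolding ss[OF Z] fpart_def[of r] r2[OF Z] ..
  qed
  then show "br s s = (\<lambda>p. (1/2) *\<^sub>R rho_star E0 p (differential (\<lambda>q. metric E0 q (s q) (s q))))"
    unfolding f r_def .
  fix t assume t: "t \<in> E0.E.G"
  note b = vpart_G[OF t]
  show "br s t \<in> E0.E.G" by (rule br_G[OF s t])
  show "br s (\<lambda>p. f p *\<^sub>R t p) = (\<lambda>p. anchor E0 p (s p) f *\<^sub>R t p + f p *\<^sub>R br s t p)"
    if f: "smooth_map A UNIV f" for f
  proof -
    have smf: "smf f" using f by (simp add: smooth_map_iff)
    then have f': "sm q f" for q by blast
    have ft: "(\<lambda>q. f q *\<^sub>R t q) \<in> E0.E.G" by (rule E0.E.G_scale[OF f' t])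
    have at: "(\<lambda>q. vpart s q f *\<^sub>R t q) \<in> E0.E.G" by (rule E0.E.G_scale[OF act_smooth[OF a f'] t])
    have fb: "(\<lambda>q. f q *\<^sub>R br s t q) \<in> E0.E.G" by (rule E0.E.G_scale[OF f' br_G[OF s t]])
    have "br s (\<lambda>p. f p *\<^sub>R t p) = (\<lambda>p. vpart s p f *\<^sub>R t p + f p *\<^sub>R br s t p)"
    proof (rule G0_eqI)
      show "vpart (br s (\<lambda>p. f p *\<^sub>R t p)) = vpart (\<lambda>p. vpart s p f *\<^sub>R t p + f p *\<^sub>R br s t p)"
        unfolding vpart_br[OF s ft] vpart_add[OF at fb] vpart_scale[OF t] vpart_scale[OF br_G[OF s t]] vpart_br[OF s t]
          lb_scale[OF a b smf] by (simp add: add.commute)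
      show "fpart (br s (\<lambda>p. f p *\<^sub>R t p)) Z = fpart (\<lambda>p. vpart s p f *\<^sub>R t p + f p *\<^sub>R br s t p) Z" if Z: "Z \<in> D.G" for Z
        unfolding fpart_br[OF s ft Z] fpart_add_left[OF at fb] fpart_scale_left[OF t] fpart_scale_left[OF br_G[OF s t]]
          fpart_br[OF s t Z] by (rule dorfman_leibniz[OF s t smf Z])
    qed (intro G_fib br_G s ft E0.E.G_add at fb)+
    then show ?thesis by (simp add: vpart_def)
  qed
  show "anchor E0 p (s p) (\<lambda>q. metric E0 q (t q) (t q)) = 2 * metric E0 p (br s t p) (t p)" for p
  proof -
    have f: "(\<lambda>q. metric E0 q (t q) (t q)) = (\<lambda>q. 2 * fpart t (vpart t) q)"
      by (simp only: me_vpart[of _ t t] mult_2)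
    have "metric E0 p (br s t p) (t p) = dorfman s t (vpart t) p + fpart t (lb (vpart s) (vpart t)) p"
      unfolding me_vpart fpart_br[OF s t b] vpart_br[OF s t] ..
    also have "\<dots> = vpart s p (fpart t (vpart t))"
    proof -
      have "w (vpart s) (vpart t) (vpart t) p = 0"
        using fun_cong[OF alt3_skew23[OF w_alt a b b], of p] by simp
      moreover have "fpart s (\<lambda>q. 0) p = 0"
        using linear_on_zero[OF dual_linear_on[OF pr2_mem[OF G_fib[OF s]]] D_subspace] by (simp add: fpart_def)
      ultimately show ?thesis by (simp add: dorfman_def lb_self)
    qed
    finally show ?thesis unfolding f using act_cmult[OF a fpart_smooth[OF t b], of p 2] by (simp add: vpart_def)
  qed
  fix u assume u: "u \<in> E0.E.G"
  have "br s (br t u) = (\<lambda>q. br (br s t) u q + br t (br s u) q)"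
  proof (rule G0_eqI)
    show "vpart (br s (br t u)) = vpart (\<lambda>q. br (br s t) u q + br t (br s u) q)"
      unfolding vpart_add[OF br_G[OF br_G[OF s t] u] br_G[OF t br_G[OF s u]]]
        vpart_br[OF s br_G[OF t u]] vpart_br[OF t u] vpart_br[OF br_G[OF s t] u] vpart_br[OF s t]
        vpart_br[OF t br_G[OF s u]] vpart_br[OF s u] by (rule lb_jacobi[OF a b vpart_G[OF u]])
    show "fpart (br s (br t u)) Z = fpart (\<lambda>q. br (br s t) u q + br t (br s u) q) Z" if Z: "Z \<in> D.G" for Z
      unfolding fpart_add_left[OF br_G[OF br_G[OF s t] u] br_G[OF t br_G[OF s u]]]
        fpart_br[OF s br_G[OF t u] Z] fpart_br[OF br_G[OF s t] u Z] fpart_br[OF t br_G[OF s u] Z]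
      by (rule ext) (rule dorfman_jacobi[OF s t u Z])
  qed (intro G_fib br_G s t u E0.E.G_add)+
  then show "br s (br t u) = br (br s t) u + br t (br s u)" by (simp add: plus_fun_def)
qed

lemma E0_exact: "E0 \<in> generalized_exact A D"
  unfolding generalized_exact_def
proof (intro CollectI conjI allI E0_courant)
  fix p
  have R: "rho_star E0 p \<alpha> = J p 0 \<alpha>" if "\<alpha> \<in> dual_space (D p)" for \<alpha>
  proof -
    have "(\<lambda>x. if x \<in> D p then \<alpha> x else 0) = \<alpha>" using dual_off[OF that] by auto
    then show ?thesis using rho_star_E0[OF dual_linear_on[OF that]] by simp
  qed
  show "inj_on (rho_star E0 p) (dual_space (D p))"
    by (rule inj_onI) (use R J_inj[OF D0 D0] in metis)
  show "rho_star E0 p ` dual_space (D p) = {e \<in> fibre E0 p. anchor E0 p e = 0}"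
  proof (intro equalityI subsetI)
    fix e assume "e \<in> rho_star E0 p ` dual_space (D p)"
    then show "e \<in> {e \<in> fibre E0 p. anchor E0 p e = 0}" using R J_fib[OF D0] pr_J(1)[OF D0] by auto
  next
    fix e assume "e \<in> {e \<in> fibre E0 p. anchor E0 p e = 0}"
    then have "e \<in> fib p" "e = J p 0 (pr2 p e)" using J_pr[of e p] by auto
    then show "e \<in> rho_star E0 p ` dual_space (D p)" using R[OF pr2_mem] pr2_mem by (metis imageI)
  qed
  show "anchor E0 p ` fibre E0 p = D p"
    using pr1_mem J_fib[OF _ dual0] pr_J(1)[OF _ dual0] by (force simp: image_iff)
qed

lemma E0_severa: "severa_class A D E0 = coh_class A D 3 W"
proof -
  interpret E: gexact A D E0 by unfold_locales (rule E0_exact)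
  define \<sigma> where "\<sigma> p x = J p x (\<lambda>y. 0)" for p x
  have pr: "pr1 p (\<sigma> p x) = x" "pr2 p (\<sigma> p x) = (\<lambda>y. 0)" if "x \<in> D p" for p x
    unfolding \<sigma>_def using pr_J[OF that dual0] by blast+
  have fs: "\<sigma> p x \<in> fib p" if "x \<in> D p" for p x unfolding \<sigma>_def by (rule J_fib[OF that dual0])
  have gs: "(\<lambda>q. \<sigma> q (X q)) \<in> E0.E.G" if X: "X \<in> D.G" for X
  proof (rule SE0_I)
    note m = D.G_mem[OF X]
    show "\<sigma> q (X q) \<in> fib q" for q by (rule fs[OF m])
    show "SD q (vpart (\<lambda>q. \<sigma> q (X q)))" for q unfolding vpart_def using pr(1)[OF m] D.G_S[OF X] by simp
    show "sm q (fpart (\<lambda>q. \<sigma> q (X q)) Y)" if "SD q Y" for q Y unfolding fpart_def using pr(2)[OF m] by simp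
  qed
  have iso: "isotropic_splitting A D E0 \<sigma>"
    unfolding E.isotropic_splitting_iff E.splitting_def
  proof (intro conjI allI ballI impI)
    fix p
    show "linear_on (D p) (\<sigma> p)"
      using J_add[OF _ _ dual0 dual0] J_scale[OF _ dual0]
      by (auto simp: linear_on_def \<sigma>_def plus_fun_def scaleR_fun_def)
    show "\<sigma> p x \<in> fibre E0 p" if "x \<in> D p" for x using fs that by simp
    show "anchor E0 p (\<sigma> p x) = x" if "x \<in> D p" for x using pr that by simp
    show "metric E0 p (\<sigma> p x) (\<sigma> p y) = 0" if "x \<in> D p" "y \<in> D p" for x y using pr that by simp
    fix X assume X: "SD p X"
    obtain X' where X': "X' \<in> D.G" "\<forall>\<^sub>F q in nhds p. X' q = X q" using D.G_extend[OF X] .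
    show "E0.SE p (\<lambda>q. \<sigma> q (X q))"
      by (rule E0.E.S_cong[OF E0.E.G_S[OF gs[OF X'(1)]]]) (use X'(2) in \<open>eventually_elim, simp\<close>)
  qed
  interpret S: gexact_split A D E0 \<sigma> by unfold_locales (rule iso)
  have "S.C X Y Z p = W p [X p, Y p, Z p]" if G: "X \<in> D.G" "Y \<in> D.G" "Z \<in> D.G" for X Y Z p
  proof -
    have sg: "S.sg X \<in> E0.E.G" "vpart (S.sg X) = X" "fpart (S.sg X) Y = (\<lambda>q. 0)" if "X \<in> D.G" for X Y
      using gs[OF that] pr D.G_mem[OF that] by (auto simp: S.sg_def vpart_def fpart_def)
    have "S.C X Y Z p = fpart (br (S.sg X) (S.sg Y)) Z p + fpart (S.sg Z) (lb X Y) p"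
      unfolding S.C_def E.ms_def me_vpart sg(2)[OF G(3)] vpart_br[OF sg(1)[OF G(1)] sg(1)[OF G(2)]]
        sg(2)[OF G(1)] sg(2)[OF G(2)] ..
    also have "\<dots> = w X Y Z p"
      unfolding fpart_br[OF sg(1)[OF G(1)] sg(1)[OF G(2)] G(3)] dorfman_def
      using G sg by (simp add: act_zero)
    finally show ?thesis by (simp add: ev3_def)
  qed
  then have "S.sev = W"
    using S.sev_off form_off[OF W_form] S.sev_value by (intro form_eqI3) simp_all
  then show ?thesis using S.severa_class_eq by simp
qed

end

section \<open>The classification\<close>

lemma independent_sequence:
  assumes "independent (B :: 'e::real_vector set)" and "infinite B"
  obtains f :: "nat \<Rightarrow> 'e::real_vector" where "\<And>n a i. (\<Sum>i<n. a i *\<^sub>R f i) = 0 \<Longrightarrow> i < n \<Longrightarrow> a i = 0"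
proof -
  obtain f :: "nat \<Rightarrow> 'e" where f: "inj f" "range f \<subseteq> B" using assms(2) infinite_countable_subset by blast
  have "a i = 0" if s: "(\<Sum>i<n. a i *\<^sub>R f i) = 0" and i: "i < n" for n a i
  proof -
    have inj: "inj_on f {..<n}" using f(1) inj_on_subset by blast
    have z: "(\<Sum>v\<in>f ` {..<n}. a (inv f v) *\<^sub>R v) = 0"
      unfolding sum.reindex[OF inj] using s f(1) by simp
    have "a (inv f (f i)) = 0"
      by (rule independentD[OF assms(1) _ _ z]) (use f i in auto)
    then show ?thesis using f(1) by simp
  qed
  then show thesis by (rule that)
qed

context involutive
begin

lemma pair_coding_exists:
  assumes "independent (B :: 'e::real_vector set)" and "infinite B" and W: "W \<in> closed_forms A D 3"
  obtains J :: "'m \<Rightarrow> 'm tvec \<Rightarrow> ('m tvec \<Rightarrow> real) \<Rightarrow> 'e::real_vector" where "standard_algebroid A D W J"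
proof -
  obtain f :: "nat \<Rightarrow> 'e" where f: "\<And>n a i. (\<Sum>i<n. a i *\<^sub>R f i) = 0 \<Longrightarrow> i < n \<Longrightarrow> a i = 0"
    using independent_sequence[OF assms(1,2)] by blast
  have "\<forall>p. \<exists>U e c. framed U e c \<and> p \<in> U" using framed_exists by blast
  then obtain U e c where g: "\<And>p. framed (U p) (e p) (c p)" "\<And>p. p \<in> U p" by metis
  define k where "k p x \<alpha> i = (if i < rD then c p p x i else \<alpha> (e p (i - rD) p))"
    for p x i and \<alpha> :: "'m tvec \<Rightarrow> real"
  define J where "J p x \<alpha> = (\<Sum>i<2 * rD. k p x \<alpha> i *\<^sub>R f i)" for p x \<alpha>
  have k_add: "k p (x + y) (\<alpha> + \<beta>) i = k p x \<alpha> i + k p y \<beta> i" if "x \<in> D p" "y \<in> D p" for p x y \<alpha> \<beta> i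
    unfolding k_def using linear_on_add[OF framed_lin[OF g] that] by simp
  have k_scale: "k p (a *\<^sub>R x) (a *\<^sub>R \<alpha>) i = a * k p x \<alpha> i" if "x \<in> D p" for p x a \<alpha> i
    unfolding k_def using linear_on_scale[OF framed_lin[OF g] that] by simp
  have "standard_algebroid A D W J"
  proof unfold_locales
    show "W \<in> closed_forms A D 3" by (rule W)
    fix p x \<alpha> assume x: "x \<in> D p" and \<alpha>: "\<alpha> \<in> dual_space (D p)"
    show "J p (a *\<^sub>R x) (a *\<^sub>R \<alpha>) = a *\<^sub>R J p x \<alpha>" for a
      unfolding J_def k_scale[OF x] by (simp add: scaleR_sum_right)
    fix y \<beta> assume y: "y \<in> D p" and \<beta>: "\<beta> \<in> dual_space (D p)"
    show "J p (x + y) (\<alpha> + \<beta>) = J p x \<alpha> + J p y \<beta>"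
      unfolding J_def k_add[OF x y] by (simp add: scaleR_add_left sum.distrib)
    assume "J p x \<alpha> = J p y \<beta>"
    then have "(\<Sum>i<2 * rD. (k p x \<alpha> i - k p y \<beta> i) *\<^sub>R f i) = 0"
      by (simp add: J_def scaleR_diff_left sum_subtractf)
    then have k: "k p x \<alpha> i = k p y \<beta> i" if "i < 2 * rD" for i using f[OF _ that] by fastforce
    have "c p p x i = c p p y i" if "i < rD" for i using k[of i] that by (simp add: k_def)
    then have "(\<Sum>i<rD. c p p x i *\<^sub>R e p i p) = (\<Sum>i<rD. c p p y i *\<^sub>R e p i p)" by simp
    then have "x = y" using framed_span[OF g x] framed_span[OF g y] by simp
    moreover have "\<alpha> = \<beta>"
    proof (rule dual_eqI[OF \<alpha> \<beta>])
      fix z assume z: "z \<in> D p"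
      have "\<alpha> (e p i p) = \<beta> (e p i p)" if "i < rD" for i using k[of "rD + i"] that by (simp add: k_def)
      then show "\<alpha> z = \<beta> z" unfolding dual_expand[OF g \<alpha> z] dual_expand[OF g \<beta> z] by simp
    qed
    ultimately show "x = y \<and> \<alpha> = \<beta>" ..
  qed
  then show thesis by (rule that)
qed

end

theorem proposition5p3:
  fixes A :: "('m::{t2_space, second_countable_topology}, 'v::real_inner) atlas"
    and D :: "'m \<Rightarrow> 'm tvec set"
  assumes "smooth_manifold A"
    and "lie_subalgebroid A D"
    and "\<exists>B::'e::real_vector set. independent B \<and> infinite B"
  shows "\<exists>\<kappa>. bij_betw \<kappa> ((generalized_exact A D :: ('m, 'e) courant set) // iso_rel A D)
                  (lie_cohomology A D 3) \<and>
             (\<forall>E \<in> generalized_exact A D. \<kappa> (iso_rel A D `` {E}) = severa_class A D E)"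
proof -
  interpret involutive A D by unfold_locales (rule assms)+
  let ?G = "generalized_exact A D :: ('m, 'e) courant set"
  let ?R = "iso_rel A D :: (('m, 'e) courant \<times> ('m, 'e) courant) set"
  define \<kappa> where "\<kappa> Q = (THE c. \<exists>E \<in> Q. c = severa_class A D E)" for Q :: "('m, 'e) courant set"
  have R: "?R = {(E, F). E \<in> ?G \<and> F \<in> ?G \<and> severa_class A D E = severa_class A D F}"
    unfolding iso_rel_def using courant_iso_iff by auto
  have \<kappa>: "\<kappa> (?R `` {E}) = severa_class A D E" if "E \<in> ?G" for E
    unfolding \<kappa>_def R using that by (intro the_equality) auto
  have "\<kappa> ` (?G // ?R) = lie_cohomology A D 3"
  proof (intro equalityI subsetI)
    fix c assume "c \<in> \<kappa> ` (?G // ?R)"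
    then obtain E where E: "E \<in> ?G" "c = severa_class A D E" by (auto simp: quotient_def \<kappa>)
    obtain \<sigma> where "severa_form A D E \<sigma> \<in> closed_forms A D 3" "c = coh_class A D 3 (severa_form A D E \<sigma>)"
      using severa_class_coh[OF E(1)] E(2) by metis
    then show "c \<in> lie_cohomology A D 3" by (auto simp: lie_cohomology_def coh_class_def quotientI)
  next
    fix c assume "c \<in> lie_cohomology A D 3"
    then obtain W where W: "W \<in> closed_forms A D 3" "c = coh_class A D 3 W"
      by (auto simp: lie_cohomology_def coh_class_def quotient_def)
    obtain B :: "'e set" where B: "independent B" "infinite B" using assms(3) by blast
    obtain J :: "'m \<Rightarrow> 'm tvec \<Rightarrow> ('m tvec \<Rightarrow> real) \<Rightarrow> 'e" where "standard_algebroid A D W J"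
      using pair_coding_exists[OF B W(1)] .
    then interpret S: standard_algebroid A D W J .
    have "c = \<kappa> (?R `` {S.E0})" unfolding \<kappa>[OF S.E0_exact] S.E0_severa by (rule W(2))
    then show "c \<in> \<kappa> ` (?G // ?R)" using S.E0_exact by (auto intro: quotientI)
  qed
  moreover have "inj_on \<kappa> (?G // ?R)"
  proof (rule inj_onI)
    fix P Q assume "P \<in> ?G // ?R" "Q \<in> ?G // ?R" and e: "\<kappa> P = \<kappa> Q"
    then obtain E F where E: "E \<in> ?G" "P = ?R `` {E}" and F: "F \<in> ?G" "Q = ?R `` {F}"
      by (auto simp: quotient_def)
    then have "severa_class A D E = severa_class A D F" using e \<kappa> by simp
    then show "P = Q" unfolding E(2) F(2) R by (auto simp: E F)
  qed
  ultimately show ?thesis using \<kappa> by (auto simp: bij_betw_def)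
qed

end
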